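(* Let $G$ be a connected algebraic group over $\mathbb{C}$ of type $G_2$, let $I_\alpha=\mathfrak{g}_{\alpha}\oplus\mathfrak{g}_{\beta+\alpha}\oplus\mathfrak{g}_{\beta+2\alpha}\oplus\mathfrak{g}_{\beta+3\alpha}\oplus\mathfrak{g}_{2\beta+3\alpha}$, and let $N\in\mathfrak{g}_{\beta+2\alpha}$ be a nonzero vector (a representative of the nilpotent orbit $\tilde A_1$). Then the Hessenberg ideal fiber $$\pi_{I_{\alpha}}^{-1}(\tilde{A}_1):=\pi_{I_\alpha}^{-1}(N)=\{\,gB\in G/B\mid g^{-1}\cdot N\in I_\alpha\,\}$$ has two connected components, each of which is irreducible as well. They are of dimension $1$ and $2$ respectively.
   Context: $B\subset G$ is a fixed Borel subgroup, $T\subset B$ a maximal torus, $\mathfrak{g}$ the Lie algebra of $G$, $\mathfrak{g}_\gamma$ the root space of the root $\gamma$. The simple roots (with respect to $T\subset B$) are $\alpha$ (short) and $\beta$ (long), so that the positive roots are $\alpha,\beta,\beta+\alpha,\beta+2\alpha,\beta+3\alpha,2\beta+3\alpha$. $g\cdot X$ denotes $\operatorname{Ad}(g)(X)$. $\tilde A_1$ is the nilpotent orbit (of dimension $8$) of a nonzero root vector for a short root. $I_\alpha$ is an $\operatorname{ad}(\operatorname{Lie}(B))$-stable subspace of the nilradical of $\operatorname{Lie}(B)$. *)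

theory Defs
  imports "HOL-Analysis.Analysis" "HOL-Library.Extended_Nat"
    "HOL-Algebra.Left_Coset" "HOL-Algebra.Solvable_Groups"
begin

section \<open>Irreducibility and Krull dimension of a topological space\<close>

definition irreducible_space :: "'a topology \<Rightarrow> bool" where
  "irreducible_space X \<longleftrightarrow> topspace X \<noteq> {} \<and>
     (\<forall>C D. closedin X C \<and> closedin X D \<and> topspace X = C \<union> D \<longrightarrow>
        C = topspace X \<or> D = topspace X)"

text \<open>The supremum of the lengths \<open>n\<close> of chains \<open>Z 0 \<subset> \<dots> \<subset> Z n\<close> of irreducible closed subsets.
  The empty space gets dimension 0.\<close>

definition krull_dim :: "'a topology \<Rightarrow> enat" where
  "krull_dim X = Sup {enat n | n. \<exists>Z :: nat \<Rightarrow> 'a set.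
      (\<forall>i\<le>n. closedin X (Z i) \<and> irreducible_space (subtopology X (Z i))) \<and>
      (\<forall>i<n. Z i \<subset> Z (Suc i))}"

section \<open>Linear algebraic groups over the complex numbers\<close>

text \<open>A linear algebraic group is a Zariski closed subgroup of some general linear group
  \<open>GL\<close>; the size of the matrices is the cardinality of the index type \<open>'n\<close>.\<close>

definition GL :: "(complex^'n^'n) monoid" where
  "GL = \<lparr>carrier = {A. invertible A}, mult = (**), one = mat 1\<rparr>"

inductive_set poly_fun :: "(complex^'n^'n \<Rightarrow> complex) set" where
  const: "(\<lambda>A. c) \<in> poly_fun"
| coord: "(\<lambda>A. A $ i $ j) \<in> poly_fun"
| add: "f \<in> poly_fun \<Longrightarrow> g \<in> poly_fun \<Longrightarrow> (\<lambda>A. f A + g A) \<in> poly_fun"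
| mult: "f \<in> poly_fun \<Longrightarrow> g \<in> poly_fun \<Longrightarrow> (\<lambda>A. f A * g A) \<in> poly_fun"

text \<open>The closed sets are the zero sets in \<open>GL\<close> of sets of polynomials in the matrix entries;
  allowing powers of the determinant as denominators gives the same zero sets.\<close>

definition zariski :: "(complex^'n^'n) topology" where
  "zariski = topology (\<lambda>U. \<exists>S\<subseteq>poly_fun. U = {A \<in> carrier GL. \<exists>f\<in>S. f A \<noteq> 0})"

lemma openin_zariski:
  fixes U :: "(complex^'n^'n) set"
  shows "openin zariski U \<longleftrightarrow> (\<exists>S\<subseteq>poly_fun. U = {A \<in> carrier GL. \<exists>f\<in>S. f A \<noteq> 0})"
proof -
  let ?O = "\<lambda>S. {A :: complex^'n^'n. A \<in> carrier GL \<and> (\<exists>f\<in>S. f A \<noteq> 0)}"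
  have "istopology (\<lambda>U :: (complex^'n^'n) set. \<exists>S\<subseteq>poly_fun. U = ?O S)"
    unfolding istopology_def
  proof (intro conjI allI impI)
    fix U V :: "(complex^'n^'n) set"
    assume "\<exists>S\<subseteq>poly_fun. U = ?O S" and "\<exists>S\<subseteq>poly_fun. V = ?O S"
    then obtain S R where S: "S \<subseteq> poly_fun" "U = ?O S" and R: "R \<subseteq> poly_fun" "V = ?O R"
      by blast
    let ?P = "(\<lambda>(f, g) A. f A * g A) ` (S \<times> R)"
    have "?P \<subseteq> poly_fun"
      using S(1) R(1) by (auto intro!: poly_fun.mult)
    moreover have "U \<inter> V = ?O ?P"
      unfolding S(2) R(2) by auto
    ultimately show "\<exists>S\<subseteq>poly_fun. U \<inter> V = ?O S"
      by blast
  next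
    fix \<U> :: "(complex^'n^'n) set set"
    assume "\<forall>U\<in>\<U>. \<exists>S\<subseteq>poly_fun. U = ?O S"
    then have opn: "\<exists>S\<subseteq>poly_fun. U = ?O S" if "U \<in> \<U>" for U
      using that by (rule bspec)
    let ?R = "{f \<in> poly_fun. \<exists>U\<in>\<U>. ?O {f} \<subseteq> U}"
    have "\<Union>\<U> = ?O ?R"
    proof (intro equalityI subsetI)
      fix A assume "A \<in> \<Union>\<U>"
      then obtain U where U: "U \<in> \<U>" "A \<in> U"
        by (rule UnionE)
      obtain S where S: "S \<subseteq> poly_fun" "U = ?O S"
        using opn[OF U(1)] by (elim exE conjE)
      obtain f where f: "f \<in> S" "f A \<noteq> 0" and A: "A \<in> carrier GL"
        using U(2) unfolding S(2) by (elim CollectE conjE bexE)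
      have "?O {f} \<subseteq> U"
        unfolding S(2) using f(1) by auto
      with S(1) f(1) U(1) have "f \<in> ?R"
        by auto
      with f(2) have "\<exists>f\<in>?R. f A \<noteq> 0"
        by (rule bexI)
      with A show "A \<in> ?O ?R"
        by simp
    next
      fix A assume "A \<in> ?O ?R"
      then show "A \<in> \<Union>\<U>"
        by auto
    qed
    moreover have "?R \<subseteq> poly_fun"
      by (rule Collect_restrict)
    ultimately show "\<exists>S\<subseteq>poly_fun. \<Union>\<U> = ?O S"
      by (intro exI[of _ ?R] conjI)
  qed
  then show ?thesis
    unfolding zariski_def by (simp only: topology_inverse')
qed

definition closed_subgroup :: "(complex^'n^'n) set \<Rightarrow> bool" where
  "closed_subgroup H \<longleftrightarrow> subgroup H GL \<and> closedin zariski H"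

definition connected_algebraic_group :: "(complex^'n^'n) set \<Rightarrow> bool" where
  "connected_algebraic_group G \<longleftrightarrow>
     closed_subgroup G \<and> connected_space (subtopology zariski G)"

abbreviation as_group :: "(complex^'n^'n) set \<Rightarrow> (complex^'n^'n) monoid" where
  "as_group H \<equiv> GL\<lparr>carrier := H\<rparr>"

text \<open>Semisimple: connected with trivial radical.\<close>

definition semisimple_group :: "(complex^'n^'n) set \<Rightarrow> bool" where
  "semisimple_group G \<longleftrightarrow> connected_algebraic_group G \<and>
     (\<forall>H. connected_algebraic_group H \<and> H \<lhd> as_group G \<and> solvable (as_group H) \<longrightarrow>
        H = {mat 1})"

definition borel_subgroup :: "(complex^'n^'n) set \<Rightarrow> (complex^'n^'n) set \<Rightarrow> bool" where
  "borel_subgroup B G \<longleftrightarrow>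
     B \<subseteq> G \<and> connected_algebraic_group B \<and> solvable (as_group B) \<and>
     (\<forall>H. B \<subseteq> H \<and> H \<subseteq> G \<and> connected_algebraic_group H \<and> solvable (as_group H) \<longrightarrow> H = B)"

text \<open>A torus is a connected diagonalizable group.\<close>

definition torus :: "(complex^'n^'n) set \<Rightarrow> bool" where
  "torus T \<longleftrightarrow> connected_algebraic_group T \<and>
     (\<exists>P :: complex^'n^'n. invertible P \<and>
        (\<forall>t\<in>T. \<forall>i j. i \<noteq> j \<longrightarrow> (matrix_inv P ** t ** P) $ i $ j = 0))"

definition maximal_torus :: "(complex^'n^'n) set \<Rightarrow> (complex^'n^'n) set \<Rightarrow> bool" where
  "maximal_torus T G \<longleftrightarrow>
     T \<subseteq> G \<and> torus T \<and> (\<forall>S. T \<subseteq> S \<and> S \<subseteq> G \<and> torus S \<longrightarrow> S = T)"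

section \<open>Lie algebra, adjoint action and roots\<close>

abbreviation mat_scale :: "complex \<Rightarrow> complex^'n^'n \<Rightarrow> complex^'n^'n" where
  "mat_scale c \<equiv> map_matrix ((*) c)"

text \<open>The tangent space at the identity: the directions in which the differentials at 1 of all
  polynomials vanishing on \<open>G\<close> are zero.\<close>

definition lie_algebra :: "(complex^'n^'n) set \<Rightarrow> (complex^'n^'n) set" where
  "lie_algebra G = {X. \<forall>f\<in>poly_fun. (\<forall>g\<in>G. f g = 0) \<longrightarrow>
     ((\<lambda>z. f (mat 1 + mat_scale z X)) has_field_derivative 0) (at 0)}"

definition Ad :: "complex^'n^'n \<Rightarrow> complex^'n^'n \<Rightarrow> complex^'n^'n" where
  "Ad g X = g ** X ** matrix_inv g"

text \<open>Characters of \<open>T\<close> are extended by \<open>undefined\<close> outside \<open>T\<close>, so that two of them are equal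
  iff they agree on \<open>T\<close>. A regular function on a closed subset of \<open>GL\<close> is the restriction of a
  polynomial in the entries divided by a power of the determinant.\<close>

definition characters :: "(complex^'n^'n) set \<Rightarrow> (complex^'n^'n \<Rightarrow> complex) set" where
  "characters T = {\<gamma> \<in> extensional T.
     (\<forall>t\<in>T. \<gamma> t \<noteq> 0) \<and> (\<forall>s\<in>T. \<forall>t\<in>T. \<gamma> (s ** t) = \<gamma> s * \<gamma> t) \<and>
     (\<exists>f\<in>poly_fun. \<exists>k::nat. \<forall>t\<in>T. \<gamma> t = f t / det t ^ k)}"

definition root_space ::
  "(complex^'n^'n) set \<Rightarrow> (complex^'n^'n) set \<Rightarrow> (complex^'n^'n \<Rightarrow> complex) \<Rightarrow> (complex^'n^'n) set"
  where "root_space H T \<gamma> = {X \<in> lie_algebra H. \<forall>t\<in>T. Ad t X = mat_scale (\<gamma> t) X}"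

definition roots ::
  "(complex^'n^'n) set \<Rightarrow> (complex^'n^'n) set \<Rightarrow> (complex^'n^'n \<Rightarrow> complex) set" where
  "roots H T = {\<gamma> \<in> characters T. \<gamma> \<noteq> (\<lambda>t\<in>T. 1) \<and> root_space H T \<gamma> \<noteq> {0}}"

text \<open>The pair \<open>(i, j)\<close> stands for the character \<open>j \<beta> + i \<alpha>\<close>; the character group, written
  additively in the literature, is multiplicative here.\<close>

definition lin_comb ::
  "(complex^'n^'n) set \<Rightarrow> (complex^'n^'n \<Rightarrow> complex) \<Rightarrow> (complex^'n^'n \<Rightarrow> complex) \<Rightarrow>
   int \<times> int \<Rightarrow> (complex^'n^'n \<Rightarrow> complex)" where
  "lin_comb T \<alpha> \<beta> = (\<lambda>(i, j). \<lambda>t\<in>T. \<alpha> t powi i * \<beta> t powi j)"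

definition G2_positive :: "(int \<times> int) set" where
  "G2_positive = {(1, 0), (0, 1), (1, 1), (2, 1), (3, 1), (3, 2)}"

text \<open>The root system of \<open>G\<close> is of type \<open>G\<^sub>2\<close>, and \<open>\<alpha>\<close> (short), \<open>\<beta>\<close> (long) are the simple roots
  of the positive system formed by the roots of \<open>B\<close>. The lengths are encoded in the list of
  positive roots, which contains \<open>\<beta> + 3 \<alpha>\<close> but not \<open>\<alpha> + 3 \<beta>\<close>.\<close>

definition G2_simple_roots ::
  "(complex^'n^'n) set \<Rightarrow> (complex^'n^'n) set \<Rightarrow> (complex^'n^'n) set \<Rightarrow>
   (complex^'n^'n \<Rightarrow> complex) \<Rightarrow> (complex^'n^'n \<Rightarrow> complex) \<Rightarrow> bool" where
  "G2_simple_roots G B T \<alpha> \<beta> \<longleftrightarrow>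
     \<alpha> \<in> characters T \<and> \<beta> \<in> characters T \<and>
     (\<forall>i j. lin_comb T \<alpha> \<beta> (i, j) = (\<lambda>t\<in>T. 1) \<longrightarrow> i = 0 \<and> j = 0) \<and>
     roots B T = lin_comb T \<alpha> \<beta> ` G2_positive \<and>
     roots G T = lin_comb T \<alpha> \<beta> ` (G2_positive \<union> (\<lambda>(i, j). (- i, - j)) ` G2_positive)"

definition I_alpha ::
  "(complex^'n^'n) set \<Rightarrow> (complex^'n^'n) set \<Rightarrow>
   (complex^'n^'n \<Rightarrow> complex) \<Rightarrow> (complex^'n^'n \<Rightarrow> complex) \<Rightarrow> (complex^'n^'n) set" where
  "I_alpha G T \<alpha> \<beta> = {X1 + X2 + X3 + X4 + X5 | X1 X2 X3 X4 X5.
     X1 \<in> root_space G T (lin_comb T \<alpha> \<beta> (1, 0)) \<and>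
     X2 \<in> root_space G T (lin_comb T \<alpha> \<beta> (1, 1)) \<and>
     X3 \<in> root_space G T (lin_comb T \<alpha> \<beta> (2, 1)) \<and>
     X4 \<in> root_space G T (lin_comb T \<alpha> \<beta> (3, 1)) \<and>
     X5 \<in> root_space G T (lin_comb T \<alpha> \<beta> (3, 2))}"

section \<open>The flag variety and Hessenberg ideal fibers\<close>

text \<open>The underlying space of the variety \<open>G/B\<close> is the set of left cosets \<open>gB\<close> with the quotient
  of the Zariski topology of \<open>G\<close>.\<close>

definition flag_variety ::
  "(complex^'n^'n) set \<Rightarrow> (complex^'n^'n) set \<Rightarrow> (complex^'n^'n) set topology" where
  "flag_variety G B = topology (\<lambda>U. U \<subseteq> lcosets\<^bsub>as_group G\<^esub> B \<and>
     openin (subtopology zariski G) {g \<in> G. g <#\<^bsub>as_group G\<^esub> B \<in> U})"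

lemma openin_flag_variety:
  "openin (flag_variety G B) U \<longleftrightarrow> U \<subseteq> lcosets\<^bsub>as_group G\<^esub> B \<and>
     openin (subtopology zariski G) {g \<in> G. g <#\<^bsub>as_group G\<^esub> B \<in> U}"
proof -
  let ?p = "\<lambda>U. {g \<in> G. g <#\<^bsub>as_group G\<^esub> B \<in> U}"
  let ?L = "\<lambda>U. U \<subseteq> lcosets\<^bsub>as_group G\<^esub> B \<and> openin (subtopology zariski G) (?p U)"
  have "istopology ?L"
    unfolding istopology_def
  proof (intro conjI allI impI)
    fix U V assume U: "?L U" and V: "?L V"
    have "?p (U \<inter> V) = ?p U \<inter> ?p V"
      by blast
    then show "openin (subtopology zariski G) (?p (U \<inter> V))"
      using openin_Int[OF conjunct2[OF U] conjunct2[OF V]] by (simp only:)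
    from U show "U \<inter> V \<subseteq> lcosets\<^bsub>as_group G\<^esub> B"
      by blast
  next
    fix \<U> assume *: "\<forall>U\<in>\<U>. ?L U"
    have "?p (\<Union>\<U>) = \<Union> (?p ` \<U>)"
      by blast
    moreover have "openin (subtopology zariski G) (\<Union> (?p ` \<U>))"
      by (rule openin_Union) (use * in blast)
    ultimately show "openin (subtopology zariski G) (?p (\<Union>\<U>))"
      by (simp only:)
    from * show "\<Union>\<U> \<subseteq> lcosets\<^bsub>as_group G\<^esub> B"
      by blast
  qed
  then show ?thesis
    unfolding flag_variety_def by (simp only: topology_inverse')
qed

definition hessenberg_fiber ::
  "(complex^'n^'n) set \<Rightarrow> (complex^'n^'n) set \<Rightarrow> (complex^'n^'n) set \<Rightarrow> complex^'n^'n \<Rightarrow>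
   (complex^'n^'n) set set" where
  "hessenberg_fiber G B I N =
     {g <#\<^bsub>as_group G\<^esub> B | g. g \<in> G \<and> Ad (matrix_inv g) N \<in> I}"

end

theory Submission
 imports Defs "HOL-Complex_Analysis.Complex_Analysis" "HOL-Computational_Algebra.Computational_Algebra"
  "HOL-Computational_Algebra.Field_as_Ring"
begin

text \<open>As the radical of \<open>G\<close> is trivial, the trace form is nondegenerate on the Lie algebra (its radical would
 consist of nilpotent matrices and have a central element by Engel's theorem). Hence \<open>T\<close> has
 one-dimensional root spaces \<open>ee c\<close>, there is a big cell, and \<open>B\<close> is determined by its Lie algebra. Put
 \<open>L = <ee (3,1), ee (3,2)>\<close>, so that \<open>L\<close> is the image of \<open>(ad N)^3\<close>. For \<open>M = g^-1 N\<close> in \<open>I_alpha\<close>, either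
 \<open>M\<close> has no component at \<open>\<alpha>\<close> and \<open>g\<close> stabilises \<open>L\<close>, so that \<open>g B\<close> lies on the projective line \<open>K B / B\<close>,
 with \<open>K\<close> generated by the root groups of \<open>\<beta>\<close> and \<open>-\<beta>\<close>; or
 \<open>M\<close> is conjugate to a multiple of \<open>ee (1,0)\<close>, and \<open>g B\<close> lies on the surface \<open>K na K B / B\<close>, \<open>na\<close> being a
 representative of the reflection in \<open>\<alpha> + \<beta>\<close>. The coefficient of \<open>ee (2,1)\<close> in \<open>g (ee (2,1))\<close> is nonzero on
 the line and zero on the surface. Both are irreducible as images of entire curves in \<open>K\<close>. Polynomial charts
 bound the dimension of the surface, since a chain of three irreducible closed sets of points of a chart
 would give too many independent relations between two variables.\<close>

section \<open>Complex matrices\<close>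

no_notation fps_nth (infixl "$" 75)

notation mat_scale (infixr "\<cdot>" 75)

text \<open>The data are a matrix group and its list of roots, so no structure constants of the Lie
  algebra are at hand. The computations rest on one fact about brackets: root spaces are lines, and
  the bracket of two of them is nonzero whenever the sum is a root. Positivity enters through
  replicas: the Lie algebra of a closed subgroup contains, with a matrix \<open>X\<close>, the
  semisimple matrix whose eigenvalues are the complex conjugates of those of \<open>X\<close>, and
  pairing the two gives a sum of squares. This stands in for Cartan's criterion and for a compact
  real form. The big cell is at first known only up to the finite kernel of the adjoint
  representation, which has to be placed inside the torus before the Borel subgroup can be computed.
  The reflection in \<alpha>+\<beta> is the right one because it exchanges the weights (2,1) and
  (1,0) and fixes (3,1). The dimension bound for the surface serves twice: a translate of the line
  lies strictly inside the surface, so a longer chain in the line would produce a forbidden chain in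
  the surface.\<close>

lemma mat_scale_simps:
 fixes A B :: "complex^'n^'n"
 shows "(c \<cdot> A) ** B = c \<cdot> (A ** B)" "A ** (c \<cdot> B) = c \<cdot> (A ** B)"
  "c \<cdot> (A + B) = c \<cdot> A + c \<cdot> B" "c \<cdot> (A - B) = c \<cdot> A - c \<cdot> B" "c \<cdot> (- A) = - (c \<cdot> A)"
  "c \<cdot> d \<cdot> A = (c * d) \<cdot> A" "(c + d) \<cdot> A = c \<cdot> A + d \<cdot> A" "(c - d) \<cdot> A = c \<cdot> A - d \<cdot> A"
  "(- c) \<cdot> A = - (c \<cdot> A)" "1 \<cdot> A = A" "0 \<cdot> A = 0" "c \<cdot> (0 :: complex^'n^'n) = 0"
 by (simp_all add: vec_eq_iff matrix_matrix_mult_def sum_distrib_left algebra_simps)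

interpretation mm: vector_space "mat_scale :: complex => complex^'n^'n => complex^'n^'n"
 by unfold_locales (simp_all add: mat_scale_simps)

lemma mat_scale_eq_0 [simp]: "c \<cdot> A = 0 \<longleftrightarrow> c = 0 \<or> A = 0" for A :: "complex^'n^'n"
 by (rule mm.scale_eq_0_iff)

lemma scaleR_eq_mat_scale: "r *\<^sub>R A = complex_of_real r \<cdot> A" for A :: "complex^'n^'n"
 by (simp add: vec_eq_iff) (simp add: scaleR_conv_of_real)

lemma map_matrix_id [simp]: "map_matrix (\<lambda>a. a) A = A"
 by (simp add: vec_eq_iff)

lemma trace_zero [simp]: "trace (0 :: complex^'n^'n) = 0"
 by (simp add: trace_def)

lemma matrix_ring_simps:
 fixes A B C :: "complex^'n^'n"
 shows "A ** (B - C) = A ** B - A ** C" "(B - C) ** A = B ** A - C ** A"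
  "A ** (- B) = - (A ** B)" "(- A) ** B = - (A ** B)"
  "A ** 0 = 0" "0 ** A = 0"
  "A ** (B + C) = A ** B + A ** C" "(B + C) ** A = B ** A + C ** A"
 by (simp_all add: vec_eq_iff matrix_matrix_mult_def sum_subtractf sum_negf sum.distrib algebra_simps)

lemmas matrix_simps = mat_scale_simps matrix_ring_simps matrix_mul_assoc

lemma mat_scale_sum: "c \<cdot> (\<Sum>x\<in>S. f x) = (\<Sum>x\<in>S. c \<cdot> f x :: complex^'n^'n)"
 by (rule mm.scale_sum_right)

lemma matrix_sum_left: "(\<Sum>x\<in>S. f x) ** A = (\<Sum>x\<in>S. f x ** A)" for A :: "complex^'n^'n" and f :: "_ => complex^'n^'n"
 by (induction S rule: infinite_finite_induct) (simp_all add: matrix_ring_simps)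

lemma matrix_sum_right: "A ** (\<Sum>x\<in>S. f x) = (\<Sum>x\<in>S. A ** f x)" for A :: "complex^'n^'n" and f :: "_ => complex^'n^'n"
 by (induction S rule: infinite_finite_induct) (simp_all add: matrix_ring_simps)

lemma trace_scale [simp]: "trace (c \<cdot> A) = c * trace A" for A :: "complex^'n^'n"
 by (simp add: trace_def sum_distrib_left)

lemma trace_sum: "trace (\<Sum>x\<in>S. f x) = (\<Sum>x\<in>S. trace (f x))" for f :: "_ => complex^'n^'n"
 by (induction S rule: infinite_finite_induct) (simp_all add: trace_add)

lemma csubspace_imp_subspace: "mm.subspace S ==> subspace S"
 unfolding subspace_def mm.subspace_def scaleR_eq_mat_scale by auto

section \<open>Powers of a matrix and nilpotency\<close>

primrec mpow :: "complex^'n^'n => nat => complex^'n^'n" where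
 "mpow X 0 = mat 1"
| "mpow X (Suc k) = X ** mpow X k"

lemma mpow_commute: "X ** Y = Y ** X ==> mpow X k ** Y = Y ** mpow X k"
proof (induction k)
 case (Suc k)
 have "mpow X (Suc k) ** Y = X ** (mpow X k ** Y)" by (simp add: matrix_mul_assoc)
 also have "\<dots> = (X ** Y) ** mpow X k" using Suc by (simp add: matrix_mul_assoc)
 also have "\<dots> = Y ** mpow X (Suc k)" using Suc.prems by (simp add: matrix_mul_assoc)
 finally show ?case .
qed simp

lemma mpow_add: "mpow X (k + l) = mpow X k ** mpow X l"
 by (induction k) (simp_all add: matrix_mul_assoc)

lemma mpow_Suc_right: "mpow X (Suc k) = mpow X k ** X"
 using mpow_add[of X k 1] by simp

lemma mpow_mult_commuting:
 assumes "X ** Y = Y ** X"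
 shows "mpow (X ** Y) k = mpow X k ** mpow Y k"
proof (induction k)
 case (Suc k)
 have "mpow (X ** Y) (Suc k) = X ** (Y ** mpow X k) ** mpow Y k"
  using Suc by (simp add: matrix_mul_assoc)
 also have "Y ** mpow X k = mpow X k ** Y" using mpow_commute[OF assms] by simp
 finally show ?case by (simp add: matrix_mul_assoc)
qed simp

lemma mpow_scale: "mpow (c \<cdot> X) k = c ^ k \<cdot> mpow X k"
 by (induction k) (simp_all add: mat_scale_simps)

definition nilpotent :: "complex^'n^'n => bool" where
 "nilpotent X \<longleftrightarrow> (\<exists>k. mpow X k = 0)"

lemma mpow_zero_mono: "mpow X k = 0 ==> k \<le> l ==> mpow X l = 0"
 using mpow_add[of X "l - k" k] by (simp add: matrix_ring_simps)

lemma nilpotent_mult_commuting: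
 "X ** Y = Y ** X ==> nilpotent X ==> nilpotent (X ** Y)"
 unfolding nilpotent_def using mpow_mult_commuting[of X Y] by (metis matrix_ring_simps(6))

text \<open>With a generalised inverse \<open>Q\<close> of \<open>N\<close>, the matrices \<open>N\<close> and \<open>N N Q\<close> have the same trace, and
 the second one has smaller nilpotency index.\<close>

lemma trace_nilpotent:
 fixes N :: "complex^'n^'n"
 assumes "nilpotent N"
 shows "trace N = 0"
proof -
 obtain k where "mpow N k = 0" using assms unfolding nilpotent_def by blast
 thus ?thesis
 proof (induction k arbitrary: N)
  case 0
  hence "mat 1 = (0 :: complex^'n^'n)" by simp
  hence "N = 0" by (metis matrix_mul_lid matrix_ring_simps(6))
  thus ?case by (simp add:)
 next
  case (Suc k)
  obtain g where g: "Vector_Spaces.linear (*s) (*s) g" "\<forall>v\<in>range ((*v) N). N *v (g v) = v"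
   using vec.linear_exists_right_inverse_on[OF matrix_vector_mul_linear_gen vec.subspace_UNIV, of N]
   by auto
  define Q where "Q = matrix g"
  have "N *v (Q *v (N *v x)) = N *v x" for x
   using g by (simp add: Q_def matrix_works)
  hence NQN: "N ** Q ** N = N"
   by (intro matrix_eq[THEN iffD2]) (simp add: matrix_vector_mul_assoc matrix_mul_assoc)
  define M where "M = N ** N ** Q"
  have M: "mpow M (Suc j) = mpow N (Suc (Suc j)) ** Q" for j
  proof (induction j)
   case (Suc j)
   have "mpow M (Suc (Suc j)) = N ** (N ** Q ** N) ** mpow N (Suc j) ** Q"
    using Suc by (simp add: M_def matrix_mul_assoc)
   thus ?case unfolding NQN by (simp add: matrix_mul_assoc)
  qed (simp add: M_def matrix_mul_assoc)
  have "trace N = trace (N ** (Q ** N))" by (simp add: NQN matrix_mul_assoc)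
  also have "\<dots> = trace ((Q ** N) ** N)" by (rule trace_mul_sym)
  also have "\<dots> = trace (Q ** (N ** N))" by (simp add: matrix_mul_assoc)
  also have "\<dots> = trace M" unfolding M_def by (rule trace_mul_sym)
  also have "\<dots> = 0"
  proof (cases k)
   case 0
   hence "N = 0" using Suc.prems by simp
   thus ?thesis by (simp add: M_def matrix_ring_simps)
  next
   case (Suc j)
   hence "mpow M k = 0" using M[of j] Suc.prems by (simp add: matrix_ring_simps)
   thus ?thesis by (rule Suc.IH)
  qed
  finally show ?case .
 qed
qed

section \<open>Spectral decomposition\<close>

definition pmat :: "complex^'n^'n => complex poly => complex^'n^'n" where
 "pmat X p = (\<Sum>i\<le>degree p. coeff p i \<cdot> mpow X i)"

lemma pmat_eq: "degree p \<le> n ==> pmat X p = (\<Sum>i\<le>n. coeff p i \<cdot> mpow X i)"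
 unfolding pmat_def by (rule sum.mono_neutral_left) (auto simp: coeff_eq_0)

lemma pmat_0 [simp]: "pmat X 0 = 0"
 by (simp add: pmat_def)

lemma pmat_add: "pmat X (p + q) = pmat X p + pmat X q"
 by (simp add: pmat_eq[of _ "max (degree p) (degree q)"] degree_add_le sum.distrib mat_scale_simps)

lemma pmat_smult: "pmat X (smult c p) = c \<cdot> pmat X p"
 by (simp add: pmat_eq[of "smult c p" "degree p"] pmat_def mat_scale_sum mat_scale_simps degree_smult_le)

lemma pmat_pCons: "pmat X (pCons a p) = a \<cdot> mat 1 + X ** pmat X p"
proof -
 have "pmat X (pCons a p) = (\<Sum>i\<le>Suc (degree p). coeff (pCons a p) i \<cdot> mpow X i)"
  by (rule pmat_eq) (rule degree_pCons_le)
 also have "\<dots> = a \<cdot> mat 1 + (\<Sum>i\<le>degree p. coeff p i \<cdot> (X ** mpow X i))"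
  by (subst sum.atMost_Suc_shift) simp
 finally show ?thesis by (simp add: pmat_def matrix_sum_right mat_scale_simps)
qed

lemma pmat_mult: "pmat X (p * q) = pmat X p ** pmat X q"
 by (induction p)
  (simp_all add: pmat_add pmat_smult pmat_pCons matrix_simps mat_scale_simps del: mult_pCons_right)

lemma pmat_minus: "pmat X (- p) = - pmat X p"
 using pmat_smult[of X "-1" p] by (simp add: mat_scale_simps)

lemma pmat_diff: "pmat X (p - q) = pmat X p - pmat X q"
 using pmat_add[of X p "- q"] by (simp add: pmat_minus)

lemma pmat_1: "pmat X 1 = mat 1"
 using pmat_pCons[of X 1 0] by (simp add: matrix_ring_simps mat_scale_simps one_pCons)

lemma pmat_sum: "pmat X (\<Sum>l\<in>S. f l) = (\<Sum>l\<in>S. pmat X (f l))"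
 by (induction S rule: infinite_finite_induct) (simp_all add: pmat_add)

lemma pmat_power: "pmat X (p ^ k) = mpow (pmat X p) k"
 by (induction k) (simp_all add: pmat_1 pmat_mult)

lemma pmat_monom: "pmat X (monom c k) = c \<cdot> mpow X k"
 by (cases "c = 0") (simp_all add: pmat_def degree_monom_eq if_distrib[of "\<lambda>c. c \<cdot> _"] mat_scale_simps sum.If_cases sum.delta cong: if_cong)

lemma pmat_linear: "pmat X [:- l, 1:] = X - l \<cdot> mat 1"
 by (simp add: pmat_pCons matrix_simps)

lemma pmat_commute: "X ** Y = Y ** X ==> pmat X p ** Y = Y ** pmat X p"
 by (simp add: pmat_def matrix_sum_left matrix_sum_right mat_scale_simps mpow_commute)

text \<open>If two powers coincide, their difference annihilates \<open>X\<close>. Otherwise there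
  are more powers than the real dimension of the matrix space, and a real linear relation among them
  gives the polynomial.\<close>

lemma ex_annihilating_poly: "\<exists>p. p ~= 0 \<and> pmat (X :: complex^'n^'n) p = 0"
proof (cases "inj (mpow X)")
 case False
 then obtain i j where "i ~= j" "mpow X i = mpow X j" by (auto simp: inj_def)
 thus ?thesis
  by (intro exI[of _ "monom 1 i - monom 1 j"])
   (auto simp: pmat_diff pmat_monom monom_eq_iff')
next
 case True
 define N where "N = DIM(complex^'n^'n)"
 have "card (mpow X ` {..N}) = Suc N"
  using True by (simp add: card_image inj_on_subset)
 hence "dependent (mpow X ` {..N})"
  by (intro dependent_biggerset) (simp add: N_def)
 then obtain t u where t: "finite t" "t \<subseteq> mpow X ` {..N}" "(\<Sum>v\<in>t. u v *\<^sub>R v) = 0" "\<exists>v\<in>t. u v ~= 0"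
  unfolding dependent_explicit by blast
 define I where "I = {i. i \<le> N \<and> mpow X i \<in> t}"
 have tI: "t = mpow X ` I" using t(2) by (auto simp: I_def)
 have finI: "finite I" by (simp add: I_def)
 define p where "p = (\<Sum>i\<in>I. monom (complex_of_real (u (mpow X i))) i)"
 have "pmat X p = (\<Sum>i\<in>I. u (mpow X i) *\<^sub>R mpow X i)"
  by (simp add: p_def pmat_sum pmat_monom scaleR_eq_mat_scale)
 also have "\<dots> = (\<Sum>v\<in>t. u v *\<^sub>R v)"
  unfolding tI using True by (subst sum.reindex) (auto simp: inj_on_def inj_def)
 finally have "pmat X p = 0" using t(3) by simp
 moreover obtain i where i: "i \<in> I" "u (mpow X i) ~= 0" using t(4) unfolding tI by blast
 have "coeff p i = u (mpow X i)"
  using i finI by (simp add: p_def coeff_sum sum.delta cong: if_cong)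
 hence "p ~= 0" using i by auto
 ultimately show ?thesis by blast
qed

lemma coprime_linear_poly: "\<not> [:- l, 1:] dvd r ==> coprime [:- l, 1:] r" for r :: "complex poly"
 by (rule prime_elem_imp_coprime[OF prime_elem_linear_field_poly]) simp_all

lemma coprime_linear_powers:
 "l ~= m ==> coprime ([:- l, 1:] ^ i) ([:- m, 1:] ^ j)" for l m :: complex
 using coprime_linear_poly[of l "[:- m, 1:]"] by (simp add: poly_eq_0_iff_dvd[symmetric])

text \<open>The \<open>E l\<close> come from a Bezout identity for the coprime polynomials \<open>p div (x - l)^m\<close>.\<close>

lemma spectral_idempotents:
 assumes p: "p ~= 0" "pmat X p = 0"
 obtains E :: "complex => complex^'n^'n" where
  "(\<Sum>l | poly p l = 0. E l) = mat 1"
  "\<And>l m. poly p l = 0 ==> poly p m = 0 ==> l ~= m ==> E l ** E m = 0"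
  "\<And>l. mpow (X - l \<cdot> mat 1) (Polynomial.order l p) ** E l = 0"
  "\<And>l. \<exists>q. E l = pmat X q"
proof -
 let ?R = "{l. poly p l = 0}"
 let ?f = "\<lambda>l. [:- l, 1:] ^ Polynomial.order l p"
 have fin: "finite ?R" using p(1) by (rule poly_roots_finite)
 define r where "r l = p div ?f l" for l
 have pr: "p = ?f l * r l" for l by (simp add: r_def order_1)
 have "\<exists>v u. v * r l + u * ?f l = 1" for l
 proof -
  have "\<not> [:- l, 1:] dvd r l"
  proof
   assume "[:- l, 1:] dvd r l"
   hence "?f l * [:- l, 1:] dvd p" by (subst pr[of l]) (rule mult_dvd_mono, simp)
   hence "[:- l, 1:] ^ Suc (Polynomial.order l p) dvd p" by (simp only: power_Suc2)
   thus False using order_2[OF p(1)] by blast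
  qed
  hence "coprime [:- l, 1:] (r l)" by (rule coprime_linear_poly)
  hence "coprime (r l) (?f l)" by (simp add: coprime_commute)
  hence "gcd (r l) (?f l) = 1" by (simp add: coprime_iff_gcd_eq_1)
  thus ?thesis using bezout_coefficients_fst_snd[of "r l" "?f l"] by metis
 qed
 then obtain v u where vu: "v l * r l + u l * ?f l = 1" for l by metis
 define E where "E l = pmat X (v l * r l)" for l
 \<comment> \<open>The aim is that \<open>s\<close> annihilates \<open>X\<close>. Every
   \<open>?f m\<close> divides it, hence so does their product, which is \<open>p\<close> up to a
   scalar because complex polynomials split.\<close>
 define s where "s = 1 - (\<Sum>l\<in>?R. v l * r l)"
 have dv: "?f m dvd s" if m: "m \<in> ?R" for m
 proof -
  have "?f m dvd r l" if "l \<in> ?R" "l ~= m" for l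
  proof -
   have "coprime (?f m) (?f l)" using that coprime_linear_powers by metis
   moreover have "?f m dvd ?f l * r l" unfolding pr[symmetric] by (rule order_1)
   ultimately show ?thesis by (simp add: coprime_dvd_mult_right_iff)
  qed
  hence "?f m dvd (\<Sum>l\<in>?R - {m}. v l * r l)" by (intro dvd_sum dvd_mult) auto
  moreover have "s = u m * ?f m - (\<Sum>l\<in>?R - {m}. v l * r l)"
   using vu[of m] m fin by (simp add: s_def sum.remove algebra_simps)
  ultimately show ?thesis by (simp add: dvd_diff)
 qed
 have "(\<Prod>l\<in>?R. ?f l) dvd s"
 proof -
  have "(\<Prod>l\<in>S. ?f l) dvd s" if "finite S" "S \<subseteq> ?R" for S
   using that
  proof (induction S rule: finite_induct)
   case (insert m S)
   have "coprime (?f m) (\<Prod>l\<in>S. ?f l)"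
   proof (rule prod_coprime_right)
    fix l assume "l \<in> S"
    hence "m ~= l" using insert by auto
    thus "coprime (?f m) (?f l)" by (rule coprime_linear_powers)
   qed
   thus ?case using insert dv[of m] by (auto intro: divides_mult)
  qed simp
  thus ?thesis using fin by blast
 qed
 hence "p dvd s"
  using p(1) by (subst complex_poly_decompose[symmetric]) (simp add: smult_dvd)
 hence "pmat X s = 0" using p(2) by (auto simp: pmat_mult matrix_ring_simps)
 hence 1: "(\<Sum>l\<in>?R. E l) = mat 1" by (simp add: s_def pmat_diff pmat_1 pmat_sum E_def)
 have 2: "E l ** E m = 0" if "poly p l = 0" "poly p m = 0" "l ~= m" for l m
 proof -
  have "coprime (?f l) (?f m)" using that coprime_linear_powers by metis
  moreover have "?f l dvd ?f m * r m" unfolding pr[symmetric] by (rule order_1)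
  ultimately have "?f l dvd r m" by (simp add: coprime_dvd_mult_right_iff)
  then obtain w where "r m = ?f l * w" ..
  hence "(v l * r l) * (v m * r m) = (?f l * r l) * (w * v l * v m)" by (simp add: algebra_simps)
  also have "\<dots> = p * (w * v l * v m)" by (simp only: pr[symmetric])
  finally have "E l ** E m = pmat X (p * (w * v l * v m))"
   by (simp only: E_def pmat_mult[symmetric])
  thus ?thesis using p(2) by (simp add: pmat_mult[of X p] matrix_ring_simps)
 qed
 have 3: "mpow (X - l \<cdot> mat 1) (Polynomial.order l p) ** E l = 0" for l
 proof -
  have "mpow (X - l \<cdot> mat 1) (Polynomial.order l p) ** E l = pmat X (?f l * (v l * r l))"
   by (simp add: E_def pmat_mult pmat_power pmat_linear matrix_mul_assoc)
  also have "?f l * (v l * r l) = (?f l * r l) * v l" by (simp add: algebra_simps)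
  also have "\<dots> = p * v l" by (simp only: pr[symmetric])
  finally show ?thesis using p(2) by (simp add: pmat_mult matrix_ring_simps)
 qed
 show ?thesis by (rule that[of E]) (use 1 2 3 in \<open>auto simp: E_def\<close>)
qed

lemma spectral_decomposition:
 fixes X :: "complex^'n^'n"
 obtains L and E :: "complex => complex^'n^'n" and K where
  "finite L" "(\<Sum>l\<in>L. E l) = mat 1"
  "\<And>l m. l \<in> L ==> m \<in> L ==> E l ** E m = (if l = m then E l else 0)"
  "\<And>l. l \<in> L ==> mpow (X - l \<cdot> mat 1) K ** E l = 0"
  "\<And>l Y. X ** Y = Y ** X ==> E l ** Y = Y ** E l"
proof -
 obtain p where p: "p ~= 0" "pmat X p = 0" using ex_annihilating_poly by blast
 let ?R = "{l. poly p l = 0}"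
 have fin: "finite ?R" using p(1) by (rule poly_roots_finite)
 obtain E :: "complex => complex^'n^'n" where E:
  "(\<Sum>l\<in>?R. E l) = mat 1"
  "\<And>l m. poly p l = 0 ==> poly p m = 0 ==> l ~= m ==> E l ** E m = 0"
  "\<And>l. mpow (X - l \<cdot> mat 1) (Polynomial.order l p) ** E l = 0"
  "\<And>l. \<exists>q. E l = pmat X q"
  using spectral_idempotents[OF p] by blast
 have idem: "E l ** E l = E l" if "l \<in> ?R" for l
 proof -
  have "E l = E l ** (\<Sum>m\<in>?R. E m)" by (simp add: E)
  also have "\<dots> = (\<Sum>m\<in>?R. if m = l then E l ** E l else 0)"
   using that E(2) unfolding matrix_sum_right by (intro sum.cong) auto
  also have "\<dots> = E l ** E l" using that fin by (simp add: sum.delta)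
  finally show ?thesis by simp
 qed
 show ?thesis
 proof (rule that[of ?R E "degree p"])
  fix l assume "l \<in> ?R"
  \<comment> \<open>The orders differ from root to root; the degree of \<open>p\<close> serves as
    exponent for all of them.\<close>
  have "Polynomial.order l p \<le> degree p" using p(1) by (rule order_degree)
  then obtain d where "degree p = d + Polynomial.order l p" using le_Suc_ex by (metis add.commute)
  thus "mpow (X - l \<cdot> mat 1) (degree p) ** E l = 0"
   using E(3)[of l] by (simp add: mpow_add matrix_mul_assoc[symmetric] matrix_ring_simps)
 next
  fix l Y assume "X ** Y = Y ** X"
  thus "E l ** Y = Y ** E l" using E(4)[of l] pmat_commute by metis
 qed (use fin E idem in auto)
qed

text \<open>The \<open>E l\<close> are the projections onto the generalised eigenspaces of
  \<open>X\<close>. The last clause, which holds since they are polynomials in \<open>X\<close>,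
  lets them be moved past every matrix commuting with \<open>X\<close>.\<close>

definition spectral :: "complex^'n^'n => complex set => (complex => complex^'n^'n) => bool" where
 "spectral X L E \<longleftrightarrow> finite L \<and> (\<Sum>l\<in>L. E l) = mat 1 \<and>
   (\<forall>l\<in>L. \<forall>m\<in>L. E l ** E m = (if l = m then E l else 0)) \<and>
   (\<exists>K. \<forall>l\<in>L. mpow (X - l \<cdot> mat 1) K ** E l = 0) \<and>
   (\<forall>l Y. X ** Y = Y ** X --> E l ** Y = Y ** E l)"

text \<open>For additive \<open>\<phi>\<close> this is a replica of \<open>X\<close> in the sense of
  Chevalley: the function is applied to the eigenvalues and the nilpotent part is dropped. The
  identity gives the semisimple part of the Jordan decomposition, \<open>cnj\<close> its
  conjugate.\<close>

definition replica :: "complex set => (complex => complex^'n^'n) => (complex => complex) => complex^'n^'n" where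
 "replica L E \<phi> = (\<Sum>l\<in>L. \<phi> l \<cdot> E l)"

lemma ex_spectral: "\<exists>L E. spectral X L E"
proof -
 obtain L E K where "finite L" "(\<Sum>l\<in>L. E l) = mat 1"
  "\<And>l m. l \<in> L ==> m \<in> L ==> E l ** E m = (if l = m then E l else 0)"
  "\<And>l. l \<in> L ==> mpow (X - l \<cdot> mat 1) K ** E l = 0"
  "\<And>l Y. X ** Y = Y ** X ==> E l ** Y = Y ** E l"
  using spectral_decomposition[of X] by metis
 thus ?thesis unfolding spectral_def by blast
qed

lemma spectralD:
 assumes "spectral X L E"
 shows "finite L" "(\<Sum>l\<in>L. E l) = mat 1" "X ** Y = Y ** X ==> E l ** Y = Y ** E l"
  "l \<in> L ==> m \<in> L ==> E l ** E m = (if l = m then E l else 0)"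
proof -
 note a = assms[unfolded spectral_def]
 show "finite L" by (rule a[THEN conjunct1])
 show "(\<Sum>l\<in>L. E l) = mat 1" by (rule a[THEN conjunct2, THEN conjunct1])
 show "X ** Y = Y ** X ==> E l ** Y = Y ** E l"
  by (rule a[THEN conjunct2, THEN conjunct2, THEN conjunct2, THEN conjunct2, rule_format])
 show "l \<in> L ==> m \<in> L ==> E l ** E m = (if l = m then E l else 0)"
  by (rule a[THEN conjunct2, THEN conjunct2, THEN conjunct1, rule_format])
qed

lemma replica_commute:
 "spectral X L E ==> X ** Y = Y ** X ==> replica L E \<phi> ** Y = Y ** replica L E \<phi>"
proof -
 assume "spectral X L E" "X ** Y = Y ** X"
 hence "E l ** Y = Y ** E l" for l by (rule spectralD(3))
 thus ?thesis by (simp add: replica_def matrix_sum_left matrix_sum_right mat_scale_simps)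
qed

lemma replica_mult_idem: "spectral X L E ==> m \<in> L ==> replica L E \<phi> ** E m = \<phi> m \<cdot> E m"
proof -
 assume sp: "spectral X L E" and m: "m \<in> L"
 have "replica L E \<phi> ** E m = (\<Sum>l\<in>L. if l = m then \<phi> m \<cdot> E m else 0)"
  unfolding replica_def matrix_sum_left
  by (rule sum.cong) (simp_all add: mat_scale_simps spectralD(4)[OF sp _ m])
 thus ?thesis using m spectralD(1)[OF sp] by simp
qed

lemma replica_mult:
 "spectral X L E ==> replica L E \<phi> ** replica L E \<psi> = replica L E (\<lambda>l. \<phi> l * \<psi> l)"
 by (subst (2) replica_def)
  (simp add: matrix_sum_right mat_scale_simps replica_mult_idem mult.commute, simp add: replica_def)

text \<open>On the image of \<open>E m\<close> the replica acts as the scalar \<open>m\<close>, so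
  there the difference is \<open>X - m\<close>, which is nilpotent with a common exponent
  \<open>K\<close>.\<close>

lemma spectral_nilpotent_part:
 assumes "spectral X L E"
 shows "nilpotent (X - replica L E (\<lambda>l. l))"
proof -
 let ?N = "X - replica L E (\<lambda>l. l)"
 obtain K where K: "\<And>l. l \<in> L ==> mpow (X - l \<cdot> mat 1) K ** E l = 0"
  using assms unfolding spectral_def by blast
 have com: "E m ** X = X ** E m" for m
  using spectralD(3)[OF assms refl] .
 have "mpow ?N k ** E m = mpow (X - m \<cdot> mat 1) k ** E m" if m: "m \<in> L" for k m
 proof (induction k)
  case (Suc k)
  have "mpow (X - m \<cdot> mat 1) k ** E m = E m ** mpow (X - m \<cdot> mat 1) k"
   by (rule mpow_commute) (simp add: matrix_simps com)
  hence "mpow ?N (Suc k) ** E m = (?N ** E m) ** mpow (X - m \<cdot> mat 1) k"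
   using Suc by (simp add: matrix_mul_assoc[symmetric])
  also have "?N ** E m = (X - m \<cdot> mat 1) ** E m"
   using replica_mult_idem[OF assms m] by (simp add: matrix_simps)
  also have "\<dots> ** mpow (X - m \<cdot> mat 1) k = mpow (X - m \<cdot> mat 1) (Suc k) ** E m"
   using \<open>mpow (X - m \<cdot> mat 1) k ** E m = _\<close> by (simp add: matrix_mul_assoc[symmetric])
  finally show ?case .
 qed simp
 hence "mpow ?N K ** E m = 0" if "m \<in> L" for m using that K by simp
 hence "mpow ?N K ** (\<Sum>m\<in>L. E m) = 0" by (simp add: matrix_sum_right)
 thus ?thesis unfolding nilpotent_def spectralD(2)[OF assms] by auto
qed

text \<open>Simultaneous diagonalisability, expressed by common eigenvectors that span. In this form
  it passes to a larger set by splitting eigenvectors.\<close>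

definition simdiag :: "(complex^'n^'n) set => bool" where
 "simdiag S \<longleftrightarrow> vec.span {v. \<forall>A\<in>S. \<exists>c. A *v v = c *s v} = UNIV"

lemma mat_scale_mult_vec: "(c \<cdot> A) *v x = c *s (A *v x)" for A :: "complex^'n^'n"
 by (simp add: vec_eq_iff matrix_vector_mult_def sum_distrib_left mult.assoc)

lemma basis_matrix_from_span:
 fixes V :: "(complex^'n) set"
 assumes "vec.span V = UNIV"
 obtains P :: "complex^'n^'n" where "invertible P" "\<And>j. column j P \<in> V"
proof -
 obtain B where B: "B \<subseteq> V" "vec.independent B" "V \<subseteq> vec.span B"
  using vec.maximal_independent_subset by blast
 have spB: "vec.span B = UNIV"
  using B(3) assms vec.span_minimal[OF B(3) vec.subspace_span] by auto
 have "card B = vec.dim (UNIV :: (complex^'n) set)"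
  using vec.basis_card_eq_dim[of B UNIV] B spB by auto
 hence card: "card B = CARD('n)" by (simp add: card_cart_basis)
 have "finite B" using B(2) by (rule vec.finiteI_independent)
 then obtain f where f: "bij_betw f (UNIV :: 'n set) B"
  using card by (metis finite_class.finite_UNIV finite_same_card_bij)
 define P where "P = (\<chi> i j. f j $ i)"
 have col: "column j P = f j" for j by (simp add: column_def P_def vec_eq_iff)
 have "columns P = B" using f by (auto simp: columns_def col bij_betw_def)
 hence "invertible P"
  using spB matrix_right_invertible_span_columns[of P] invertible_right_inverse by auto
 thus ?thesis using that[of P] f B(1) by (auto simp: col bij_betw_def)
qed

lemma matrix_inv_mult: "invertible P ==> matrix_inv P ** P = mat 1" "invertible P ==> P ** matrix_inv P = mat 1"
 for P :: "complex^'n^'n"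
 using someI_ex[of "\<lambda>A. P ** A = mat 1 \<and> A ** P = mat 1"] unfolding invertible_def matrix_inv_def by auto

lemma simdiag_imp_diagonalizable:
 assumes "simdiag S"
 shows "\<exists>P :: complex^'n^'n. invertible P \<and>
  (\<forall>A\<in>S. \<forall>i j. i ~= j --> (matrix_inv P ** A ** P) $ i $ j = 0)"
proof -
 obtain P :: "complex^'n^'n" where P: "invertible P" "\<And>j. column j P \<in> {v. \<forall>A\<in>S. \<exists>c. A *v v = c *s v}"
  using basis_matrix_from_span assms unfolding simdiag_def by blast
 have "(matrix_inv P ** A ** P) $ i $ j = 0" if "A \<in> S" "i ~= j" for A i j
 proof -
  obtain c where c: "A *v column j P = c *s column j P" using P(2) \<open>A \<in> S\<close> by auto
  have "column j (matrix_inv P ** A ** P) = matrix_inv P *v (A *v column j P)"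
   by (simp add: vec_eq_iff column_def matrix_matrix_mult_def matrix_vector_mult_def
     sum_distrib_left sum_distrib_right mult.assoc) (intro allI sum.swap)
  also have "\<dots> = c *s column j (matrix_inv P ** P)"
   unfolding c by (simp add: vec_eq_iff column_def matrix_matrix_mult_def matrix_vector_mult_def
     sum_distrib_left algebra_simps)
  finally show ?thesis
   using that(2) matrix_inv_mult(1)[OF P(1)] by (simp add: vec_eq_iff column_def mat_def)
 qed
 thus ?thesis using P(1) by blast
qed

lemma column_mult: "column j (A ** P) = A *v column j P" for A P :: "complex^'n^'n"
 by (simp add: vec_eq_iff column_def matrix_matrix_mult_def matrix_vector_mult_def)

lemma diagonalizable_imp_simdiag:
 fixes P :: "complex^'n^'n"
 assumes "invertible P" "\<And>A i j. A \<in> S ==> i ~= j ==> (matrix_inv P ** A ** P) $ i $ j = 0"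
 shows "simdiag S"
proof -
 have "columns P \<subseteq> {v. \<forall>A\<in>S. \<exists>c. A *v v = c *s v}"
 proof (clarsimp simp: columns_def)
  fix j A assume A: "A \<in> S"
  let ?D = "matrix_inv P ** A ** P"
  have e: "A ** P = P ** ?D"
   by (simp add: matrix_mul_assoc matrix_inv_mult(2)[OF assms(1)])
  have "A *v column j P = P *v column j ?D"
   unfolding column_mult[symmetric] by (rule arg_cong[OF e])
  also have "column j ?D = ?D $ j $ j *s axis j 1"
   using assms(2)[OF A] by (auto simp: vec_eq_iff column_def axis_def)
  also have "P *v (?D $ j $ j *s axis j 1) = ?D $ j $ j *s column j P"
   by (simp add: vec_eq_iff matrix_vector_mult_def column_def axis_def if_distrib sum.delta mult.commute cong: if_cong)
  finally show "\<exists>c. A *v column j P = c *s column j P" by blast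
 qed
 moreover have "vec.span (columns P) = UNIV"
  using assms(1) matrix_right_invertible_span_columns[of P] invertible_right_inverse by auto
 ultimately show ?thesis unfolding simdiag_def using vec.span_mono by blast
qed

text \<open>A common eigenvector of \<open>S\<close> is the sum of its components under the
  \<open>E l\<close>. A component is still an eigenvector of \<open>S\<close> because
  \<open>E l\<close> commutes with \<open>S\<close>, and one of \<open>S'\<close> because
  \<open>S'\<close> acts by scalars on the image of \<open>E l\<close>.\<close>

lemma simdiag_Un:
 fixes E :: "'i => complex^'n^'n"
 assumes "simdiag S" "finite L" "(\<Sum>l\<in>L. E l) = mat 1"
  "\<And>l A. l \<in> L ==> A \<in> S ==> E l ** A = A ** E l"
  "\<And>l D. l \<in> L ==> D \<in> S' ==> \<exists>c. D ** E l = c \<cdot> E l"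
 shows "simdiag (S \<union> S')"
proof -
 let ?V = "{v. \<forall>A\<in>S. \<exists>c. A *v v = c *s v}" and ?W = "{v. \<forall>A\<in>S \<union> S'. \<exists>c. A *v v = c *s v}"
 have "?V \<subseteq> vec.span ?W"
 proof
  fix v assume v: "v \<in> ?V"
  have "E l *v v \<in> ?W" if l: "l \<in> L" for l
  proof (clarsimp, elim disjE)
   fix A assume A: "A \<in> S"
   then obtain c where "A *v v = c *s v" using v by auto
   hence "A *v (E l *v v) = c *s (E l *v v)"
    using assms(4)[OF l A] by (metis matrix_vector_mul_assoc vector_scalar_commute)
   thus "\<exists>c. A *v (E l *v v) = c *s (E l *v v)" by blast
  next
   fix D assume D: "D \<in> S'"
   thus "\<exists>c. D *v (E l *v v) = c *s (E l *v v)"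
    using assms(5)[OF l D] by (metis matrix_vector_mul_assoc mat_scale_mult_vec)
  qed
  hence "(\<Sum>l\<in>L. E l *v v) \<in> vec.span ?W"
   by (intro vec.span_sum vec.span_base) auto
  moreover have "(\<Sum>l\<in>L. E l *v v) = (\<Sum>l\<in>L. E l) *v v"
   using assms(2) by (induction L rule: finite_induct) (simp_all add: matrix_vector_mult_add_rdistrib)
  ultimately show "v \<in> vec.span ?W" using assms(3) by simp
 qed
 thus ?thesis using assms(1) unfolding simdiag_def
  by (metis (no_types, lifting) top.extremum_uniqueI vec.span_minimal vec.subspace_span)
qed

lemma simdiag_empty: "simdiag {}"
 by (simp add: simdiag_def)

lemma trace_conj: "invertible P ==> trace (matrix_inv P ** A ** P) = trace A" for A P :: "complex^'n^'n"
 using trace_mul_sym[of "matrix_inv P ** A" P] by (simp add: matrix_mul_assoc matrix_inv_mult)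

text \<open>Diagonalising \<open>E\<close> leaves only the entries 0 and 1, and the trace counts the
  ones. That the result is a nonnegative integer makes the terms of the sum in
  \<open>trace_star\<close> nonnegative.\<close>

lemma trace_idempotent:
 fixes E :: "complex^'n^'n"
 assumes "E ** E = E"
 shows "\<exists>n. trace E = of_nat n \<and> (n = 0 --> E = 0)"
proof -
 have sc: "\<exists>c. E ** (if b then E else mat 1 - E) = c \<cdot> (if b then E else mat 1 - E)" for b
  by (rule exI[of _ "if b then 1 else 0"]) (simp add: matrix_simps assms)
 have "simdiag ({} \<union> {E})"
 proof (rule simdiag_Un[where L = "UNIV :: bool set" and E = "\<lambda>b. if b then E else mat 1 - E"])
  fix l D assume "D \<in> {E}"
  thus "\<exists>c. D ** (if l then E else mat 1 - E) = c \<cdot> (if l then E else mat 1 - E)"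
   using sc[of l] by (simp only: singleton_iff)
 qed (simp_all add: simdiag_empty UNIV_bool)
 from simdiag_imp_diagonalizable[OF this]
 obtain P :: "complex^'n^'n" where P: "invertible P" "\<And>i j. i ~= j ==> (matrix_inv P ** E ** P) $ i $ j = 0"
  by auto
 define D where "D = matrix_inv P ** E ** P"
 have "D ** D = matrix_inv P ** (E ** (P ** matrix_inv P) ** E) ** P"
  by (simp add: D_def matrix_mul_assoc)
 hence DD: "D ** D = D" by (simp add: matrix_inv_mult P(1) assms D_def)
 have off: "D $ i $ j = 0" if "i ~= j" for i j using P(2)[OF that] by (simp add: D_def)
 have diag: "D $ i $ i = 0 \<or> D $ i $ i = 1" for i
 proof -
  have "D $ i $ i = (D ** D) $ i $ i" by (simp only: DD)
  also have "\<dots> = (\<Sum>k\<in>UNIV. D $ i $ k * D $ k $ i)" by (simp add: matrix_matrix_mult_def)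
  also have "\<dots> = (\<Sum>k\<in>UNIV. if k = i then D $ i $ i * D $ i $ i else 0)"
   by (intro sum.cong) (use off in auto)
  also have "\<dots> = D $ i $ i * D $ i $ i" by simp
  finally have "D $ i $ i * (D $ i $ i - 1) = 0" by (metis eq_iff_diff_eq_0 mult.right_neutral right_diff_distrib)
  thus ?thesis by simp
 qed
 have "trace D = (\<Sum>i\<in>UNIV. if D $ i $ i = 1 then 1 else 0)"
  unfolding trace_def using diag by (intro sum.cong) auto
 also have "\<dots> = of_nat (card {i. D $ i $ i = 1})" by (simp add: sum.If_cases)
 finally have tr: "trace E = of_nat (card {i. D $ i $ i = 1})"
  using trace_conj[OF P(1), of E] by (simp add: D_def)
 moreover have "E = 0" if "card {i. D $ i $ i = 1} = 0"
 proof -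
  have "D $ i $ j = 0" for i j using that off diag by (cases "i = j") auto
  hence "D = 0" by (simp add: vec_eq_iff)
  have "E = P ** D ** matrix_inv P"
   by (simp add: D_def matrix_mul_assoc matrix_inv_mult[OF P(1)])
    (simp add: matrix_mul_assoc[symmetric] matrix_inv_mult[OF P(1)])
  thus ?thesis using \<open>D = 0\<close> by (simp add: matrix_ring_simps)
 qed
 ultimately show ?thesis by (intro exI[of _ "card {i. D $ i $ i = 1}"] conjI impI)
qed

text \<open>The nilpotent part of \<open>X\<close> contributes nothing to the trace. What remains is
  the sum of the squared absolute values of the eigenvalues, each weighted with the rank of its
  projection, and this vanishes only if \<open>l \<cdot> E l\<close> is zero for every
  \<open>l\<close>.\<close>

lemma trace_star:
 assumes sp: "spectral X L E" and 0: "trace (X ** replica L E cnj) = 0"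
 shows "replica L E (\<lambda>l. l) = 0" "nilpotent X"
proof -
 let ?S = "replica L E (\<lambda>l. l)" and ?C = "replica L E cnj"
 have fin: "finite L" using sp by (rule spectralD)
 have "X ** ?C = ?C ** X" by (metis replica_commute[OF sp refl])
 moreover have "?S ** ?C = ?C ** ?S" by (simp add: replica_mult[OF sp] mult.commute)
 ultimately have "nilpotent ((X - ?S) ** ?C)"
  by (intro nilpotent_mult_commuting spectral_nilpotent_part[OF sp]) (simp add: matrix_simps)
 hence "trace ((X - ?S) ** ?C) = 0" by (rule trace_nilpotent)
 hence "trace (?S ** ?C) = 0" using 0 by (simp add: matrix_simps trace_sub)
 moreover have "trace (?S ** ?C) = (\<Sum>l\<in>L. l * cnj l * trace (E l))"
  unfolding replica_mult[OF sp] by (simp add: replica_def trace_sum)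
 moreover have "\<exists>n. trace (E l) = of_nat n \<and> (n = 0 --> E l = 0)" if "l \<in> L" for l
  by (rule trace_idempotent) (simp add: spectralD(4)[OF sp that that])
 then obtain n where n: "\<And>l. l \<in> L ==> trace (E l) = of_nat (n l) \<and> (n l = 0 --> E l = 0)" by metis
 ultimately have "(\<Sum>l\<in>L. complex_of_real ((cmod l)\<^sup>2 * real (n l))) = 0"
  by (simp add: complex_norm_square[symmetric])
 hence "(\<Sum>l\<in>L. (cmod l)\<^sup>2 * real (n l)) = 0"
  by (simp only: of_real_sum[symmetric] of_real_eq_0_iff)
 hence "(cmod l)\<^sup>2 * real (n l) = 0" if "l \<in> L" for l
  using that fin by (subst (asm) sum_nonneg_eq_0_iff) auto
 hence "l \<cdot> E l = 0" if "l \<in> L" for l using n[OF that] that by force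
 thus "?S = 0" unfolding replica_def by (rule sum.neutral[OF ballI])
 thus "nilpotent X" using spectral_nilpotent_part[OF sp] by simp
qed

section \<open>Brackets and Engel's theorem\<close>

definition br :: "complex^'n^'n => complex^'n^'n => complex^'n^'n" where
 "br X Y = X ** Y - Y ** X"

lemma br_simps:
 "br (X + Y) Z = br X Z + br Y Z" "br X (Y + Z) = br X Y + br X Z"
 "br (X - Y) Z = br X Z - br Y Z" "br X (Y - Z) = br X Y - br X Z"
 "br (c \<cdot> X) Y = c \<cdot> br X Y" "br X (c \<cdot> Y) = c \<cdot> br X Y"
 "br 0 Y = 0" "br X 0 = 0" "br X X = 0" "br (- X) Y = - br X Y" "br X (- Y) = - br X Y"
 by (simp_all add: br_def matrix_simps)

lemma br_anti: "br X Y = - br Y X"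
 by (simp add: br_def)

lemma br_sum_right: "br X (\<Sum>i\<in>I. f i) = (\<Sum>i\<in>I. br X (f i))"
 by (simp add: br_def matrix_sum_left matrix_sum_right sum_subtractf)

lemma br_sum_left: "br (\<Sum>i\<in>I. f i) X = (\<Sum>i\<in>I. br (f i) X)"
 by (simp add: br_def matrix_sum_left matrix_sum_right sum_subtractf)

lemma jacobi: "br X (br Y Z) = br (br X Y) Z + br Y (br X Z)"
 by (simp add: br_def matrix_simps)

lemma trace_br: "trace (br X Y ** Z) = trace (X ** br Y Z)"
proof -
 have "trace (Y ** X ** Z) = trace (X ** Z ** Y)"
  using trace_mul_sym[of Y "X ** Z"] by (simp only: matrix_mul_assoc)
 thus ?thesis by (simp add: br_def matrix_simps trace_sub)
qed

text \<open>The pair \<open>U0\<close>, \<open>U\<close> takes the place of a quotient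
  representation. A largest proper subalgebra \<open>K'\<close> has codimension one in
  \<open>K\<close>, because the induction hypothesis for \<open>K\<close> modulo \<open>K'\<close>
  yields an element \<open>y\<close> normalising it. For \<open>U\<close> modulo \<open>U0\<close>
  the hypothesis yields vectors killed by \<open>K'\<close>, and \<open>y\<close> acts nilpotently
  on these.\<close>

lemma engel:
 fixes K U U0 :: "(complex^'n^'n) set"
 assumes "mm.subspace K" "\<And>X Y. X \<in> K ==> Y \<in> K ==> br X Y \<in> K"
  and "\<And>X u. X \<in> K ==> u \<in> K \<union> U ==> \<exists>k. (br X ^^ k) u = 0"
  and "mm.subspace U" "mm.subspace U0" "U0 \<subset> U"
  and "\<And>X u. X \<in> K ==> u \<in> U ==> br X u \<in> U" "\<And>X u. X \<in> K ==> u \<in> U0 ==> br X u \<in> U0"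
 shows "\<exists>u\<in>U - U0. \<forall>X\<in>K. br X u \<in> U0"
 using assms
proof (induction "dim K" arbitrary: K U U0 rule: less_induct)
 case less
 note K = less.prems(1,2) and nil = less.prems(3) and U = less.prems(4-8)
 show ?case
 proof (cases "K = {0}")
  case True
  thus ?thesis using U(3) mm.subspace_0[OF U(2)] by (auto simp: br_simps)
 next
  case False
  define P where "P K' \<longleftrightarrow> mm.subspace K' \<and> (\<forall>X\<in>K'. \<forall>Y\<in>K'. br X Y \<in> K') \<and> K' \<subset> K" for K'
  have "P {0}" using False mm.subspace_0[OF K(1)] by (auto simp: P_def br_simps)
  moreover have "\<forall>K'. P K' --> dim K' < Suc DIM(complex^'n^'n)"
   by (intro allI impI le_imp_less_Suc dim_subset_UNIV)
  ultimately have "\<exists>K'. P K' \<and> (\<forall>K''. P K'' --> dim K'' \<le> dim K')"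
   by (rule ex_has_greatest_nat[of P "{0}" dim "Suc DIM(complex^'n^'n)"])
  then obtain K' where K': "P K'" and max: "\<And>K''. P K'' ==> dim K'' \<le> dim K'" by auto
  hence sK': "mm.subspace K'" and cK': "\<And>X Y. X \<in> K' ==> Y \<in> K' ==> br X Y \<in> K'" and KK': "K' \<subset> K"
   by (auto simp: P_def)
  have dim_less: "dim A < dim B" if "mm.subspace A" "mm.subspace B" "A \<subset> B" for A B
   using that csubspace_imp_subspace[OF that(1)] csubspace_imp_subspace[OF that(2)]
   by (intro dim_psubset) (simp add: span_eq_iff[THEN iffD2])
  have d: "dim K' < dim K" by (rule dim_less[OF sK' K(1) KK'])
  have "\<exists>y\<in>K - K'. \<forall>X\<in>K'. br X y \<in> K'"
  proof (rule less.hyps[OF d sK' cK' _ K(1) sK' KK'])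
   show "\<exists>k. (br X ^^ k) u = 0" if "X \<in> K'" "u \<in> K' \<union> K" for X u
    using nil[of X u] KK' that by blast
   show "br X u \<in> K" if "X \<in> K'" "u \<in> K" for X u
    using K(2)[of X u] KK' that by blast
  qed (use cK' in blast)+
  then obtain y where y: "y \<in> K" "y \<notin> K'" "\<And>X. X \<in> K' ==> br X y \<in> K'" by blast
  define K2 where "K2 = {x + c \<cdot> y | x c. x \<in> K'}"
  have "K2 = K"
  proof (rule ccontr)
   assume ne: "K2 ~= K"
   have "K2 \<subseteq> K" using y(1) KK' K(1) by (auto simp: K2_def intro!: mm.subspace_add[OF K(1)] mm.subspace_scale[OF K(1)])
   moreover have "mm.subspace K2"
    unfolding mm.subspace_def
   proof (intro conjI ballI allI)
    show "0 \<in> K2" using mm.subspace_0[OF sK'] by (auto simp: K2_def intro!: exI[of _ 0])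
    show "a + b \<in> K2" if ab: "a \<in> K2" "b \<in> K2" for a b
    proof -
     obtain x c x' c' where "a = x + c \<cdot> y" "x \<in> K'" "b = x' + c' \<cdot> y" "x' \<in> K'"
      using ab by (auto simp: K2_def)
     thus ?thesis unfolding K2_def
      by (intro CollectI exI[of _ "x + x'"] exI[of _ "c + c'"])
       (simp add: mat_scale_simps mm.subspace_add[OF sK'] algebra_simps)
    qed
    show "k \<cdot> a \<in> K2" if "a \<in> K2" for k a
    proof -
     obtain x c where "a = x + c \<cdot> y" "x \<in> K'" using \<open>a \<in> K2\<close> by (auto simp: K2_def)
     thus ?thesis unfolding K2_def
      by (intro CollectI exI[of _ "k \<cdot> x"] exI[of _ "k * c"])
       (simp add: mat_scale_simps mm.subspace_scale[OF sK'])
    qed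
   qed
   moreover have "br a b \<in> K2" if ab: "a \<in> K2" "b \<in> K2" for a b
   proof -
    obtain x c x' c' where e: "a = x + c \<cdot> y" "x \<in> K'" "b = x' + c' \<cdot> y" "x' \<in> K'"
     using ab by (auto simp: K2_def)
    have "br a b = (br x x' + c' \<cdot> br x y - c \<cdot> br x' y) + 0 \<cdot> y"
     using br_anti[of y x'] by (simp add: e br_simps mat_scale_simps)
    thus ?thesis unfolding K2_def
     by (intro CollectI exI conjI, assumption)
      (intro mm.subspace_add[OF sK'] mm.subspace_diff[OF sK'] mm.subspace_scale[OF sK'] cK' y(3) e)
   qed
   ultimately have "P K2" using ne by (auto simp: P_def)
   hence "dim K2 \<le> dim K'" by (rule max)
   moreover have "K' \<subset> K2"
   proof
    show "K' \<subseteq> K2" by (force simp: K2_def intro: exI[of _ "0::complex"])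
    have "y = 0 + 1 \<cdot> y" by (simp add: mat_scale_simps)
    hence "y \<in> K2" unfolding K2_def using mm.subspace_0[OF sK'] by blast
    thus "K' ~= K2" using y(2) by blast
   qed
   ultimately show False using dim_less[OF sK' \<open>mm.subspace K2\<close>] by simp
  qed
  define W where "W = {u \<in> U. \<forall>X\<in>K'. br X u \<in> U0}"
  have "\<exists>u\<in>U - U0. \<forall>X\<in>K'. br X u \<in> U0"
  proof (rule less.hyps[OF d sK' cK' _ U(1,2,3)])
   show "\<exists>k. (br X ^^ k) u = 0" if "X \<in> K'" "u \<in> K' \<union> U" for X u
    using nil[of X u] KK' that by blast
   show "br X u \<in> U" if "X \<in> K'" "u \<in> U" for X u
    using U(4)[of X u] KK' that by blast
   show "br X u \<in> U0" if "X \<in> K'" "u \<in> U0" for X u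
    using U(5)[of X u] KK' that by blast
  qed
  then obtain w where w: "w \<in> W" "w \<notin> U0" by (auto simp: W_def)
  have Wy: "br y u \<in> W" if "u \<in> W" for u
  proof -
   have "br X (br y u) \<in> U0" if X: "X \<in> K'" for X
    unfolding jacobi[of X y u] using \<open>u \<in> W\<close> y X U(5)
    by (intro mm.subspace_add[OF U(2)]) (auto simp: W_def)
   thus ?thesis using that U(4)[OF y(1), of u] by (simp add: W_def)
  qed
  have Wk: "(br y ^^ k) w \<in> W" for k by (induction k) (use w Wy in auto)
  obtain k where "(br y ^^ k) w = 0" using nil[OF y(1), of w] w by (auto simp: W_def)
  hence "(br y ^^ k) w \<in> U0" using mm.subspace_0[OF U(2)] by simp
  \<comment> \<open>The vector sought is the one just before the first iterate of
    \<open>br y\<close> that falls into \<open>U0\<close>.\<close>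
  then obtain k where k: "(br y ^^ k) w \<in> U0" "\<And>j. j < k ==> (br y ^^ j) w \<notin> U0"
   using exists_least_iff[of "\<lambda>k. (br y ^^ k) w \<in> U0"] by blast
  then obtain j where j: "k = Suc j" using w(2) by (cases k) auto
  let ?u = "(br y ^^ j) w"
  have "br X ?u \<in> U0" if "X \<in> K" for X
  proof -
   obtain x c where "X = x + c \<cdot> y" "x \<in> K'" using \<open>X \<in> K\<close> \<open>K2 = K\<close> by (auto simp: K2_def)
   moreover have "br x ?u \<in> U0" using Wk[of j] \<open>x \<in> K'\<close> by (simp add: W_def)
   moreover have "br y ?u \<in> U0" using k(1) by (simp add: j)
   ultimately show ?thesis
    by (simp add: br_simps mm.subspace_add[OF U(2)] mm.subspace_scale[OF U(2)])
  qed
  thus ?thesis using Wk[of j] k(2)[of j] by (auto simp: j W_def)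
 qed
qed

section \<open>The matrix exponential\<close>

definition mexp :: "complex^'n^'n => complex => complex^'n^'n" where
 "mexp X t = (\<chi> i j. \<Sum>k. mpow X k $ i $ j / fact k * t ^ k)"

lemma mpow_entry_bound: "\<exists>C. \<forall>k i j. cmod (mpow X k $ i $ j) \<le> C ^ k"
proof -
 define C where "C = 1 + (\<Sum>i\<in>UNIV. \<Sum>l\<in>UNIV. cmod (X $ i $ l))"
 have C: "(\<Sum>l\<in>UNIV. cmod (X $ i $ l)) \<le> C" for i
 proof -
  have "(\<Sum>l\<in>UNIV. cmod (X $ i $ l)) \<le> (\<Sum>i\<in>UNIV. \<Sum>l\<in>UNIV. cmod (X $ i $ l))"
   by (rule member_le_sum) (auto intro: sum_nonneg)
  thus ?thesis by (simp add: C_def)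
 qed
 have "1 \<le> C" unfolding C_def by (simp add: sum_nonneg)
 have "cmod (mpow X k $ i $ j) \<le> C ^ k" for k i j
 proof (induction k arbitrary: i)
  case 0
  thus ?case by (simp add: mat_def)
 next
  case (Suc k)
  have "cmod (mpow X (Suc k) $ i $ j) \<le> (\<Sum>l\<in>UNIV. cmod (X $ i $ l) * cmod (mpow X k $ l $ j))"
   by (simp add: matrix_matrix_mult_def) (rule order_trans[OF norm_sum], simp add: norm_mult)
  also have "\<dots> \<le> (\<Sum>l\<in>UNIV. cmod (X $ i $ l) * C ^ k)"
   by (intro sum_mono mult_left_mono Suc) auto
  also have "\<dots> = (\<Sum>l\<in>UNIV. cmod (X $ i $ l)) * C ^ k" by (simp add: sum_distrib_right)
  also have "\<dots> \<le> C * C ^ k" using C[of i] \<open>1 \<le> C\<close> by (intro mult_right_mono) auto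
  finally show ?case by simp
 qed
 thus ?thesis by blast
qed

lemma mexp_summable: "summable (\<lambda>k. mpow X k $ i $ j / fact k * t ^ k)"
proof -
 obtain C where C: "\<And>k. cmod (mpow X k $ i $ j) \<le> C ^ k" using mpow_entry_bound by blast
 have "summable (\<lambda>k. inverse (fact k) * (C * cmod t) ^ k)" by (rule summable_exp)
 thus ?thesis
 proof (rule summable_comparison_test'[where N = 0], goal_cases)
  case (1 k)
  have "cmod (mpow X k $ i $ j) * cmod t ^ k / fact k \<le> C ^ k * cmod t ^ k / fact k"
   by (intro divide_right_mono mult_right_mono C) auto
  thus ?case by (simp add: norm_mult norm_divide norm_power power_mult_distrib field_simps)
 qed
qed

text \<open>The complex derivative at \<open>t\<close>, taken entry by entry, so that facts about
  functions of one complex variable apply.\<close>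

definition mderiv :: "(complex => complex^'n^'n) => complex^'n^'n => complex => bool" where
 "mderiv g D t \<longleftrightarrow> (\<forall>i j. ((\<lambda>s. g s $ i $ j) has_field_derivative D $ i $ j) (at t))"

lemma one_plus_of_nat_neq_0 [simp]: "1 + complex_of_nat k ~= 0"
 by (metis of_nat_Suc of_nat_neq_0)

lemma mderiv_mexp: "mderiv (mexp X) (X ** mexp X t) t"
 unfolding mderiv_def
proof (intro allI)
 fix i j
 let ?c = "\<lambda>k. mpow X k $ i $ j / fact k"
 have "((\<lambda>t. \<Sum>k. ?c k * t ^ k) has_field_derivative (\<Sum>k. diffs ?c k * t ^ k)) (at t)"
  by (rule termdiffs_strong_converges_everywhere) (rule mexp_summable)
 moreover have "(\<Sum>k. diffs ?c k * t ^ k) = (X ** mexp X t) $ i $ j"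
 proof -
  have "diffs ?c k * t ^ k = (\<Sum>l\<in>UNIV. X $ i $ l * (mpow X k $ l $ j / fact k * t ^ k))" for k
  proof -
   have "diffs ?c k = mpow X (Suc k) $ i $ j / fact k"
    by (simp add: diffs_def divide_simps del: mpow.simps)
   thus ?thesis
    by (simp add: matrix_matrix_mult_def sum_distrib_right sum_divide_distrib mult.assoc)
  qed
  hence "(\<Sum>k. diffs ?c k * t ^ k) = (\<Sum>k. \<Sum>l\<in>UNIV. X $ i $ l * (mpow X k $ l $ j / fact k * t ^ k))"
   by simp
  also have "\<dots> = (\<Sum>l\<in>UNIV. \<Sum>k. X $ i $ l * (mpow X k $ l $ j / fact k * t ^ k))"
   by (rule suminf_sum) (intro summable_mult mexp_summable)
  also have "\<dots> = (\<Sum>l\<in>UNIV. X $ i $ l * (\<Sum>k. mpow X k $ l $ j / fact k * t ^ k))"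
   by (intro sum.cong refl suminf_mult mexp_summable)
  also have "\<dots> = (X ** mexp X t) $ i $ j" by (simp add: matrix_matrix_mult_def mexp_def)
  finally show ?thesis .
 qed
 ultimately show "((\<lambda>s. mexp X s $ i $ j) has_field_derivative (X ** mexp X t) $ i $ j) (at t)"
  by (simp add: mexp_def)
qed

lemma mexp_0 [simp]: "mexp X 0 = mat 1"
proof -
 have "(\<Sum>k. mpow X k $ i $ j / fact k * 0 ^ k) = mat 1 $ i $ j" for i j
  using powser_zero[of "\<lambda>k. mpow X k $ i $ j / fact k"] by simp
 thus ?thesis by (simp add: mexp_def vec_eq_iff)
qed

lemma mexp_commute:
 assumes "X ** Y = Y ** X"
 shows "mexp X t ** Y = Y ** mexp X t"
proof -
 have "(mexp X t ** Y) $ i $ j = (Y ** mexp X t) $ i $ j" for i j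
 proof -
  have "(mexp X t ** Y) $ i $ j = (\<Sum>l\<in>UNIV. \<Sum>k. mpow X k $ i $ l / fact k * t ^ k * Y $ l $ j)"
   unfolding matrix_matrix_mult_def mexp_def by (simp only: vec_lambda_beta suminf_mult2[OF mexp_summable])
  also have "\<dots> = (\<Sum>k. \<Sum>l\<in>UNIV. mpow X k $ i $ l / fact k * t ^ k * Y $ l $ j)"
   by (rule suminf_sum[symmetric]) (intro summable_mult2 mexp_summable)
  also have "\<dots> = (\<Sum>k. (mpow X k ** Y) $ i $ j / fact k * t ^ k)"
   by (simp add: matrix_matrix_mult_def sum_distrib_left sum_divide_distrib mult_ac)
  also have "\<dots> = (\<Sum>k. (Y ** mpow X k) $ i $ j / fact k * t ^ k)"
   by (simp only: mpow_commute[OF assms])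
  also have "\<dots> = (\<Sum>k. \<Sum>l\<in>UNIV. Y $ i $ l * (mpow X k $ l $ j / fact k * t ^ k))"
   by (simp add: matrix_matrix_mult_def sum_distrib_left sum_divide_distrib mult_ac)
  also have "\<dots> = (\<Sum>l\<in>UNIV. \<Sum>k. Y $ i $ l * (mpow X k $ l $ j / fact k * t ^ k))"
   by (rule suminf_sum) (intro summable_mult mexp_summable)
  also have "\<dots> = (Y ** mexp X t) $ i $ j"
   unfolding matrix_matrix_mult_def mexp_def by (simp only: vec_lambda_beta suminf_mult[OF mexp_summable])
  finally show ?thesis .
 qed
 thus ?thesis by (simp add: vec_eq_iff)
qed

lemma mderiv_const: "mderiv (\<lambda>t. C) 0 t"
 by (simp add: mderiv_def)

lemma mderiv_mult: "mderiv g D t ==> mderiv h D' t ==> mderiv (\<lambda>t. g t ** h t) (D ** h t + g t ** D') t"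
 unfolding mderiv_def matrix_matrix_mult_def
 by (auto intro!: derivative_eq_intros simp: sum.distrib[symmetric] algebra_simps)

lemma mderiv_add: "mderiv g D t ==> mderiv h D' t ==> mderiv (\<lambda>t. g t + h t) (D + D') t"
 unfolding mderiv_def by (auto intro!: derivative_eq_intros)

lemma mderiv_sum: "(\<And>k. k \<in> I ==> mderiv (g k) (D k) t) ==> mderiv (\<lambda>t. \<Sum>k\<in>I. g k t) (\<Sum>k\<in>I. D k) t"
 by (induction I rule: infinite_finite_induct) (simp_all add: mderiv_const mderiv_add)

lemma mderiv_scale: "(f has_field_derivative f') (at t) ==> mderiv (\<lambda>t. f t \<cdot> C) (f' \<cdot> C) t"
 unfolding mderiv_def by (auto intro!: derivative_eq_intros)

lemma mderiv_compose:
 "mderiv g D (f t) ==> (f has_field_derivative f') (at t) ==> mderiv (\<lambda>t. g (f t)) (f' \<cdot> D) t"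
 unfolding mderiv_def by (auto simp: mult.commute[of f'] intro!: DERIV_chain2[where g = f])

lemma mderiv_zero_const:
 assumes "\<And>t. mderiv g 0 t"
 shows "g t = g 0"
proof -
 have "g t $ i $ j = g 0 $ i $ j" for i j
 proof -
  have "\<exists>c. \<forall>x\<in>UNIV. g x $ i $ j = c"
   by (rule has_field_derivative_zero_constant) (use assms in \<open>auto simp: mderiv_def\<close>)
  thus ?thesis by auto
 qed
 thus ?thesis by (simp add: vec_eq_iff)
qed

lemma mexp_commute_self: "mexp X t ** X = X ** mexp X t"
 by (rule mexp_commute) (rule refl)

lemma mexp_inverse: "mexp X t ** mexp (- X) t = mat 1" "mexp (- X) t ** mexp X t = mat 1"
proof -
 have *: "mexp X t ** mexp (- X) t = mat 1" for X :: "complex^'n^'n"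
 proof -
  have "mderiv (\<lambda>t. mexp X t ** mexp (- X) t) 0 t" for t
   using mderiv_mult[OF mderiv_mexp[of X] mderiv_mexp[of "- X"], of t]
   by (simp add: matrix_simps mexp_commute_self)
  from mderiv_zero_const[OF this, of t] show ?thesis by simp
 qed
 show "mexp X t ** mexp (- X) t = mat 1" by (rule *)
 show "mexp (- X) t ** mexp X t = mat 1" using *[of "- X"] by simp
qed

text \<open>The derivative of \<open>mexp (- X) t ** g t\<close> vanishes. The functional equations
  of the exponential below are consequences of this uniqueness.\<close>

lemma mexp_unique:
 assumes "\<And>t. mderiv g (X ** g t) t"
 shows "g t = mexp X t ** g 0"
proof -
 have "mderiv (\<lambda>t. mexp (- X) t ** g t) 0 t" for t
  using mderiv_mult[OF mderiv_mexp[of "- X" t] assms[of t]] mexp_commute_self[of "- X" t]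
  by (simp add: matrix_simps)
 from mderiv_zero_const[OF this, of t] have "mexp (- X) t ** g t = g 0" by simp
 hence "mexp X t ** (mexp (- X) t ** g t) = mexp X t ** g 0" by simp
 thus ?thesis by (simp add: matrix_mul_assoc mexp_inverse)
qed

lemma mexp_add: "mexp X (s + t) = mexp X s ** mexp X t"
proof -
 have "mderiv (\<lambda>s. mexp X (s + t)) (X ** mexp X (s + t)) s" for s
 proof -
  have "((\<lambda>s. s + t) has_field_derivative 1) (at s)" by (auto intro!: derivative_eq_intros)
  from mderiv_compose[OF mderiv_mexp this, of X] show ?thesis by simp
 qed
 from mexp_unique[OF this, of s] show ?thesis by simp
qed

lemma mexp_sum_commuting:
 assumes "X ** Y = Y ** X"
 shows "mexp (X + Y) t = mexp X t ** mexp Y t"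
proof -
 have "mderiv (\<lambda>t. mexp X t ** mexp Y t) ((X + Y) ** (mexp X t ** mexp Y t)) t" for t
  using mderiv_mult[OF mderiv_mexp[of X t] mderiv_mexp[of Y t]]
  by (simp add: matrix_simps mexp_commute[OF assms])
 from mexp_unique[OF this, of t] show ?thesis by simp
qed

lemma mexp_scale: "mexp (c \<cdot> X) t = mexp X (c * t)"
proof -
 have "mderiv (\<lambda>t. mexp X (c * t)) ((c \<cdot> X) ** mexp X (c * t)) t" for t
 proof -
  have "((\<lambda>t. c * t) has_field_derivative c) (at t)" by (auto intro!: derivative_eq_intros)
  from mderiv_compose[OF mderiv_mexp this, of X] show ?thesis by (simp add: mat_scale_simps)
 qed
 from mexp_unique[OF this, of t] show ?thesis by simp
qed

lemma mexp_uminus: "mexp (- X) t = mexp X (- t)"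
 using mexp_scale[of "-1" X t] by (simp add: mat_scale_simps)

lemma invertible_mexp: "invertible (mexp X t)"
 unfolding invertible_def using mexp_inverse by blast

lemma matrix_inv_unique: "A ** B = mat 1 ==> B ** A = mat 1 ==> matrix_inv A = B" for A B :: "complex^'n^'n"
 by (metis invertible_def matrix_inv_mult(1) matrix_mul_assoc matrix_mul_lid matrix_mul_rid)

lemma matrix_inv_mexp: "matrix_inv (mexp X t) = mexp (- X) t"
 by (rule matrix_inv_unique) (rule mexp_inverse)+

lemma mexp_conj:
 assumes "invertible g"
 shows "g ** mexp X t ** matrix_inv g = mexp (Ad g X) t"
proof -
 have "mderiv (\<lambda>t. g ** mexp X t ** matrix_inv g) (Ad g X ** (g ** mexp X t ** matrix_inv g)) t" for t
 proof -
  have "Ad g X ** (g ** mexp X t ** matrix_inv g) = g ** X ** (matrix_inv g ** g) ** mexp X t ** matrix_inv g"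
   by (simp only: Ad_def matrix_mul_assoc)
  also have "\<dots> = g ** (X ** mexp X t) ** matrix_inv g"
   by (simp add: matrix_inv_mult[OF assms] matrix_mul_assoc)
  finally have e: "Ad g X ** (g ** mexp X t ** matrix_inv g) = g ** (X ** mexp X t) ** matrix_inv g" .
  show ?thesis unfolding e
   using mderiv_mult[OF mderiv_mult[OF mderiv_const[of g] mderiv_mexp[of X t]] mderiv_const[of "matrix_inv g"]]
   by (simp add: matrix_ring_simps)
 qed
 from mexp_unique[OF this, of t] show ?thesis by (simp add: matrix_inv_mult[OF assms])
qed

lemma mexp_replica:
 assumes "spectral X L E"
 shows "mexp (replica L E \<phi>) t = (\<Sum>l\<in>L. exp (\<phi> l * t) \<cdot> E l)"
proof -
 have "mderiv (\<lambda>t. \<Sum>l\<in>L. exp (\<phi> l * t) \<cdot> E l) (replica L E \<phi> ** (\<Sum>l\<in>L. exp (\<phi> l * t) \<cdot> E l)) t" for t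
 proof -
  have e: "replica L E \<phi> ** (\<Sum>l\<in>L. exp (\<phi> l * t) \<cdot> E l) = (\<Sum>l\<in>L. (exp (\<phi> l * t) * \<phi> l) \<cdot> E l)"
   by (simp add: matrix_sum_right mat_scale_simps replica_mult_idem[OF assms] cong: sum.cong)
  show ?thesis unfolding e
   by (intro mderiv_sum mderiv_scale) (auto intro!: derivative_eq_intros)
 qed
 from mexp_unique[OF this, of t] show ?thesis by (simp add: spectralD(2)[OF assms])
qed

lemma mexp_nilpotent:
 assumes "mpow X K = 0"
 shows "mexp X t = (\<Sum>k<K. (t ^ k / fact k) \<cdot> mpow X k)"
proof -
 have "(\<Sum>k. mpow X k $ i $ j / fact k * t ^ k) = (\<Sum>k<K. mpow X k $ i $ j / fact k * t ^ k)" for i j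
  by (rule suminf_finite) (use mpow_zero_mono[OF assms] in \<open>auto simp: not_less\<close>)
 thus ?thesis by (simp add: mexp_def vec_eq_iff sum_component mult.commute)
qed

lemma Ad_mexp: "Ad (mexp X t) Y = mexp X t ** Y ** mexp (- X) t"
 by (simp add: Ad_def matrix_inv_mexp)

text \<open>The finite sum \<open>h\<close> satisfies the differential equation of
  \<open>Ad (mexp X t) Y\<close>, and both start at \<open>Y\<close>.\<close>

lemma Ad_mexp_finite:
 assumes "(br X ^^ K) Y = 0"
 shows "Ad (mexp X t) Y = (\<Sum>k<K. (t ^ k / fact k) \<cdot> (br X ^^ k) Y)"
proof -
 define h where "h t = (\<Sum>k<K. (t ^ k / fact k) \<cdot> (br X ^^ k) Y)" for t
 have h': "mderiv h (br X (h t)) t" for t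
 proof -
  have "mderiv h (\<Sum>k<K. (of_nat k * t ^ (k - 1) / fact k) \<cdot> (br X ^^ k) Y) t"
   unfolding h_def by (intro mderiv_sum mderiv_scale) (auto intro!: derivative_eq_intros)
  also have "(\<Sum>k<K. (of_nat k * t ^ (k - 1) / fact k) \<cdot> (br X ^^ k) Y) = br X (h t)"
  proof (cases K)
   case (Suc m)
   have "(\<Sum>k<Suc m. (of_nat k * t ^ (k - 1) / fact k) \<cdot> (br X ^^ k) Y)
     = (\<Sum>k<m. (t ^ k / fact k) \<cdot> (br X ^^ Suc k) Y)"
    by (subst sum.lessThan_Suc_shift) (simp add: divide_simps)
   also have "\<dots> = (\<Sum>k<Suc m. (t ^ k / fact k) \<cdot> (br X ^^ Suc k) Y)"
    using assms Suc by simp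
   also have "\<dots> = br X (h t)" by (simp add: h_def Suc br_sum_right br_simps)
   finally show ?thesis by (simp add: Suc)
  qed (simp add: h_def br_simps)
  finally show ?thesis .
 qed
 have "mderiv (\<lambda>t. mexp (- X) t ** h t ** mexp X t) 0 t" for t
  using mderiv_mult[OF mderiv_mult[OF mderiv_mexp[of "- X" t] h'[of t]] mderiv_mexp[of X t]]
   mexp_commute_self[of "- X" t]
  by (simp add: matrix_simps br_def)
 from mderiv_zero_const[OF this, of t] have "mexp (- X) t ** h t ** mexp X t = h 0" by simp
 moreover have "h 0 = Y"
 proof (cases K)
  case (Suc m)
  thus ?thesis by (simp add: h_def sum.lessThan_Suc_shift mat_scale_simps del: sum.lessThan_Suc)
 next
  case 0
  thus ?thesis using assms by (simp add: h_def)
 qed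
 ultimately have "mexp X t ** (mexp (- X) t ** h t ** mexp X t) ** mexp (- X) t = Ad (mexp X t) Y"
  by (simp add: Ad_mexp)
 thus ?thesis
  by (simp add: matrix_mul_assoc mexp_inverse) (simp add: matrix_mul_assoc[symmetric] mexp_inverse h_def)
qed

text \<open>The successive derivatives are given explicitly as a family \<open>F\<close>, the form
  in which they arise from brackets and derivations; the identity theorem for entire functions does
  the rest.\<close>

lemma entire_zero_if_derivatives_vanish:
 fixes F :: "nat => complex => complex"
 assumes "\<And>k t. (F k has_field_derivative F (Suc k) t) (at t)" and "\<And>k. F k 0 = 0"
 shows "F 0 t = 0"
proof -
 have "(deriv ^^ k) (F 0) = F k" for k
 proof (induction k)
  case (Suc k)
  have "deriv (F k) = F (Suc k)" by (rule ext) (rule DERIV_imp_deriv[OF assms(1)])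
  thus ?case using Suc by simp
 qed simp
 moreover have "F 0 holomorphic_on UNIV"
  using assms(1)[of 0] by (auto simp: holomorphic_on_def field_differentiable_def)
 ultimately show ?thesis
  using holomorphic_fun_eq_0_on_connected[of "F 0" UNIV 0 t] assms(2) connected_UNIV by simp
qed

text \<open>The real orthogonal complement supplies a normal vector \<open>z\<close>. Pairing with
  its conjugate transpose has the real inner product with \<open>z\<close> as real part, and since
  \<open>V\<close> is stable under the imaginary unit, the imaginary part vanishes on
  \<open>V\<close> as well.\<close>

lemma csubspace_separation:
 fixes V :: "(complex^'n^'n) set"
 assumes "mm.subspace V" "W \<notin> V"
 obtains Z where "\<And>A. A \<in> V ==> trace (A ** Z) = 0" "trace (W ** Z) ~= 0"
proof -
 have V: "subspace V" using assms(1) by (rule csubspace_imp_subspace)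
 obtain y z where yz: "y \<in> span V" "\<And>w. w \<in> span V ==> orthogonal z w" "W = y + z"
  using orthogonal_subspace_decomp_exists[of V W] by metis
 hence y: "y \<in> V" using V by (simp add: span_eq_iff[THEN iffD2])
 have z: "z \<bullet> w = 0" if "w \<in> V" for w
  using yz(2)[of w] that by (simp add: span_base orthogonal_def)
 define Z where "Z = (\<chi> i j. cnj (z $ j $ i))"
 have tr: "trace (A ** Z) = (\<Sum>i\<in>UNIV. \<Sum>j\<in>UNIV. A $ i $ j * cnj (z $ i $ j))" for A
  by (simp add: trace_def matrix_matrix_mult_def Z_def)
 have re: "Re (trace (A ** Z)) = z \<bullet> A" for A
  by (simp add: tr inner_vec_def inner_complex_def mult.commute)
 have 0: "trace (A ** Z) = 0" if A: "A \<in> V" for A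
 proof -
  have "\<i> \<cdot> A \<in> V" using A mm.subspace_scale[OF assms(1)] by blast
  hence "Re (trace ((\<i> \<cdot> A) ** Z)) = 0" by (simp only: re z)
  hence "Im (trace (A ** Z)) = 0" by (simp add: mat_scale_simps)
  moreover have "Re (trace (A ** Z)) = 0" using A by (simp only: re z)
  ultimately show ?thesis by (simp add: complex_eq_iff)
 qed
 have "z ~= 0" using y yz(3) assms(2) by auto
 hence "Re (trace (z ** Z)) ~= 0" by (simp add: re)
 hence "trace (W ** Z) ~= 0" using 0[OF y] by (auto simp: yz(3) matrix_ring_simps trace_add)
 thus ?thesis using that 0 by blast
qed

lemma mderiv_trace:
 "mderiv g D t ==> ((\<lambda>t. trace (g t ** Z)) has_field_derivative trace (D ** Z)) (at t)"
 unfolding mderiv_def trace_def matrix_matrix_mult_def by (auto intro!: derivative_eq_intros)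

text \<open>A trace functional vanishing on \<open>V\<close> turns the orbit of \<open>Y\<close>
  into an entire function whose derivatives at 0 are the values on iterated brackets, and these
  brackets stay in \<open>V\<close>.\<close>

lemma Ad_mexp_stable:
 assumes V: "mm.subspace V" and stable: "\<And>Y. Y \<in> V ==> br X Y \<in> V" and Y: "Y \<in> V"
 shows "Ad (mexp X t) Y \<in> V"
proof (rule ccontr)
 assume "Ad (mexp X t) Y \<notin> V"
 then obtain Z where Z: "\<And>A. A \<in> V ==> trace (A ** Z) = 0" "trace (Ad (mexp X t) Y ** Z) ~= 0"
  using csubspace_separation[OF V] by blast
 define F where "F k t = trace (mexp X t ** (br X ^^ k) Y ** mexp (- X) t ** Z)" for k t
 have "(F k has_field_derivative F (Suc k) t) (at t)" for k t
 proof -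
  let ?C = "(br X ^^ k) Y"
  have e: "X ** mexp X t ** ?C ** mexp (- X) t + mexp X t ** ?C ** (- X ** mexp (- X) t)
    = mexp X t ** br X ?C ** mexp (- X) t"
   by (simp add: br_def matrix_simps mexp_commute_self)
  have "mderiv (\<lambda>t. mexp X t ** ?C ** mexp (- X) t)
    (X ** mexp X t ** ?C ** mexp (- X) t + mexp X t ** ?C ** (- X ** mexp (- X) t)) t"
   using mderiv_mult[OF mderiv_mult[OF mderiv_mexp[of X t] mderiv_const[of ?C]] mderiv_mexp[of "- X" t]]
   by (simp add: matrix_ring_simps)
  from mderiv_trace[OF this[unfolded e], of Z] show ?thesis unfolding F_def by simp
 qed
 moreover have "(br X ^^ k) Y \<in> V" for k by (induction k) (use Y stable in auto)
 hence "F k 0 = 0" for k by (simp add: F_def Z)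
 ultimately have "F 0 t = 0" by (rule entire_zero_if_derivatives_vanish)
 thus False using Z(2) by (simp add: F_def Ad_mexp)
qed

section \<open>Polynomial and regular functions\<close>

lemma poly_fun_sum: "(\<And>i. i \<in> I ==> f i \<in> poly_fun) ==> (\<lambda>A. \<Sum>i\<in>I. f i A) \<in> poly_fun"
 by (induction I rule: infinite_finite_induct) (auto intro: poly_fun.intros)

lemma poly_fun_prod: "(\<And>i. i \<in> I ==> f i \<in> poly_fun) ==> (\<lambda>A. \<Prod>i\<in>I. f i A) \<in> poly_fun"
 by (induction I rule: infinite_finite_induct) (auto intro: poly_fun.intros)

lemma poly_fun_power: "f \<in> poly_fun ==> (\<lambda>A. f A ^ k) \<in> poly_fun"
 by (induction k) (auto intro: poly_fun.intros)

lemma poly_fun_compose: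
 assumes "f \<in> poly_fun" "\<And>i j. (\<lambda>A. M A $ i $ j) \<in> poly_fun"
 shows "(\<lambda>A. f (M A)) \<in> poly_fun"
 using assms(1) by induction (auto intro: poly_fun.intros assms(2))

lemma poly_fun_subst: "f \<in> poly_fun ==> (\<lambda>A. f (P ** A ** Q)) \<in> poly_fun"
 by (erule poly_fun_compose)
  (auto simp: matrix_matrix_mult_def intro!: poly_fun_sum poly_fun.intros)

lemma poly_fun_det:
 assumes "\<And>i j. (\<lambda>A. M A $ i $ j) \<in> poly_fun"
 shows "(\<lambda>A. det (M A)) \<in> poly_fun"
 unfolding det_def by (intro poly_fun_sum poly_fun.mult poly_fun.const poly_fun_prod assms)

text \<open>Regular functions on the open set where \<open>d\<close> is nonzero; the values
  elsewhere are left free. With \<open>det\<close> for \<open>d\<close> these are the regular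
  functions on \<open>GL\<close>; later a product of minors takes the place of
  \<open>d\<close>.\<close>

definition loc_fun :: "(complex^'n^'n => complex) => (complex^'n^'n => complex) set" where
 "loc_fun d = {F. \<exists>f\<in>poly_fun. \<exists>k::nat. \<forall>A. d A ~= 0 --> F A = f A / d A ^ k}"

lemma loc_funI: "f \<in> poly_fun ==> (\<And>A. d A ~= 0 ==> F A = f A / d A ^ k) ==> F \<in> loc_fun d"
 unfolding loc_fun_def by blast

lemma poly_fun_imp_loc_fun: "f \<in> poly_fun ==> f \<in> loc_fun d"
 by (rule loc_funI[where k = 0]) auto

lemma loc_fun_add:
 assumes d: "d \<in> poly_fun" and "F \<in> loc_fun d" "G \<in> loc_fun d"
 shows "(\<lambda>A. F A + G A) \<in> loc_fun d"
proof -
 obtain f k where f: "f \<in> poly_fun" "\<And>A. d A ~= 0 ==> F A = f A / d A ^ k" using assms(2) unfolding loc_fun_def by blast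
 obtain g l where g: "g \<in> poly_fun" "\<And>A. d A ~= 0 ==> G A = g A / d A ^ l" using assms(3) unfolding loc_fun_def by blast
 show ?thesis
 proof (rule loc_funI[where k = "k + l"])
  show "(\<lambda>A. f A * d A ^ l + g A * d A ^ k) \<in> poly_fun"
   by (intro poly_fun.add poly_fun.mult f(1) g(1) poly_fun_power d)
  show "F A + G A = (f A * d A ^ l + g A * d A ^ k) / d A ^ (k + l)" if "d A ~= 0" for A
   unfolding f(2)[OF that] g(2)[OF that] power_add add_divide_distrib using that by simp
 qed
qed

lemma loc_fun_mult:
 assumes "F \<in> loc_fun d" "G \<in> loc_fun d"
 shows "(\<lambda>A. F A * G A) \<in> loc_fun d"
proof -
 obtain f k where f: "f \<in> poly_fun" "\<And>A. d A ~= 0 ==> F A = f A / d A ^ k" using assms(1) unfolding loc_fun_def by blast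
 obtain g l where g: "g \<in> poly_fun" "\<And>A. d A ~= 0 ==> G A = g A / d A ^ l" using assms(2) unfolding loc_fun_def by blast
 show ?thesis
  by (rule loc_funI[where k = "k + l", OF poly_fun.mult[OF f(1) g(1)]])
   (simp add: f(2) g(2) power_add)
qed

lemma loc_fun_compose:
 assumes "f \<in> poly_fun" "d \<in> poly_fun" "\<And>i j. (\<lambda>A. M A $ i $ j) \<in> loc_fun d"
 shows "(\<lambda>A. f (M A)) \<in> loc_fun d"
 using assms(1)
proof induction
 case (const c)
 show ?case by (intro poly_fun_imp_loc_fun poly_fun.const)
next
 case (coord i j)
 show ?case by (rule assms(3))
next
 case (add f g)
 thus ?case by (intro loc_fun_add assms(2))
next
 case (mult f g)
 thus ?case by (intro loc_fun_mult)
qed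

abbreviation reg_fun :: "(complex^'n^'n => complex) set" where
 "reg_fun \<equiv> loc_fun det"

lemma reg_funI: "f \<in> poly_fun ==> (\<And>A. invertible A ==> F A = f A / det A ^ k) ==> F \<in> reg_fun"
 by (rule loc_funI) (simp_all add: invertible_det_nz)

lemma reg_funE:
 assumes "F \<in> reg_fun"
 obtains f k where "f \<in> poly_fun" "\<And>A. invertible A ==> F A = f A / det A ^ k"
 using assms unfolding loc_fun_def invertible_det_nz[symmetric] by blast

lemmas poly_fun_imp_reg_fun = poly_fun_imp_loc_fun[of _ det]

lemma det_nz: "invertible A ==> det A ~= (0 :: complex)"
 by (simp add: invertible_det_nz)

lemma poly_fun_det_id: "(\<lambda>A. det A) \<in> poly_fun"
 by (rule poly_fun_det) (rule poly_fun.coord)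

lemmas reg_fun_add = loc_fun_add[OF poly_fun_det_id]
lemmas reg_fun_mult = loc_fun_mult[of _ det]

lemma reg_fun_const: "(\<lambda>A. c) \<in> reg_fun"
 by (intro poly_fun_imp_reg_fun poly_fun.const)

lemma reg_fun_coord: "(\<lambda>A. A $ i $ j) \<in> reg_fun"
 by (intro poly_fun_imp_reg_fun poly_fun.coord)

lemma reg_fun_sum: "(\<And>i. i \<in> I ==> f i \<in> reg_fun) ==> (\<lambda>A. \<Sum>i\<in>I. f i A) \<in> reg_fun"
 by (induction I rule: infinite_finite_induct) (auto intro: reg_fun_add reg_fun_const)

lemma reg_fun_prod: "(\<And>i. i \<in> I ==> f i \<in> reg_fun) ==> (\<lambda>A. \<Prod>i\<in>I. f i A) \<in> reg_fun"
 by (induction I rule: infinite_finite_induct) (auto intro: reg_fun_mult reg_fun_const)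

text \<open>Cramer's rule, which makes the entries of the inverse regular functions.\<close>

lemma matrix_inv_entry:
 fixes A :: "complex^'n^'n"
 assumes "invertible A"
 shows "matrix_inv A $ i $ j = det (\<chi> r c. if c = i then axis j 1 $ r else A $ r $ c) / det A"
proof -
 have "A *v column j (matrix_inv A) = column j (mat 1)"
  by (simp add: column_mult[symmetric] matrix_inv_mult[OF assms])
 also have "column j (mat 1) = axis j (1::complex)"
  by (auto simp: vec_eq_iff column_def mat_def axis_def)
 finally have "column j (matrix_inv A) = (\<chi> k. det (\<chi> r c. if c = k then axis j 1 $ r else A $ r $ c) / det A)"
  using cramer[OF det_nz[OF assms]] by blast
 thus ?thesis by (simp add: vec_eq_iff column_def)
qed

lemma reg_fun_inv: "(\<lambda>A. matrix_inv A $ i $ j) \<in> reg_fun"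
proof (rule reg_funI[where k = 1])
 show "(\<lambda>A. det (\<chi> r c. if c = i then axis j 1 $ r else A $ r $ c)) \<in> poly_fun"
 proof (rule poly_fun_det)
  show "(\<lambda>A. (\<chi> r c. if c = i then axis j 1 $ r else A $ r $ c) $ r $ c) \<in> poly_fun" for r c
   by (cases "c = i") (simp_all add: poly_fun.const poly_fun.coord)
 qed
qed (simp add: matrix_inv_entry)

lemma reg_fun_matrix_mult:
 assumes "\<And>i j. (\<lambda>A. M A $ i $ j) \<in> reg_fun" "\<And>i j. (\<lambda>A. N A $ i $ j) \<in> reg_fun"
 shows "(\<lambda>A. (M A ** N A) $ i $ j) \<in> reg_fun"
 unfolding matrix_matrix_mult_def by (simp, intro reg_fun_sum reg_fun_mult assms)

lemma reg_fun_Ad: "(\<lambda>A. Ad A X $ i $ j) \<in> reg_fun"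
 unfolding Ad_def by (intro reg_fun_matrix_mult reg_fun_coord reg_fun_const reg_fun_inv)

lemma reg_fun_trace_Ad: "(\<lambda>A. trace (Ad A X ** Z)) \<in> reg_fun"
 unfolding trace_def by (intro reg_fun_sum reg_fun_matrix_mult reg_fun_Ad reg_fun_const)

lemma reg_fun_compose_inv:
 assumes "f \<in> poly_fun"
 shows "(\<lambda>A. f (matrix_inv A)) \<in> reg_fun"
 using assms by induction (auto intro: reg_fun_const reg_fun_inv reg_fun_add reg_fun_mult)

lemma reg_fun_det:
 assumes "\<And>i j. (\<lambda>A. M A $ i $ j) \<in> reg_fun"
 shows "(\<lambda>A. det (M A)) \<in> reg_fun"
proof -
 have "(\<lambda>A. det (M A)) = (\<lambda>A. \<Sum>p | p permutes UNIV. of_int (sign p) * (\<Prod>i\<in>UNIV. M A $ i $ p i))"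
  by (rule ext) (rule det_def)
 thus ?thesis by (simp only:) (intro reg_fun_sum reg_fun_mult reg_fun_const reg_fun_prod assms)
qed

section \<open>The Zariski topology\<close>

lemma topspace_zariski [simp]: "topspace zariski = carrier GL"
proof
 show "topspace (zariski :: (complex^'n^'n) topology) \<subseteq> carrier GL"
  unfolding topspace_def openin_zariski by blast
 have "openin zariski (carrier GL :: (complex^'n^'n) set)"
  unfolding openin_zariski by (rule exI[of _ "{\<lambda>A. 1}"]) (auto intro: poly_fun.const)
 thus "carrier GL \<subseteq> topspace (zariski :: (complex^'n^'n) topology)"
  by (rule openin_subset)
qed

lemma closedin_zariski:
 "closedin zariski C \<longleftrightarrow> (\<exists>S\<subseteq>poly_fun. C = {A \<in> carrier GL. \<forall>f\<in>S. f A = 0})"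
proof -
 have "closedin zariski C \<longleftrightarrow> C \<subseteq> carrier GL \<and> (\<exists>S\<subseteq>poly_fun. carrier GL - C = {A \<in> carrier GL. \<exists>f\<in>S. f A ~= 0})"
  by (simp add: closedin_def openin_zariski)
 also have "\<dots> \<longleftrightarrow> (\<exists>S\<subseteq>poly_fun. C = {A \<in> carrier GL. \<forall>f\<in>S. f A = 0})"
 proof (intro iffI; elim conjE exE)
  fix S assume "C \<subseteq> carrier GL" "S \<subseteq> poly_fun" "carrier GL - C = {A \<in> carrier GL. \<exists>f\<in>S. f A ~= 0}"
  thus "\<exists>S\<subseteq>poly_fun. C = {A \<in> carrier GL. \<forall>f\<in>S. f A = 0}"
   by (intro exI[of _ S] conjI) auto
 next
  fix S assume "S \<subseteq> poly_fun" "C = {A \<in> carrier GL. \<forall>f\<in>S. f A = 0}"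
  thus "C \<subseteq> carrier GL \<and> (\<exists>S\<subseteq>poly_fun. carrier GL - C = {A \<in> carrier GL. \<exists>f\<in>S. f A ~= 0})"
   by (intro conjI exI[of _ S]) auto
 qed
 finally show ?thesis .
qed

lemma carrier_GL [simp]: "A \<in> carrier GL \<longleftrightarrow> invertible A"
 by (simp add: GL_def)

lemma closedin_reg_zero: "F \<in> reg_fun ==> closedin zariski {A. invertible A \<and> F A = 0}"
proof -
 assume "F \<in> reg_fun"
 then obtain f k where f: "f \<in> poly_fun" "\<And>A. invertible A ==> F A = f A / det A ^ k"
  using reg_funE by blast
 have "{A. invertible A \<and> F A = 0} = {A \<in> carrier GL. \<forall>f\<in>{f}. f A = 0}"
  using f(2) by (auto simp: det_nz)
 thus ?thesis unfolding closedin_zariski using f(1) by blast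
qed

definition zcl :: "(complex^'n^'n) set => (complex^'n^'n) set" where
 "zcl S = {A. invertible A \<and> (\<forall>f\<in>poly_fun. (\<forall>s\<in>S. f s = 0) --> f A = 0)}"

lemma closedin_zcl: "closedin zariski (zcl S)"
 unfolding closedin_zariski zcl_def
 by (rule exI[of _ "{f \<in> poly_fun. \<forall>s\<in>S. f s = 0}"]) auto

lemma zcl_superset: "S \<subseteq> carrier GL ==> S \<subseteq> zcl S"
 by (auto simp: zcl_def)

lemma zcl_minimal: "closedin zariski C ==> S \<subseteq> C ==> zcl S \<subseteq> C"
proof
 assume "closedin zariski C" and S: "S \<subseteq> C"
 then obtain P where P: "P \<subseteq> poly_fun" "C = {A \<in> carrier GL. \<forall>f\<in>P. f A = 0}"
  unfolding closedin_zariski by auto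
 fix A assume A: "A \<in> zcl S"
 have "f A = 0" if "f \<in> P" for f
  using A that P S by (auto simp: zcl_def subset_iff)
 thus "A \<in> C" using A P(2) by (simp add: zcl_def)
qed

lemma zcl_closed: "closedin zariski C ==> zcl C = C"
 using zcl_minimal[of C C] zcl_superset[of C] closedin_subset[of zariski C] by auto

lemma zcl_mono: "S \<subseteq> T ==> zcl S \<subseteq> zcl T"
 unfolding zcl_def by blast

lemma zcl_reg_zero:
 assumes "F \<in> reg_fun" "\<And>s. s \<in> S ==> invertible s" "\<And>s. s \<in> S ==> F s = 0" "A \<in> zcl S"
 shows "F A = 0"
 using zcl_minimal[OF closedin_reg_zero[OF assms(1)], of S] assms by blast

text \<open>One factor varies at a time: for fixed \<open>s\<close> the polynomial conditions on the
  right factor pass from \<open>T\<close> to its closure, and then for fixed \<open>b\<close> those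
  on the left factor pass from \<open>S\<close> to its closure.\<close>

lemma zcl_mult:
 assumes "\<And>s t. s \<in> S ==> t \<in> T ==> s ** t \<in> zcl U" "a \<in> zcl S" "b \<in> zcl T"
 shows "a ** b \<in> zcl U"
proof -
 have inv: "invertible (a ** b)" using assms(2,3) by (auto simp: zcl_def intro: invertible_mult)
 have "f (a ** b) = 0" if f: "f \<in> poly_fun" "\<forall>u\<in>U. f u = 0" for f
 proof -
  have 1: "f (s ** b) = 0" if s: "s \<in> S" for s
  proof -
   have "(\<lambda>B. f (s ** B)) \<in> poly_fun" using poly_fun_subst[OF f(1), of s "mat 1"] by simp
   moreover have "\<forall>t\<in>T. f (s ** t) = 0" using assms(1)[OF s] f by (auto simp: zcl_def)
   ultimately show ?thesis using assms(3) by (auto simp: zcl_def)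
  qed
  have "(\<lambda>B. f (B ** b)) \<in> poly_fun" using poly_fun_subst[OF f(1), of "mat 1" b] by simp
  thus ?thesis using assms(2) 1 by (auto simp: zcl_def)
 qed
 thus ?thesis using inv by (simp add: zcl_def)
qed

lemma invertible_matrix_inv: "invertible A ==> invertible (matrix_inv A)" for A :: "complex^'n^'n"
 unfolding invertible_def[of "matrix_inv A"] using matrix_inv_mult by blast

lemma matrix_inv_inv: "invertible A ==> matrix_inv (matrix_inv A) = A" for A :: "complex^'n^'n"
 by (rule matrix_inv_unique) (simp_all add: matrix_inv_mult)

lemma matrix_inv_mult_distrib:
 "invertible A ==> invertible B ==> matrix_inv (A ** B) = matrix_inv B ** matrix_inv A"
 for A B :: "complex^'n^'n"
proof (rule matrix_inv_unique)
 assume AB: "invertible A" "invertible B"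
 have "A ** B ** (matrix_inv B ** matrix_inv A) = A ** (B ** matrix_inv B) ** matrix_inv A"
  by (simp only: matrix_mul_assoc)
 thus "A ** B ** (matrix_inv B ** matrix_inv A) = mat 1" by (simp add: matrix_inv_mult AB)
 have "matrix_inv B ** matrix_inv A ** (A ** B) = matrix_inv B ** (matrix_inv A ** A) ** B"
  by (simp only: matrix_mul_assoc)
 thus "matrix_inv B ** matrix_inv A ** (A ** B) = mat 1" by (simp add: matrix_inv_mult AB)
qed

lemma zcl_inv:
 assumes "\<And>s. s \<in> S ==> invertible s" "\<And>s. s \<in> S ==> matrix_inv s \<in> zcl U" "a \<in> zcl S"
 shows "matrix_inv a \<in> zcl U"
proof -
 have "f (matrix_inv a) = 0" if f: "f \<in> poly_fun" "\<forall>u\<in>U. f u = 0" for f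
  using zcl_reg_zero[OF reg_fun_compose_inv[OF f(1)] assms(1) _ assms(3)] assms(2) f
  by (auto simp: zcl_def)
 thus ?thesis using assms(3) by (simp add: zcl_def invertible_matrix_inv)
qed

lemma invertible_mat_1 [simp]: "invertible (mat 1 :: complex^'n^'n)"
 unfolding invertible_def by (rule exI[of _ "mat 1"]) simp

lemma GL_simps [simp]: "A \<otimes>\<^bsub>GL\<^esub> B = A ** B" "\<one>\<^bsub>GL\<^esub> = mat 1"
 by (simp_all add: GL_def)

lemma group_GL: "group (GL :: (complex^'n^'n) monoid)"
proof (rule groupI)
 show "\<exists>y\<in>carrier GL. y \<otimes>\<^bsub>GL\<^esub> x = \<one>\<^bsub>GL\<^esub>" if "x \<in> carrier GL" for x :: "complex^'n^'n"
  using that matrix_inv_mult[of x] by (intro bexI[of _ "matrix_inv x"]) (simp_all add: invertible_matrix_inv)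
qed (simp_all add: matrix_mul_assoc invertible_mult)

lemma inv_GL: "invertible A ==> inv\<^bsub>GL\<^esub> A = matrix_inv A" for A :: "complex^'n^'n"
 using group.inv_equality[OF group_GL, of "matrix_inv A" A]
 by (simp add: matrix_inv_mult invertible_matrix_inv)

lemma subgroup_GL_iff:
 "subgroup H GL \<longleftrightarrow> (\<forall>A\<in>H. invertible A) \<and> mat 1 \<in> H \<and> (\<forall>A\<in>H. \<forall>B\<in>H. A ** B \<in> H) \<and>
   (\<forall>A\<in>H. matrix_inv A \<in> H)" for H :: "(complex^'n^'n) set"
proof
 assume H: "subgroup H GL"
 hence inv: "\<forall>A\<in>H. invertible A" using subgroup.subset[OF H] by auto
 thus "(\<forall>A\<in>H. invertible A) \<and> mat 1 \<in> H \<and> (\<forall>A\<in>H. \<forall>B\<in>H. A ** B \<in> H) \<and> (\<forall>A\<in>H. matrix_inv A \<in> H)"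
  using subgroup.m_closed[OF H] subgroup.one_closed[OF H] subgroup.m_inv_closed[OF H]
  by (simp add: inv_GL)
next
 assume H: "(\<forall>A\<in>H. invertible A) \<and> mat 1 \<in> H \<and> (\<forall>A\<in>H. \<forall>B\<in>H. A ** B \<in> H) \<and> (\<forall>A\<in>H. matrix_inv A \<in> H)"
 thus "subgroup H GL"
  by (intro subgroup.intro)
   (auto simp: inv_GL)
qed

lemma zcl_subgroup:
 assumes "subgroup H GL"
 shows "closed_subgroup (zcl H)"
proof -
 note H = assms[unfolded subgroup_GL_iff]
 have sup: "H \<subseteq> zcl H" using H by (intro zcl_superset) auto
 have "subgroup (zcl H) GL"
  unfolding subgroup_GL_iff
 proof (intro conjI ballI)
  show "A ** B \<in> zcl H" if "A \<in> zcl H" "B \<in> zcl H" for A B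
   using zcl_mult[OF _ that] H sup by blast
  show "matrix_inv A \<in> zcl H" if "A \<in> zcl H" for A
   using zcl_inv[OF _ _ that] H sup by blast
 qed (use H sup in \<open>auto simp: zcl_def\<close>)
 thus ?thesis unfolding closed_subgroup_def using closedin_zcl by blast
qed

lemma closed_subgroupD:
 assumes "closed_subgroup G"
 shows "A \<in> G ==> invertible A" "mat 1 \<in> G" "A \<in> G ==> B \<in> G ==> A ** B \<in> G"
  "A \<in> G ==> matrix_inv A \<in> G" "zcl G = G"
 using assms zcl_closed[of G] unfolding closed_subgroup_def subgroup_GL_iff by auto

section \<open>Irreducible sets\<close>

text \<open>Irreducibility as primeness of the ideal of polynomials vanishing on \<open>S\<close>.
  It makes sense for sets that are not closed, such as groups generated by exponentials.\<close>

definition zirr :: "(complex^'n^'n) set => bool" where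
 "zirr S \<longleftrightarrow> S ~= {} \<and> (\<forall>f\<in>poly_fun. \<forall>g\<in>poly_fun. (\<forall>A\<in>S. f A * g A = 0) -->
   (\<forall>A\<in>S. f A = 0) \<or> (\<forall>A\<in>S. g A = 0))"

lemma zirr_zcl: "zirr S ==> S \<subseteq> carrier GL ==> zirr (zcl S)"
 unfolding zirr_def
proof (intro conjI ballI impI, goal_cases)
 case 1
 thus ?case using zcl_superset by blast
next
 case (2 f g)
 hence "\<forall>A\<in>S. f A * g A = 0" using zcl_superset[of S] by blast
 with 2 have "(\<forall>A\<in>S. f A = 0) \<or> (\<forall>A\<in>S. g A = 0)" by blast
 thus ?case using 2 unfolding zcl_def by blast
qed

lemma zirr_imp_irreducible:
 assumes "zirr S" "S \<subseteq> carrier GL"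
 shows "irreducible_space (subtopology zariski S)"
 unfolding irreducible_space_def
proof (intro conjI allI impI)
 have ts: "topspace (subtopology zariski S) = S" using assms(2) by auto
 thus "topspace (subtopology zariski S) ~= {}" using assms(1) by (simp add: zirr_def)
 fix C D assume CD: "closedin (subtopology zariski S) C \<and> closedin (subtopology zariski S) D \<and>
  topspace (subtopology zariski S) = C \<union> D"
 then obtain C' D' where C': "closedin zariski C'" "C = C' \<inter> S" and D': "closedin zariski D'" "D = D' \<inter> S"
  unfolding closedin_subtopology by blast
 obtain P where P: "P \<subseteq> poly_fun" "C' = {A \<in> carrier GL. \<forall>f\<in>P. f A = 0}"
  using C'(1) unfolding closedin_zariski by blast
 obtain Q where Q: "Q \<subseteq> poly_fun" "D' = {A \<in> carrier GL. \<forall>f\<in>Q. f A = 0}"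
  using D'(1) unfolding closedin_zariski by blast
 show "C = topspace (subtopology zariski S) \<or> D = topspace (subtopology zariski S)"
 proof (rule ccontr)
  assume ne: "\<not> ?thesis"
  then obtain a where a: "a \<in> S" "a \<notin> C'" using C' ts by auto
  obtain b where b: "b \<in> S" "b \<notin> D'" using D' ts ne by auto
  obtain f where f: "f \<in> P" "f a ~= 0" using a P assms(2) by auto
  obtain g where g: "g \<in> Q" "g b ~= 0" using b Q assms(2) by auto
  have "\<forall>A\<in>S. f A * g A = 0"
  proof
   fix A assume "A \<in> S"
   hence "A \<in> C' \<or> A \<in> D'" using CD C' D' ts by auto
   thus "f A * g A = 0" using f(1) g(1) P Q by auto
  qed
  thus False using assms(1) f g P(1) Q(1) a(1) b(1) unfolding zirr_def by blast
 qed
qed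

lemma irreducible_imp_connected: "irreducible_space X ==> connected_space X"
 unfolding connected_space_closedin
proof (intro notI, elim exE conjE)
 fix E1 E2 assume X: "irreducible_space X" and E: "closedin X E1" "closedin X E2"
  "topspace X \<subseteq> E1 \<union> E2" "E1 \<inter> E2 = {}" "E1 ~= {}" "E2 ~= {}"
 have "topspace X = E1 \<union> E2" by (intro equalityI Un_least E closedin_subset)
 hence "E1 = topspace X \<or> E2 = topspace X" using X E(1,2) by (simp add: irreducible_space_def)
 thus False using E closedin_subset[OF E(1)] closedin_subset[OF E(2)] by auto
qed

definition entire_curve :: "(complex => complex^'n^'n) => bool" where
 "entire_curve c \<longleftrightarrow> (\<forall>i j. (\<lambda>t. c t $ i $ j) holomorphic_on UNIV)"

lemma entire_curve_poly_fun: "entire_curve c ==> f \<in> poly_fun ==> (\<lambda>t. f (c t)) holomorphic_on UNIV"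
proof -
 assume c: "entire_curve c"
 assume "f \<in> poly_fun"
 thus ?thesis using c by induction (auto simp: entire_curve_def intro: holomorphic_intros)
qed

lemma entire_curve_mult: "entire_curve c ==> entire_curve d ==> entire_curve (\<lambda>t. c t ** d t)"
 unfolding entire_curve_def matrix_matrix_mult_def by (auto intro!: holomorphic_intros)

lemma entire_curve_const: "entire_curve (\<lambda>t. A)"
 unfolding entire_curve_def by (auto intro!: holomorphic_intros)

lemma entire_curve_mexp: "entire_curve (\<lambda>t. mexp X (a * t))"
 unfolding entire_curve_def
proof (intro allI)
 fix i j
 have "(\<lambda>t. mexp X t $ i $ j) holomorphic_on UNIV"
  using mderiv_mexp[of X] by (auto simp: mderiv_def holomorphic_on_def field_differentiable_def)
 hence "(\<lambda>t. mexp X t $ i $ j) \<circ> (\<lambda>t. a * t) holomorphic_on UNIV"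
  by (intro holomorphic_on_compose_gen[where t = UNIV] holomorphic_intros) auto
 thus "(\<lambda>t. mexp X (a * t) $ i $ j) holomorphic_on UNIV" by (simp add: o_def)
qed

lemma entire_mult_eq_0:
 assumes f: "f holomorphic_on UNIV" and g: "g holomorphic_on UNIV" and 0: "\<And>t. f t * g t = 0" and a: "f a ~= 0"
 shows "g t = (0 :: complex)"
proof -
 have "open (f -` (- {0}))"
  using holomorphic_on_imp_continuous_on[OF f] by (intro continuous_open_vimage) (auto simp: continuous_on_eq_continuous_at)
 moreover have "a \<in> f -` (- {0})" using a by simp
 moreover have "g z = 0" if "z \<in> f -` (- {0})" for z using 0[of z] that by simp
 ultimately show ?thesis
  using analytic_continuation_open[of "f -` (- {0})" UNIV g "\<lambda>_. 0" t] g by (auto simp: connected_UNIV)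
qed

text \<open>On an entire curve from a point where \<open>f\<close> is nonzero to one where
  \<open>g\<close> is nonzero, the product of two nonzero entire functions would vanish
  identically.\<close>

lemma zirr_curves:
 assumes "S ~= {}" "\<And>p q. p \<in> S ==> q \<in> S ==> \<exists>c. entire_curve c \<and> (\<forall>t. c t \<in> S) \<and> c 0 = p \<and> c 1 = q"
 shows "zirr S"
 unfolding zirr_def
proof (intro conjI ballI impI)
 show "S ~= {}" by (rule assms(1))
 fix f g :: "complex^'a^'a => complex"
 assume fg: "f \<in> poly_fun" "g \<in> poly_fun" "\<forall>A\<in>S. f A * g A = 0"
 show "(\<forall>A\<in>S. f A = 0) \<or> (\<forall>A\<in>S. g A = 0)"
 proof (rule ccontr)
  assume "\<not> ?thesis"
  then obtain p q where pq: "p \<in> S" "q \<in> S" "f p ~= 0" "g q ~= 0" by blast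
  obtain c where c: "entire_curve c" "\<And>t. c t \<in> S" "c 0 = p" "c 1 = q" using assms(2)[OF pq(1,2)] by blast
  have "g (c 1) = 0"
   by (rule entire_mult_eq_0[OF entire_curve_poly_fun[OF c(1) fg(1)] entire_curve_poly_fun[OF c(1) fg(2)], where a = 0])
    (use c fg(3) pq in auto)
  thus False using c pq by simp
 qed
qed

section \<open>The Lie algebra of a closed subgroup\<close>

text \<open>Differentiation along the left invariant vector field of \<open>X\<close> preserves polynomial functions.\<close>

lemma poly_fun_invariant_derivative:
 assumes "f \<in> poly_fun"
 shows "\<exists>f'\<in>poly_fun. \<forall>c t. mderiv c (c t ** X) t --> ((\<lambda>s. f (c s)) has_field_derivative f' (c t)) (at t)"
 using assms
proof induction
 case (const a)
 show ?case by (rule bexI[of _ "\<lambda>A. 0"]) (auto intro: poly_fun.const)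
next
 case (coord i j)
 have "(\<lambda>A. (A ** X) $ i $ j) \<in> poly_fun"
  by (auto simp: matrix_matrix_mult_def intro!: poly_fun_sum poly_fun.intros)
 thus ?case by (rule bexI[rotated]) (auto simp: mderiv_def)
next
 case (add f g)
 then obtain f' g' where
  "f' \<in> poly_fun" "\<And>c t. mderiv c (c t ** X) t ==> ((\<lambda>s. f (c s)) has_field_derivative f' (c t)) (at t)"
  "g' \<in> poly_fun" "\<And>c t. mderiv c (c t ** X) t ==> ((\<lambda>s. g (c s)) has_field_derivative g' (c t)) (at t)"
  by blast
 thus ?case
  by (intro bexI[of _ "\<lambda>A. f' A + g' A"] allI impI DERIV_add poly_fun.add) auto
next
 case (mult f g)
 then obtain f' g' where
  "f' \<in> poly_fun" "\<And>c t. mderiv c (c t ** X) t ==> ((\<lambda>s. f (c s)) has_field_derivative f' (c t)) (at t)"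
  "g' \<in> poly_fun" "\<And>c t. mderiv c (c t ** X) t ==> ((\<lambda>s. g (c s)) has_field_derivative g' (c t)) (at t)"
  by blast
 thus ?case using mult.hyps
  by (intro bexI[of _ "\<lambda>A. f' A * g A + g' A * f A"] allI impI DERIV_mult poly_fun.add poly_fun.mult) auto
qed

lemma mderiv_line: "mderiv (\<lambda>z. g ** (mat 1 + z \<cdot> X)) (g ** X) t"
proof -
 have "mderiv (\<lambda>z. mat 1 + z \<cdot> X) (0 + 1 \<cdot> X) t"
  by (intro mderiv_add mderiv_const mderiv_scale DERIV_ident)
 from mderiv_mult[OF mderiv_const[of g] this] show ?thesis by (simp add: matrix_simps)
qed

text \<open>The derivative at 0 of a polynomial along \<open>c\<close> depends only on the tangent
  vector \<open>X\<close>, so the curve may be replaced by the line through the identity that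
  defines the Lie algebra.\<close>

lemma lie_algebraI:
 assumes c: "mderiv c X 0" "c 0 = mat 1" "\<And>t. c t \<in> G"
 shows "X \<in> lie_algebra G"
 unfolding lie_algebra_def
proof (intro CollectI ballI impI)
 fix f :: "complex^'a^'a => complex" assume f: "f \<in> poly_fun" "\<forall>g\<in>G. f g = 0"
 obtain f' where f': "\<And>c t. mderiv c (c t ** X) t ==> ((\<lambda>s. f (c s)) has_field_derivative f' (c t)) (at t)"
  using poly_fun_invariant_derivative[OF f(1)] by blast
 have "((\<lambda>s. f (c s)) has_field_derivative f' (mat 1)) (at 0)"
  using f'[of c 0] c by simp
 moreover have "((\<lambda>s. f (c s)) has_field_derivative 0) (at 0)" using f(2) c(3) by simp
 ultimately have "f' (mat 1) = 0" by (rule DERIV_unique)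
 moreover have "((\<lambda>z. f (mat 1 ** (mat 1 + z \<cdot> X))) has_field_derivative f' (mat 1)) (at 0)"
  using f'[of "\<lambda>z. mat 1 ** (mat 1 + z \<cdot> X)" 0] mderiv_line[of "mat 1" X 0] by simp
 ultimately show "((\<lambda>z. f (mat 1 + z \<cdot> X)) has_field_derivative 0) (at 0)" by simp
qed

text \<open>The ideal of \<open>G\<close> is stable under the invariant derivation given by
  \<open>X\<close>. Hence all derivatives of such a polynomial along the exponential curve vanish at
  the identity, and the polynomial vanishes on the whole curve.\<close>

lemma mexp_in_closed_subgroup:
 assumes G: "closed_subgroup G" and X: "X \<in> lie_algebra G"
 shows "mexp X t \<in> G"
proof -
 define I where "I = {f \<in> poly_fun. \<forall>g\<in>G. f g = 0}"
 have "\<exists>f'\<in>I. \<forall>c t. mderiv c (c t ** X) t --> ((\<lambda>s. f (c s)) has_field_derivative f' (c t)) (at t)"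
  if f: "f \<in> I" for f
 proof -
  obtain f' where f': "f' \<in> poly_fun"
   "\<And>c t. mderiv c (c t ** X) t ==> ((\<lambda>s. f (c s)) has_field_derivative f' (c t)) (at t)"
   using poly_fun_invariant_derivative[of f X] f by (auto simp: I_def)
  have "f' g = 0" if g: "g \<in> G" for g
  proof -
   \<comment> \<open>The left translate of \<open>f\<close> by \<open>g\<close> again vanishes on
     \<open>G\<close>, so the tangency condition at the identity transfers to
     \<open>g\<close>.\<close>
   have "(\<lambda>A. f (g ** A)) \<in> poly_fun"
    using poly_fun_subst[of f g "mat 1"] f by (simp add: I_def)
   moreover have "\<forall>h\<in>G. f (g ** h) = 0" using f g closed_subgroupD(3)[OF G] by (auto simp: I_def)
   ultimately have "((\<lambda>z. f (g ** (mat 1 + z \<cdot> X))) has_field_derivative 0) (at 0)"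
    using X by (auto simp: lie_algebra_def)
   moreover have "((\<lambda>z. f (g ** (mat 1 + z \<cdot> X))) has_field_derivative f' g) (at 0)"
    using f'(2)[of "\<lambda>z. g ** (mat 1 + z \<cdot> X)" 0] mderiv_line[of g X 0] by simp
   ultimately show ?thesis by (metis DERIV_unique)
  qed
  thus ?thesis using f' by (auto simp: I_def)
 qed
 then obtain D where D: "\<And>f. f \<in> I ==> D f \<in> I"
  "\<And>f c t. f \<in> I ==> mderiv c (c t ** X) t ==> ((\<lambda>s. f (c s)) has_field_derivative D f (c t)) (at t)"
  by metis
 have "f (mexp X t) = 0" if f: "f \<in> I" for f
 proof -
  have k: "(D ^^ k) f \<in> I" for k by (induction k) (use D f in auto)
  have "(\<lambda>s. (D ^^ 0) f (mexp X s)) t = 0"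
  proof (rule entire_zero_if_derivatives_vanish[where F = "\<lambda>k s. (D ^^ k) f (mexp X s)"])
   show "((\<lambda>s. (D ^^ k) f (mexp X s)) has_field_derivative (D ^^ Suc k) f (mexp X t)) (at t)" for k t
    using D(2)[OF k[of k], of "mexp X" t] mderiv_mexp[of X t] by (simp add: mexp_commute_self)
   show "(D ^^ k) f (mexp X 0) = 0" for k
    using k[of k] closed_subgroupD(2)[OF G] by (simp add: I_def)
  qed
  thus ?thesis by simp
 qed
 hence "mexp X t \<in> zcl G" by (simp add: zcl_def I_def invertible_mexp)
 thus ?thesis using closed_subgroupD(5)[OF G] by simp
qed

lemma csubspace_lie_algebra:
 assumes G: "closed_subgroup G"
 shows "mm.subspace (lie_algebra G)"
 unfolding mm.subspace_def
proof (intro conjI ballI allI)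
 show "0 \<in> lie_algebra G"
  by (rule lie_algebraI[of "\<lambda>t. mat 1"]) (auto simp: mderiv_const closed_subgroupD[OF G])
 fix X Y assume X: "X \<in> lie_algebra G"
 show "X + Y \<in> lie_algebra G" if Y: "Y \<in> lie_algebra G"
 proof (rule lie_algebraI[of "\<lambda>t. mexp X t ** mexp Y t"])
  show "mderiv (\<lambda>t. mexp X t ** mexp Y t) (X + Y) 0"
   using mderiv_mult[OF mderiv_mexp[of X 0] mderiv_mexp[of Y 0]] by simp
 qed (auto intro: closed_subgroupD(3)[OF G] mexp_in_closed_subgroup[OF G] X Y)
 show "c \<cdot> X \<in> lie_algebra G" for c
 proof (rule lie_algebraI[of "mexp (c \<cdot> X)"])
  show "mderiv (mexp (c \<cdot> X)) (c \<cdot> X) 0" using mderiv_mexp[of "c \<cdot> X" 0] by simp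
  show "mexp (c \<cdot> X) t \<in> G" for t using mexp_in_closed_subgroup[OF G X] by (simp add: mexp_scale)
 qed simp
qed

lemma mexp_lie_algebraI: "(\<And>t. mexp X t \<in> G) ==> X \<in> lie_algebra G"
 by (rule lie_algebraI[of "mexp X"]) (use mderiv_mexp[of X 0] in auto)

lemma Ad_lie_algebra:
 assumes G: "closed_subgroup G" and "g \<in> G" "X \<in> lie_algebra G"
 shows "Ad g X \<in> lie_algebra G"
proof (rule mexp_lie_algebraI)
 show "mexp (Ad g X) t \<in> G" for t
  using assms mexp_in_closed_subgroup[OF G assms(3)]
  by (simp flip: mexp_conj[OF closed_subgroupD(1)[OF G assms(2)]] add: closed_subgroupD[OF G])
qed

text \<open>The bracket is the derivative at 0 of a curve inside the linear space
  \<open>lie_algebra G\<close>, so every functional vanishing on that space kills it.\<close>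

lemma br_lie_algebra:
 assumes G: "closed_subgroup G" and X: "X \<in> lie_algebra G" and Y: "Y \<in> lie_algebra G"
 shows "br X Y \<in> lie_algebra G"
proof (rule ccontr)
 assume "br X Y \<notin> lie_algebra G"
 then obtain Z where Z: "\<And>A. A \<in> lie_algebra G ==> trace (A ** Z) = 0" "trace (br X Y ** Z) ~= 0"
  using csubspace_separation[OF csubspace_lie_algebra[OF G]] by blast
 have "mderiv (\<lambda>t. mexp X t ** Y ** mexp (- X) t) (br X Y) 0"
  using mderiv_mult[OF mderiv_mult[OF mderiv_mexp[of X 0] mderiv_const[of Y]] mderiv_mexp[of "- X" 0]]
  by (simp add: br_def matrix_simps)
 from mderiv_trace[OF this, of Z]
 have "((\<lambda>t. trace (Ad (mexp X t) Y ** Z)) has_field_derivative trace (br X Y ** Z)) (at 0)"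
  by (simp add: Ad_mexp)
 moreover have "trace (Ad (mexp X t) Y ** Z) = 0" for t
  by (intro Z Ad_lie_algebra[OF G] mexp_in_closed_subgroup[OF G] X Y)
 ultimately have "trace (br X Y ** Z) = 0" by (simp add: DERIV_unique[OF _ DERIV_const])
 thus False using Z(2) by simp
qed

lemma lie_algebra_mono: "H \<subseteq> G ==> lie_algebra H \<subseteq> lie_algebra G"
 unfolding lie_algebra_def by blast

section \<open>Replicas\<close>

text \<open>Dividing by one exponential and differentiating lowers the degree of its coefficient, or
  removes a constant one, and raises no other degree. The induction measure adds up degree plus one
  over the nonzero coefficients.\<close>

lemma exp_poly_independent:
 fixes M :: "complex set" and p :: "complex => complex poly"
 assumes "finite M" "\<And>t. (\<Sum>m\<in>M. exp (m * t) * poly (p m) t) = 0" "m \<in> M"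
 shows "p m = 0"
 using assms
proof (induction "\<Sum>m\<in>M. if p m = 0 then 0 else Suc (degree (p m))" arbitrary: p m rule: less_induct)
 case less
 note fin = less.prems(1) and eq0 = less.prems(2)
 show ?case
 proof (rule ccontr)
  assume "p m ~= 0"
  define q where "q l = smult (l - m) (p l) + pderiv (p l)" for l
  have shift: "exp (l * t) = exp (m * t) * exp ((l - m) * t)" for l t
   by (simp add: exp_add[symmetric] algebra_simps)
  have factor: "(\<Sum>l\<in>M. exp (l * t) * poly (r l) t) = exp (m * t) * (\<Sum>l\<in>M. exp ((l - m) * t) * poly (r l) t)" for r t
   unfolding sum_distrib_left
   by (intro sum.cong refl) (subst shift, simp only: mult.assoc)
  have 1: "(\<Sum>l\<in>M. exp ((l - m) * t) * poly (p l) t) = 0" for t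
  proof -
   have "exp (m * t) * (\<Sum>l\<in>M. exp ((l - m) * t) * poly (p l) t) = 0"
    using eq0[of t] by (simp only: factor)
   thus ?thesis by simp
  qed
  have 2: "(\<Sum>l\<in>M. exp ((l - m) * t) * poly (q l) t) = 0" for t
  proof -
   have "((\<lambda>t. \<Sum>l\<in>M. exp ((l - m) * t) * poly (p l) t) has_field_derivative
     (\<Sum>l\<in>M. exp ((l - m) * t) * poly (q l) t)) (at t)"
    by (rule DERIV_sum) (auto intro!: derivative_eq_intros poly_DERIV simp: q_def algebra_simps)
   hence "((\<lambda>t. 0) has_field_derivative (\<Sum>l\<in>M. exp ((l - m) * t) * poly (q l) t)) (at t)"
    by (simp only: 1)
   thus ?thesis by (simp add: DERIV_unique[OF _ DERIV_const])
  qed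
  have 3: "(\<Sum>l\<in>M. exp (l * t) * poly (q l) t) = 0" for t
   unfolding factor 2 by simp
  have deg: "degree (q l) \<le> degree (p l)" for l
   unfolding q_def by (rule degree_add_le) (auto simp: degree_pderiv degree_smult_le)
  have le: "(if q l = 0 then 0 else Suc (degree (q l))) \<le> (if p l = 0 then 0 else Suc (degree (p l)))" for l
   using deg[of l] by (auto simp: q_def)
  have qm: "q m = pderiv (p m)" by (simp add: q_def)
  have lt: "(if q m = 0 then 0 else Suc (degree (q m))) < (if p m = 0 then 0 else Suc (degree (p m)))"
   using \<open>p m ~= 0\<close> by (auto simp: qm degree_pderiv pderiv_eq_0_iff)
  have "(\<Sum>l\<in>M. if q l = 0 then 0 else Suc (degree (q l))) < (\<Sum>l\<in>M. if p l = 0 then 0 else Suc (degree (p l)))"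
  proof (rule sum_strict_mono_ex1[OF fin])
   show "\<exists>l\<in>M. (if q l = 0 then 0 else Suc (degree (q l))) < (if p l = 0 then 0 else Suc (degree (p l)))"
    by (rule bexI[of _ m]) (rule lt, rule less.prems(3))
  qed (intro ballI le)
  from less.hyps[OF this fin 3] have q0: "q l = 0" if "l \<in> M" for l using that by blast
  \<comment> \<open>For \<open>l\<close> different from \<open>m\<close> the leading coefficient is
    only multiplied by the nonzero number \<open>l - m\<close>, so \<open>q l\<close> can vanish
    only if \<open>p l\<close> does.\<close>
  have pl: "p l = 0" if "l \<in> M" "l ~= m" for l
  proof -
   have "coeff (q l) (degree (p l)) = (l - m) * lead_coeff (p l)"
    by (simp add: q_def coeff_pderiv coeff_eq_0)
   thus ?thesis using q0[OF that(1)] that(2) by simp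
  qed
  have "(\<Sum>l\<in>M. exp (l * t) * poly (p l) t) = (\<Sum>l\<in>M. if l = m then exp (m * t) * poly (p m) t else 0)" for t
   by (rule sum.cong) (auto simp: pl)
  hence "poly (p m) t = 0" for t using eq0[of t] fin less.prems(3) by simp
  hence "p m = 0" using poly_all_0_iff_0 by blast
  thus False using \<open>p m ~= 0\<close> by simp
 qed
qed

text \<open>A function \<open>f\<close> that is a combination of \<open>t^k exp (m t)\<close> is related to the function in which the
 exponents are replaced by \<open>\<phi> m\<close> and the positive powers of \<open>t\<close> are dropped.\<close>

definition exp_poly :: "(complex \<times> complex poly) list => complex => complex" where
 "exp_poly xs t = (\<Sum>(m, p)\<leftarrow>xs. exp (m * t) * poly p t)"

definition exp_poly0 :: "(complex => complex) => (complex \<times> complex poly) list => complex => complex" where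
 "exp_poly0 \<phi> xs t = (\<Sum>(m, p)\<leftarrow>xs. exp (\<phi> m * t) * poly p 0)"

definition exp_related :: "(complex => complex) => (complex => complex) => (complex => complex) => bool" where
 "exp_related \<phi> f h \<longleftrightarrow> (\<exists>xs. f = exp_poly xs \<and> h = exp_poly0 \<phi> xs)"

lemma exp_poly_Nil [simp]: "exp_poly [] t = 0" "exp_poly0 \<phi> [] t = 0"
 by (simp_all add: exp_poly_def exp_poly0_def)

lemma exp_poly_Cons [simp]:
 "exp_poly ((m, p) # xs) t = exp (m * t) * poly p t + exp_poly xs t"
 "exp_poly0 \<phi> ((m, p) # xs) t = exp (\<phi> m * t) * poly p 0 + exp_poly0 \<phi> xs t"
 by (simp_all add: exp_poly_def exp_poly0_def)

lemma exp_poly_append: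
 "exp_poly (xs @ ys) t = exp_poly xs t + exp_poly ys t"
 "exp_poly0 \<phi> (xs @ ys) t = exp_poly0 \<phi> xs t + exp_poly0 \<phi> ys t"
 by (simp_all add: exp_poly_def exp_poly0_def)

lemma exp_related_add:
 assumes "exp_related \<phi> f h" "exp_related \<phi> f' h'"
 shows "exp_related \<phi> (\<lambda>t. f t + f' t) (\<lambda>t. h t + h' t)"
proof -
 obtain xs ys where "f = exp_poly xs" "h = exp_poly0 \<phi> xs" "f' = exp_poly ys" "h' = exp_poly0 \<phi> ys"
  using assms unfolding exp_related_def by auto
 thus ?thesis unfolding exp_related_def
  by (intro exI[of _ "xs @ ys"]) (auto simp: exp_poly_append)
qed

lemma exp_poly_map_mult:
 "exp_poly (map (\<lambda>(l, q). (m + l, p * q)) ys) t = exp (m * t) * poly p t * exp_poly ys t"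
 "(\<And>a b. \<phi> (a + b) = \<phi> a + \<phi> b) ==>
  exp_poly0 \<phi> (map (\<lambda>(l, q). (m + l, p * q)) ys) t = exp (\<phi> m * t) * poly p 0 * exp_poly0 \<phi> ys t"
 by (induction ys) (auto simp: exp_add algebra_simps)

lemma exp_related_mult:
 assumes "exp_related \<phi> f h" "exp_related \<phi> f' h'" and \<phi>: "\<And>a b. \<phi> (a + b) = \<phi> a + \<phi> b"
 shows "exp_related \<phi> (\<lambda>t. f t * f' t) (\<lambda>t. h t * h' t)"
proof -
 obtain xs ys where e: "f = exp_poly xs" "h = exp_poly0 \<phi> xs" "f' = exp_poly ys" "h' = exp_poly0 \<phi> ys"
  using assms unfolding exp_related_def by auto
 define zs where "zs = concat (map (\<lambda>(m, p). map (\<lambda>(l, q). (m + l, p * q)) ys) xs)"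
 have "exp_poly zs t = exp_poly xs t * exp_poly ys t \<and>
   exp_poly0 \<phi> zs t = exp_poly0 \<phi> xs t * exp_poly0 \<phi> ys t" for t
  unfolding zs_def
  by (induction xs) (auto simp: exp_poly_append exp_poly_map_mult \<phi> algebra_simps)
 thus ?thesis unfolding exp_related_def e by (intro exI[of _ zs]) auto
qed

lemma exp_related_const: "\<phi> 0 = 0 ==> exp_related \<phi> (\<lambda>t. c) (\<lambda>t. c)"
 unfolding exp_related_def by (intro exI[of _ "[(0, [:c:])]"]) auto

lemma exp_related_sum:
 assumes "\<phi> 0 = 0" "\<And>i. i \<in> I ==> exp_related \<phi> (f i) (h i)"
 shows "exp_related \<phi> (\<lambda>t. \<Sum>i\<in>I. f i t) (\<lambda>t. \<Sum>i\<in>I. h i t)"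
 using assms(2)
proof (induction I rule: infinite_finite_induct)
 case (insert i I)
 thus ?case using exp_related_add[of \<phi> "f i" "h i"] by simp
qed (simp_all add: exp_related_const[of \<phi>, OF assms(1)])

text \<open>Once equal exponents are collected, linear independence makes every coefficient zero, so
  the related function is zero too. This carries polynomial identities from the exponential of
  \<open>X\<close> to that of a replica.\<close>

lemma exp_related_zero:
 assumes "exp_related \<phi> (\<lambda>t. 0) h"
 shows "h t = 0"
proof -
 obtain xs where xs: "exp_poly xs = (\<lambda>t. 0)" "h = exp_poly0 \<phi> xs"
  using assms unfolding exp_related_def by metis
 define P where "P m = (\<Sum>(l, p)\<leftarrow>xs. if l = m then p else 0)" for m
 define M where "M = fst ` set xs"
 have fin: "finite M" by (simp add: M_def)
 have 1: "exp_poly ys t = (\<Sum>m\<in>M. exp (m * t) * poly (\<Sum>(l, p)\<leftarrow>ys. if l = m then p else 0) t) \<and>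
   exp_poly0 \<phi> ys t = (\<Sum>m\<in>M. exp (\<phi> m * t) * poly (\<Sum>(l, p)\<leftarrow>ys. if l = m then p else 0) 0)"
  if "fst ` set ys \<subseteq> M" for ys t
  using that
 proof (induction ys)
  case (Cons y ys)
  obtain l p where y: "y = (l, p)" by (cases y)
  have l: "l \<in> M" using Cons.prems y by auto
  have "(\<Sum>m\<in>M. exp (m * t) * poly (if l = m then p else 0) t) = (\<Sum>m\<in>M. if m = l then exp (l * t) * poly p t else 0)"
   "(\<Sum>m\<in>M. exp (\<phi> m * t) * poly (if l = m then p else 0) 0) = (\<Sum>m\<in>M. if m = l then exp (\<phi> l * t) * poly p 0 else 0)"
   by (auto intro!: sum.cong)
  thus ?case using Cons l fin by (simp add: y distrib_left sum.distrib)
 qed simp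
 have "P m = 0" if "m \<in> M" for m
  by (rule exp_poly_independent[OF fin _ that]) (use 1[of xs] xs(1) in \<open>auto simp: P_def M_def\<close>)
 thus ?thesis using 1[of xs t] by (simp add: xs(2) M_def P_def)
qed

lemma exp_related_poly_fun:
 assumes f: "f \<in> poly_fun" and \<phi>: "\<And>a b. \<phi> (a + b) = \<phi> a + \<phi> b"
  and e: "\<And>i j. exp_related \<phi> (\<lambda>t. c t $ i $ j) (\<lambda>t. d t $ i $ j)"
 shows "exp_related \<phi> (\<lambda>t. f (c t)) (\<lambda>t. f (d t))"
proof -
 have 0: "\<phi> 0 = 0" using \<phi>[of 0 0] by simp
 show ?thesis using f
 proof induction
  case (const a)
  show ?case by (rule exp_related_const[of \<phi>, OF 0])
 next
  case (coord i j)
  show ?case by (rule e)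
 next
  case (add f g)
  thus ?case by (intro exp_related_add)
 next
  case (mult f g)
  thus ?case by (intro exp_related_mult[OF _ _ \<phi>])
 qed
qed

text \<open>The entries of \<open>mexp X t\<close> are combinations of terms
  \<open>t^k exp (l t)\<close> with \<open>l\<close> in \<open>L\<close>. Replacing \<open>l\<close>
  by \<open>\<phi> l\<close> and dropping the terms with positive \<open>k\<close> gives the entries
  of the exponential of the replica, and since \<open>\<phi>\<close> is additive this replacement
  respects sums and products.\<close>

lemma mexp_replica_in_closed_subgroup:
 assumes G: "closed_subgroup G" and X: "X \<in> lie_algebra G" and sp: "spectral X L E"
  and \<phi>: "\<And>a b. \<phi> (a + b) = \<phi> a + \<phi> b"
 shows "mexp (replica L E \<phi>) t \<in> G"
proof -
 let ?S = "replica L E (\<lambda>l. l)"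
 define N where "N = X - ?S"
 obtain K where K: "mpow N K = 0" using spectral_nilpotent_part[OF sp] unfolding nilpotent_def N_def by blast
 \<comment> \<open>Passing to \<open>Suc K\<close> guarantees that the sum over \<open>k\<close>
   contains the term \<open>k = 0\<close>, the only one that survives in the related
   function.\<close>
 hence K': "mpow N (Suc K) = 0" by (simp add: matrix_ring_simps)
 have SX: "?S ** X = X ** ?S" by (rule replica_commute[OF sp refl])
 hence "?S ** N = N ** ?S" by (simp add: N_def matrix_ring_simps)
 from mexp_sum_commuting[OF this] have split: "mexp X t = mexp ?S t ** mexp N t" for t
  by (simp add: N_def)
 have 0: "\<phi> 0 = 0" using \<phi>[of 0 0] by simp
 have ent: "exp_related \<phi> (\<lambda>t. mexp X t $ i $ j) (\<lambda>t. mexp (replica L E \<phi>) t $ i $ j)" for i j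
 proof -
  have "exp_related \<phi> (\<lambda>t. \<Sum>k<Suc K. exp (l * t) * (t ^ k / fact k * (E l ** mpow N k) $ i $ j))
    (\<lambda>t. exp (\<phi> l * t) * E l $ i $ j)" for l
  proof -
   let ?xs = "map (\<lambda>k. (l, monom ((E l ** mpow N k) $ i $ j / fact k) k)) [0..<Suc K]"
   have "exp_poly ?xs t = (\<Sum>k<Suc K. exp (l * t) * (t ^ k / fact k * (E l ** mpow N k) $ i $ j))" for t
    unfolding exp_poly_def by (simp add: interv_sum_list_conv_sum_set_nat o_def poly_monom atLeast0LessThan
      algebra_simps del: upt_Suc sum.lessThan_Suc)
   moreover have "exp_poly0 \<phi> ?xs t = (\<Sum>k<Suc K. if k = 0 then exp (\<phi> l * t) * E l $ i $ j else 0)" for t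
   proof -
    have "exp_poly0 \<phi> ?xs t = (\<Sum>k<Suc K. exp (\<phi> l * t) * poly (monom ((E l ** mpow N k) $ i $ j / fact k) k) 0)"
     unfolding exp_poly0_def by (simp add: interv_sum_list_conv_sum_set_nat o_def atLeast0LessThan
       del: upt_Suc sum.lessThan_Suc)
    also have "\<dots> = (\<Sum>k<Suc K. if k = 0 then exp (\<phi> l * t) * E l $ i $ j else 0)"
     by (rule sum.cong) (auto simp: poly_monom)
    finally show ?thesis .
   qed
   hence "exp_poly0 \<phi> ?xs t = exp (\<phi> l * t) * E l $ i $ j" for t
    by (simp add: sum.delta del: sum.lessThan_Suc)
   ultimately show ?thesis unfolding exp_related_def by (intro exI[of _ ?xs]) auto
  qed
  from exp_related_sum[OF 0 this]
  have "exp_related \<phi> (\<lambda>t. \<Sum>l\<in>L. \<Sum>k<Suc K. exp (l * t) * (t ^ k / fact k * (E l ** mpow N k) $ i $ j))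
   (\<lambda>t. \<Sum>l\<in>L. exp (\<phi> l * t) * E l $ i $ j)" .
  moreover have "mexp X t $ i $ j =
    (\<Sum>l\<in>L. \<Sum>k<Suc K. exp (l * t) * (t ^ k / fact k * (E l ** mpow N k) $ i $ j))" for t
   unfolding split mexp_replica[OF sp] mexp_nilpotent[OF K']
   by (simp add: matrix_sum_left matrix_sum_right mat_scale_simps sum_component sum_distrib_left
     del: sum.lessThan_Suc mpow.simps)
    (subst sum.swap, simp add: mult_ac del: sum.lessThan_Suc mpow.simps)
  moreover have "mexp (replica L E \<phi>) t $ i $ j = (\<Sum>l\<in>L. exp (\<phi> l * t) * E l $ i $ j)" for t
   by (simp add: mexp_replica[OF sp] sum_component)
  ultimately show ?thesis by simp
 qed
 have "f (mexp (replica L E \<phi>) t) = 0" if f: "f \<in> poly_fun" "\<forall>g\<in>G. f g = 0" for f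
 proof (rule exp_related_zero[where h = "\<lambda>t. f (mexp (replica L E \<phi>) t)" and \<phi> = \<phi>])
  have "(\<lambda>t. f (mexp X t)) = (\<lambda>t. 0)" using mexp_in_closed_subgroup[OF G X] f(2) by auto
  thus "exp_related \<phi> (\<lambda>t. 0) (\<lambda>t. f (mexp (replica L E \<phi>) t))"
   using exp_related_poly_fun[OF f(1) \<phi> ent] by simp
 qed
 hence "mexp (replica L E \<phi>) t \<in> zcl G" by (simp add: zcl_def invertible_mexp)
 thus ?thesis using closed_subgroupD(5)[OF G] by simp
qed

lemma replica_in_lie_algebra:
 assumes "closed_subgroup G" "X \<in> lie_algebra G" "spectral X L E" "\<And>a b. \<phi> (a + b) = \<phi> a + \<phi> b"
 shows "replica L E \<phi> \<in> lie_algebra G"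
 by (rule mexp_lie_algebraI) (rule mexp_replica_in_closed_subgroup[OF assms])

section \<open>Nondegeneracy of the trace form\<close>

lemma matrix_inv_mat_1 [simp]: "matrix_inv (mat 1) = (mat 1 :: complex^'n^'n)"
 by (rule matrix_inv_unique) simp_all

lemma mexp_zero_matrix [simp]: "mexp (0 :: complex^'n^'n) t = mat 1"
 using mexp_scale[of 0 "0 :: complex^'n^'n" t] by simp

lemma Ad_simps:
 "Ad g (X + Y) = Ad g X + Ad g Y" "Ad g (X - Y) = Ad g X - Ad g Y" "Ad g (c \<cdot> X) = c \<cdot> Ad g X"
 "Ad g 0 = 0" "Ad (mat 1) X = X" "Ad g (- X) = - Ad g X"
 by (simp_all add: Ad_def matrix_simps)

lemma Ad_sum: "Ad g (\<Sum>i\<in>I. f i) = (\<Sum>i\<in>I. Ad g (f i))"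
 by (induction I rule: infinite_finite_induct) (simp_all add: Ad_simps)

lemma Ad_mult: "invertible g ==> invertible h ==> Ad (g ** h) X = Ad g (Ad h X)"
 by (simp add: Ad_def matrix_inv_mult_distrib matrix_mul_assoc)

lemma Ad_inv: "invertible g ==> Ad (matrix_inv g) (Ad g X) = X" "invertible g ==> Ad g (Ad (matrix_inv g) X) = X"
proof -
 assume g: "invertible g"
 show "Ad (matrix_inv g) (Ad g X) = X"
  using Ad_mult[OF invertible_matrix_inv[OF g] g, of X] by (simp add: matrix_inv_mult[OF g] Ad_simps)
 show "Ad g (Ad (matrix_inv g) X) = X"
  using Ad_mult[OF g invertible_matrix_inv[OF g], of X] by (simp add: matrix_inv_mult[OF g] Ad_simps)
qed

lemma Ad_times: "invertible g ==> Ad g (X ** Y) = Ad g X ** Ad g Y"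
proof -
 assume g: "invertible g"
 have "Ad g X ** Ad g Y = g ** X ** (matrix_inv g ** g) ** Y ** matrix_inv g"
  by (simp only: Ad_def matrix_mul_assoc)
 thus ?thesis by (simp add: matrix_inv_mult[OF g] Ad_def matrix_mul_assoc)
qed

lemma Ad_br: "invertible g ==> Ad g (br X Y) = br (Ad g X) (Ad g Y)"
 by (simp add: br_def Ad_simps Ad_times)

lemma trace_Ad: "invertible g ==> trace (Ad g X) = trace X"
 using trace_mul_sym[of "g ** X" "matrix_inv g"] by (simp add: Ad_def matrix_mul_assoc matrix_inv_mult)

lemma trace_Ad_Ad: "invertible g ==> trace (Ad g X ** Ad g Y) = trace (X ** Y)"
 by (simp add: Ad_times[symmetric] trace_Ad)

lemma Ad_eq_0_iff: "invertible g ==> Ad g X = 0 \<longleftrightarrow> X = 0"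
 using Ad_inv(1)[of g X] by (auto simp: Ad_simps)

text \<open>The \<open>k\<close>-fold bracket lies in the span of the products
  \<open>X^i Y X^j\<close> with \<open>i + j = k\<close>. For \<open>k = 2 * K\<close> one of the
  two exponents is at least \<open>K\<close>.\<close>

lemma ad_nilpotent:
 assumes "nilpotent X"
 shows "\<exists>k. \<forall>Y. (br X ^^ k) Y = 0"
proof -
 obtain K where K: "mpow X K = 0" using assms unfolding nilpotent_def by blast
 define S where "S Y k = mm.span {mpow X i ** Y ** mpow X j | i j. i + j = k}" for Y k
 have step: "br X Z \<in> S Y (Suc k)" if "Z \<in> S Y k" for Y Z k
  using that unfolding S_def
 proof (rule mm.span_induct)
  show "mm.subspace {Z. br X Z \<in> mm.span {mpow X i ** Y ** mpow X j |i j. i + j = Suc k}}"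
   unfolding mm.subspace_def by (auto simp: br_simps mm.span_zero intro: mm.span_add mm.span_scale)
  fix Z assume "Z \<in> {mpow X i ** Y ** mpow X j |i j. i + j = k}"
  then obtain i j where ij: "Z = mpow X i ** Y ** mpow X j" "i + j = k" by blast
  have "br X Z = mpow X (Suc i) ** Y ** mpow X j - mpow X i ** Y ** mpow X (Suc j)"
   unfolding mpow_Suc_right[of X j] by (simp add: ij(1) br_def matrix_mul_assoc)
  moreover have "mpow X (Suc i) ** Y ** mpow X j \<in> {mpow X i ** Y ** mpow X j |i j. i + j = Suc k}"
   using ij(2) by (intro CollectI exI[of _ "Suc i"] exI[of _ j]) simp
  moreover have "mpow X i ** Y ** mpow X (Suc j) \<in> {mpow X i ** Y ** mpow X j |i j. i + j = Suc k}"
   using ij(2) by (intro CollectI exI[of _ i] exI[of _ "Suc j"]) simp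
  ultimately show "br X Z \<in> mm.span {mpow X i ** Y ** mpow X j |i j. i + j = Suc k}"
   by (simp only: mm.span_diff mm.span_base)
 qed
 have "(br X ^^ k) Y \<in> S Y k" for Y k
 proof (induction k)
  case 0
  have "Y \<in> {mpow X i ** Y ** mpow X j |i j. i + j = 0}" by simp
  thus ?case unfolding S_def by (simp add: mm.span_base)
 next
  case (Suc k)
  thus ?case using step by simp
 qed
 moreover have "S Y (2 * K) \<subseteq> {0}" for Y
 proof -
  have "mpow X i ** Y ** mpow X j = 0" if "i + j = 2 * K" for i j
  proof (cases "K \<le> i")
   case True
   thus ?thesis using mpow_zero_mono[OF K] by (simp add: matrix_ring_simps)
  next
   case False
   hence "K \<le> j" using that by simp
   thus ?thesis using mpow_zero_mono[OF K] by (simp add: matrix_ring_simps)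
  qed
  hence "{mpow X i ** Y ** mpow X j |i j. i + j = 2 * K} \<subseteq> {0}" by auto
  thus ?thesis unfolding S_def by (intro mm.span_minimal) (auto intro: mm.subspace_single_0)
 qed
 ultimately show ?thesis by blast
qed

lemma as_group_simps: "subgroup H GL ==> h \<in> H ==> inv\<^bsub>as_group H\<^esub> h = matrix_inv h"
 using group.m_inv_consistent[OF group_GL, of H h] by (simp add: subgroup_GL_iff inv_GL)

lemma solvable_if_commuting:
 assumes H: "subgroup H GL" and com: "\<And>a b. a \<in> H ==> b \<in> H ==> a ** b = b ** a"
 shows "solvable (as_group H)"
proof -
 have g: "group (as_group H)" using group.subgroup_imp_group[OF group_GL H] .
 have "comm_group (as_group H)"
  by (rule group.group_comm_groupI[OF g]) (simp add: com)
 hence "derived (as_group H) (carrier (as_group H)) = {\<one>\<^bsub>as_group H\<^esub>}"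
  by (rule comm_group.derived_eq_singleton) simp
 hence "(derived (as_group H) ^^ 1) (carrier (as_group H)) = {\<one>\<^bsub>as_group H\<^esub>}" by simp
 thus ?thesis unfolding group.solvable_iff_trivial_derived_seq[OF g] by blast
qed

lemma zclD: "a \<in> zcl S ==> f \<in> poly_fun ==> (\<And>s. s \<in> S ==> f s = 0) ==> f a = 0"
 by (simp add: zcl_def)

lemma zcl_commute:
 assumes "\<And>s t. s \<in> S ==> t \<in> T ==> s ** t = t ** s" "a \<in> zcl S" "b \<in> zcl T"
 shows "a ** b = b ** a"
proof -
 have c: "(\<lambda>A. (A ** t - t ** A) $ i $ j) \<in> poly_fun" for t :: "complex^'a^'a" and i j
 proof -
  have "(\<lambda>A. (A ** t) $ i $ j + (- 1) * (t ** A) $ i $ j) \<in> poly_fun"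
   by (intro poly_fun.add poly_fun.mult[OF poly_fun.const])
    (auto simp: matrix_matrix_mult_def intro!: poly_fun_sum poly_fun.intros)
  thus ?thesis by simp
 qed
 have 1: "x ** t = t ** x" if "\<And>s. s \<in> S ==> s ** t = t ** s" "x \<in> zcl S" for x t and S :: "(complex^'a^'a) set"
 proof -
  have "(x ** t - t ** x) $ i $ j = 0" for i j
   by (rule zclD[OF that(2) c]) (simp add: that(1))
  thus ?thesis by (simp add: vec_eq_iff)
 qed
 have "t ** a = a ** t" if "t \<in> T" for t     using 1[OF assms(1)[OF _ that] assms(2)] by simp
 thus ?thesis using 1[of T a b] assms(3) by simp
qed

lemma zcl_conj:
 fixes g :: "complex^'n^'n"
 assumes g: "invertible g" and "\<And>s. s \<in> S ==> g ** s ** matrix_inv g \<in> zcl U" "a \<in> zcl S"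
 shows "g ** a ** matrix_inv g \<in> zcl U"
proof -
 have "f (g ** a ** matrix_inv g) = 0" if f: "f \<in> poly_fun" "\<forall>u\<in>U. f u = 0" for f
 proof -
  have "f (g ** s ** matrix_inv g) = 0" if "s \<in> S" for s
   using assms(2)[OF that] f by (simp add: zcl_def)
  thus ?thesis by (rule zclD[OF assms(3) poly_fun_subst[OF f(1), of g "matrix_inv g"]])
 qed
 moreover have "invertible a" using assms(3) by (simp add: zcl_def)
 ultimately show ?thesis
  by (simp add: zcl_def invertible_mult[OF invertible_mult[OF g] invertible_matrix_inv[OF g]])
qed

lemma normal_as_groupI:
 assumes G: "subgroup G GL" and H: "subgroup H GL" "H \<subseteq> G"
  and "\<And>g h. g \<in> G ==> h \<in> H ==> g ** h ** matrix_inv g \<in> H"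
 shows "H \<lhd> as_group G"
proof -
 have g: "group (as_group G)" using group.subgroup_imp_group[OF group_GL G] .
 have "subgroup H (as_group G)" using group.subgroup_incl[OF group_GL H(1) G H(2)] .
 thus ?thesis
  unfolding group.normal_inv_iff[OF g] using assms(4) as_group_simps[OF G] by simp
qed

text \<open>The exponentials of \<open>V\<close> form a commutative group, joined by curves and
  normalised by \<open>G\<close>. Its Zariski closure is a connected solvable normal subgroup, hence
  trivial by semisimplicity.\<close>

lemma semisimple_no_abelian_ideal:
 assumes ss: "semisimple_group G" and V: "mm.subspace V" "V \<subseteq> lie_algebra G"
  and Ad: "\<And>g X. g \<in> G ==> X \<in> V ==> Ad g X \<in> V"
  and ab: "\<And>X Y. X \<in> V ==> Y \<in> V ==> br X Y = 0" and X: "X \<in> V"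
 shows "X = 0"
proof -
 have G: "closed_subgroup G" using ss by (simp add: semisimple_group_def connected_algebraic_group_def)
 have sG: "subgroup G GL" using G by (simp add: closed_subgroup_def)
 define A where "A = (\<lambda>X. mexp X 1) ` V"
 have com: "X ** Y = Y ** X" if "X \<in> V" "Y \<in> V" for X Y using ab[OF that] by (simp add: br_def)
 have sum: "mexp X 1 ** mexp Y 1 = mexp (X + Y) 1" if "X \<in> V" "Y \<in> V" for X Y
  using mexp_sum_commuting[OF com[OF that]] by simp
 have sA: "subgroup A GL"
  unfolding subgroup_GL_iff A_def
 proof (intro conjI ballI; (elim imageE)?)
  show "mat 1 \<in> (\<lambda>X. mexp X 1) ` V"
   using mm.subspace_0[OF V(1)] by (intro image_eqI[of _ _ 0]) simp_all
  show "a ** b \<in> (\<lambda>X. mexp X 1) ` V" if "a = mexp X 1" "X \<in> V" "b = mexp Y 1" "Y \<in> V" for a b X Y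
   using that sum by (auto intro: mm.subspace_add[OF V(1)])
  show "matrix_inv a \<in> (\<lambda>X. mexp X 1) ` V" if "a = mexp X 1" "X \<in> V" for a X
   using that by (auto simp: matrix_inv_mexp intro: mm.subspace_neg[OF V(1)])
 qed (auto simp: invertible_mexp)
 have AG: "A \<subseteq> G" unfolding A_def using mexp_in_closed_subgroup[OF G] V(2) by blast
 define H where "H = zcl A"
 have H: "closed_subgroup H" unfolding H_def by (rule zcl_subgroup[OF sA])
 hence sH: "subgroup H GL" by (simp add: closed_subgroup_def)
 have AH: "A \<subseteq> H" unfolding H_def using sA by (intro zcl_superset) (auto simp: subgroup_GL_iff)
 have "H \<subseteq> G" unfolding H_def using zcl_mono[OF AG] closed_subgroupD(5)[OF G] by simp
 have "zirr A"
 proof (rule zirr_curves)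
  show "A ~= {}" using X by (auto simp: A_def)
  fix p q assume "p \<in> A" "q \<in> A"
  then obtain Y Z where YZ: "p = mexp Y 1" "Y \<in> V" "q = mexp Z 1" "Z \<in> V" by (auto simp: A_def)
  have "Z - Y \<in> V" using YZ by (intro mm.subspace_diff[OF V(1)])
  have e: "mexp Y 1 ** mexp (Z - Y) (1 * t) = mexp (Y + t \<cdot> (Z - Y)) 1" for t
   using sum[OF YZ(2) mm.subspace_scale[OF V(1) \<open>Z - Y \<in> V\<close>], of t] by (simp add: mexp_scale)
  show "\<exists>c. entire_curve c \<and> (\<forall>t. c t \<in> A) \<and> c 0 = p \<and> c 1 = q"
  proof (intro exI[of _ "\<lambda>t. mexp Y 1 ** mexp (Z - Y) (1 * t)"] conjI allI)
   show "entire_curve (\<lambda>t. mexp Y 1 ** mexp (Z - Y) (1 * t))"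
    by (intro entire_curve_mult entire_curve_const entire_curve_mexp)
   show "mexp Y 1 ** mexp (Z - Y) (1 * t) \<in> A" for t
    unfolding e A_def using YZ(2) \<open>Z - Y \<in> V\<close> V(1) by (intro imageI mm.subspace_add mm.subspace_scale)
   show "mexp Y 1 ** mexp (Z - Y) (1 * 1) = q" unfolding e by (simp add: YZ(3) mat_scale_simps)
  qed (simp add: YZ(1))
 qed
 hence "connected_space (subtopology zariski H)"
  unfolding H_def using sA
  by (intro irreducible_imp_connected zirr_imp_irreducible zirr_zcl) (auto simp: subgroup_GL_iff zcl_def)
 hence "connected_algebraic_group H" using H by (simp add: connected_algebraic_group_def)
 moreover have "H \<lhd> as_group G"
 proof (rule normal_as_groupI[OF sG sH \<open>H \<subseteq> G\<close>])
  fix g h assume g: "g \<in> G" "h \<in> H"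
  have gi: "invertible g" by (rule closed_subgroupD(1)[OF G g(1)])
  have "g ** s ** matrix_inv g \<in> zcl A" if s: "s \<in> A" for s
  proof -
   obtain Y where Y: "s = mexp Y 1" "Y \<in> V" using s by (auto simp: A_def)
   hence "g ** s ** matrix_inv g \<in> A" using Ad[OF g(1) Y(2)] by (simp add: mexp_conj[OF gi] A_def)
   thus ?thesis using AH unfolding H_def by (rule rev_subsetD)
  qed
  thus "g ** h ** matrix_inv g \<in> H" using g(2) unfolding H_def by (rule zcl_conj[OF gi])
 qed
 moreover have "solvable (as_group H)"
 proof (rule solvable_if_commuting[OF sH])
  fix a b assume "a \<in> H" "b \<in> H"
  moreover have "s ** t = t ** s" if st: "s \<in> A" "t \<in> A" for s t
  proof -
   obtain Y Z where YZ: "s = mexp Y 1" "Y \<in> V" "t = mexp Z 1" "Z \<in> V"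
    using st unfolding A_def by (elim imageE)
   thus ?thesis using sum[OF YZ(2,4)] sum[OF YZ(4,2)] by (simp add: add.commute)
  qed
  ultimately show "a ** b = b ** a" unfolding H_def by (intro zcl_commute[of A A a b])
 qed
 ultimately have "H = {mat 1}" using ss by (simp add: semisimple_group_def)
 \<comment> \<open>The exponential curve of \<open>X\<close> is constant, while its derivative at 0
   is \<open>X\<close>.\<close>
 hence 1: "mexp X t = mat 1" for t
  using AH mm.subspace_scale[OF V(1) X, of t] by (auto simp: A_def mexp_scale dest: subsetD)
 have "mexp X = (\<lambda>t. mat 1)" by (rule ext) (rule 1)
 hence "mderiv (\<lambda>t. mat 1) (X ** mat 1) 0" using mderiv_mexp[of X 0] by simp
 hence d: "((\<lambda>s. mat 1 $ i $ j) has_field_derivative (X ** mat 1) $ i $ j) (at 0)" for i j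
  unfolding mderiv_def by (elim allE)
 have "X $ i $ j = 0" for i j using DERIV_unique[OF d[of i j] DERIV_const] by simp
 thus ?thesis by (simp add: vec_eq_iff)
qed

lemma trace_form_nondegenerate:
 assumes ss: "semisimple_group G" and X: "X \<in> lie_algebra G"
  and 0: "\<And>Y. Y \<in> lie_algebra G ==> trace (X ** Y) = 0"
 shows "X = 0"
proof (rule ccontr)
 assume "X ~= 0"
 have G: "closed_subgroup G" using ss by (simp add: semisimple_group_def connected_algebraic_group_def)
 let ?g = "lie_algebra G"
 note sub = csubspace_lie_algebra[OF G]
 define R where "R = {X \<in> ?g. \<forall>Y\<in>?g. trace (X ** Y) = 0}"
 have sR: "mm.subspace R"
  unfolding mm.subspace_def R_def
  by (auto simp: mm.subspace_0[OF sub] mm.subspace_add[OF sub] mm.subspace_scale[OF sub] matrix_simps trace_add)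
 have XR: "X \<in> R" using X 0 by (simp add: R_def)
 have idR: "br X Y \<in> R" if "X \<in> ?g" "Y \<in> R" for X Y
 proof -
  have "trace (br X Y ** Z) = 0" if Z: "Z \<in> ?g" for Z
  proof -
   have "trace (br Y X ** Z) = trace (Y ** br X Z)" by (rule trace_br)
   also have "\<dots> = 0" using \<open>Y \<in> R\<close> br_lie_algebra[OF G \<open>X \<in> ?g\<close> Z] by (simp add: R_def)
   finally show ?thesis using br_anti[of X Y] by (simp add: matrix_ring_simps trace_def sum_negf)
  qed
  thus ?thesis using that br_lie_algebra[OF G] by (simp add: R_def)
 qed
 have nilR: "nilpotent Y" if "Y \<in> R" for Y
 proof -
  obtain L E where sp: "spectral Y L E" using ex_spectral by blast
  \<comment> \<open>The conjugate replica belongs to the Lie algebra, so \<open>Y\<close> is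
    orthogonal to it and the positivity argument of \<open>trace_star\<close> applies.\<close>
  have "replica L E cnj \<in> ?g"
   by (rule replica_in_lie_algebra[OF G _ sp]) (use that in \<open>auto simp: R_def\<close>)
  hence "trace (Y ** replica L E cnj) = 0" using that by (simp add: R_def)
  thus ?thesis by (rule trace_star[OF sp])
 qed
 have AdR: "Ad g Y \<in> R" if g: "g \<in> G" and Y: "Y \<in> R" for g Y
 proof -
  note gi = closed_subgroupD(1)[OF G g]
  have "trace (Ad g Y ** Z) = 0" if Z: "Z \<in> ?g" for Z
  proof -
   have "trace (Ad g Y ** Z) = trace (Ad g Y ** Ad g (Ad (matrix_inv g) Z))"
    by (simp add: Ad_inv[OF gi])
   also have "\<dots> = trace (Y ** Ad (matrix_inv g) Z)" by (rule trace_Ad_Ad[OF gi])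
   also have "\<dots> = 0"
    using Y Ad_lie_algebra[OF G closed_subgroupD(4)[OF G g] Z] by (simp add: R_def)
   finally show ?thesis .
  qed
  thus ?thesis using Ad_lie_algebra[OF G g] Y by (simp add: R_def)
 qed
 have "\<exists>u\<in>R - {0}. \<forall>X\<in>R. br X u \<in> {0}"
 proof (rule engel[OF sR])
  show "\<exists>k. (br Y ^^ k) u = 0" if "Y \<in> R" "u \<in> R \<union> R" for Y u
   using ad_nilpotent[OF nilR[OF that(1)]] by auto
  show "mm.subspace {0 :: complex^'a^'a}" by (rule mm.subspace_single_0)
  show "{0} \<subset> R" using XR \<open>X ~= 0\<close> mm.subspace_0[OF sR] by auto
 qed (use sR idR in \<open>auto simp: R_def br_simps\<close>)
 then obtain u where u: "u \<in> R" "u ~= 0" "\<And>X. X \<in> R ==> br X u = 0" by auto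
 \<comment> \<open>It is the centre of \<open>R\<close>, nonzero by the preceding step, that is an
   abelian subspace stable under the group.\<close>
 define C where "C = {u \<in> R. \<forall>X\<in>R. br X u = 0}"
 have "u = 0"
 proof (rule semisimple_no_abelian_ideal[OF ss, of C])
  show "mm.subspace C" unfolding mm.subspace_def C_def
   by (auto simp: mm.subspace_0[OF sR] mm.subspace_add[OF sR] mm.subspace_scale[OF sR] br_simps)
  show "C \<subseteq> ?g" by (auto simp: C_def R_def)
  show "Ad g Y \<in> C" if g: "g \<in> G" and Y: "Y \<in> C" for g Y
  proof -
   note gi = closed_subgroupD(1)[OF G g]
   have "br Z (Ad g Y) = 0" if Z: "Z \<in> R" for Z
   proof -
    have "br Z (Ad g Y) = Ad g (br (Ad (matrix_inv g) Z) Y)"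
     by (simp add: Ad_br[OF gi] Ad_inv[OF gi])
    also have "br (Ad (matrix_inv g) Z) Y = 0"
     using Y AdR[OF closed_subgroupD(4)[OF G g] Z] by (simp add: C_def)
    finally show ?thesis by (simp add: Ad_simps)
   qed
   thus ?thesis using AdR[OF g] Y by (simp add: C_def)
  qed
 qed (use u in \<open>auto simp: C_def\<close>)
 thus False using u(2) by simp
qed

section \<open>Weights of a torus\<close>

text \<open>If the weights \<open>u\<close> and \<open>v\<close> differ at \<open>t\<close>, the
  operator \<open>Ad t - v t\<close> kills the component of weight \<open>v\<close> and rescales
  that of weight \<open>u\<close> by a nonzero number. This reduces the number of components without
  leaving \<open>V\<close>.\<close>

lemma Ad_eigen_components:
 fixes T :: "(complex^'n^'n) set" and x :: "(complex^'n^'n => complex) => complex^'n^'n"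
 assumes V: "mm.subspace V" and stable: "\<And>t X. t \<in> T ==> X \<in> V ==> Ad t X \<in> V"
  and F: "finite F" "F \<subseteq> extensional T"
  and x: "\<And>w t. w \<in> F ==> t \<in> T ==> Ad t (x w) = w t \<cdot> x w" and s: "(\<Sum>w\<in>F. x w) \<in> V" and w: "w \<in> F"
 shows "x w \<in> V"
 using F x s w
proof (induction F arbitrary: x w rule: finite_induct)
 case (insert v F)
 have *: "x u \<in> V" if u: "u \<in> F" for u
 proof -
  have "u ~= v" "u \<in> extensional T" "v \<in> extensional T" using u insert by auto
  then obtain t where t: "t \<in> T" "u t ~= v t" using extensionalityI[of u T v] by auto
  have "(u t - v t) \<cdot> x u \<in> V"
  proof (rule insert.IH[where x = "\<lambda>w. (w t - v t) \<cdot> x w"])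
   show "F \<subseteq> extensional T" using insert.prems by auto
   show "Ad t' ((w t - v t) \<cdot> x w) = w t' \<cdot> (w t - v t) \<cdot> x w" if "w \<in> F" "t' \<in> T" for w t'
    unfolding Ad_simps(3) insert.prems(2)[OF insertI2[OF that(1)] that(2)]
    by (rule mm.scale_left_commute)
   have e: "Ad t (\<Sum>w\<in>insert v F. x w) - v t \<cdot> (\<Sum>w\<in>insert v F. x w) = (\<Sum>w\<in>F. (w t - v t) \<cdot> x w)"
   proof -
    have "Ad t (\<Sum>w\<in>insert v F. x w) - v t \<cdot> (\<Sum>w\<in>insert v F. x w)
      = (\<Sum>w\<in>insert v F. (w t - v t) \<cdot> x w)"
     unfolding Ad_sum mat_scale_sum sum_subtractf[symmetric]
     by (rule sum.cong) (use insert.prems(2) t in \<open>auto simp: mat_scale_simps\<close>)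
    thus ?thesis using insert.hyps by simp
   qed
   show "(\<Sum>w\<in>F. (w t - v t) \<cdot> x w) \<in> V"
    unfolding e[symmetric] using insert.prems(3) stable[OF t(1)]
    by (intro mm.subspace_diff[OF V] mm.subspace_scale[OF V])
  qed (rule u)
  hence "(1 / (u t - v t)) \<cdot> (u t - v t) \<cdot> x u \<in> V" by (rule mm.subspace_scale[OF V])
  thus ?thesis using t(2) by (simp add: mat_scale_simps(6))
 qed
 have "(\<Sum>w\<in>insert v F. x w) - (\<Sum>w\<in>F. x w) \<in> V"
  by (intro mm.subspace_diff[OF V insert.prems(3)] mm.subspace_sum[OF V] *)
 hence "x v \<in> V" using insert.hyps by simp
 thus ?case using * insert.prems(4) by blast
qed simp

lemma simdiag_zcl:
 fixes S :: "(complex^'n^'n) set"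
 assumes "simdiag S"
 shows "simdiag (zcl S)"
proof -
 obtain P :: "complex^'n^'n" where P: "invertible P" "\<forall>A\<in>S. \<forall>i j. i ~= j --> (matrix_inv P ** A ** P) $ i $ j = 0"
  using simdiag_imp_diagonalizable[OF assms] by auto
 show ?thesis
 proof (rule diagonalizable_imp_simdiag[OF P(1)])
  fix A and i j :: 'n assume A: "A \<in> zcl S" "i ~= j"
  show "(matrix_inv P ** A ** P) $ i $ j = 0"
   by (rule zclD[OF A(1) poly_fun_subst[OF poly_fun.coord]]) (use P(2) A(2) in auto)
 qed
qed

lemma continuous_map_mult:
 fixes P Q :: "complex^'n^'n"
 assumes PQ: "invertible P" "invertible Q"
 shows "continuous_map zariski zariski (\<lambda>A. P ** A ** Q)"
 unfolding continuous_map_closedin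
proof (intro conjI ballI allI impI)
 fix C :: "(complex^'n^'n) set" assume "closedin zariski C"
 then obtain S where S: "S \<subseteq> poly_fun" "C = {A \<in> carrier GL. \<forall>f\<in>S. f A = 0}"
  unfolding closedin_zariski by auto
 have "(\<lambda>f A. f (P ** A ** Q)) ` S \<subseteq> poly_fun"
  using S(1) poly_fun_subst[of _ P Q] by auto
 moreover have "{A \<in> topspace zariski. P ** A ** Q \<in> C} = {A \<in> carrier GL. \<forall>f\<in>(\<lambda>f A. f (P ** A ** Q)) ` S. f A = 0}"
  using PQ S(2) by (auto simp: invertible_mult)
 ultimately show "closedin zariski {A \<in> topspace zariski. P ** A ** Q \<in> C}"
  unfolding closedin_zariski by blast
qed (use PQ in \<open>auto simp: invertible_mult\<close>)

lemma continuous_map_right_mult: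
 "invertible g ==> continuous_map zariski zariski (\<lambda>A. A ** g)" for g :: "complex^'n^'n"
 using continuous_map_mult[of "mat 1" g] by simp

lemma continuous_map_left_mult:
 "invertible g ==> continuous_map zariski zariski (\<lambda>A. g ** A)" for g :: "complex^'n^'n"
 using continuous_map_mult[of g "mat 1"] by simp

lemma closedin_translate:
 fixes z :: "complex^'n^'n"
 assumes z: "invertible z" and C: "closedin zariski C"
 shows "closedin zariski ((**) z ` C)"
proof -
 have inv: "A \<in> C ==> invertible A" for A using closedin_subset[OF C] by auto
 have "(**) z ` C = {A. invertible A \<and> matrix_inv z ** A \<in> C}"
 proof safe
  fix A assume "A \<in> C"
  thus "invertible (z ** A)" "matrix_inv z ** (z ** A) \<in> C"
   using inv z by (auto simp: invertible_mult matrix_mul_assoc matrix_inv_mult(1)[OF z])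
 next
  fix A assume "matrix_inv z ** A \<in> C"
  thus "A \<in> (**) z ` C"
   by (intro image_eqI[of _ _ "matrix_inv z ** A"]) (simp_all add: matrix_mul_assoc matrix_inv_mult(2)[OF z])
 qed
 thus ?thesis
  using closedin_continuous_map_preimage[OF continuous_map_left_mult[OF invertible_matrix_inv[OF z]] C] by simp
qed

lemma zariski_closure_of: "S \<subseteq> carrier GL ==> zariski closure_of S = zcl S"
proof (rule equalityI)
 assume S: "S \<subseteq> carrier GL"
 show "zariski closure_of S \<subseteq> zcl S"
  by (rule closure_of_minimal[OF zcl_superset[OF S] closedin_zcl])
 show "zcl S \<subseteq> zariski closure_of S"
  by (rule zcl_minimal[OF closedin_closure_of]) (use S in \<open>simp add: closure_of_subset\<close>)
qed

section \<open>The group and its weight spaces\<close>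

locale g2_setting =
 fixes G B T :: "(complex^'n^'n) set" and \<alpha> \<beta> :: "complex^'n^'n => complex"
 assumes ss: "semisimple_group G" and borel: "borel_subgroup B G"
  and torus: "maximal_torus T G" and TB: "T \<subseteq> B"
  and simple: "G2_simple_roots G B T \<alpha> \<beta>"
begin

abbreviation chr where "chr \<equiv> lin_comb T \<alpha> \<beta>"

definition \<g> :: "(complex^'n^'n) set" where "\<g> = lie_algebra G"

definition wts :: "(int \<times> int) set" where
 "wts = insert (0, 0) (G2_positive \<union> (\<lambda>(i, j). (- i, - j)) ` G2_positive)"

lemma wts_eq: "wts = {(0,0), (1,0), (0,1), (1,1), (2,1), (3,1), (3,2),
  (-1,0), (0,-1), (-1,-1), (-2,-1), (-3,-1), (-3,-2)}"
 by (simp add: wts_def G2_positive_def insert_commute)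

lemma finite_wts [simp]: "finite wts"
 by (simp add: wts_eq)

definition gs :: "int \<times> int => (complex^'n^'n) set" where
 "gs c = root_space G T (chr c)"

lemma G_closed: "closed_subgroup G"
 using ss by (simp add: semisimple_group_def connected_algebraic_group_def)

lemma B_closed: "closed_subgroup B"
 using borel by (simp add: borel_subgroup_def connected_algebraic_group_def)

lemma T_torus: "torus T"
 using torus by (simp add: maximal_torus_def)

lemma T_closed: "closed_subgroup T"
 using T_torus by (simp add: torus_def connected_algebraic_group_def)

lemma B_subset: "B \<subseteq> G"
 using borel by (simp add: borel_subgroup_def)

lemma T_subset: "T \<subseteq> G"
 using torus by (simp add: maximal_torus_def)

lemmas G_group = closed_subgroupD[OF G_closed]
lemmas B_group = closed_subgroupD[OF B_closed]
lemmas T_group = closed_subgroupD[OF T_closed]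

lemma csub_g: "mm.subspace \<g>"
 unfolding \<g>_def by (rule csubspace_lie_algebra[OF G_closed])

lemma br_g: "X \<in> \<g> ==> Y \<in> \<g> ==> br X Y \<in> \<g>"
 unfolding \<g>_def by (rule br_lie_algebra[OF G_closed])

lemma Ad_g: "g \<in> G ==> X \<in> \<g> ==> Ad g X \<in> \<g>"
 unfolding \<g>_def by (rule Ad_lie_algebra[OF G_closed])

lemma mexp_G: "X \<in> \<g> ==> mexp X t \<in> G"
 unfolding \<g>_def by (rule mexp_in_closed_subgroup[OF G_closed])

lemma T_simdiag: "simdiag T"
proof -
 obtain P :: "complex^'n^'n" where "invertible P" "\<forall>t\<in>T. \<forall>i j. i ~= j --> (matrix_inv P ** t ** P) $ i $ j = 0"
  using T_torus[unfolded torus_def] by (elim conjE exE)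
 thus ?thesis by (intro diagonalizable_imp_simdiag) auto
qed

definition PP :: "complex^'n^'n" where
 "PP = (SOME P. invertible P \<and> (\<forall>t\<in>T. \<forall>i j. i ~= j --> (matrix_inv P ** t ** P) $ i $ j = 0))"

lemma PP: "invertible PP" "t \<in> T ==> i ~= j ==> (matrix_inv PP ** t ** PP) $ i $ j = 0"
proof -
 note P = someI_ex[OF simdiag_imp_diagonalizable[OF T_simdiag], folded PP_def]
 show "invertible PP" by (rule P[THEN conjunct1])
 show "t \<in> T ==> i ~= j ==> (matrix_inv PP ** t ** PP) $ i $ j = 0" by (rule P[THEN conjunct2, rule_format])
qed

definition chi :: "'n => complex^'n^'n => complex" where
 "chi i t = (matrix_inv PP ** t ** PP) $ i $ i"

definition wt :: "'n => 'n => complex^'n^'n => complex" where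
 "wt i j = (\<lambda>t\<in>T. chi i t * chi j (matrix_inv t))"

text \<open>In a basis diagonalising \<open>T\<close> the matrix unit in position \<open>i\<close>,
  \<open>j\<close> has weight \<open>wt i j\<close>, so projecting onto a weight space means keeping
  the entries of that weight. This is defined on all matrices.\<close>

definition wcomp :: "(complex^'n^'n => complex) => complex^'n^'n => complex^'n^'n" where
 "wcomp w X = PP ** (\<chi> i j. if wt i j = w then (matrix_inv PP ** X ** PP) $ i $ j else 0) ** matrix_inv PP"

lemma diag_mult:
 fixes D A :: "complex^'n^'n"
 assumes "\<And>i j. i ~= j ==> D $ i $ j = 0"
 shows "(D ** A) $ i $ j = D $ i $ i * A $ i $ j" "(A ** D) $ i $ j = A $ i $ j * D $ j $ j"
proof -
 have "(D ** A) $ i $ j = (\<Sum>k\<in>UNIV. if k = i then D $ i $ i * A $ i $ j else 0)"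
  unfolding matrix_matrix_mult_def using assms by (simp del: sum.delta, intro sum.cong) auto
 thus "(D ** A) $ i $ j = D $ i $ i * A $ i $ j" by simp
 have "(A ** D) $ i $ j = (\<Sum>k\<in>UNIV. if k = j then A $ i $ j * D $ j $ j else 0)"
  unfolding matrix_matrix_mult_def using assms by (simp del: sum.delta, intro sum.cong) auto
 thus "(A ** D) $ i $ j = A $ i $ j * D $ j $ j" by simp
qed

lemma conj_PP: "PP ** (matrix_inv PP ** X ** PP) ** matrix_inv PP = X"
 "matrix_inv PP ** (PP ** X ** matrix_inv PP) ** PP = X"
proof -
 have "PP ** (matrix_inv PP ** X ** PP) ** matrix_inv PP = (PP ** matrix_inv PP) ** X ** (PP ** matrix_inv PP)"
  by (simp only: matrix_mul_assoc)
 thus "PP ** (matrix_inv PP ** X ** PP) ** matrix_inv PP = X" by (simp add: matrix_inv_mult PP(1))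
 have "matrix_inv PP ** (PP ** X ** matrix_inv PP) ** PP = (matrix_inv PP ** PP) ** X ** (matrix_inv PP ** PP)"
  by (simp only: matrix_mul_assoc)
 thus "matrix_inv PP ** (PP ** X ** matrix_inv PP) ** PP = X" by (simp add: matrix_inv_mult PP(1))
qed

lemma conj_PP_mult:
 "matrix_inv PP ** (X ** Y) ** PP = (matrix_inv PP ** X ** PP) ** (matrix_inv PP ** Y ** PP)"
proof -
 have "(matrix_inv PP ** X ** PP) ** (matrix_inv PP ** Y ** PP)
   = matrix_inv PP ** X ** (PP ** matrix_inv PP) ** Y ** PP" by (simp only: matrix_mul_assoc)
 thus ?thesis by (simp add: matrix_inv_mult PP(1) matrix_mul_assoc)
qed

lemma PP_eqI: "matrix_inv PP ** X ** PP = matrix_inv PP ** Y ** PP ==> X = Y"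
 by (metis conj_PP(1))

lemma Ad_T_entry:
 assumes "t \<in> T"
 shows "(matrix_inv PP ** Ad t X ** PP) $ i $ j = wt i j t * (matrix_inv PP ** X ** PP) $ i $ j"
 unfolding Ad_def conj_PP_mult
 by (simp add: diag_mult[OF PP(2)[OF assms]] diag_mult[OF PP(2)[OF T_group(4)[OF assms]]] wt_def assms chi_def)

lemma wcomp_entry:
 "(matrix_inv PP ** wcomp w X ** PP) $ i $ j = (if wt i j = w then (matrix_inv PP ** X ** PP) $ i $ j else 0)"
 unfolding wcomp_def conj_PP(2) by simp

lemma matrix_PP_eqI:
 "(\<And>i j. (matrix_inv PP ** X ** PP) $ i $ j = (matrix_inv PP ** Y ** PP) $ i $ j) ==> X = Y"
 by (rule PP_eqI) (simp add: vec_eq_iff)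

lemma conj_PP_scale: "matrix_inv PP ** (c \<cdot> X) ** PP = c \<cdot> (matrix_inv PP ** X ** PP)"
 by (simp add: mat_scale_simps)

lemma Ad_wcomp: "t \<in> T ==> Ad t (wcomp w X) = w t \<cdot> wcomp w X"
 by (rule matrix_PP_eqI) (simp add: Ad_T_entry wcomp_entry conj_PP_scale)

lemma wcomp_simps:
 "wcomp w (X + Y) = wcomp w X + wcomp w Y" "wcomp w (c \<cdot> X) = c \<cdot> wcomp w X"
 by (rule matrix_PP_eqI; simp add: wcomp_entry conj_PP_scale matrix_ring_simps)+

lemma wcomp_eigen:
 assumes "v \<in> extensional T" "\<And>t. t \<in> T ==> Ad t X = v t \<cdot> X"
 shows "wcomp w X = (if w = v then X else 0)"
proof (rule matrix_PP_eqI)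
 fix i j
 let ?x = "(matrix_inv PP ** X ** PP) $ i $ j"
 have "wt i j = v" if "?x ~= 0"
 proof (rule extensionalityI)
  show "wt i j \<in> extensional T" by (simp add: wt_def)
  show "wt i j t = v t" if t: "t \<in> T" for t
   using Ad_T_entry[OF t, of X i j] \<open>?x ~= 0\<close> by (simp add: assms(2)[OF t] conj_PP_scale)
 qed (rule assms(1))
 thus "(matrix_inv PP ** wcomp w X ** PP) $ i $ j = (matrix_inv PP ** (if w = v then X else 0) ** PP) $ i $ j"
  by (auto simp: wcomp_entry matrix_ring_simps)
qed

lemma wcomp_sum_all: "(\<Sum>w\<in>range (case_prod wt). wcomp w X) = X"
proof (rule matrix_PP_eqI)
 fix i j
 have "(matrix_inv PP ** (\<Sum>w\<in>range (case_prod wt). wcomp w X) ** PP) $ i $ j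
   = (\<Sum>w\<in>range (case_prod wt). if wt i j = w then (matrix_inv PP ** X ** PP) $ i $ j else 0)"
  by (simp add: matrix_sum_left matrix_sum_right sum_component wcomp_entry)
 also have "\<dots> = (matrix_inv PP ** X ** PP) $ i $ j" by (subst sum.delta') auto
 finally show "(matrix_inv PP ** (\<Sum>w\<in>range (case_prod wt). wcomp w X) ** PP) $ i $ j
   = (matrix_inv PP ** X ** PP) $ i $ j" .
qed

lemma wcomp_stable:
 assumes V: "mm.subspace V" and stable: "\<And>t X. t \<in> T ==> X \<in> V ==> Ad t X \<in> V" and X: "X \<in> V"
 shows "wcomp w X \<in> V"
proof (cases "w \<in> range (case_prod wt)")
 case True
 show ?thesis
  by (rule Ad_eigen_components[OF V stable, of _ "range (case_prod wt)" "\<lambda>w. wcomp w X"])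
   (use True X in \<open>auto simp: wcomp_sum_all Ad_wcomp wt_def\<close>)
next
 case False
 hence "wcomp w X = 0" by (intro matrix_PP_eqI) (auto simp: wcomp_entry matrix_ring_simps)
 thus ?thesis using mm.subspace_0[OF V] by simp
qed

lemma chi_mult: "s \<in> T ==> chi i (s ** t) = chi i s * chi i t"
 unfolding chi_def conj_PP_mult by (simp add: diag_mult[OF PP(2)])

lemma chi_1: "chi i (mat 1) = 1"
 by (simp add: chi_def matrix_inv_mult[OF PP(1)]) (simp add: mat_def)

lemma wt_character: "wt i j \<in> characters T"
 unfolding characters_def
proof (intro CollectI conjI ballI)
 show "wt i j \<in> extensional T" by (simp add: wt_def)
 show "wt i j t ~= 0" if "t \<in> T" for t
 proof -
  have "chi k t * chi k (matrix_inv t) = 1" for k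
   using chi_mult[OF that, of k "matrix_inv t"] by (simp add: matrix_inv_mult[OF T_group(1)[OF that]] chi_1)
  thus ?thesis using that by (auto simp: wt_def) (metis mult_zero_left mult_zero_right zero_neq_one)+
 qed
 show "wt i j (s ** t) = wt i j s * wt i j t" if "s \<in> T" "t \<in> T" for s t
  using that by (simp add: wt_def T_group matrix_inv_mult_distrib chi_mult)
 have "(\<lambda>t. chi i t * chi j (matrix_inv t)) \<in> reg_fun"
  unfolding chi_def
  by (intro reg_fun_mult reg_fun_matrix_mult reg_fun_const reg_fun_coord reg_fun_inv)
 then obtain f k where "f \<in> poly_fun"
  "\<And>t. invertible t ==> chi i t * chi j (matrix_inv t) = f t / det t ^ k"
  using reg_funE by blast
 thus "\<exists>f\<in>poly_fun. \<exists>k. \<forall>t\<in>T. wt i j t = f t / det t ^ k"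
  using T_group(1) by (intro bexI[of _ f] exI[of _ k] ballI) (simp_all add: wt_def)
qed

lemma alpha_beta_nz: "t \<in> T ==> \<alpha> t ~= 0" "t \<in> T ==> \<beta> t ~= 0"
 using simple by (auto simp: G2_simple_roots_def characters_def)

lemma lin_comb_ext: "chr c \<in> extensional T"
 by (cases c) (simp add: lin_comb_def)

lemma lin_comb_add: "t \<in> T ==> chr (c + d) t = chr c t * chr d t"
 by (cases c; cases d) (simp add: lin_comb_def power_int_add alpha_beta_nz)

lemma lin_comb_0: "chr (0, 0) = (\<lambda>t\<in>T. 1)"
 by (simp add: lin_comb_def)

lemma lin_comb_inj: "chr c = chr d ==> c = d"
proof -
 assume e: "chr c = chr d"
 have "chr (c - d) t = 1" if t: "t \<in> T" for t
 proof -
  have "chr d t ~= 0" using t alpha_beta_nz by (cases d) (simp add: lin_comb_def)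
  moreover have "chr (c - d) t * chr d t = chr c t"
   using lin_comb_add[OF t, of "c - d" d] by simp
  ultimately show ?thesis unfolding e by simp
 qed
 hence "chr (c - d) = (\<lambda>t\<in>T. 1)"
  using lin_comb_ext[of "c - d"] by (intro extensionalityI[of _ T]) auto
 moreover have ind: "\<forall>i j. chr (i, j) = (\<lambda>t\<in>T. 1) --> i = 0 \<and> j = 0"
  using simple unfolding G2_simple_roots_def by (elim conjE)
 ultimately have "fst (c - d) = 0 \<and> snd (c - d) = 0"
  using ind[THEN spec, THEN spec, of "fst (c - d)" "snd (c - d)"] by (simp del: fst_diff snd_diff)
 thus ?thesis by (simp add: prod_eq_iff)
qed

lemma gs_iff: "X \<in> gs c \<longleftrightarrow> X \<in> \<g> \<and> (\<forall>t\<in>T. Ad t X = chr c t \<cdot> X)"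
 by (simp add: gs_def root_space_def \<g>_def)

lemma gs_g: "X \<in> gs c ==> X \<in> \<g>"
 by (simp add: gs_iff)

lemma csub_gs: "mm.subspace (gs c)"
 unfolding mm.subspace_def
 by (auto simp: gs_iff mm.subspace_0[OF csub_g] mm.subspace_add[OF csub_g] mm.subspace_scale[OF csub_g] Ad_simps
   mat_scale_simps(3) simp del: mm.scale_scale intro: mm.scale_left_commute)

text \<open>A nonzero vector of this weight has a nonzero entry in the diagonalising basis, so its
  weight is one of the \<open>wt i j\<close> and hence a regular character. Being nontrivial, it
  would have to be a root.\<close>

lemma gs_outside: "c \<notin> wts ==> X \<in> gs c ==> X = 0"
proof (rule ccontr)
 assume c: "c \<notin> wts" and X: "X \<in> gs c" "X ~= 0"
 let ?w = "chr c"
 have "wcomp ?w X = X" using X(1) by (subst wcomp_eigen[OF lin_comb_ext]) (auto simp: gs_iff)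
 hence "\<exists>i j. wt i j = ?w"
  using X(2) wcomp_entry[of ?w X] by (metis (no_types, lifting) matrix_PP_eqI matrix_ring_simps(5,6) zero_index)
 hence ch: "?w \<in> characters T" using wt_character by metis
 have "c ~= (0, 0)" using c by (auto simp: wts_def)
 hence "?w ~= (\<lambda>t\<in>T. 1)" using lin_comb_inj[of c "(0,0)"] lin_comb_0 by auto
 hence "?w \<in> roots G T" using ch X by (auto simp: roots_def gs_def)
 hence "\<exists>d\<in>G2_positive \<union> (\<lambda>(i, j). (- i, - j)) ` G2_positive. ?w = chr d"
  using simple unfolding G2_simple_roots_def by auto
 thus False using c lin_comb_inj unfolding wts_def by blast
qed

definition pc :: "int \<times> int => complex^'n^'n => complex^'n^'n" where
 "pc c X = wcomp (chr c) X"

lemma pc_add: "pc c (X + Y) = pc c X + pc c Y" and pc_scale: "pc c (k \<cdot> X) = k \<cdot> pc c X"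
 by (simp_all add: pc_def wcomp_simps)

lemma pc_sum: "pc c (\<Sum>i\<in>I. f i) = (\<Sum>i\<in>I. pc c (f i))"
 using pc_scale[of c 0 0] by (induction I rule: infinite_finite_induct) (simp_all add: pc_add mat_scale_simps)

lemma pc_0 [simp]: "pc c 0 = 0"
 using pc_scale[of c 0 0] by (simp add: mat_scale_simps)

lemma pc_gs: "X \<in> gs d ==> pc c X = (if c = d then X else 0)"
 unfolding pc_def using lin_comb_inj
 by (subst wcomp_eigen[OF lin_comb_ext[of d]]) (auto simp: gs_iff)

lemma pc_stable:
 "mm.subspace V ==> (\<And>t X. t \<in> T ==> X \<in> V ==> Ad t X \<in> V) ==> X \<in> V ==> pc c X \<in> V"
 unfolding pc_def by (rule wcomp_stable)

lemma pc_in_gs: "X \<in> \<g> ==> pc c X \<in> gs c"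
 unfolding gs_iff
 by (intro conjI ballI pc_stable[OF csub_g])
  (use T_subset Ad_g in \<open>auto simp: pc_def Ad_wcomp\<close>)

lemma weight_is_lin_comb: "X \<in> \<g> ==> wcomp w X ~= 0 ==> w \<in> chr ` wts"
proof -
 assume X: "X \<in> \<g>" and nz: "wcomp w X ~= 0"
 have "\<exists>i j. wt i j = w"
  using nz wcomp_entry[of w X] by (metis (no_types, lifting) matrix_PP_eqI matrix_ring_simps(5,6) zero_index)
 hence ch: "w \<in> characters T" using wt_character by metis
 have "wcomp w X \<in> \<g>" by (rule wcomp_stable[OF csub_g _ X]) (use T_subset Ad_g in auto)
 hence "root_space G T w ~= {0}" using nz Ad_wcomp[of _ w X] by (auto simp: root_space_def \<g>_def)
 hence "w = (\<lambda>t\<in>T. 1) \<or> w \<in> roots G T" using ch by (auto simp: roots_def)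
 thus ?thesis using simple lin_comb_0 unfolding G2_simple_roots_def wts_def by auto
qed

lemma sum_pc: "X \<in> \<g> ==> (\<Sum>c\<in>wts. pc c X) = X"
proof -
 assume X: "X \<in> \<g>"
 have "(\<Sum>c\<in>wts. pc c X) = (\<Sum>w\<in>chr ` wts. wcomp w X)"
  using lin_comb_inj by (subst sum.reindex) (auto simp: inj_on_def pc_def)
 also have "\<dots> = (\<Sum>w\<in>range (case_prod wt). wcomp w X)"
 proof (rule sum.mono_neutral_cong)
  show "wcomp w X = 0" if "w \<in> range (case_prod wt) - chr ` wts" for w
   using weight_is_lin_comb[OF X] that by blast
  show "wcomp w X = 0" if "w \<in> chr ` wts - range (case_prod wt)" for w
  proof (rule matrix_PP_eqI)
   fix i j
   have "wt i j \<in> range (case_prod wt)" by (rule range_eqI[of _ _ "(i, j)"]) simp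
   hence "wt i j ~= w" using DiffD2[OF that] by metis
   thus "(matrix_inv PP ** wcomp w X ** PP) $ i $ j = (matrix_inv PP ** 0 ** PP) $ i $ j"
    by (simp add: wcomp_entry matrix_ring_simps)
  qed
 qed auto
 also have "\<dots> = X" by (rule wcomp_sum_all)
 finally show ?thesis .
qed

lemma br_gs: "X \<in> gs c ==> Y \<in> gs d ==> br X Y \<in> gs (c + d)"
 unfolding gs_iff
 by (auto simp: br_g Ad_br[OF T_group(1)] lin_comb_add br_simps mat_scale_simps(6))

text \<open>The trace is invariant under \<open>Ad t\<close>, which multiplies the product by
  \<open>chr (c + d) t\<close>, and this number differs from 1 for some \<open>t\<close>.\<close>

lemma trace_gs:
 assumes X: "X \<in> gs c" and Y: "Y \<in> gs d" and "c + d ~= (0, 0)"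
 shows "trace (X ** Y) = 0"
proof -
 obtain t where t: "t \<in> T" "chr (c + d) t ~= 1"
  using assms(3) lin_comb_inj[of "c + d" "(0,0)"] lin_comb_0 lin_comb_ext[of "c + d"]
   extensionalityI[of "chr (c + d)" T "\<lambda>t\<in>T. 1"] by auto
 have "trace (X ** Y) = trace (Ad t X ** Ad t Y)" by (rule trace_Ad_Ad[OF T_group(1)[OF t(1)], symmetric])
 also have "\<dots> = chr (c + d) t * trace (X ** Y)"
  using X Y t(1) by (simp add: gs_iff lin_comb_add mat_scale_simps(1,2) mult.assoc)
 finally show ?thesis using t(2) by (metis mult_cancel_right1)
qed

lemma nondeg: "X \<in> \<g> ==> (\<And>Y. Y \<in> \<g> ==> trace (X ** Y) = 0) ==> X = 0"
 unfolding \<g>_def by (rule trace_form_nondegenerate[OF ss])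

lemma nondeg_gs:
 assumes X: "X \<in> gs c" "X ~= 0"
 obtains Y where "Y \<in> gs (- c)" "trace (X ** Y) ~= 0"
proof -
 obtain Y where Y: "Y \<in> \<g>" "trace (X ** Y) ~= 0" using nondeg X gs_g by blast
 have "trace (X ** Y) = (\<Sum>d\<in>wts. trace (X ** pc d Y))"
  by (subst sum_pc[OF Y(1), symmetric]) (simp add: matrix_sum_right trace_sum)
 then obtain d where d: "d \<in> wts" "trace (X ** pc d Y) ~= 0" using Y(2) by (metis (no_types, lifting) sum.neutral)
 hence "c + d = (0, 0)" using trace_gs[OF X(1) pc_in_gs[OF Y(1)]] by blast
 hence "d = - c" by (cases c; cases d) auto
 thus ?thesis using that[of "pc d Y"] d pc_in_gs[OF Y(1)] by simp
qed

end

section \<open>The Cartan subalgebra\<close>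

lemma torus_iff_simdiag: "torus T \<longleftrightarrow> connected_algebraic_group T \<and> simdiag T"
 for T :: "(complex^'n^'n) set"
proof -
 have "(\<exists>P :: complex^'n^'n. invertible P \<and> (\<forall>t\<in>T. \<forall>i j. i ~= j --> (matrix_inv P ** t ** P) $ i $ j = 0)) \<longleftrightarrow> simdiag T"
  (is "?L \<longleftrightarrow> _")
 proof (rule iffI)
  assume ?L
  thus "simdiag T" by (elim exE conjE) (rule diagonalizable_imp_simdiag, assumption, simp)
 qed (rule simdiag_imp_diagonalizable)
 thus ?thesis unfolding torus_def by (simp only:)
qed

lemma simdiag_transfer:
 assumes "simdiag S" "\<And>v A. (\<And>A. A \<in> S ==> \<exists>c. A *v v = c *s v) ==> A \<in> S' ==> \<exists>c. A *v v = c *s v"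
 shows "simdiag S'"
proof -
 have "{v. \<forall>A\<in>S. \<exists>c. A *v v = c *s v} \<subseteq> {v. \<forall>A\<in>S'. \<exists>c. A *v v = c *s v}"
  using assms(2) by (intro Collect_mono impI ballI) simp
 from vec.span_mono[OF this] show ?thesis using assms(1) by (simp add: simdiag_def top.extremum_unique)
qed

lemma mexp_commute_imp:
 assumes "\<And>s. mexp D s ** Y = Y ** mexp D s"
 shows "D ** Y = Y ** D"
proof -
 have "mderiv (\<lambda>s. mexp D s ** Y) (D ** Y) 0" "mderiv (\<lambda>s. Y ** mexp D s) (Y ** D) 0"
  using mderiv_mult[OF mderiv_mexp[of D 0] mderiv_const[of Y]] mderiv_mult[OF mderiv_const[of Y] mderiv_mexp[of D 0]]
  by (simp_all add: matrix_ring_simps)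
 hence "(D ** Y) $ i $ j = (Y ** D) $ i $ j" for i j
  unfolding assms mderiv_def using DERIV_unique by fast
 thus ?thesis by (simp add: vec_eq_iff)
qed

lemma commute_iff_Ad: "invertible g ==> Ad g X = X \<longleftrightarrow> g ** X = X ** g"
proof
 assume g: "invertible g"
 have *: "Ad g X ** g = g ** X"
  by (simp add: Ad_def matrix_mul_assoc[symmetric] matrix_inv_mult[OF g])
 show "Ad g X = X ==> g ** X = X ** g" using * by simp
 assume "g ** X = X ** g"
 hence "Ad g X = X ** (g ** matrix_inv g)" by (simp add: Ad_def matrix_mul_assoc)
 thus "Ad g X = X" by (simp add: matrix_inv_mult[OF g])
qed

lemma br_eq_0_iff: "br X Y = 0 \<longleftrightarrow> X ** Y = Y ** X"
 by (simp add: br_def)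

context g2_setting
begin

lemma gs0_commute_T: "X \<in> gs (0, 0) ==> t \<in> T ==> t ** X = X ** t"
 using commute_iff_Ad[OF T_group(1), of t X] by (simp add: gs_iff lin_comb_0 mat_scale_simps)

lemma T_commute: "s \<in> T ==> t \<in> T ==> s ** t = t ** s"
proof (rule PP_eqI)
 assume s: "s \<in> T" and t: "t \<in> T"
 have "(matrix_inv PP ** (s ** t) ** PP) $ i $ j = (matrix_inv PP ** (t ** s) ** PP) $ i $ j" for i j
  by (cases "i = j") (simp_all add: conj_PP_mult diag_mult[OF PP(2)[OF s]] PP(2)[OF t])
 thus "matrix_inv PP ** (s ** t) ** PP = matrix_inv PP ** (t ** s) ** PP"
  by (simp add: vec_eq_iff)
qed

text \<open>\<open>T\<close> and the exponentials of the replica commute and are diagonalisable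
  together. The closure of the group they generate is connected, hence a torus, and \<open>T\<close>
  is a maximal one.\<close>

lemma mexp_replica_T:
 assumes X: "X \<in> gs (0, 0)" and sp: "spectral X L E" and \<phi>: "\<And>a b. \<phi> (a + b) = \<phi> a + \<phi> b"
 shows "mexp (replica L E \<phi>) s \<in> T"
proof -
 define D where "D = replica L E \<phi>"
 have DG: "mexp D s \<in> G" for s
  unfolding D_def using gs_g[OF X] mexp_replica_in_closed_subgroup[OF G_closed _ sp \<phi>] by (simp add: \<g>_def)
 have Dt: "mexp D s ** t = t ** mexp D s" if "t \<in> T" for t s
  unfolding D_def by (rule mexp_commute[OF replica_commute[OF sp gs0_commute_T[OF X that, symmetric]]])
 define H0 where "H0 = {t ** mexp D s | t s. t \<in> T}"
 have mem: "t ** mexp D s \<in> H0" if "t \<in> T" for t s using that by (auto simp: H0_def)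
 have sH0: "subgroup H0 GL"
  unfolding subgroup_GL_iff
 proof (intro conjI ballI)
  fix a assume "a \<in> H0"
  then obtain t s where a: "a = t ** mexp D s" "t \<in> T" by (auto simp: H0_def)
  show "invertible a" using T_group(1) a by (simp add: invertible_mult invertible_mexp)
  have "matrix_inv a = mexp (- D) s ** matrix_inv t"
   using T_group(1)[OF a(2)] by (simp add: a(1) matrix_inv_mult_distrib invertible_mexp matrix_inv_mexp)
  also have "\<dots> = matrix_inv t ** mexp D (- s)"
   using Dt[OF T_group(4)[OF a(2)]] by (simp add: mexp_uminus)
  finally show "matrix_inv a \<in> H0" using mem T_group(4)[OF a(2)] by simp
  fix b assume "b \<in> H0"
  then obtain t' s' where b: "b = t' ** mexp D s'" "t' \<in> T" by (auto simp: H0_def)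
  have "a ** b = t ** (mexp D s ** t') ** mexp D s'" by (simp only: a(1) b(1) matrix_mul_assoc)
  also have "\<dots> = (t ** t') ** mexp D (s + s')" by (simp only: Dt[OF b(2)] matrix_mul_assoc mexp_add)
  finally show "a ** b \<in> H0" using mem T_group(3)[OF a(2) b(2)] by simp
 qed (use mem[OF T_group(2), of 0] in simp)
 define H where "H = zcl H0"
 have H: "closed_subgroup H" unfolding H_def by (rule zcl_subgroup[OF sH0])
 have H0GL: "H0 \<subseteq> carrier GL" using sH0 by (auto simp: subgroup_GL_iff)
 have H0H: "H0 \<subseteq> H" unfolding H_def by (rule zcl_superset[OF H0GL])
 have TH0: "T \<subseteq> H0" using mem[of _ 0] by auto
 have "H0 \<subseteq> G" using T_subset DG G_group(3) by (auto simp: H0_def)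
 hence HG: "H \<subseteq> G" unfolding H_def using zcl_mono[of H0 G] G_group(5) by simp
 have "simdiag (T \<union> range (mexp D))"
 proof (rule simdiag_Un[OF T_simdiag, of L E])
  show "finite L" "(\<Sum>l\<in>L. E l) = mat 1" by (rule spectralD[OF sp])+
  show "E l ** t = t ** E l" if "t \<in> T" for l t
   by (rule spectralD(3)[OF sp gs0_commute_T[OF X that, symmetric]])
  show "\<exists>c. A ** E l = c \<cdot> E l" if l: "l \<in> L" and A: "A \<in> range (mexp D)" for l A
  proof -
   obtain s where s: "A = mexp D s" using A by (rule rangeE)
   have "A ** E l = (\<Sum>m\<in>L. if m = l then exp (\<phi> l * s) \<cdot> E l else 0)"
    unfolding s D_def mexp_replica[OF sp] matrix_sum_left
    by (rule sum.cong) (simp_all add: mat_scale_simps spectralD(4)[OF sp _ l])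
   thus ?thesis using l spectralD(1)[OF sp] by auto
  qed
 qed
 hence "simdiag H0"
 proof (rule simdiag_transfer)
  fix v A assume v: "\<And>A. A \<in> T \<union> range (mexp D) ==> \<exists>c. A *v v = c *s v" and "A \<in> H0"
  then obtain t s where A: "A = t ** mexp D s" "t \<in> T" by (auto simp: H0_def)
  obtain c where c: "t *v v = c *s v" using v[of t] A(2) by auto
  obtain d where d: "mexp D s *v v = d *s v" using v[of "mexp D s"] by auto
  have "A *v v = t *v (mexp D s *v v)" by (simp add: A(1) matrix_vector_mul_assoc)
  also have "\<dots> = (d * c) *s v" by (simp add: d c vector_scalar_commute vector_smult_assoc)
  finally show "\<exists>c. A *v v = c *s v" by blast
 qed
 hence "simdiag H" unfolding H_def by (rule simdiag_zcl)
 have "connectedin zariski H0"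
 proof -
  have cT: "connectedin zariski T"
   using T_torus closed_subgroupD(1)[OF T_closed]
   by (auto simp: torus_def connected_algebraic_group_def connectedin_def)
  define M where "M = range (mexp D)"
  have "zirr M"
  proof (rule zirr_curves)
   fix p q assume "p \<in> M" "q \<in> M"
   then obtain a b where ab: "p = mexp D a" "q = mexp D b" by (auto simp: M_def)
   have e: "mexp D a ** mexp D ((b - a) * t) = mexp D (a + (b - a) * t)" for t by (rule mexp_add[symmetric])
   show "\<exists>c. entire_curve c \<and> (\<forall>t. c t \<in> M) \<and> c 0 = p \<and> c 1 = q"
   proof (intro exI[of _ "\<lambda>t. mexp D a ** mexp D ((b - a) * t)"] conjI allI)
    show "entire_curve (\<lambda>t. mexp D a ** mexp D ((b - a) * t))"
     by (intro entire_curve_mult entire_curve_const entire_curve_mexp)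
    show "mexp D a ** mexp D ((b - a) * t) \<in> M" for t unfolding e M_def by simp
    show "mexp D a ** mexp D ((b - a) * 1) = q" unfolding e by (simp add: ab)
   qed (simp add: ab)
  qed (simp add: M_def)
  hence cM: "connectedin zariski M"
   unfolding connectedin_def M_def
   by (auto simp: invertible_mexp intro!: irreducible_imp_connected zirr_imp_irreducible)
  \<comment> \<open>Each translate of \<open>T\<close> is connected and meets the curve
    \<open>M\<close>; attaching \<open>M\<close> to all of them makes the union connected.\<close>
  have "connectedin zariski (\<Union>s. (\<lambda>A. A ** mexp D s) ` T \<union> M)"
  proof (rule connectedin_Union)
   show "connectedin zariski S" if R: "S \<in> range (\<lambda>s. (\<lambda>A. A ** mexp D s) ` T \<union> M)" for S
   proof -
    obtain s where S: "S = (\<lambda>A. A ** mexp D s) ` T \<union> M" using R by (rule rangeE)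
    have "connectedin zariski ((\<lambda>A. A ** mexp D s) ` T)"
     by (rule connectedin_continuous_map_image[OF continuous_map_right_mult[OF invertible_mexp] cT])
    moreover have "mexp D s \<in> (\<lambda>A. A ** mexp D s) ` T \<inter> M"
     using T_group(2) by (auto simp: M_def intro!: image_eqI[of _ _ "mat 1"])
    ultimately show ?thesis unfolding S using cM by (intro connectedin_Un) auto
   qed
   show "\<Inter> (range (\<lambda>s. (\<lambda>A. A ** mexp D s) ` T \<union> M)) ~= {}" by (auto simp: M_def)
  qed
  moreover have "(\<Union>s. (\<lambda>A. A ** mexp D s) ` T \<union> M) = H0"
   using mem[OF T_group(2)] by (auto simp: H0_def M_def)
  ultimately show ?thesis by simp
 qed
 hence "connectedin zariski H"
  unfolding H_def zariski_closure_of[OF H0GL, symmetric] by (rule connectedin_closure_of)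
 hence "torus H"
  unfolding torus_iff_simdiag connected_algebraic_group_def
  using H \<open>simdiag H\<close> by (simp add: connectedin_def)
 hence "H = T" using torus TH0 H0H HG unfolding maximal_torus_def by (meson subset_trans)
 thus ?thesis using H0H mem[OF T_group(2), of s] by (auto simp: D_def)
qed

lemma T_curve_commute:
 assumes "\<And>s. mexp D s \<in> T" "Y \<in> gs (0, 0)"
 shows "D ** Y = Y ** D"
 by (rule mexp_commute_imp) (rule gs0_commute_T[OF assms(2,1)])

lemma T_curve_gs0:
 assumes "\<And>s. mexp D s \<in> T"
 shows "D \<in> gs (0, 0)"
 unfolding gs_iff
proof (intro conjI ballI)
 show "D \<in> \<g>" unfolding \<g>_def by (rule mexp_lie_algebraI) (use assms T_subset in auto)
 fix t assume t: "t \<in> T"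
 have "D ** t = t ** D" by (rule mexp_commute_imp) (rule T_commute[OF assms t])
 thus "Ad t D = chr (0, 0) t \<cdot> D"
  using commute_iff_Ad[OF T_group(1)[OF t], of D] t by (simp add: lin_comb_0 mat_scale_simps)
qed

lemma replica_gs0:
 "X \<in> gs (0, 0) ==> spectral X L E ==> (\<And>a b. \<phi> (a + b) = \<phi> a + \<phi> b) ==> replica L E \<phi> \<in> gs (0, 0)"
 by (rule T_curve_gs0) (rule mexp_replica_T)

text \<open>As \<open>X\<close> is nilpotent and commutes with \<open>gs (0, 0)\<close>, the
  products \<open>X ** Y\<close> are nilpotent and have trace zero, against the nondegeneracy of the
  trace form on this space.\<close>

lemma nilpotent_central_zero:
 assumes X: "X \<in> gs (0, 0)" "nilpotent X" and c: "\<And>Y. Y \<in> gs (0, 0) ==> X ** Y = Y ** X"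
 shows "X = 0"
proof (rule ccontr)
 assume "X ~= 0"
 then obtain Y where Y: "Y \<in> gs (- (0, 0))" "trace (X ** Y) ~= 0" using nondeg_gs[OF X(1)] by metis
 hence "Y \<in> gs (0, 0)" by simp
 hence "nilpotent (X ** Y)" using nilpotent_mult_commuting c X(2) by metis
 thus False using Y(2) trace_nilpotent by blast
qed

text \<open>A nonzero derived algebra would contain a nonzero central element \<open>u\<close> by
  Engel's theorem. The trace of \<open>u\<close> against its conjugate replica vanishes because
  \<open>u\<close> is a combination of brackets and the replica is central; so \<open>u\<close> is
  nilpotent, hence zero.\<close>

lemma gs0_abelian:
 assumes "X \<in> gs (0, 0)" "Y \<in> gs (0, 0)"
 shows "br X Y = 0"
proof (rule ccontr)
 assume nz: "br X Y ~= 0"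
 let ?t = "gs (0, 0)"
 have brt: "br A C \<in> ?t" if "A \<in> ?t" "C \<in> ?t" for A C using br_gs[OF that] by simp
 define S where "S = {br A C | A C. A \<in> ?t \<and> C \<in> ?t}"
 have U: "mm.span S \<subseteq> ?t" by (rule mm.span_minimal[OF _ csub_gs]) (use brt in \<open>auto simp: S_def\<close>)
 have "br X Y \<in> mm.span S" using assms by (intro mm.span_base) (auto simp: S_def)
 have "\<exists>u\<in>mm.span S - {0}. \<forall>A\<in>?t. br A u \<in> {0}"
 proof (rule engel[OF csub_gs])
  show "\<exists>k. (br A ^^ k) u = 0" if "A \<in> ?t" "u \<in> ?t \<union> mm.span S" for A u
  proof -
   have u: "u \<in> ?t" using that U by auto
   obtain L E where sp: "spectral A L E" using ex_spectral by blast
   let ?S = "replica L E (\<lambda>l. l)"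
   \<comment> \<open>The semisimple part of \<open>A\<close> has its exponentials in
     \<open>T\<close> and is therefore central, so on this space \<open>br A\<close> agrees with the
     bracket with a nilpotent matrix.\<close>
   have c: "br ?S w = 0" if "w \<in> ?t" for w
    unfolding br_eq_0_iff by (rule T_curve_commute[OF mexp_replica_T[OF \<open>A \<in> ?t\<close> sp] that]) simp
   obtain k where k: "(br (A - ?S) ^^ k) u = 0" using ad_nilpotent[OF spectral_nilpotent_part[OF sp]] by blast
   have "(br (A - ?S) ^^ j) u = (br A ^^ j) u \<and> (br A ^^ j) u \<in> ?t" for j
    by (induction j) (use u c brt[OF \<open>A \<in> ?t\<close>] in \<open>auto simp: br_simps\<close>)
   thus ?thesis using k by metis
  qed
  show "br A u \<in> mm.span S" if "A \<in> ?t" "u \<in> mm.span S" for A u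
   using that U by (intro mm.span_base) (auto simp: S_def)
  show "{0} \<subset> mm.span S" using nz \<open>br X Y \<in> mm.span S\<close> mm.span_zero by auto
 qed (auto simp: brt br_simps mm.subspace_single_0)
 then obtain u where u: "u \<in> mm.span S" "u ~= 0" "\<And>A. A \<in> ?t ==> br A u = 0" by auto
 have ut: "u \<in> ?t" using u(1) U by auto
 obtain L E where sp: "spectral u L E" using ex_spectral by blast
 let ?C = "replica L E cnj"
 have C: "mexp ?C s \<in> T" for s by (rule mexp_replica_T[OF ut sp]) simp
 have "trace (u ** ?C) = 0"
  using u(1)
 proof (rule mm.span_induct)
  show "mm.subspace {u. trace (u ** ?C) = 0}"
   unfolding mm.subspace_def by (auto simp: matrix_simps trace_add)
  fix v assume "v \<in> S"
  then obtain A D where v: "v = br A D" "A \<in> ?t" "D \<in> ?t" by (auto simp: S_def)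
  have "br D ?C = 0" unfolding br_eq_0_iff by (rule T_curve_commute[OF C v(3), symmetric])
  thus "trace (v ** ?C) = 0" by (simp add: v(1) trace_br matrix_ring_simps)
 qed
 hence "nilpotent u" by (rule trace_star(2)[OF sp])
 hence "u = 0"
 proof (rule nilpotent_central_zero[OF ut])
  show "u ** Y = Y ** u" if "Y \<in> gs (0, 0)" for Y
   using u(3)[OF that] by (simp only: br_eq_0_iff)
 qed
 thus False using u(2) by simp
qed

lemma gs0_semisimple:
 assumes X: "X \<in> gs (0, 0)" and sp: "spectral X L E"
 shows "replica L E (\<lambda>l. l) = X"
proof -
 let ?S = "replica L E (\<lambda>l. l)"
 have S: "?S \<in> gs (0, 0)" by (rule replica_gs0[OF X sp]) simp
 have d: "X - ?S \<in> gs (0, 0)" by (rule mm.subspace_diff[OF csub_gs X S])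
 have "X - ?S = 0"
  by (rule nilpotent_central_zero[OF d spectral_nilpotent_part[OF sp]])
   (use gs0_abelian[OF d] in \<open>simp add: br_eq_0_iff\<close>)
 thus ?thesis by simp
qed

lemma mexp_T: "X \<in> gs (0, 0) ==> mexp X s \<in> T"
proof -
 assume X: "X \<in> gs (0, 0)"
 obtain L E where sp: "spectral X L E" using ex_spectral by blast
 show ?thesis using mexp_replica_T[OF X sp, of "\<lambda>l. l" s] by (simp add: gs0_semisimple[OF X sp])
qed

text \<open>The conjugate replica is a substitute for complex conjugation with respect to a real
  form of the Cartan subalgebra.\<close>

lemma ex_conjugate:
 assumes X: "X \<in> gs (0, 0)"
 obtains C where "C \<in> gs (0, 0)" "trace (X ** C) = 0 ==> X = 0" "\<And>Y. br X Y = 0 ==> br C Y = 0"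
proof -
 obtain L E where sp: "spectral X L E" using ex_spectral by blast
 show ?thesis
 proof (rule that[of "replica L E cnj"])
  show "replica L E cnj \<in> gs (0, 0)" by (rule replica_gs0[OF X sp]) simp
  show "X = 0" if "trace (X ** replica L E cnj) = 0"
   using trace_star(1)[OF sp that] gs0_semisimple[OF X sp] by simp
  show "br (replica L E cnj) Y = 0" if "br X Y = 0" for Y
   using replica_commute[OF sp] that by (simp add: br_eq_0_iff)
 qed
qed

lemma character_derivative:
 assumes h: "h \<in> gs (0, 0)" and w: "w \<in> characters T"
 shows "\<exists>a. ((\<lambda>s. w (mexp h s)) has_field_derivative a) (at 0)"
proof -
 obtain f k where f: "f \<in> poly_fun" "\<forall>t\<in>T. w t = f t / det t ^ k"
  using w by (auto simp: characters_def)
 have e: "entire_curve (\<lambda>s. mexp h s)" using entire_curve_mexp[of h 1] by simp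
 have "(\<lambda>s. f (mexp h s) / det (mexp h s) ^ k) holomorphic_on UNIV"
  by (intro holomorphic_intros entire_curve_poly_fun[OF e f(1)] entire_curve_poly_fun[OF e poly_fun_det_id])
   (simp add: det_nz invertible_mexp)
 hence "(\<lambda>s. w (mexp h s)) holomorphic_on UNIV" using f(2) mexp_T[OF h] by simp
 thus ?thesis by (auto simp: holomorphic_on_def field_differentiable_def)
qed

lemma character_one: "w \<in> characters T ==> w (mat 1) = 1"
proof -
 assume w: "w \<in> characters T"
 have "w (mat 1 ** mat 1) = w (mat 1) * w (mat 1)" "w (mat 1) ~= 0"
  using w T_group(2) unfolding characters_def by blast+
 thus ?thesis by simp
qed

text \<open>\<open>a\<close> and \<open>b\<close> are the derivatives of \<alpha> and \<beta> along
  the exponential curve of \<open>h\<close>. Differentiating \<open>Ad (mexp h s) X\<close> in two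
  ways gives the bracket.\<close>

lemma ex_eigenvalues:
 assumes h: "h \<in> gs (0, 0)"
 shows "\<exists>a b. \<forall>i j. \<forall>X\<in>gs (i, j). br h X = (of_int i * a + of_int j * b) \<cdot> X"
proof -
 have ch: "\<alpha> \<in> characters T" "\<beta> \<in> characters T" using simple by (auto simp: G2_simple_roots_def)
 obtain a where a: "((\<lambda>s. \<alpha> (mexp h s)) has_field_derivative a) (at 0)" using character_derivative[OF h ch(1)] by blast
 obtain b where b: "((\<lambda>s. \<beta> (mexp h s)) has_field_derivative b) (at 0)" using character_derivative[OF h ch(2)] by blast
 have nz: "\<alpha> (mexp h s) ~= 0" "\<beta> (mexp h s) ~= 0" for s using alpha_beta_nz mexp_T[OF h] by auto
 have "br h X = (of_int i * a + of_int j * b) \<cdot> X" if X: "X \<in> gs (i, j)" for i j X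
 proof -
  have "((\<lambda>s. \<alpha> (mexp h s) powi i * \<beta> (mexp h s) powi j) has_field_derivative (of_int i * a + of_int j * b)) (at 0)"
   using nz[of 0] by (auto intro!: derivative_eq_intros a b simp: character_one[OF ch(1)] character_one[OF ch(2)])
  hence "mderiv (\<lambda>s. (\<alpha> (mexp h s) powi i * \<beta> (mexp h s) powi j) \<cdot> X) ((of_int i * a + of_int j * b) \<cdot> X) 0"
   by (rule mderiv_scale)
  moreover have "Ad (mexp h s) X = (\<alpha> (mexp h s) powi i * \<beta> (mexp h s) powi j) \<cdot> X" for s
   using X mexp_T[OF h, of s] by (simp add: gs_iff lin_comb_def)
  ultimately have 1: "mderiv (\<lambda>s. Ad (mexp h s) X) ((of_int i * a + of_int j * b) \<cdot> X) 0" by simp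
  have 2: "mderiv (\<lambda>s. Ad (mexp h s) X) (br h X) 0"
   using mderiv_mult[OF mderiv_mult[OF mderiv_mexp[of h 0] mderiv_const[of X]] mderiv_mexp[of "- h" 0]]
   by (simp add: Ad_mexp br_def matrix_simps)
  have "br h X $ k $ l = ((of_int i * a + of_int j * b) \<cdot> X) $ k $ l" for k l
   using DERIV_unique[OF 2[unfolded mderiv_def, rule_format, of k l] 1[unfolded mderiv_def, rule_format, of k l]] .
  thus ?thesis by (simp add: vec_eq_iff)
 qed
 thus ?thesis by blast
qed

definition eig :: "complex^'n^'n => complex \<times> complex" where
 "eig h = (SOME (a, b). \<forall>i j. \<forall>X\<in>gs (i, j). br h X = (of_int i * a + of_int j * b) \<cdot> X)"

text \<open>The differential of the character \<open>chr c\<close>, evaluated at \<open>h\<close>.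
  Built from the two numbers \<open>eig h\<close>, it is additive in \<open>c\<close> by
  construction, while linearity in \<open>h\<close> is proved with root vectors.\<close>

definition ev :: "int \<times> int => complex^'n^'n => complex" where
 "ev c h = of_int (fst c) * fst (eig h) + of_int (snd c) * snd (eig h)"

lemma br_h: "h \<in> gs (0, 0) ==> X \<in> gs c ==> br h X = ev c h \<cdot> X"
proof -
 assume h: "h \<in> gs (0, 0)" and X: "X \<in> gs c"
 have "\<exists>p. case p of (a, b) => \<forall>i j. \<forall>X\<in>gs (i, j). br h X = (of_int i * a + of_int j * b) \<cdot> X"
  using ex_eigenvalues[OF h] by auto
 from someI_ex[OF this] show ?thesis
  using X unfolding eig_def[symmetric] ev_def by (cases c) (auto split: prod.splits)
qed

lemma br_h_right: "h \<in> gs (0, 0) ==> X \<in> gs c ==> br X h = (- ev c h) \<cdot> X"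
 using br_anti[of X h] br_h[of h X c] by (simp add: mat_scale_simps)

definition rts :: "(int \<times> int) set" where
 "rts = {(1,0), (0,1), (1,1), (2,1), (3,1), (3,2), (-1,0), (0,-1), (-1,-1), (-2,-1), (-3,-1), (-3,-2)}"

lemma rts_wts: "c \<in> rts ==> c \<in> wts" "c \<in> wts ==> c ~= (0, 0) ==> c \<in> rts" "c \<in> rts ==> c ~= (0, 0)"
 "c \<in> rts ==> - c \<in> rts"
 by (auto simp: rts_def wts_eq)

lemma root_vector_exists: "c \<in> rts ==> \<exists>X\<in>gs c. X ~= 0"
proof -
 assume "c \<in> rts"
 hence "c \<in> G2_positive \<union> (\<lambda>(i, j). (- i, - j)) ` G2_positive" by (auto simp: rts_def G2_positive_def)
 hence "chr c \<in> roots G T" using simple by (auto simp: G2_simple_roots_def)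
 hence "gs c ~= {0}" by (simp add: roots_def gs_def)
 thus ?thesis using mm.subspace_0[OF csub_gs, of c] by blast
qed

definition ee :: "int \<times> int => complex^'n^'n" where
 "ee c = (SOME X. X \<in> gs c \<and> X ~= 0)"

lemma ee: "c \<in> rts ==> ee c \<in> gs c" "c \<in> rts ==> ee c ~= 0"
 using someI_ex[of "\<lambda>X. X \<in> gs c \<and> X ~= 0"] root_vector_exists[of c] unfolding ee_def by blast+

text \<open>The powers of \<open>X\<close> have the weights \<open>k\<close> times \<open>c\<close>,
  which are pairwise distinct, while only finitely many weights \<open>wt i j\<close> occur in the
  matrix space.\<close>

lemma root_nilpotent:
 assumes X: "X \<in> gs c" and c: "c ~= (0, 0)"
 shows "nilpotent X"
proof (rule ccontr)
 assume "\<not> nilpotent X"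
 hence nz: "mpow X k ~= 0" for k by (auto simp: nilpotent_def)
 let ?c = "\<lambda>k::nat. (int k * fst c, int k * snd c)"
 have Ad: "Ad t (mpow X k) = chr (?c k) t \<cdot> mpow X k" if t: "t \<in> T" for t k
 proof (induction k)
  case 0
  have "Ad t (mat 1) = mat 1" by (simp add: Ad_def matrix_inv_mult T_group(1)[OF t])
  thus ?case using t by (simp add: lin_comb_0 mat_scale_simps)
 next
  case (Suc k)
  have "?c (Suc k) = c + ?c k" by (simp add: prod_eq_iff algebra_simps)
  thus ?case
   using Suc X t by (simp add: Ad_times[OF T_group(1)[OF t]] gs_iff lin_comb_add mat_scale_simps(1,2,6))
 qed
 have "chr (?c k) \<in> range (case_prod wt)" for k
 proof -
  have "wcomp (chr (?c k)) (mpow X k) = mpow X k"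
   by (subst wcomp_eigen[OF lin_comb_ext Ad]) auto
  hence "\<exists>i j. wt i j = chr (?c k)"
   using nz[of k] wcomp_entry[of "chr (?c k)" "mpow X k"]
   by (metis (no_types, lifting) matrix_PP_eqI matrix_ring_simps(5,6) zero_index)
  thus ?thesis by (metis case_prod_conv rangeI)
 qed
 hence "range (\<lambda>k. chr (?c k)) \<subseteq> range (case_prod wt)" by blast
 hence "finite (range (\<lambda>k. chr (?c k)))" by (rule finite_subset) simp
 moreover have "inj (\<lambda>k. chr (?c k))"
 proof (rule injI)
  fix k l :: nat assume "chr (?c k) = chr (?c l)"
  hence "?c k = ?c l" by (rule lin_comb_inj)
  thus "k = l" using c by (cases "fst c = 0") (auto simp: prod_eq_iff)
 qed
 ultimately show False using finite_imageD[of "\<lambda>k. chr (?c k)" UNIV] by simp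
qed

end

section \<open>Root vectors\<close>

text \<open>The numbers \<open>-(k + 1) (w + k)\<close> below are those of the representation theory of \<open>sl(2)\<close>.\<close>

lemma sl2_chain:
 assumes h: "br e f = h" "br h e = 2 \<cdot> e" "br h y = w \<cdot> y" and ef: "br e (br f y) = 0"
 shows "br h ((br e ^^ k) y) = (w + 2 * of_nat k) \<cdot> (br e ^^ k) y"
  "br f ((br e ^^ Suc k) y) = (- (of_nat (Suc k) * (w + of_nat k))) \<cdot> (br e ^^ k) y"
proof -
 have 1: "br h ((br e ^^ k) y) = (w + 2 * of_nat k) \<cdot> (br e ^^ k) y" for k
 proof (induction k)
  case (Suc k)
  let ?z = "(br e ^^ k) y"
  have "br h (br e ?z) = 2 \<cdot> br e ?z + (w + 2 * of_nat k) \<cdot> br e ?z"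
   by (simp only: jacobi[of h e] h(2) Suc br_simps)
  also have "\<dots> = (w + 2 * of_nat (Suc k)) \<cdot> br e ?z"
   unfolding mat_scale_simps(7)[symmetric] by (simp add: algebra_simps)
  finally show ?case by simp
 qed (simp add: h(3))
 have step: "br f (br e z) = br e (br f z) - br h z" for z
  using jacobi[of e f z] by (simp add: h(1))
 show "br h ((br e ^^ k) y) = (w + 2 * of_nat k) \<cdot> (br e ^^ k) y" by (rule 1)
 show "br f ((br e ^^ Suc k) y) = (- (of_nat (Suc k) * (w + of_nat k))) \<cdot> (br e ^^ k) y"
 proof (induction k)
  case 0
  have "br f (br e y) = (- w) \<cdot> y" by (simp only: step ef h(3) mat_scale_simps(9) diff_0)
  moreover have "- (of_nat (Suc 0) * (w + of_nat 0)) = - w" by simp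
  ultimately show ?case by (simp only: funpow.simps o_apply id_apply)
 next
  case (Suc k)
  have "br f ((br e ^^ Suc (Suc k)) y) = br e (br f ((br e ^^ Suc k) y)) - br h ((br e ^^ Suc k) y)"
   by (simp add: step)
  also have "\<dots> = (- (of_nat (Suc k) * (w + of_nat k)) - (w + 2 * of_nat (Suc k))) \<cdot> (br e ^^ Suc k) y"
   unfolding Suc 1 by (simp add: br_simps mat_scale_simps(8))
  also have "- (of_nat (Suc k) * (w + of_nat k)) - (w + 2 * of_nat (Suc k)) =
    - (of_nat (Suc (Suc k)) * (w + of_nat (Suc k)))" by (simp add: algebra_simps)
  finally show ?case .
 qed
qed

text \<open>A positive real part keeps \<open>w + of_nat k\<close> away from zero, so the factor in
  \<open>sl2_chain\<close> never vanishes and the chain never ends.\<close>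

lemma sl2_chain_nonzero:
 assumes h: "br e f = h" "br h e = 2 \<cdot> e" "br h y = w \<cdot> y" and ef: "br e (br f y) = 0"
  and w: "Re w > 0" and y: "y ~= 0"
 shows "(br e ^^ k) y ~= 0"
proof (induction k)
 case (Suc k)
 have "Re (w + of_nat k) > 0" using w by simp
 hence "w + of_nat k ~= 0" by (metis less_irrefl zero_complex.simps(1))
 hence "br f ((br e ^^ Suc k) y) ~= 0"
  unfolding sl2_chain(2)[OF h ef] using Suc by (simp del: of_nat_Suc funpow.simps)
 thus ?case by (auto simp: br_simps simp del: funpow.simps)
qed (simp add: y)

context g2_setting
begin

lemma ev_linear:
 assumes h: "h \<in> gs (0, 0)" "h' \<in> gs (0, 0)"
 shows "ev c (h + h') = ev c h + ev c h'" "ev c (k \<cdot> h) = k * ev c h"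
proof -
 have root: "ev d (h + h') = ev d h + ev d h' \<and> ev d (k \<cdot> h) = k * ev d h" if d: "d \<in> rts" for d
 proof -
  have "ev d (h + h') \<cdot> ee d = (ev d h + ev d h') \<cdot> ee d"
   using br_h[OF mm.subspace_add[OF csub_gs h] ee(1)[OF d]] br_h[OF h(1) ee(1)[OF d]] br_h[OF h(2) ee(1)[OF d]]
   by (simp add: br_simps mat_scale_simps(7))
  moreover have "ev d (k \<cdot> h) \<cdot> ee d = br (k \<cdot> h) (ee d)"
   by (rule br_h[OF mm.subspace_scale[OF csub_gs h(1)] ee(1)[OF d], symmetric])
  hence "ev d (k \<cdot> h) \<cdot> ee d = (k * ev d h) \<cdot> ee d"
   by (simp only: br_simps br_h[OF h(1) ee(1)[OF d]] mat_scale_simps(6))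
  ultimately show ?thesis using ee(2)[OF d] mm.scale_right_imp_eq by blast
 qed
 have "fst (eig x) = ev (1, 0) x" "snd (eig x) = ev (0, 1) x" for x by (simp_all add: ev_def)
 thus "ev c (h + h') = ev c h + ev c h'" "ev c (k \<cdot> h) = k * ev c h"
  using root[of "(1, 0)"] root[of "(0, 1)"] by (simp_all add: ev_def[of c] rts_def algebra_simps)
qed

lemma ev_add: "ev (c + d) h = ev c h + ev d h" and ev_minus: "ev (- c) h = - ev c h"
 and ev_0: "ev (0, 0) h = 0"
 by (simp_all add: ev_def algebra_simps)

lemma trace_h_br:
 assumes "e \<in> gs c" "f \<in> gs (- c)" "h \<in> gs (0, 0)"
 shows "trace (h ** br e f) = ev c h * trace (e ** f)"
proof -
 have "trace (h ** br e f) = trace (br h e ** f)" by (simp add: trace_br)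
 thus ?thesis using br_h[OF assms(3,1)] by (simp add: mat_scale_simps)
qed

lemma br_ef: "e \<in> gs c ==> f \<in> gs (- c) ==> br e f \<in> gs (0, 0)"
 using br_gs[of e c f "- c"] by (simp add: zero_prod_def)

text \<open>If \<open>c\<close> vanished on the bracket, the conjugate \<open>C\<close> of the
  bracket would commute with \<open>e\<close> too, and the trace of the bracket against
  \<open>C\<close> would be zero. Then \<open>e\<close> and \<open>f\<close> commute, their product
  is nilpotent, and its trace vanishes.\<close>

lemma sl2_nonzero:
 assumes c: "c \<in> rts" and e: "e \<in> gs c" and f: "f \<in> gs (- c)" and tr: "trace (e ** f) ~= 0"
 shows "ev c (br e f) ~= 0"
proof
 let ?h = "br e f"
 assume 0: "ev c ?h = 0"
 have h: "?h \<in> gs (0, 0)" by (rule br_ef[OF e f])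
 obtain C where C: "C \<in> gs (0, 0)" "trace (?h ** C) = 0 ==> ?h = 0" "\<And>Y. br ?h Y = 0 ==> br C Y = 0"
  using ex_conjugate[OF h] by metis
 have "br ?h e = 0" using br_h[OF h e] 0 by (simp add: mat_scale_simps)
 hence "br C e = 0" by (rule C(3))
 hence "ev c C \<cdot> e = 0" using br_h[OF C(1) e] by simp
 moreover have "e ~= 0" using tr by (auto simp: matrix_ring_simps)
 ultimately have "ev c C = 0" by simp
 hence "trace (?h ** C) = 0" using trace_h_br[OF e f C(1)] trace_mul_sym[of ?h C] by simp
 hence "?h = 0" by (rule C(2))
 hence "e ** f = f ** e" by (simp add: br_eq_0_iff)
 hence "nilpotent (e ** f)"
  by (rule nilpotent_mult_commuting) (rule root_nilpotent[OF e rts_wts(3)[OF c]])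
 thus False using tr trace_nilpotent by blast
qed

lemma sl2_triple:
 assumes c: "c \<in> rts" and e: "e \<in> gs c" "e ~= 0"
 obtains f where "f \<in> gs (- c)" "ev c (br e f) = 2" "trace (e ** f) ~= 0"
proof -
 obtain f where f: "f \<in> gs (- c)" "trace (e ** f) ~= 0" using nondeg_gs[OF e] by metis
 have nz: "ev c (br e f) ~= 0" by (rule sl2_nonzero[OF c e(1) f])
 have h: "br e f \<in> gs (0, 0)" by (rule br_ef[OF e(1) f(1)])
 let ?k = "2 / ev c (br e f)"
 show ?thesis
 proof (rule that[of "?k \<cdot> f"])
  show "?k \<cdot> f \<in> gs (- c)" by (rule mm.subspace_scale[OF csub_gs f(1)])
  show "ev c (br e (?k \<cdot> f)) = 2" using nz by (simp add: br_simps ev_linear(2)[OF h h])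
  show "trace (e ** ?k \<cdot> f) ~= 0" using nz f(2) by (simp add: mat_scale_simps)
 qed
qed

lemma br_root_nilpotent: "X \<in> gs c ==> c \<in> rts ==> \<exists>k. (br X ^^ k) Y = 0"
 using ad_nilpotent[OF root_nilpotent[OF _ rts_wts(3)], of X c] by auto

text \<open>A nonzero \<open>y\<close> would start a chain that never ends, while \<open>e\<close>
  acts nilpotently. One-dimensionality of root spaces and nonvanishing of brackets are both derived
  from this contradiction.\<close>

lemma root_chain_finite:
 assumes c: "c \<in> rts" and e: "e \<in> gs c" and f: "f \<in> gs (- c)" and 2: "ev c (br e f) = 2"
  and y: "y \<in> gs d" "Re (ev d (br e f)) > 0" "br e (br f y) = 0"
 shows "y = 0"
proof (rule ccontr)
 assume "y ~= 0"
 note h = br_ef[OF e f]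
 have "(br e ^^ k) y ~= 0" for k
  by (rule sl2_chain_nonzero[OF refl _ _ y(3,2) \<open>y ~= 0\<close>]) (use br_h[OF h e] br_h[OF h y(1)] 2 in auto)
 thus False using br_root_nilpotent[OF e c, of y] by blast
qed

text \<open>Subtracting a multiple of \<open>e\<close> achieves that \<open>x\<close> is orthogonal
  to \<open>f\<close>. Then \<open>br x f\<close> is orthogonal to \<open>gs (0, 0)\<close>, hence
  zero, and \<open>x\<close> is a lowest vector of weight 2.\<close>

lemma gs_1dim:
 assumes c: "c \<in> rts" and e: "e \<in> gs c" "e ~= 0" and X: "X \<in> gs c"
 shows "\<exists>k. X = k \<cdot> e"
proof -
 obtain f where f: "f \<in> gs (- c)" "ev c (br e f) = 2" "trace (e ** f) ~= 0" using sl2_triple[OF c e] by metis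
 define x where "x = X - (trace (X ** f) / trace (e ** f)) \<cdot> e"
 have x: "x \<in> gs c" unfolding x_def by (intro mm.subspace_diff[OF csub_gs X] mm.subspace_scale[OF csub_gs e(1)])
 have "trace (x ** f) = 0" using f(3) by (simp add: x_def matrix_ring_simps mat_scale_simps trace_sub)
 hence tr: "trace (h ** br x f) = 0" if "h \<in> gs (0, 0)" for h using trace_h_br[OF x f(1) that] by simp
 have "br x f = 0"
 proof (rule ccontr)
  assume "br x f ~= 0"
  then obtain Y where "Y \<in> gs (- (0, 0))" "trace (br x f ** Y) ~= 0"
   using nondeg_gs[OF br_ef[OF x f(1)]] by metis
  thus False using tr[of Y] trace_mul_sym[of Y "br x f"] by simp
 qed
 hence "br f x = 0" using br_anti[of f x] by simp
 hence "x = 0"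
  by (intro root_chain_finite[OF c e(1) f(1,2) x]) (simp_all add: f(2) br_simps)
 thus ?thesis unfolding x_def by auto
qed

text \<open>If \<open>x\<close> kills \<open>y\<close>, then \<open>y\<close> is a highest vector,
  so \<open>d\<close> has nonnegative real part on the coroot of \<open>c\<close>. A vector of
  weight \<open>c + d\<close> then has real part at least 2 there, and \<open>f\<close> followed by
  \<open>x\<close> kills it because \<open>gs d\<close> is a line.\<close>

lemma root_string:
 assumes c: "c \<in> rts" and d: "d \<in> rts" and cd: "c + d \<in> rts"
  and x: "x \<in> gs c" "x ~= 0" and y: "y \<in> gs d" "y ~= 0"
 shows "br x y ~= 0"
proof
 assume 0: "br x y = 0"
 obtain f where f: "f \<in> gs (- c)" "ev c (br x f) = 2" "trace (x ** f) ~= 0" using sl2_triple[OF c x] by metis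
 let ?h = "br x f"
 have e': "br f x = - ?h" by (rule br_anti)
 have h: "?h \<in> gs (0, 0)" by (rule br_ef[OF x(1) f(1)])
 have h': "br f x \<in> gs (0, 0)" unfolding e' by (rule mm.subspace_neg[OF csub_gs h])
 have evn: "ev k (br f x) = - ev k ?h" for k
  using ev_linear(2)[OF h h, of k "-1"] by (simp add: e' mat_scale_simps)
 have "\<not> Re (ev d (br f x)) > 0"
 proof
  assume p: "Re (ev d (br f x)) > 0"
  have "y = 0"
  proof (rule root_chain_finite[OF rts_wts(4)[OF c] f(1) _ _ y(1) p])
   show "x \<in> gs (- (- c))" using x(1) by simp
   show "ev (- c) (br f x) = 2" by (simp add: evn ev_minus f(2))
   show "br f (br x y) = 0" by (simp add: 0 br_simps)
  qed
  thus False using y(2) by simp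
 qed
 hence ge: "Re (ev d ?h) \<ge> 0" by (simp add: evn)
 let ?z = "ee (c + d)"
 have z: "?z \<in> gs (c + d)" "?z ~= 0" using ee[OF cd] by auto
 have "br f ?z \<in> gs d" using br_gs[OF f(1) z(1)] by simp
 then obtain k where "br f ?z = k \<cdot> y" using gs_1dim[OF d y] by blast
 hence "br x (br f ?z) = 0" by (simp add: br_simps 0)
 hence "?z = 0"
  by (intro root_chain_finite[OF c x(1) f(1,2) z(1)]) (use ge in \<open>simp_all add: ev_add f(2)\<close>)
 thus False using z(2) by simp
qed

lemma trace_ee: "c \<in> rts ==> trace (ee c ** ee (- c)) ~= 0"
proof -
 assume c: "c \<in> rts"
 obtain f where f: "f \<in> gs (- c)" "trace (ee c ** f) ~= 0" using nondeg_gs[OF ee[OF c]] by metis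
 obtain k where "f = k \<cdot> ee (- c)" using gs_1dim[OF rts_wts(4)[OF c] ee[OF rts_wts(4)[OF c]] f(1)] by blast
 thus ?thesis using f(2) by (simp add: mat_scale_simps)
qed

text \<open>The coroot of \<open>c\<close>, normalised so that \<open>c\<close> takes the value 2 on
  it. Together with \<open>ee c\<close> and \<open>ff c\<close> it forms an \<open>sl(2)\<close>
  triple.\<close>

definition hh :: "int \<times> int => complex^'n^'n" where
 "hh c = (2 / ev c (br (ee c) (ee (- c)))) \<cdot> br (ee c) (ee (- c))"

definition ff :: "int \<times> int => complex^'n^'n" where
 "ff c = (2 / ev c (br (ee c) (ee (- c)))) \<cdot> ee (- c)"

lemma ff_gs: "c \<in> rts ==> ff c \<in> gs (- c)"
 unfolding ff_def using ee(1) rts_wts(4) by (intro mm.subspace_scale[OF csub_gs]) auto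

lemma br_ee_ff: "br (ee c) (ff c) = hh c"
 by (simp add: ff_def hh_def br_simps)

lemma hh: assumes c: "c \<in> rts" shows "hh c \<in> gs (0, 0)" "ev c (hh c) = 2" "hh c ~= 0" "ff c ~= 0"
proof -
 have nz: "ev c (br (ee c) (ee (- c))) ~= 0"
  by (rule sl2_nonzero[OF c ee(1)[OF c] ee(1)[OF rts_wts(4)[OF c]] trace_ee[OF c]])
 have h: "br (ee c) (ee (- c)) \<in> gs (0, 0)" by (rule br_ef[OF ee(1)[OF c] ee(1)[OF rts_wts(4)[OF c]]])
 show "hh c \<in> gs (0, 0)" unfolding hh_def by (rule mm.subspace_scale[OF csub_gs h])
 show 2: "ev c (hh c) = 2" unfolding hh_def using nz by (simp add: ev_linear(2)[OF h h])
 have "ev c 0 = 0" using ev_linear(2)[OF h h, of c 0] by (simp add: mat_scale_simps)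
 thus "hh c ~= 0" using 2 by auto
 thus "ff c ~= 0" using br_ee_ff[of c] by (auto simp: br_simps)
qed

text \<open>\<open>d\<close> is the bottom of its string in direction \<open>c\<close>. At the top
  of the string, reached after \<open>k\<close> steps, the factor in \<open>sl2_chain\<close> has to
  vanish, which gives the Cartan integer.\<close>

lemma ev_string:
 assumes c: "c \<in> rts" and d: "d \<in> rts" "d - c \<notin> wts"
  and nz: "(br (ee c) ^^ k) (ee d) ~= 0" and 0: "(br (ee c) ^^ Suc k) (ee d) = 0"
 shows "ev d (hh c) = - of_nat k"
proof -
 have "br (ff c) (ee d) \<in> gs (d - c)" using br_gs[OF ff_gs[OF c] ee(1)[OF d(1)]] by simp
 from gs_outside[OF d(2) this] have 1: "br (ee c) (br (ff c) (ee d)) = 0" by (simp add: br_simps)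
 have "br (ff c) ((br (ee c) ^^ Suc k) (ee d)) =
   (- (of_nat (Suc k) * (ev d (hh c) + of_nat k))) \<cdot> (br (ee c) ^^ k) (ee d)"
  using br_h[OF hh(1)[OF c] ee(1)[OF c]] br_h[OF hh(1)[OF c] ee(1)[OF d(1)]] hh(2)[OF c]
  by (intro sl2_chain(2)[OF br_ee_ff _ _ 1]) auto
 hence "of_nat (Suc k) * (ev d (hh c) + of_nat k) = 0"
  using nz unfolding 0 by (simp add: br_simps del: of_nat_Suc)
 hence "ev d (hh c) + of_nat k = 0" by (simp del: of_nat_Suc)
 thus ?thesis by (simp add: add_eq_0_iff2)
qed

text \<open>The strings are \<beta>, \<beta>+\<alpha>, \<beta>+2\<alpha>, \<beta>+3\<alpha> and
  \<alpha>, \<alpha>+\<beta>; their lengths give the entries of the Cartan matrix.\<close>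

lemma ev_hh: "ev (0,1) (hh (1,0)) = - 3" "ev (1,0) (hh (0,1)) = - 1"
proof -
 let ?a = "ee (1,0)" and ?b = "ee (0,1)"
 have r: "(1,0) \<in> rts" "(0,1) \<in> rts" "(1,1) \<in> rts" "(2,1) \<in> rts" "(3,1) \<in> rts" by (simp_all add: rts_def)
 have 1: "br ?a ?b \<in> gs (1,1)" "br ?a ?b ~= 0"
  using br_gs[OF ee(1)[OF r(1)] ee(1)[OF r(2)]] root_string[OF r(1,2) _ ee[OF r(1)] ee[OF r(2)]] r by auto
 have 2: "br ?a (br ?a ?b) \<in> gs (2,1)" "br ?a (br ?a ?b) ~= 0"
  using br_gs[OF ee(1)[OF r(1)] 1(1)] root_string[OF r(1,3) _ ee[OF r(1)] 1] r by auto
 have 3: "br ?a (br ?a (br ?a ?b)) \<in> gs (3,1)" "br ?a (br ?a (br ?a ?b)) ~= 0"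
  using br_gs[OF ee(1)[OF r(1)] 2(1)] root_string[OF r(1,4) _ ee[OF r(1)] 2] r by auto
 have 4: "br ?a (br ?a (br ?a (br ?a ?b))) = 0"
  using br_gs[OF ee(1)[OF r(1)] 3(1)] by (intro gs_outside[of "(4,1)"]) (auto simp: wts_eq)
 show "ev (0,1) (hh (1,0)) = - 3"
  using ev_string[OF r(1,2), of 3] 3(2) 4 by (simp add: wts_eq numeral_3_eq_3)
 have 5: "br ?b ?a ~= 0" using 1(2) br_anti[of ?b ?a] by simp
 have "br ?b ?a \<in> gs (1,1)" using br_gs[OF ee(1)[OF r(2)] ee(1)[OF r(1)]] by simp
 hence 6: "br ?b (br ?b ?a) = 0"
  using br_gs[OF ee(1)[OF r(2)], of "br ?b ?a" "(1,1)"] by (intro gs_outside[of "(1,2)"]) (auto simp: wts_eq)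
 show "ev (1,0) (hh (0,1)) = - 1"
  using ev_string[OF r(2,1), of 1] 5 6 by (simp add: wts_eq)
qed

lemma ex_cartan: "\<exists>h\<in>gs (0, 0). ev (1,0) h = p \<and> ev (0,1) h = q"
proof -
 have r: "(1,0) \<in> rts" "(0,1) \<in> rts" by (simp_all add: rts_def)
 \<comment> \<open>The coefficients \<open>x\<close>, \<open>y\<close> solve
   \<open>2 * x - y = p\<close> and \<open>- 3 * x + 2 * y = q\<close>, the linear system with the
   Cartan matrix, whose determinant is 1.\<close>
 let ?h = "(2 * p + q) \<cdot> hh (1,0) + (3 * p + 2 * q) \<cdot> hh (0,1)"
 note s = mm.subspace_scale[OF csub_gs hh(1)[OF r(1)]] mm.subspace_scale[OF csub_gs hh(1)[OF r(2)]]
 have "?h \<in> gs (0, 0)" by (rule mm.subspace_add[OF csub_gs s])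
 moreover have "ev (1,0) ?h = p" "ev (0,1) ?h = q"
  using hh(1,2)[OF r(1)] hh(1,2)[OF r(2)] by (simp_all add: ev_linear s ev_hh)
 ultimately show ?thesis by blast
qed

lemma no_center:
 assumes X: "X \<in> \<g>" and c: "\<And>Y. Y \<in> \<g> ==> br X Y = 0"
 shows "X = 0"
proof (rule semisimple_no_abelian_ideal[OF ss, of "{X \<in> \<g>. \<forall>Y\<in>\<g>. br X Y = 0}"])
 show "mm.subspace {X \<in> \<g>. \<forall>Y\<in>\<g>. br X Y = 0}"
  unfolding mm.subspace_def
  by (auto simp: mm.subspace_0[OF csub_g] mm.subspace_add[OF csub_g] mm.subspace_scale[OF csub_g] br_simps)
 fix g Y assume g: "g \<in> G" and Y: "Y \<in> {X \<in> \<g>. \<forall>Y\<in>\<g>. br X Y = 0}"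
 note gi = G_group(1)[OF g]
 have "br (Ad g Y) Z = 0" if Z: "Z \<in> \<g>" for Z
 proof -
  have "br (Ad g Y) Z = Ad g (br Y (Ad (matrix_inv g) Z))" by (simp add: Ad_br[OF gi] Ad_inv[OF gi])
  also have "br Y (Ad (matrix_inv g) Z) = 0" using Y Ad_g[OF G_group(4)[OF g] Z] by simp
  finally show ?thesis by (simp add: Ad_simps)
 qed
 thus "Ad g Y \<in> {X \<in> \<g>. \<forall>Y\<in>\<g>. br X Y = 0}" using Y Ad_g[OF g] by simp
qed (use assms in \<open>auto simp: \<g>_def\<close>)

lemma ev_eq_0: "ev (1,0) h = 0 ==> ev (0,1) h = 0 ==> ev c h = 0"
 by (simp add: ev_def)

lemma cartan_zero:
 assumes h: "h \<in> gs (0, 0)" and 0: "ev (1,0) h = 0" "ev (0,1) h = 0"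
 shows "h = 0"
proof (rule no_center[OF gs_g[OF h]])
 fix Y assume Y: "Y \<in> \<g>"
 have "br h Y = (\<Sum>c\<in>wts. br h (pc c Y))" by (subst sum_pc[OF Y, symmetric]) (rule br_sum_right)
 also have "\<dots> = 0"
  using br_h[OF h pc_in_gs[OF Y]] ev_eq_0[OF 0] by (intro sum.neutral) (simp add: mat_scale_simps)
 finally show "br h Y = 0" .
qed

end

section \<open>Groups generated by exponentials\<close>

inductive_set gen :: "(complex^'n^'n) set => (complex^'n^'n) set" for S where
 one: "mat 1 \<in> gen S"
| step: "X \<in> S ==> g \<in> gen S ==> mexp X t ** g \<in> gen S"

lemma gen_mult: "g \<in> gen S ==> h \<in> gen S ==> g ** h \<in> gen S"
 by (induction g rule: gen.induct) (auto simp: matrix_mul_assoc[symmetric] intro: gen.step)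

lemma gen_mexp: "X \<in> S ==> mexp X t \<in> gen S"
 using gen.step[OF _ gen.one, of X S t] by simp

lemma gen_invertible: "g \<in> gen S ==> invertible g"
 by (induction rule: gen.induct) (simp_all add: invertible_mult invertible_mexp)

lemma gen_inv: "g \<in> gen S ==> matrix_inv g \<in> gen S"
proof (induction rule: gen.induct)
 case (step X g t)
 have "matrix_inv (mexp X t ** g) = matrix_inv g ** mexp X (- t)"
  by (simp add: matrix_inv_mult_distrib invertible_mexp gen_invertible[OF step(2)] matrix_inv_mexp mexp_uminus)
 thus ?case using gen_mult[OF step(3) gen_mexp[OF step(1)]] by simp
qed (simp add: gen.one)

lemma gen_subgroup: "subgroup (gen S) GL"
 by (simp add: subgroup_GL_iff gen_invertible gen.one gen_mult gen_inv)

lemma gen_mono: "S \<subseteq> S' ==> gen S \<subseteq> gen S'"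
proof
 fix g assume "g \<in> gen S" "S \<subseteq> S'"
 thus "g \<in> gen S'" by (induction rule: gen.induct) (auto intro: gen.intros)
qed

lemma gen_subset:
 assumes "closed_subgroup H" "\<And>X t. X \<in> S ==> mexp X t \<in> H"
 shows "gen S \<subseteq> H"
proof
 fix g assume "g \<in> gen S"
 thus "g \<in> H" by (induction rule: gen.induct) (auto intro: closed_subgroupD[OF assms(1)] assms(2))
qed

text \<open>All parameters in the product of exponentials are scaled by the same complex
  variable.\<close>

lemma gen_curve:
 assumes "g \<in> gen S"
 shows "\<exists>c. entire_curve c \<and> (\<forall>t. c t \<in> gen S) \<and> c 0 = mat 1 \<and> c 1 = g"
 using assms
proof (induction rule: gen.induct)
 case one
 show ?case by (rule exI[of _ "\<lambda>t. mat 1"]) (simp add: entire_curve_const gen.one)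
next
 case (step X g t)
 then obtain c where c: "entire_curve c" "\<And>t. c t \<in> gen S" "c 0 = mat 1" "c 1 = g" by auto
 thus ?case
  by (intro exI[of _ "\<lambda>s. mexp X (t * s) ** c s"] conjI allI entire_curve_mult entire_curve_mexp gen.step step(1))
   simp_all
qed

lemma zirr_gen: "zirr (gen S)"
proof (rule zirr_curves)
 show "gen S ~= {}" using gen.one by auto
 fix p q assume p: "p \<in> gen S" and q: "q \<in> gen S"
 obtain c where c: "entire_curve c" "\<And>t. c t \<in> gen S" "c 0 = mat 1" "c 1 = matrix_inv p ** q"
  using gen_curve[OF gen_mult[OF gen_inv[OF p] q]] by auto
 show "\<exists>c. entire_curve c \<and> (\<forall>t. c t \<in> gen S) \<and> c 0 = p \<and> c 1 = q"
  by (intro exI[of _ "\<lambda>t. p ** c t"] conjI allI entire_curve_mult entire_curve_const gen_mult p c)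
   (simp_all add: c matrix_mul_assoc matrix_inv_mult[OF gen_invertible[OF p]])
qed

lemma Ad_gen_stable:
 assumes V: "mm.subspace V" and "\<And>X Y. X \<in> S ==> Y \<in> V ==> br X Y \<in> V" and g: "g \<in> gen S" and "Y \<in> V"
 shows "Ad g Y \<in> V"
 using g
proof (induction rule: gen.induct)
 case (step X g t)
 thus ?case
  using Ad_mexp_stable[OF V assms(2)[OF step(1)] step(3)]
  by (simp add: Ad_mult invertible_mexp gen_invertible[OF step(2)])
qed (use assms(4) in \<open>simp add: Ad_simps\<close>)

lemma mderiv_Ad_mexp: "mderiv (\<lambda>t. Ad (mexp X t) Y) (br X (Ad (mexp X t) Y)) t"
proof -
 have "mexp (- X) t ** X = X ** mexp (- X) t" by (rule mexp_commute) (simp add: matrix_ring_simps)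
 hence c: "A ** mexp (- X) t ** X = A ** X ** mexp (- X) t" for A by (simp add: matrix_mul_assoc[symmetric])
 show ?thesis
  using mderiv_mult[OF mderiv_mult[OF mderiv_mexp[of X t] mderiv_const[of Y]] mderiv_mexp[of "- X" t]]
  by (simp add: Ad_mexp br_def matrix_simps c)
qed

text \<open>Along each exponential the derivative of \<open>Ad (mexp X t) Z\<close> lies in
  \<open>W\<close>, so functionals vanishing on \<open>W\<close> are constant on the curve.\<close>

lemma Ad_gen_unipotent:
 assumes V: "mm.subspace V" and W: "mm.subspace W" "W \<subseteq> V"
  and S: "\<And>X Y. X \<in> S ==> Y \<in> V ==> br X Y \<in> W" and g: "g \<in> gen S" and Y: "Y \<in> V"
 shows "Ad g Y - Y \<in> W"
proof -
 have V': "br X Y \<in> V" if "X \<in> S" "Y \<in> V" for X Y using S[OF that] W(2) by auto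
 have *: "Ad (mexp X t) Z - Z \<in> W" if X: "X \<in> S" and Z: "Z \<in> V" for X Z t
 proof (rule ccontr)
  assume "Ad (mexp X t) Z - Z \<notin> W"
  then obtain F where F: "\<And>A. A \<in> W ==> trace (A ** F) = 0" "trace ((Ad (mexp X t) Z - Z) ** F) ~= 0"
   using csubspace_separation[OF W(1)] by metis
  have "((\<lambda>s. trace (Ad (mexp X s) Z ** F)) has_field_derivative 0) (at s)" for s
   using mderiv_trace[OF mderiv_Ad_mexp[of X Z s], of F]
   by (simp add: F(1)[OF S[OF X Ad_mexp_stable[OF V V'[OF X] Z]]])
  hence "\<exists>c. \<forall>s\<in>UNIV. trace (Ad (mexp X s) Z ** F) = c"
   by (intro has_field_derivative_zero_constant) auto
  then obtain c where c: "\<And>s. trace (Ad (mexp X s) Z ** F) = c" by auto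
  have "trace (Ad (mexp X t) Z ** F) = trace (Ad (mexp X 0) Z ** F)" by (simp only: c)
  thus False using F(2) by (simp add: matrix_ring_simps trace_sub Ad_simps)
 qed
 show ?thesis
  using g
 proof (induction rule: gen.induct)
  case one
  show ?case using mm.subspace_0[OF W(1)] by (simp add: Ad_simps)
 next
  case (step X g t)
  have "Ad g Y \<in> V" using mm.subspace_add[OF V subsetD[OF W(2) step(3)] Y] by simp
  from mm.subspace_add[OF W(1) *[OF step(1) this, of t] step(3)]
  show ?case by (simp add: Ad_mult invertible_mexp gen_invertible[OF step(2)])
 qed
qed

section \<open>Gradings\<close>

context g2_setting
begin

text \<open>The filtration by the degree \<open>p * fst c + q * snd c\<close>. The pair (1,1) gives
  the height, (1,0) the coefficient of \<alpha>, and the opposite signs the opposite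
  filtration.\<close>

definition gr :: "int => int => int => (complex^'n^'n) set" where
 "gr p q k = {X \<in> \<g>. \<forall>c\<in>wts. p * fst c + q * snd c < k --> pc c X = 0}"

lemma csub_gr: "mm.subspace (gr p q k)"
 unfolding mm.subspace_def gr_def
 by (auto simp: mm.subspace_0[OF csub_g] mm.subspace_add[OF csub_g] mm.subspace_scale[OF csub_g] pc_add pc_scale)

lemmas gr_0 = mm.subspace_0[OF csub_gr] and gr_add = mm.subspace_add[OF csub_gr]
 and gr_diff = mm.subspace_diff[OF csub_gr] and gr_scale = mm.subspace_scale[OF csub_gr]
 and gr_sum_mem = mm.subspace_sum[OF csub_gr]

lemma gr_g: "X \<in> gr p q k ==> X \<in> \<g>"
 by (simp add: gr_def)

lemma gr_mono: "k \<le> l ==> gr p q l \<subseteq> gr p q k"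
 by (auto simp: gr_def)

lemma gs_gr: "X \<in> gs c ==> k \<le> p * fst c + q * snd c ==> X \<in> gr p q k"
 by (auto simp: gr_def gs_g pc_gs)

lemma gr_sum: "X \<in> gr p q k ==> X = (\<Sum>c\<in>{c \<in> wts. k \<le> p * fst c + q * snd c}. pc c X)"
proof -
 assume X: "X \<in> gr p q k"
 have "X = (\<Sum>c\<in>wts. pc c X)" using sum_pc X by (simp add: gr_def)
 also have "\<dots> = (\<Sum>c\<in>{c \<in> wts. k \<le> p * fst c + q * snd c}. pc c X)"
  by (rule sum.mono_neutral_right) (use X in \<open>auto simp: gr_def\<close>)
 finally show ?thesis .
qed

lemma gr_induct:
 assumes X: "X \<in> gr p q k" and V: "mm.subspace V"
  and "\<And>c Y. c \<in> wts ==> k \<le> p * fst c + q * snd c ==> Y \<in> gs c ==> Y \<in> V"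
 shows "X \<in> V"
 by (subst gr_sum[OF X], rule mm.subspace_sum[OF V]) (use assms(3) pc_in_gs[OF gr_g[OF X]] in auto)

lemma csub_br_left: "mm.subspace V ==> mm.subspace {X. br X Y \<in> V}"
 and csub_br_right: "mm.subspace V ==> mm.subspace {X. br Y X \<in> V}"
 unfolding mm.subspace_def by (auto simp: br_simps)

lemma br_gr:
 assumes X: "X \<in> gr p q k" and Y: "Y \<in> gr p q l"
 shows "br X Y \<in> gr p q (k + l)"
proof -
 have "X \<in> {X. br X Y \<in> gr p q (k + l)}"
 proof (rule gr_induct[OF X csub_br_left[OF csub_gr]], rule CollectI)
  fix c X assume c: "k \<le> p * fst c + q * snd c" "X \<in> gs c"
  have "Y \<in> {Y. br X Y \<in> gr p q (k + l)}"
  proof (rule gr_induct[OF Y csub_br_right[OF csub_gr]], rule CollectI)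
   fix d Y assume d: "l \<le> p * fst d + q * snd d" "Y \<in> gs d"
   have "k + l \<le> p * fst (c + d) + q * snd (c + d)" using c(1) d(1) by (simp add: distrib_left)
   thus "br X Y \<in> gr p q (k + l)" by (rule gs_gr[OF br_gs[OF c(2) d(2)]])
  qed
  thus "br X Y \<in> gr p q (k + l)" by simp
 qed
 thus ?thesis by simp
qed

lemma gr_stable: "g \<in> gen (gr p q 0) ==> Y \<in> gr p q k ==> Ad g Y \<in> gr p q k"
 by (rule Ad_gen_stable[OF csub_gr _]) (use br_gr[of _ p q 0 _ k] in auto)

lemma gr_unipotent: "g \<in> gen (gr p q 1) ==> Y \<in> gr p q k ==> Ad g Y - Y \<in> gr p q (k + 1)"
 by (rule Ad_gen_unipotent[OF csub_gr csub_gr gr_mono _]) (use br_gr[of _ p q 1 _ k] in \<open>auto simp: add.commute\<close>)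

text \<open>The highest root 3\<alpha>+2\<beta> has height 5.\<close>

lemma gr_principal_zero: "s = 1 \<or> s = - 1 ==> X \<in> gr s s 6 ==> X = 0"
proof -
 assume s: "s = 1 \<or> s = - 1" and X: "X \<in> gr s s 6"
 have e: "{c \<in> wts. 6 \<le> s * fst c + s * snd c} = {}" using s by (auto simp: wts_eq)
 have "X = (\<Sum>c\<in>{c \<in> wts. 6 \<le> s * fst c + s * snd c}. pc c X)" by (rule gr_sum[OF X])
 also have "\<dots> = 0" unfolding e by simp
 finally show "X = 0" .
qed

definition h0 :: "complex^'n^'n" where
 "h0 = (SOME h. h \<in> gs (0, 0) \<and> ev (1,0) h = 1 \<and> ev (0,1) h = 1)"

lemma h0: "h0 \<in> gs (0, 0)" "ev c h0 = of_int (fst c + snd c)"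
proof -
 have "h0 \<in> gs (0, 0) \<and> ev (1,0) h0 = 1 \<and> ev (0,1) h0 = 1"
  unfolding h0_def by (rule someI_ex) (use ex_cartan[of 1 1] in blast)
 thus "h0 \<in> gs (0, 0)" "ev c h0 = of_int (fst c + snd c)" by (simp_all add: ev_def)
qed

lemma br_h0: "X \<in> gs c ==> br h0 X = of_int (fst c + snd c) \<cdot> X"
 using br_h[OF h0(1)] by (simp add: h0(2))

lemma br_h0_gr:
 assumes s: "s = 1 \<or> s = - 1" and X: "X \<in> gr s s k"
 shows "br h0 X - of_int (s * k) \<cdot> X \<in> gr s s (k + 1)"
proof -
 have "X \<in> {X. br h0 X - of_int (s * k) \<cdot> X \<in> gr s s (k + 1)}" (is "_ \<in> ?V")
 proof (rule gr_induct[OF X])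
  show "mm.subspace ?V"
   unfolding mm.subspace_def
  proof (intro conjI ballI allI; clarify?)
   fix x y assume "br h0 x - of_int (s * k) \<cdot> x \<in> gr s s (k + 1)" "br h0 y - of_int (s * k) \<cdot> y \<in> gr s s (k + 1)"
   from gr_add[OF this]
   show "br h0 (x + y) - of_int (s * k) \<cdot> (x + y) \<in> gr s s (k + 1)"
    by (simp only: br_simps mat_scale_simps(3) add_diff_add)
  next
   fix c x assume "br h0 x - of_int (s * k) \<cdot> x \<in> gr s s (k + 1)"
   from gr_scale[OF this, of c]
   show "br h0 (c \<cdot> x) - of_int (s * k) \<cdot> c \<cdot> x \<in> gr s s (k + 1)"
    by (simp only: br_simps mat_scale_simps(4) mm.scale_left_commute[of c])
  qed (simp add: br_simps gr_0)
  fix c Y assume c: "k \<le> s * fst c + s * snd c" and Y: "Y \<in> gs c"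
  have e: "br h0 Y - of_int (s * k) \<cdot> Y = of_int (fst c + snd c - s * k) \<cdot> Y"
   by (simp only: br_h0[OF Y] of_int_diff mat_scale_simps(8))
  show "Y \<in> ?V"
  proof (cases "fst c + snd c = s * k")
   case True
   thus ?thesis by (simp only: mem_Collect_eq e) (simp add: mat_scale_simps(11) gr_0)
  next
   case False
   hence "k + 1 \<le> s * fst c + s * snd c" using c s by auto
   thus ?thesis unfolding mem_Collect_eq e by (intro gr_scale gs_gr[OF Y])
  qed
 qed
 thus ?thesis by simp
qed

text \<open>The deviation from \<open>h0\<close> is removed one height at a time, since the bracket
  with \<open>h0\<close> is invertible in every nonzero height; nothing is left in height 6.\<close>

lemma conjugate_to_h0:
 assumes s: "s = 1 \<or> s = - 1" and X: "X - h0 \<in> gr s s 1"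
 shows "\<exists>u\<in>gen (gr s s 1). Ad u X = h0"
proof -
 have "\<exists>u\<in>gen (gr s s 1). Ad u X - h0 \<in> gr s s (int (Suc m))" for m
 proof (induction m)
  case 0
  show ?case by (rule bexI[OF _ gen.one]) (use X in \<open>simp add: Ad_simps\<close>)
 next
  case (Suc m)
  let ?k = "int (Suc m)"
  obtain u where u: "u \<in> gen (gr s s 1)" and n: "Ad u X - h0 \<in> gr s s ?k" using Suc by auto
  define n where "n = Ad u X - h0"
  \<comment> \<open>On the leading part of \<open>n\<close> the bracket with \<open>h0\<close> is
    multiplication by \<open>s * ?k\<close>, so \<open>br Y h0\<close> is \<open>- n\<close> up to
    higher terms and cancels the deviation.\<close>
  define Y where "Y = (1 / of_int (s * ?k)) \<cdot> n"
  have nk: "n \<in> gr s s ?k" using n by (simp add: n_def)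
  have Yk: "Y \<in> gr s s ?k" unfolding Y_def by (rule gr_scale[OF nk])
  hence Y1: "Y \<in> gr s s 1" using gr_mono[of 1 ?k] by auto
  have h0gr: "h0 \<in> gr s s 0" by (rule gs_gr[OF h0(1)]) simp
  have Z: "Ad u X \<in> gr s s 0"
   using gr_add[OF h0gr subsetD[OF gr_mono[of 0 ?k] nk]] by (simp add: n_def)
  have iter: "(br Y ^^ j) (Ad u X) \<in> gr s s (int j * ?k)" for j
  proof (induction j)
   case (Suc j)
   thus ?case using br_gr[OF Yk Suc] by (simp add: algebra_simps)
  qed (use Z in simp)
  have "(br Y ^^ 6) (Ad u X) \<in> gr s s 6" using iter[of 6] gr_mono[of 6 "int 6 * ?k"] by auto
  hence "(br Y ^^ Suc (Suc 4)) (Ad u X) = 0" using gr_principal_zero[OF s] by (simp add: numeral_eq_Suc)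
  from Ad_mexp_finite[OF this, of 1]
  have Ad: "Ad (mexp Y 1) (Ad u X) =
    Ad u X + br Y (Ad u X) + (\<Sum>j<4. (1 / fact (Suc (Suc j))) \<cdot> (br Y ^^ Suc (Suc j)) (Ad u X))"
   by (simp only: sum.lessThan_Suc_shift) (simp add: mat_scale_simps(10) add.assoc)
  have rest: "(\<Sum>j<4. (1 / fact (Suc (Suc j))) \<cdot> (br Y ^^ Suc (Suc j)) (Ad u X)) \<in> gr s s (?k + 1)"
  proof (intro gr_sum_mem gr_scale)
   fix j
   have "?k + 1 \<le> int (Suc (Suc j)) * ?k" by (simp add: algebra_simps)
   thus "(br Y ^^ Suc (Suc j)) (Ad u X) \<in> gr s s (?k + 1)" using iter[of "Suc (Suc j)"] gr_mono by blast
  qed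
  have Yn: "br Y n \<in> gr s s (?k + 1)"
   by (rule subsetD[OF gr_mono br_gr[OF Yk nk]]) simp
  have "br Y h0 = - ((1 / of_int (s * ?k)) \<cdot> br h0 n)" using br_anti[of Y h0] by (simp add: Y_def br_simps)
  moreover have "(1 / of_int (s * ?k)) \<cdot> (br h0 n - of_int (s * ?k) \<cdot> n) \<in> gr s s (?k + 1)"
   by (rule gr_scale[OF br_h0_gr[OF s nk]])
  moreover have "(1 / of_int (s * ?k)) \<cdot> of_int (s * ?k) \<cdot> n = n"
   using s by (auto simp: mat_scale_simps(6,10))
  ultimately have "- (br Y h0) - n \<in> gr s s (?k + 1)" by (simp add: mat_scale_simps(4))
  from gr_diff[OF gr_add[OF Yn rest] this]
  have "Ad (mexp Y 1) (Ad u X) - h0 \<in> gr s s (?k + 1)"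
   unfolding Ad by (simp add: n_def br_simps algebra_simps)
  moreover have "mexp Y 1 ** u \<in> gen (gr s s 1)" by (rule gen.step[OF Y1 u])
  moreover have "Ad (mexp Y 1 ** u) X = Ad (mexp Y 1) (Ad u X)"
   by (simp add: Ad_mult invertible_mexp gen_invertible[OF u])
  ultimately show ?case by (intro bexI[of _ "mexp Y 1 ** u"]) (simp_all add: add.commute)
 qed
 from this[of 5] obtain u where u: "u \<in> gen (gr s s 1)" "Ad u X - h0 \<in> gr s s 6" by auto
 thus ?thesis using gr_principal_zero[OF s u(2)] by (intro bexI[of _ u]) simp_all
qed

lemma generators:
 assumes V: "mm.subspace V" and br: "\<And>X Y. X \<in> V ==> Y \<in> V ==> br X Y \<in> V"
  and g: "gs (0,0) \<subseteq> V" "gs (1,0) \<subseteq> V" "gs (0,1) \<subseteq> V" "gs (-1,0) \<subseteq> V" "gs (0,-1) \<subseteq> V"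
 shows "\<g> \<subseteq> V"
proof -
 have up: "gs e \<subseteq> V" if r: "c \<in> rts" "d \<in> rts" "c + d = e" "e \<in> rts" and s: "gs c \<subseteq> V" "gs d \<subseteq> V" for c d e
 proof
  fix X assume X: "X \<in> gs e"
  let ?e = "br (ee c) (ee d)"
  have "?e \<in> gs e" using br_gs[OF ee(1)[OF r(1)] ee(1)[OF r(2)]] r(3) by simp
  moreover have "?e ~= 0" using root_string[OF r(1,2) _ ee[OF r(1)] ee[OF r(2)]] r(3,4) by simp
  ultimately obtain k where "X = k \<cdot> ?e" using gs_1dim[OF r(4) _ _ X] by blast
  moreover have "?e \<in> V" using br s ee(1)[OF r(1)] ee(1)[OF r(2)] by blast
  ultimately show "X \<in> V" by (simp add: mm.subspace_scale[OF V])
 qed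
 have 1: "gs (1,1) \<subseteq> V" by (rule up[of "(1,0)" "(0,1)"]) (simp_all add: rts_def g)
 have 2: "gs (2,1) \<subseteq> V" by (rule up[of "(1,0)" "(1,1)"]) (simp_all add: rts_def g 1)
 have 3: "gs (3,1) \<subseteq> V" by (rule up[of "(1,0)" "(2,1)"]) (simp_all add: rts_def g 2)
 have 4: "gs (3,2) \<subseteq> V" by (rule up[of "(0,1)" "(3,1)"]) (simp_all add: rts_def g 3)
 have 5: "gs (-1,-1) \<subseteq> V" by (rule up[of "(-1,0)" "(0,-1)"]) (simp_all add: rts_def g)
 have 6: "gs (-2,-1) \<subseteq> V" by (rule up[of "(-1,0)" "(-1,-1)"]) (simp_all add: rts_def g 5)
 have 7: "gs (-3,-1) \<subseteq> V" by (rule up[of "(-1,0)" "(-2,-1)"]) (simp_all add: rts_def g 6)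
 have 8: "gs (-3,-2) \<subseteq> V" by (rule up[of "(0,-1)" "(-3,-1)"]) (simp_all add: rts_def g 7)
 show ?thesis
 proof
  fix X assume X: "X \<in> \<g>"
  have "pc c X \<in> V" if "c \<in> wts" for c
   using that pc_in_gs[OF X, of c] g 1 2 3 4 5 6 7 8 unfolding wts_eq by auto
  hence "(\<Sum>c\<in>wts. pc c X) \<in> V" by (intro mm.subspace_sum[OF V])
  thus "X \<in> V" by (simp add: sum_pc[OF X])
 qed
qed

text \<open>The kernel of the adjoint representation on \<open>\<g>\<close>. It will turn out to be
  finite and contained in \<open>T\<close>.\<close>

definition Z1 :: "(complex^'n^'n) set" where
 "Z1 = {z \<in> G. \<forall>Y\<in>\<g>. Ad z Y = Y}"

lemma Ad_mexp_h:
 assumes h: "h \<in> gs (0, 0)" and X: "X \<in> gs c"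
 shows "Ad (mexp h t) X = exp (ev c h * t) \<cdot> X"
proof -
 have "mderiv (\<lambda>t. exp (- ev c h * t) \<cdot> Ad (mexp h t) X) 0 t" for t
 proof -
  have "Ad (mexp h t) X \<in> gs c"
   by (rule Ad_mexp_stable[OF csub_gs _ X]) (simp add: br_h[OF h] mm.subspace_scale[OF csub_gs])
  hence e: "br h (Ad (mexp h t) X) = ev c h \<cdot> Ad (mexp h t) X" by (rule br_h[OF h])
  have "((\<lambda>t. exp (- ev c h * t)) has_field_derivative - ev c h * exp (- ev c h * t)) (at t)"
   by (auto intro!: derivative_eq_intros)
  thus ?thesis
   using mderiv_Ad_mexp[of h X t] unfolding mderiv_def e
   by (auto intro!: derivative_eq_intros)
 qed
 from mderiv_zero_const[OF this, of t] have "exp (- ev c h * t) \<cdot> Ad (mexp h t) X = X" by (simp add: Ad_simps)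
 hence "exp (ev c h * t) \<cdot> exp (- ev c h * t) \<cdot> Ad (mexp h t) X = exp (ev c h * t) \<cdot> X" by simp
 thus ?thesis by (simp add: mat_scale_simps(6) exp_minus_inverse)
qed

lemma cartan_centralizer_scalar:
 assumes g: "g \<in> G" and fix_h: "\<And>h. h \<in> gs (0, 0) ==> Ad g h = h" and c: "c \<in> wts" and X: "X \<in> gs c"
 shows "Ad g X \<in> gs c"
proof -
 \<comment> \<open>The values 1 and 10 make the numbers \<open>fst c + 10 * snd c\<close> pairwise
   distinct on \<open>wts\<close>, so the eigenvalue of \<open>h\<close> alone identifies a
   weight.\<close>
 obtain h where h: "h \<in> gs (0, 0)" "ev (1,0) h = 1" "ev (0,1) h = 10" using ex_cartan by blast
 have Y: "Ad g X \<in> \<g>" by (rule Ad_g[OF g gs_g[OF X]])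
 have "br h (Ad g X) = Ad g (br h X)" using fix_h[OF h(1)] by (simp add: Ad_br[OF G_group(1)[OF g]])
 also have "\<dots> = ev c h \<cdot> Ad g X" by (simp only: br_h[OF h(1) X] Ad_simps)
 finally have e: "br h (Ad g X) = ev c h \<cdot> Ad g X" .
 have "pc d (Ad g X) = 0" if d: "d \<in> wts" "d ~= c" for d
 proof -
  have "pc d (br h (Ad g X)) = ev d h \<cdot> pc d (Ad g X)"
  proof -
   have "pc d (br h (Ad g X)) = pc d (\<Sum>e\<in>wts. ev e h \<cdot> pc e (Ad g X))"
    by (subst sum_pc[OF Y, symmetric]) (simp add: br_sum_right br_h[OF h(1) pc_in_gs[OF Y]])
   also have "\<dots> = (\<Sum>e\<in>wts. pc d (ev e h \<cdot> pc e (Ad g X)))"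
    by (rule pc_sum)
   also have "\<dots> = (\<Sum>e\<in>wts. if d = e then ev d h \<cdot> pc d (Ad g X) else 0)"
    by (rule sum.cong) (auto simp: pc_scale pc_gs[OF pc_in_gs[OF Y]])
   also have "\<dots> = ev d h \<cdot> pc d (Ad g X)" using d by simp
   finally show ?thesis .
  qed
  hence "(ev d h - ev c h) \<cdot> pc d (Ad g X) = 0" unfolding e by (auto simp add: pc_scale mat_scale_simps(8))
  moreover have "ev d h ~= ev c h"
  proof
   have "ev f h = of_int (fst f + 10 * snd f)" for f using h(2,3) by (simp add: ev_def)
   moreover assume "ev d h = ev c h"
   ultimately have "fst d + 10 * snd d = fst c + 10 * snd c" using of_int_eq_iff by metis
   thus False using d c unfolding wts_eq by auto
  qed
  ultimately show ?thesis by simp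
 qed
 hence "(\<Sum>d\<in>wts. pc d (Ad g X)) = (\<Sum>d\<in>wts. if d = c then pc c (Ad g X) else 0)" by (intro sum.cong) auto
 hence "Ad g X = pc c (Ad g X)" using c by (simp add: sum_pc[OF Y])
 thus ?thesis using pc_in_gs[OF Y] by metis
qed

text \<open>The zero weight and the roots (1,1) and (2,1) are determined by their heights, so
  \<open>g\<close> preserves their spaces. These two roots span all roots, hence \<open>g\<close>
  fixes the Cartan subalgebra pointwise and scales the root vectors. An exponential from the torus
  undoes the scaling of the simple ones.\<close>

lemma fixes_h0:
 assumes g: "g \<in> G" and 0: "Ad g h0 = h0"
 shows "\<exists>h\<in>gs (0, 0). \<exists>z\<in>Z1. g = mexp h 1 ** z"
proof -
 note gi = G_group(1)[OF g]
 have eig: "Ad g X \<in> gs c"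
  if c: "c \<in> wts" "\<And>d. d \<in> wts ==> fst d + snd d = fst c + snd c ==> d = c" and X: "X \<in> gs c" for c X
 proof -
  have Y: "Ad g X \<in> \<g>" by (rule Ad_g[OF g gs_g[OF X]])
  have "br h0 (Ad g X) = Ad g (br h0 X)" by (simp add: Ad_br[OF gi] 0)
  hence e: "br h0 (Ad g X) = of_int (fst c + snd c) \<cdot> Ad g X" by (simp only: br_h0[OF X] Ad_simps)
  have "pc d (Ad g X) = 0" if d: "d \<in> wts" "d ~= c" for d
  proof -
   have "(\<Sum>e\<in>wts. of_int (fst e + snd e - (fst c + snd c)) \<cdot> pc e (Ad g X)) = br h0 (Ad g X) - of_int (fst c + snd c) \<cdot> Ad g X"
   proof -
    have "br h0 (Ad g X) = (\<Sum>e\<in>wts. of_int (fst e + snd e) \<cdot> pc e (Ad g X))"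
     by (subst sum_pc[OF Y, symmetric]) (simp add: br_sum_right br_h0[OF pc_in_gs[OF Y]])
    moreover have "of_int (fst c + snd c) \<cdot> Ad g X = (\<Sum>e\<in>wts. of_int (fst c + snd c) \<cdot> pc e (Ad g X))"
     by (subst sum_pc[OF Y, symmetric]) (rule mat_scale_sum)
    ultimately show ?thesis by (simp only: sum_subtractf[symmetric] of_int_diff mat_scale_simps(8))
   qed
   hence s: "(\<Sum>e\<in>wts. of_int (fst e + snd e - (fst c + snd c)) \<cdot> pc e (Ad g X)) = 0" by (simp add: e)
   have "pc d 0 = (\<Sum>e\<in>wts. pc d (of_int (fst e + snd e - (fst c + snd c)) \<cdot> pc e (Ad g X)))"
    unfolding s[symmetric] by (rule pc_sum)
   also have "\<dots> = (\<Sum>e\<in>wts. if d = e then of_int (fst d + snd d - (fst c + snd c)) \<cdot> pc d (Ad g X) else 0)"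
    by (rule sum.cong) (auto simp: pc_scale pc_gs[OF pc_in_gs[OF Y]] simp del: of_int_diff)
   finally have "of_int (fst d + snd d - (fst c + snd c)) \<cdot> pc d (Ad g X) = 0" using d by simp
   thus ?thesis using c(2)[OF d(1)] d(2) by (auto simp: of_int_eq_0_iff simp del: of_int_diff)
  qed
  hence "(\<Sum>d\<in>wts. pc d (Ad g X)) = (\<Sum>d\<in>wts. if d = c then pc c (Ad g X) else 0)" by (intro sum.cong) auto
  hence "Ad g X = pc c (Ad g X)" using c(1) by (simp add: sum_pc[OF Y])
  thus ?thesis using pc_in_gs[OF Y] by metis
 qed
 have fix_h: "Ad g h = h" if h: "h \<in> gs (0, 0)" for h
 proof -
  have gh: "Ad g h \<in> gs (0, 0)" by (rule eig[OF _ _ h]) (auto simp: wts_eq)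
  have e: "ev c (Ad g h) = ev c h" if c: "c \<in> rts" "\<And>d. d \<in> wts ==> fst d + snd d = fst c + snd c ==> d = c" for c
  proof -
   have ge: "Ad g (ee c) \<in> gs c" by (rule eig[OF rts_wts(1)[OF c(1)] c(2) ee(1)[OF c(1)]])
   have "ev c (Ad g h) \<cdot> Ad g (ee c) = br (Ad g h) (Ad g (ee c))" by (rule br_h[OF gh ge, symmetric])
   also have "\<dots> = ev c h \<cdot> Ad g (ee c)" by (simp only: Ad_br[OF gi, symmetric] br_h[OF h ee(1)[OF c(1)]] Ad_simps)
   finally show ?thesis using ee(2)[OF c(1)] by (simp add: Ad_eq_0_iff[OF gi])
  qed
  have 2: "ev (1,1) (Ad g h) = ev (1,1) h" by (rule e) (auto simp: wts_eq rts_def)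
  have 3: "ev (2,1) (Ad g h) = ev (2,1) h" by (rule e) (auto simp: wts_eq rts_def)
  have "ev (1,0) (Ad g h) = ev (1,0) h" "ev (0,1) (Ad g h) = ev (0,1) h"
  proof -
   have "ev (1,0) k = ev (2,1) k - ev (1,1) k" "ev (0,1) k = 2 * ev (1,1) k - ev (2,1) k" for k
    by (simp_all add: ev_def algebra_simps)
   thus "ev (1,0) (Ad g h) = ev (1,0) h" "ev (0,1) (Ad g h) = ev (0,1) h" by (simp_all only: 2 3)
  qed
  moreover have d: "ev c (Ad g h - h) = ev c (Ad g h) - ev c h" for c
   using ev_linear(1)[OF gh mm.subspace_neg[OF csub_gs h], of c] ev_linear(2)[OF h h, of c "-1"]
   by (simp add: mat_scale_simps)
  ultimately have "Ad g h - h = 0" by (intro cartan_zero mm.subspace_diff[OF csub_gs gh h]) simp_all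
  thus ?thesis by simp
 qed
 have r: "(1,0) \<in> rts" "(0,1) \<in> rts" "(-1,0) \<in> rts" "(0,-1) \<in> rts" by (simp_all add: rts_def)
 have sc: "\<exists>k. k ~= 0 \<and> Ad g (ee c) = k \<cdot> ee c" if c: "c \<in> rts" for c
 proof -
  obtain k where k: "Ad g (ee c) = k \<cdot> ee c"
   using gs_1dim[OF c ee[OF c] cartan_centralizer_scalar[OF g fix_h rts_wts(1)[OF c] ee(1)[OF c]]] by blast
  have "Ad g (ee c) ~= 0" using ee(2)[OF c] by (simp add: Ad_eq_0_iff[OF gi])
  hence "k ~= 0" using k by auto
  thus ?thesis using k by blast
 qed
 obtain x y where x: "x ~= 0" "Ad g (ee (1,0)) = x \<cdot> ee (1,0)" and y: "y ~= 0" "Ad g (ee (0,1)) = y \<cdot> ee (0,1)"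
  using sc[OF r(1)] sc[OF r(2)] by blast
 obtain h where h: "h \<in> gs (0, 0)" "ev (1,0) h = Ln x" "ev (0,1) h = Ln y" using ex_cartan by blast
 define z where "z = mexp (- h) 1 ** g"
 have hn: "- h \<in> gs (0, 0)" by (rule mm.subspace_neg[OF csub_gs h(1)])
 have evn: "ev c (- h) = - ev c h" for c using ev_linear(2)[OF h(1) h(1), of c "-1"] by (simp add: mat_scale_simps)
 have zG: "z \<in> G" unfolding z_def by (intro G_group(3) mexp_G gs_g[OF hn] g)
 note zi = G_group(1)[OF zG]
 have Adz: "Ad z X = Ad (mexp (- h) 1) (Ad g X)" for X by (simp add: z_def Ad_mult invertible_mexp gi)
 have z0: "Ad z k = k" if "k \<in> gs (0, 0)" for k
  using Ad_mexp_h[OF hn that, of 1] by (simp add: Adz fix_h[OF that] ev_0 mat_scale_simps)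
 have za: "Ad z (ee (1,0)) = ee (1,0)"
  unfolding Adz x(2) Ad_simps Ad_mexp_h[OF hn ee(1)[OF r(1)]] evn h(2)
  using x(1) by (simp add: mat_scale_simps(6,10) exp_minus)
 have zb: "Ad z (ee (0,1)) = ee (0,1)"
  unfolding Adz y(2) Ad_simps Ad_mexp_h[OF hn ee(1)[OF r(2)]] evn h(3)
  using y(1) by (simp add: mat_scale_simps(6,10) exp_minus)
 \<comment> \<open>The trace pairing of opposite root vectors is preserved, so fixing one of them
   fixes the other.\<close>
 have neg: "Ad z (ee (- c)) = ee (- c)" if c: "c \<in> rts" and fc: "Ad z (ee c) = ee c" for c
 proof -
  note c' = rts_wts(4)[OF c]
  obtain k where k: "Ad z (ee (- c)) = k \<cdot> ee (- c)"
   using gs_1dim[OF c' ee[OF c'] cartan_centralizer_scalar[OF zG z0 rts_wts(1)[OF c'] ee(1)[OF c']]] by blast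
  have "trace (ee c ** ee (- c)) = trace (Ad z (ee c) ** Ad z (ee (- c)))" by (rule trace_Ad_Ad[OF zi, symmetric])
  hence "k = 1" using trace_ee[OF c] by (simp add: fc k mat_scale_simps(2))
  thus ?thesis using k by (simp add: mat_scale_simps)
 qed
 have all: "gs c \<subseteq> {X. Ad z X = X}" if c: "c \<in> rts" "Ad z (ee c) = ee c" for c
 proof
  fix X assume "X \<in> gs c"
  then obtain k where "X = k \<cdot> ee c" using gs_1dim[OF c(1) ee[OF c(1)]] by blast
  thus "X \<in> {X. Ad z X = X}" by (simp add: Ad_simps c(2))
 qed
 have "\<g> \<subseteq> {X. Ad z X = X}"
 proof (rule generators)
  show "mm.subspace {X. Ad z X = X}" unfolding mm.subspace_def by (simp add: Ad_simps)
  show "gs (1,0) \<subseteq> {X. Ad z X = X}" by (rule all[OF r(1) za])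
  show "gs (0,1) \<subseteq> {X. Ad z X = X}" by (rule all[OF r(2) zb])
  show "gs (-1,0) \<subseteq> {X. Ad z X = X}" using all[OF r(3)] neg[OF r(1) za] by simp
  show "gs (0,-1) \<subseteq> {X. Ad z X = X}" using all[OF r(4)] neg[OF r(2) zb] by simp
 qed (use z0 in \<open>auto simp: Ad_br[OF zi]\<close>)
 hence "z \<in> Z1" using zG by (auto simp: Z1_def)
 moreover have "g = mexp h 1 ** z" by (simp add: z_def matrix_mul_assoc mexp_inverse)
 ultimately show ?thesis using h(1) by blast
qed

end

section \<open>Groups with trivial Lie algebra are finite\<close>

lemma trace_unit:
 fixes X :: "complex^'n^'n"
 shows "trace ((\<chi> a b. if a = j then if b = i then 1 else 0 else 0) ** X) = X $ i $ j"
proof -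
 have "(\<Sum>k\<in>UNIV. (if a = j then if k = i then 1 else 0 else 0) * X $ k $ a) = (if a = j then X $ i $ a else 0)" for a
  by (cases "a = j") (simp_all add: if_distrib[of "\<lambda>x. x * _"] cong: if_cong)
 thus ?thesis by (simp add: trace_def matrix_matrix_mult_def)
qed

text \<open>A first-order expansion without remainder: the coefficient matrix \<open>D A\<close> is
  itself polynomial in \<open>A\<close>. Equations of a group thus become linear in
  \<open>A - 1\<close> with polynomial coefficients.\<close>

lemma poly_fun_taylor:
 fixes f :: "complex^'n^'n => complex"
 assumes "f \<in> poly_fun"
 shows "\<exists>D. (\<forall>i j. (\<lambda>A. D A $ i $ j) \<in> poly_fun) \<and> (\<forall>A. f A = f (mat 1) + trace (D A ** (A - mat 1)))"
 using assms
proof induction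
 case (const c)
 show ?case by (rule exI[of _ "\<lambda>A. 0"]) (simp add: poly_fun.const matrix_ring_simps)
next
 case (coord i j)
 show ?case
  by (rule exI[of _ "\<lambda>A. \<chi> a b. if a = j then if b = i then 1 else 0 else 0"]) (simp only: trace_unit, simp add: poly_fun.const)
next
 case (add f g)
 then obtain D E where D: "\<forall>i j. (\<lambda>A. D A $ i $ j) \<in> poly_fun" "\<forall>A. f A = f (mat 1) + trace (D A ** (A - mat 1))"
  and E: "\<forall>i j. (\<lambda>A. E A $ i $ j) \<in> poly_fun" "\<forall>A. g A = g (mat 1) + trace (E A ** (A - mat 1))" by (elim exE conjE)
 show ?case
 proof (intro exI[of _ "\<lambda>A. D A + E A"] conjI allI)
  show "f A + g A = f (mat 1) + g (mat 1) + trace ((D A + E A) ** (A - mat 1))" for A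
   unfolding matrix_ring_simps(8) trace_add using D(2)[rule_format, of A] E(2)[rule_format, of A] by simp
 qed (simp add: poly_fun.add D(1) E(1))
next
 case (mult f g)
 then obtain D E where D: "\<forall>i j. (\<lambda>A. D A $ i $ j) \<in> poly_fun" "\<forall>A. f A = f (mat 1) + trace (D A ** (A - mat 1))"
  and E: "\<forall>i j. (\<lambda>A. E A $ i $ j) \<in> poly_fun" "\<forall>A. g A = g (mat 1) + trace (E A ** (A - mat 1))" by (elim exE conjE)
 show ?case
 proof (intro exI[of _ "\<lambda>A. g A \<cdot> D A + f (mat 1) \<cdot> E A"] conjI allI)
  fix A
  have "f A * g A = f (mat 1) * g A + trace (D A ** (A - mat 1)) * g A"
   using D(2)[rule_format, of A] by (simp add: distrib_right[symmetric])
  also have "f (mat 1) * g A = f (mat 1) * g (mat 1) + f (mat 1) * trace (E A ** (A - mat 1))"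
   using E(2)[rule_format, of A] by (simp add: distrib_left[symmetric])
  finally show "f A * g A = f (mat 1) * g (mat 1) + trace ((g A \<cdot> D A + f (mat 1) \<cdot> E A) ** (A - mat 1))"
   by (simp add: matrix_ring_simps(8) mat_scale_simps(1) trace_add mult.commute[of "g A"])
 qed (simp add: poly_fun.intros mult.hyps D(1) E(1))
qed

text \<open>The determinant is that of \<open>L\<close> in the basis of matrix units, whose indices
  are pairs.\<close>

lemma det_operator:
 fixes L :: "complex^'n^'n => complex^'n^'n"
 assumes add: "\<And>X Y. L (X + Y) = L X + L Y" and scale: "\<And>c X. L (c \<cdot> X) = c \<cdot> L X"
  and nz: "det (\<chi> r s. L (\<chi> i j. if (i, j) = s then 1 else 0) $ fst r $ snd r :: complex^('n \<times> 'n)^('n \<times> 'n)) ~= 0"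
 shows "L X = 0 ==> X = 0" "\<exists>X. L X = Y"
proof -
 define M where "M = (\<chi> r s. L (\<chi> i j. if (i, j) = s then 1 else 0) $ fst r $ snd r :: complex^('n \<times> 'n)^('n \<times> 'n))"
 define E :: "'n \<times> 'n => complex^'n^'n" where "E s = (\<chi> i j. if (i, j) = s then 1 else 0)" for s
 define vec :: "complex^'n^'n => complex^('n \<times> 'n)" where "vec X = (\<chi> r. X $ fst r $ snd r)" for X
 have L0: "L 0 = 0" using scale[of 0 0] by simp
 have L_sum: "L (\<Sum>s\<in>I. f s) = (\<Sum>s\<in>I. L (f s))" if "finite I" for I :: "('n \<times> 'n) set" and f
  using that by induction (simp_all add: L0 add)
 have X: "X = (\<Sum>s\<in>UNIV. X $ fst s $ snd s \<cdot> E s)" for X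
 proof -
  have "(\<Sum>s\<in>UNIV. X $ fst s $ snd s \<cdot> E s) $ i $ j = (\<Sum>s\<in>UNIV. if s = (i, j) then X $ i $ j else 0)" for i j
   unfolding sum_component by (rule sum.cong) (auto simp: E_def)
  thus ?thesis by (simp add: vec_eq_iff)
 qed
 have M: "M *v vec X = vec (L X)" for X
 proof -
  have "L X = (\<Sum>s\<in>UNIV. X $ fst s $ snd s \<cdot> L (E s))"
   by (subst X) (simp only: L_sum finite scale)
  hence "L X $ fst r $ snd r = (M *v vec X) $ r" for r
   by (simp add: M_def vec_def matrix_vector_mult_def E_def[symmetric] mult.commute)
  thus ?thesis by (simp add: vec_eq_iff vec_def)
 qed
 have vec_inj: "vec X = vec Y ==> X = Y" for X Y
  unfolding vec_eq_iff vec_def by (simp add: split_paired_all)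
 have inv: "invertible M" using nz by (simp add: M_def invertible_det_nz)
 have "vec 0 = 0" by (simp add: vec_eq_iff vec_def)
 show "X = 0" if "L X = 0"
 proof (rule vec_inj)
  have "matrix_inv M *v (M *v vec X) = matrix_inv M *v vec 0" by (simp only: M that)
  thus "vec X = vec 0"
   by (simp add: matrix_vector_mul_assoc matrix_inv_mult(1)[OF inv] \<open>vec 0 = 0\<close>)
 qed
 show "\<exists>X. L X = Y"
 proof (intro exI vec_inj)
  define x where "x = matrix_inv M *v vec Y"
  have "vec (\<chi> i j. x $ (i, j)) = x" by (simp add: vec_eq_iff vec_def)
  thus "vec (L (\<chi> i j. x $ (i, j))) = vec Y"
   unfolding M[symmetric] by (simp add: x_def matrix_vector_mul_assoc matrix_inv_mult(2)[OF inv])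
 qed
qed

text \<open>A vanishing tangent space makes the equations of the group, written as a linear system for
 the entries of \<open>A - 1\<close>, invertible at the identity; \<open>q\<close> is the determinant of this system.\<close>

lemma isolated_identity:
 fixes Z :: "(complex^'n^'n) set"
 assumes Z: "mat 1 \<in> Z" and lie: "lie_algebra Z \<subseteq> {0}"
 shows "\<exists>q\<in>poly_fun. q (mat 1) = 1 \<and> (\<forall>A\<in>Z. A ~= mat 1 --> q A = 0)"
proof -
 define I :: "(complex^'n^'n => complex^'n^'n) set" where
  "I = {D. (\<forall>i j. (\<lambda>A. D A $ i $ j) \<in> poly_fun) \<and> (\<forall>A\<in>Z. trace (D A ** (A - mat 1)) = 0)}"
 define W where "W = (\<lambda>D. D (mat 1)) ` I"
 have tr: "(\<lambda>A. trace (D A ** F)) \<in> poly_fun" if "D \<in> I" for D F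
  unfolding trace_def matrix_matrix_mult_def
  by (simp, intro poly_fun_sum poly_fun.mult poly_fun.const) (use that in \<open>simp add: I_def\<close>)
 have W: "mm.subspace W"
  unfolding mm.subspace_def
 proof (intro conjI ballI allI)
  show "0 \<in> W" unfolding W_def by (rule image_eqI[of _ _ "\<lambda>A. 0"]) (simp_all add: I_def poly_fun.const matrix_ring_simps)
  fix x y assume "x \<in> W" "y \<in> W"
  then obtain D E where "D \<in> I" "x = D (mat 1)" "E \<in> I" "y = E (mat 1)" unfolding W_def by blast
  thus "x + y \<in> W" unfolding W_def
   by (intro image_eqI[of _ _ "\<lambda>A. D A + E A"]) (simp_all add: I_def poly_fun.add matrix_ring_simps(8) trace_add)
 next
  fix c x assume "x \<in> W"
  then obtain D where "D \<in> I" "x = D (mat 1)" unfolding W_def by blast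
  thus "c \<cdot> x \<in> W" unfolding W_def
   by (intro image_eqI[of _ _ "\<lambda>A. c \<cdot> D A"]) (simp_all add: I_def poly_fun.intros mat_scale_simps(1))
 qed
 \<comment> \<open>A matrix outside \<open>W\<close> would be separated from \<open>W\<close> by a
   trace functional, and the matrix \<open>F\<close> of this functional would be a nonzero tangent
   vector at the identity.\<close>
 have WY: "Y \<in> W" for Y
 proof (rule ccontr)
  assume "Y \<notin> W"
  then obtain F where F: "\<And>A. A \<in> W ==> trace (A ** F) = 0" "trace (Y ** F) ~= 0"
   using csubspace_separation[OF W] by auto
  have "F \<in> lie_algebra Z"
   unfolding lie_algebra_def
  proof (intro CollectI ballI impI)
   fix f assume f: "f \<in> poly_fun" "\<forall>g\<in>Z. f g = 0"
   obtain D where D: "\<forall>i j. (\<lambda>A. D A $ i $ j) \<in> poly_fun" "\<forall>A. f A = f (mat 1) + trace (D A ** (A - mat 1))"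
    using poly_fun_taylor[OF f(1)] by (elim exE conjE)
   have "trace (D A ** (A - mat 1)) = 0" if "A \<in> Z" for A
    using D(2)[rule_format, of A] f(2) Z that by simp
   hence DI: "D \<in> I" using D(1) by (simp add: I_def)
   have "entire_curve (\<lambda>z. mat 1 + z \<cdot> F)" unfolding entire_curve_def by (auto intro!: holomorphic_intros)
   from entire_curve_poly_fun[OF this tr[OF DI]]
   obtain h where h: "((\<lambda>z. trace (D (mat 1 + z \<cdot> F) ** F)) has_field_derivative h) (at 0)"
    by (auto simp: holomorphic_on_def field_differentiable_def)
   have "trace (D (mat 1) ** F) = 0" using F(1) DI by (simp add: W_def)
   hence "((\<lambda>z. f (mat 1) + z * trace (D (mat 1 + z \<cdot> F) ** F)) has_field_derivative 0) (at 0)"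
    by (auto intro!: derivative_eq_intros h)
   moreover have "f (mat 1 + z \<cdot> F) = f (mat 1) + z * trace (D (mat 1 + z \<cdot> F) ** F)" for z
    by (subst D(2)[rule_format]) (simp add: mat_scale_simps(2))
   ultimately show "((\<lambda>z. f (mat 1 + z \<cdot> F)) has_field_derivative 0) (at 0)" by simp
  qed
  thus False using F(2) lie by (auto simp: matrix_ring_simps)
 qed
 have ex: "\<exists>D. D \<in> I \<and> D (mat 1) = Y" for Y
  using WY[of Y] unfolding W_def by (elim imageE) (intro exI conjI, assumption, rule sym)
 define U :: "'n \<times> 'n => complex^'n^'n" where "U r = (\<chi> i j. if i = snd r then if j = fst r then 1 else 0 else 0)" for r
 define D where "D r = (SOME D. D \<in> I \<and> D (mat 1) = U r)" for r
 have D: "D r \<in> I" "D r (mat 1) = U r" for r using someI_ex[OF ex[of "U r"]] by (simp_all add: D_def)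
 define L :: "complex^'n^'n => complex^'n^'n => complex^'n^'n" where "L A X = (\<chi> i j. trace (D (i, j) A ** X))" for A X
 let ?M = "\<lambda>A. (\<chi> r s. L A (\<chi> i j. if (i, j) = s then 1 else 0) $ fst r $ snd r) :: complex^('n \<times> 'n)^('n \<times> 'n)"
 show ?thesis
 proof (intro bexI[of _ "\<lambda>A. det (?M A)"] conjI ballI impI)
  show "(\<lambda>A. det (?M A)) \<in> poly_fun" by (rule poly_fun_det) (simp add: L_def tr D(1))
  have "L (mat 1) X = X" for X
   by (simp add: L_def D(2) U_def trace_unit vec_eq_iff)
  hence "?M (mat 1) = mat 1" by (simp add: vec_eq_iff mat_def)
  thus "det (?M (mat 1)) = 1" by simp
  fix A assume A: "A \<in> Z" "A ~= mat 1"
  show "det (?M A) = 0"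
  proof (rule ccontr)
   assume nz: "det (?M A) ~= 0"
   have L: "L A (X + Y) = L A X + L A Y" "L A (c \<cdot> X) = c \<cdot> L A X" for X Y c
    by (simp_all add: L_def vec_eq_iff matrix_ring_simps(7) trace_add mat_scale_simps(2))
   have "L A (A - mat 1) = 0" using D(1) A(1) by (simp add: L_def I_def vec_eq_iff)
   hence "A - mat 1 = 0" by (rule det_operator(1)[OF L nz])
   thus False using A(2) by simp
  qed
 qed
qed

text \<open>This is the comultiplication of the coordinate ring: matrix entries of a product are
  sums of products, and the property is stable under sums and products.\<close>

lemma poly_fun_separable:
 fixes f :: "complex^'n^'n => complex"
 assumes "f \<in> poly_fun"
 shows "\<exists>xs. \<forall>P A :: complex^'n^'n. f (P ** A) = (\<Sum>(u, m)\<leftarrow>xs. u P * m A)"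
 using assms
proof induction
 case (const c)
 show ?case by (rule exI[of _ "[(\<lambda>P. c, \<lambda>A. 1)]"]) simp
next
 case (coord i j)
 obtain ks where ks: "set ks = (UNIV :: 'n set)" "distinct ks" using finite_distinct_list[OF finite_class.finite_UNIV] by blast
 show ?case
  by (rule exI[of _ "map (\<lambda>k. (\<lambda>P :: complex^'n^'n. P $ i $ k, \<lambda>A :: complex^'n^'n. A $ k $ j)) ks"])
   (simp add: matrix_matrix_mult_def ks(1)[symmetric] sum.distinct_set_conv_list[OF ks(2)] o_def)
next
 case (add f g)
 then obtain xs ys where "\<forall>P A :: complex^'n^'n. f (P ** A) = (\<Sum>(u, m)\<leftarrow>xs. u P * m A)" "\<forall>P A :: complex^'n^'n. g (P ** A) = (\<Sum>(u, m)\<leftarrow>ys. u P * m A)"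
  by (elim exE)
 thus ?case by (intro exI[of _ "xs @ ys"]) simp
next
 case (mult f g)
 then obtain xs ys where xs: "\<forall>P A :: complex^'n^'n. f (P ** A) = (\<Sum>(u, m)\<leftarrow>xs. u P * m A)"
  and ys: "\<forall>P A :: complex^'n^'n. g (P ** A) = (\<Sum>(u, m)\<leftarrow>ys. u P * m A)" by (elim exE)
 let ?ys = "\<lambda>u m. map (\<lambda>(v, n). (\<lambda>P. u P * v P, \<lambda>A. m A * n A)) ys"
 have "(\<Sum>(v, n)\<leftarrow>?ys u m. v P * n A) = u P * m A * (\<Sum>(v, n)\<leftarrow>ys. v P * n A)" for u m P A
  by (induction ys) (auto simp: algebra_simps)
 hence "(\<Sum>(v, n)\<leftarrow>concat (map (\<lambda>(u, m). ?ys u m) zs). v P * n A) = (\<Sum>(u, m)\<leftarrow>zs. u P * m A) * (\<Sum>(v, n)\<leftarrow>ys. v P * n A)" for zs P A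
  by (induction zs) (auto simp: algebra_simps)
 thus ?case by (intro exI[of _ "concat (map (\<lambda>(u, m). ?ys u m) xs)"]) (simp add: xs ys)
qed

text \<open>The rows \<open>v b\<close> have dual functionals \<open>w a\<close> supported on
  finitely many coordinates, so there are only finitely many rows. Each coordinate is eliminated at
  the cost of one element of \<open>Z\<close>.\<close>

lemma finite_dual_families:
 fixes w v :: "'a => 'b => complex"
 assumes "finite M" "\<And>a b. a \<in> Z ==> b \<in> Z ==> (\<Sum>m\<in>M. w a m * v b m) = (if a = b then 1 else 0)"
 shows "finite Z"
 using assms
proof (induction M arbitrary: Z w rule: finite_induct)
 case empty
 have "Z = {}"
 proof (rule equals0I)
  fix x assume "x \<in> Z"
  thus False using empty.prems[of x x] by simp
 qed
 thus ?case by simp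
next
 case (insert m M)
 show ?case
 proof (cases "\<exists>c\<in>Z. w c m ~= 0")
  case False
  show ?thesis
   by (rule insert.IH[of Z w]) (use False insert.prems insert.hyps in \<open>simp add: sum.insert\<close>)
 next
  case True
  then obtain c where c: "c \<in> Z" "w c m ~= 0" by blast
  define w' where "w' a k = w a k - w a m / w c m * w c k" for a k
  have "(\<Sum>k\<in>M. w' a k * v b k) = (if a = b then 1 else 0)" if ab: "a \<in> Z - {c}" "b \<in> Z - {c}" for a b
  proof -
   have "w' a m = 0" using c(2) by (simp add: w'_def)
   hence "(\<Sum>k\<in>M. w' a k * v b k) = (\<Sum>k\<in>insert m M. w' a k * v b k)" using insert.hyps by simp
   also have "\<dots> = (\<Sum>k\<in>insert m M. w a k * v b k) - w a m / w c m * (\<Sum>k\<in>insert m M. w c k * v b k)"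
    unfolding sum_distrib_left sum_subtractf[symmetric] by (rule sum.cong) (simp_all add: w'_def algebra_simps)
   also have "\<dots> = (if a = b then 1 else 0)"
    using insert.prems[of a b] insert.prems[of c b] ab c(1) by auto
   finally show ?thesis .
  qed
  hence "finite (Z - {c})" by (rule insert.IH)
  thus ?thesis by simp
 qed
qed

text \<open>The polynomial \<open>q\<close> isolating the identity gives the Kronecker delta of
  \<open>a\<close> and \<open>b\<close> when evaluated at the quotient of \<open>b\<close> by
  \<open>a\<close>; separating the variables turns this into dual families.\<close>

lemma finite_if_lie_algebra_trivial:
 fixes Z :: "(complex^'n^'n) set"
 assumes Z: "closed_subgroup Z" and lie: "lie_algebra Z \<subseteq> {0}"
 shows "finite Z"
proof -
 obtain q where q: "q \<in> poly_fun" "q (mat 1) = 1" "\<And>A. A \<in> Z ==> A ~= mat 1 ==> q A = 0"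
  using isolated_identity[OF closed_subgroupD(2)[OF Z] lie] by blast
 obtain xs where xs: "\<forall>P A :: complex^'n^'n. q (P ** A) = (\<Sum>(u, m)\<leftarrow>xs. u P * m A)" using poly_fun_separable[OF q(1)] by (elim exE)
 show ?thesis
 proof (rule finite_dual_families[of "{0..<length xs}" Z "\<lambda>(a :: complex^'n^'n) k. fst (xs ! k) (matrix_inv a)" "\<lambda>b k. snd (xs ! k) b"])
  fix a b assume ab: "a \<in> Z" "b \<in> Z"
  note ai = closed_subgroupD(1)[OF Z ab(1)]
  have "a ** (matrix_inv a ** b) = b" by (simp add: matrix_mul_assoc matrix_inv_mult(2)[OF ai])
  hence e: "matrix_inv a ** b = mat 1 \<longleftrightarrow> a = b" using matrix_inv_mult(1)[OF ai] by (metis matrix_mul_rid)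
  have "matrix_inv a ** b \<in> Z" using ab by (intro closed_subgroupD[OF Z])
  hence "q (matrix_inv a ** b) = (if a = b then 1 else 0)" using q(2,3) e by auto
  thus "(\<Sum>k\<in>{0..<length xs}. fst (xs ! k) (matrix_inv a) * snd (xs ! k) b) = (if a = b then 1 else 0)"
   by (simp add: xs sum_list_sum_nth split_beta)
 qed simp
qed

context g2_setting
begin

lemma Z1_closed: "closed_subgroup Z1"
 unfolding closed_subgroup_def subgroup_GL_iff
proof (intro conjI ballI)
 show "mat 1 \<in> Z1" by (simp add: Z1_def G_group Ad_simps)
 show "invertible A" if "A \<in> Z1" for A using that G_group(1) by (simp add: Z1_def)
 show "A ** A' \<in> Z1" if "A \<in> Z1" "A' \<in> Z1" for A A'
  using that G_group(1,3) by (simp add: Z1_def Ad_mult)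
 show "matrix_inv A \<in> Z1" if "A \<in> Z1" for A
  using that G_group(4) Ad_inv(1)[OF G_group(1), of A] by (simp add: Z1_def) metis
 have "{A. invertible A \<and> Ad A Y $ i $ j + (- 1) * Y $ i $ j = 0} = {A. invertible A \<and> Ad A Y $ i $ j = Y $ i $ j}" for Y i j
  by auto
 hence c: "closedin zariski {A. invertible A \<and> Ad A Y $ i $ j = Y $ i $ j}" for Y i j
  using closedin_reg_zero[OF reg_fun_add[OF reg_fun_Ad reg_fun_const], of Y i j "(- 1) * Y $ i $ j"] by simp
 have "Z1 = \<Inter> (insert G ((\<lambda>(Y, i, j). {A. invertible A \<and> Ad A Y $ i $ j = Y $ i $ j}) ` (\<g> \<times> UNIV \<times> UNIV)))"
  using G_group(1) by (auto simp: Z1_def vec_eq_iff)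
 also have "closedin zariski \<dots>"
  using G_closed c by (intro closedin_Inter) (auto simp: closed_subgroup_def)
 finally show "closedin zariski Z1" .
qed

lemma finite_Z1: "finite Z1"
proof (rule finite_if_lie_algebra_trivial[OF Z1_closed], rule subsetI)
 fix X assume X: "X \<in> lie_algebra Z1"
 have Xg: "X \<in> \<g>" using lie_algebra_mono[of Z1 G] X by (auto simp: \<g>_def Z1_def)
 have "br X Y = 0" if Y: "Y \<in> \<g>" for Y
 proof -
  have "mexp X s \<in> Z1" for s by (rule mexp_in_closed_subgroup[OF Z1_closed X])
  hence "Ad (mexp X s) Y = Y" for s using Y by (simp add: Z1_def)
  hence "mexp X s ** Y = Y ** mexp X s" for s using commute_iff_Ad[OF invertible_mexp] by blast
  thus ?thesis unfolding br_eq_0_iff by (rule mexp_commute_imp)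
 qed
 thus "X \<in> {0}" using no_center[OF Xg] by blast
qed

end

section \<open>The big cell\<close>

context g2_setting
begin

text \<open>Reading off the coordinate along \<open>ee c\<close> with the trace form makes it a
  linear functional on all matrices, so applied to \<open>Ad g X\<close> it is regular in
  \<open>g\<close>.\<close>

definition cf :: "int \<times> int => complex^'n^'n => complex" where
 "cf c X = trace (X ** ee (- c)) / trace (ee c ** ee (- c))"

lemma cf_simps: "cf c (X + Y) = cf c X + cf c Y" "cf c (k \<cdot> X) = k * cf c X" "cf c 0 = 0"
  "cf c (X - Y) = cf c X - cf c Y"
 by (simp_all only: cf_def matrix_ring_simps trace_add trace_sub add_divide_distrib diff_divide_distrib)
  (simp_all add: mat_scale_simps trace_def sum_distrib_left)

lemma cf_sum: "cf c (\<Sum>i\<in>I. f i) = (\<Sum>i\<in>I. cf c (f i))"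
 by (induction I rule: infinite_finite_induct) (simp_all add: cf_simps)

lemma cf_gs: "c \<in> rts ==> X \<in> gs d ==> d ~= c ==> cf c X = 0"
 unfolding cf_def using trace_gs[of X d "ee (- c)" "- c"] ee(1)[of "- c"] rts_wts(4)[of c]
 by (simp add: prod_eq_iff)

lemma cf_ee: "c \<in> rts ==> cf c (ee c) = 1"
 unfolding cf_def using trace_ee by simp

lemma pc_cf:
 assumes c: "c \<in> rts" and X: "X \<in> \<g>"
 shows "pc c X = cf c X \<cdot> ee c"
proof -
 obtain k where k: "pc c X = k \<cdot> ee c"
  using gs_1dim[OF c ee(1)[OF c] ee(2)[OF c] pc_in_gs[OF X]] by blast
 have "cf c X = (\<Sum>d\<in>wts. cf c (pc d X))" by (subst sum_pc[OF X, symmetric]) (rule cf_sum)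
 also have "\<dots> = (\<Sum>d\<in>wts. if d = c then cf c (pc c X) else 0)"
  by (rule sum.cong) (use cf_gs[OF c pc_in_gs[OF X]] in auto)
 also have "\<dots> = k" using rts_wts(1)[OF c] by (simp add: k cf_simps cf_ee[OF c])
 finally show ?thesis by (simp add: k)
qed

definition hproj :: "int => complex^'n^'n => complex^'n^'n" where
 "hproj k X = (\<Sum>c\<in>{c \<in> rts. k \<le> fst c + snd c}. cf c X \<cdot> ee c)"

lemma finite_rts [simp]: "finite rts" by (simp add: rts_def)

lemma hproj_simps: "hproj k (X + Y) = hproj k X + hproj k Y" "hproj k (c \<cdot> X) = c \<cdot> hproj k X"
 by (simp_all add: hproj_def cf_simps mm.scale_left_distrib sum.distrib mm.scale_sum_right)

lemma hproj_gr: "hproj k X \<in> gr 1 1 k"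
 unfolding hproj_def
 by (intro gr_sum_mem gr_scale gs_gr[OF ee(1)]) auto

lemma hproj_pc:
 assumes "X \<in> \<g>" "1 \<le> k"
 shows "hproj k X = (\<Sum>c\<in>{c \<in> wts. k \<le> 1 * fst c + 1 * snd c}. pc c X)"
proof -
 have *: "{c \<in> wts. k \<le> 1 * fst c + 1 * snd c} = {c \<in> rts. k \<le> fst c + snd c}"
  using rts_wts(1,2) assms(2) by force
 show ?thesis unfolding hproj_def * by (rule sum.cong) (auto simp: pc_cf assms)
qed

lemma hproj_id: "1 \<le> k ==> X \<in> gr 1 1 k ==> hproj k X = X"
 by (rule trans[OF hproj_pc[OF gr_g] gr_sum[symmetric]])

lemma hproj_eq_0:
 assumes X: "X \<in> \<g>" and k: "1 \<le> k"
 shows "hproj k X = 0 \<longleftrightarrow> X \<in> gr (-1) (-1) (1 - k)"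
proof
 assume 0: "hproj k X = 0"
 have "pc c X = 0" if c: "c \<in> wts" "k \<le> fst c + snd c" for c
 proof -
  have "pc c (hproj k X) = (\<Sum>d\<in>{c \<in> wts. k \<le> 1 * fst c + 1 * snd c}. pc c (pc d X))"
   unfolding hproj_pc[OF X k] pc_sum ..
  also have "\<dots> = (\<Sum>d\<in>{c \<in> wts. k \<le> 1 * fst c + 1 * snd c}. if d = c then pc c X else 0)"
   by (rule sum.cong) (auto simp: pc_gs[OF pc_in_gs[OF X]])
  also have "\<dots> = pc c X" using c by simp
  finally show ?thesis by (simp add: 0)
 qed
 thus "X \<in> gr (-1) (-1) (1 - k)" using X by (auto simp: gr_def)
next
 assume "X \<in> gr (-1) (-1) (1 - k)"
 hence "pc c X = 0" if "c \<in> wts" "k \<le> 1 * fst c + 1 * snd c" for c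
  using that unfolding gr_def by force
 thus "hproj k X = 0" unfolding hproj_pc[OF X k] by (intro sum.neutral) blast
qed

text \<open>The compression of \<open>Ad g\<close> to the part of height at least \<open>k\<close>,
  completed by the identity on the kernel of \<open>hproj k\<close>, so that its determinant can be
  taken on the whole matrix space.\<close>

definition cell_op :: "int => complex^'n^'n => complex^'n^'n => complex^'n^'n" where
 "cell_op k g X = X - hproj k X + hproj k (Ad g (hproj k X))"

definition cell_det :: "int => complex^'n^'n => complex" where
 "cell_det k g = det (\<chi> r s. cell_op k g (\<chi> i j. if (i, j) = s then 1 else 0) $ fst r $ snd r
   :: complex^('n \<times> 'n)^('n \<times> 'n))"

lemma cell_op_simps: "cell_op k g (X + Y) = cell_op k g X + cell_op k g Y"
  "cell_op k g (c \<cdot> X) = c \<cdot> cell_op k g X"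
 by (simp_all add: cell_op_def hproj_simps Ad_simps mm.scale_right_distrib mm.scale_right_diff_distrib)

lemma cell_det_reg: "cell_det k \<in> reg_fun"
 unfolding cell_det_def
proof (rule reg_fun_det)
 fix r s
 define W :: "complex^'n^'n" where "W = (\<chi> i j. if (i, j) = s then 1 else 0)"
 have 1: "(\<lambda>A. cf c (Ad A Y)) \<in> reg_fun" for c Y
  unfolding cf_def divide_inverse by (intro reg_fun_mult reg_fun_trace_Ad reg_fun_const)
 have "(\<lambda>A. (W - hproj k W) $ fst r $ snd r +
   (\<Sum>c\<in>{c \<in> rts. k \<le> fst c + snd c}. cf c (Ad A (hproj k W)) * ee c $ fst r $ snd r)) \<in> reg_fun"
  by (intro reg_fun_add reg_fun_const reg_fun_sum reg_fun_mult 1)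
 thus "(\<lambda>A. (\<chi> r s. cell_op k A (\<chi> i j. if (i, j) = s then 1 else 0) $ fst r $ snd r) $ r $ s) \<in> reg_fun"
  by (simp only: vec_lambda_beta W_def[symmetric]) (simp add: cell_op_def hproj_def[of k "Ad _ _"])
qed

lemma cell_det_1: "1 \<le> k ==> cell_det k (mat 1) = 1"
proof -
 assume "1 \<le> k"
 hence "cell_op k (mat 1) X = X" for X by (simp add: cell_op_def Ad_simps hproj_id[OF _ hproj_gr])
 hence "(\<chi> r s. cell_op k (mat 1) (\<chi> i j. if (i, j) = s then 1 else 0) $ fst r $ snd r) = (mat 1 :: complex^('n \<times> 'n)^('n \<times> 'n))"
  by (simp add: vec_eq_iff mat_def)
 thus ?thesis by (simp add: cell_det_def)
qed

lemma cell_det_inj: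
 assumes nz: "cell_det k g ~= 0" and k: "1 \<le> k" and X: "X \<in> gr 1 1 k" "hproj k (Ad g X) = 0"
 shows "X = 0"
proof (rule det_operator(1)[OF cell_op_simps nz[unfolded cell_det_def]])
 show "cell_op k g X = 0" using X by (simp add: cell_op_def hproj_id k)
qed

lemma cell_det_surj:
 assumes nz: "cell_det k g ~= 0" and k: "1 \<le> k" and W: "W \<in> gr 1 1 k"
 shows "\<exists>X\<in>gr 1 1 k. hproj k (Ad g X) = W"
proof -
 obtain X where X: "cell_op k g X = W"
  using det_operator(2)[OF cell_op_simps nz[unfolded cell_det_def]] by blast
 have "X = W + hproj k X - hproj k (Ad g (hproj k X))" unfolding X[symmetric] cell_op_def by simp
 also have "\<dots> \<in> gr 1 1 k"
  by (intro gr_diff gr_add W hproj_gr)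
 finally have "X \<in> gr 1 1 k" .
 thus ?thesis using X by (intro bexI[of _ X]) (simp_all add: cell_op_def hproj_id k)
qed

end

context g2_setting
begin

lemma gen_gr_G: "g \<in> gen (gr p q k) ==> g \<in> G" and gen_g_G: "g \<in> gen \<g> ==> g \<in> G"
 using gen_subset[OF G_closed, of "gr p q k"] gen_subset[OF G_closed, of \<g>] mexp_G gr_g by blast+

lemma gr_stable_unipotent:
 assumes "1 \<le> l" "g \<in> gen (gr p q l)" "Y \<in> gr p q k"
 shows "Ad g Y \<in> gr p q k"
 using gr_stable[OF _ assms(3)] gen_mono[OF gr_mono[of 0 l p q]] assms(1,2) by auto

lemma gr_minus_cartan:
 assumes s: "s = 1 \<or> s = - 1" and Z: "Z \<in> gr s s 0"
 shows "Z - pc (0,0) Z \<in> gr s s 1"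
proof -
 have g: "pc (0,0) Z \<in> gs (0,0)" by (rule pc_in_gs[OF gr_g[OF Z]])
 have "pc c (Z - pc (0,0) Z) = 0" if c: "c \<in> wts" "s * fst c + s * snd c < 1" for c
 proof -
  have eq: "pc c (Z - pc (0,0) Z) = pc c Z - (if c = (0,0) then pc (0,0) Z else 0)"
   using pc_add[of c "Z - pc (0,0) Z" "pc (0,0) Z"] by (simp add: pc_gs[OF g])
  show ?thesis
  proof (cases "c = (0,0)")
   case False
   hence "s * fst c + s * snd c < 0" using c s by (auto simp: wts_eq)
   thus ?thesis using Z c(1) eq False by (simp add: gr_def)
  qed (use eq in simp)
 qed
 thus ?thesis
  using mm.subspace_diff[OF csub_g gr_g[OF Z] gs_g[OF g]] by (simp add: gr_def)
qed

lemma h0_unique: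
 assumes h: "h \<in> gs (0,0)" "ev (1,0) h = 1" "ev (0,1) h = 1"
 shows "h = h0"
proof -
 have d: "h - h0 \<in> gs (0,0)" by (rule mm.subspace_diff[OF csub_gs h(1) h0(1)])
 have "ev c (h - h0) = ev c h - ev c h0" for c using ev_linear(1)[OF d h0(1), of c] by simp
 hence "h - h0 = 0" by (intro cartan_zero[OF d]) (simp_all add: h h0(2))
 thus ?thesis by simp
qed

text \<open>The first determinant provides \<open>Y\<close> of positive height such that
  \<open>Ad g (h0 + Y)\<close> has no positive part. Conjugating \<open>h0 + Y\<close> to
  \<open>h0\<close> on the right and the image to \<open>h0\<close> on the left leaves an element
  fixing \<open>h0\<close>, which \<open>fixes_h0\<close> describes.\<close>

lemma big_cell:
 assumes g: "g \<in> G" and nz: "cell_det 1 g ~= 0" "cell_det 2 g ~= 0"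
 shows "\<exists>v\<in>gen (gr (-1) (-1) 1). \<exists>h\<in>gs (0,0). \<exists>z\<in>Z1. \<exists>u\<in>gen (gr 1 1 1). g = v ** (mexp h 1 ** z) ** u"
proof -
 note Ginv = G_group(1)
 have hg: "h0 \<in> \<g>" using h0(1) gs_g by blast
 have "- hproj 1 (Ad g h0) \<in> gr 1 1 1" by (rule mm.subspace_neg[OF csub_gr hproj_gr])
 then obtain Y where Y: "Y \<in> gr 1 1 1" "hproj 1 (Ad g Y) = - hproj 1 (Ad g h0)"
  using cell_det_surj[OF nz(1)] by auto
 have "h0 + Y - h0 \<in> gr 1 1 1" using Y by simp
 then obtain w where w: "w \<in> gen (gr 1 1 1)" "Ad w (h0 + Y) = h0"
  using conjugate_to_h0[of 1] by blast
 have wG: "w \<in> G" by (rule gen_gr_G[OF w(1)])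
 have iw: "matrix_inv w \<in> gen (gr 1 1 1)" by (rule gen_inv[OF w(1)])
 define g' where "g' = g ** matrix_inv w"
 have g'G: "g' \<in> G" unfolding g'_def by (intro G_group g wG)
 have g': "Ad g' (Ad w X) = Ad g X" for X
  unfolding g'_def using Ad_mult[OF Ginv[OF g] invertible_matrix_inv[OF Ginv[OF wG]]] Ad_inv(1)[OF Ginv[OF wG]] by simp
 define Z where "Z = Ad g' h0"
 have Zg: "Z \<in> \<g>" unfolding Z_def by (rule Ad_g[OF g'G hg])
 have "Z = Ad g (h0 + Y)" using g'[of "h0 + Y"] by (simp add: w(2) Z_def)
 hence "hproj 1 Z = 0" using Y(2) by (simp add: Ad_simps hproj_simps)
 hence Z0: "Z \<in> gr (-1) (-1) 0" using hproj_eq_0[OF Zg, of 1] by simp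
 define h' where "h' = pc (0,0) Z"
 have h': "h' \<in> gs (0,0)" unfolding h'_def by (rule pc_in_gs[OF Zg])
 have Z1: "Z - h' \<in> gr (-1) (-1) 1" unfolding h'_def by (rule gr_minus_cartan[OF _ Z0]) simp
 \<comment> \<open>Let \<open>X\<close> be mapped by \<open>g\<close> to \<open>ee c\<close> up to
   nonpositive height. If \<open>h'\<close> had a value other than 1 at \<open>c\<close>, comparing
   eigenvalues would place \<open>X\<close> in height at least 2, where the second determinant
   forces it to vanish.\<close>
 have one: "ev c h' = 1" if c: "c \<in> {(1,0), (0,1)}" for c
 proof -
  have cr: "c \<in> rts" using c by (auto simp: rts_def)
  have ec: "ee c \<in> gr 1 1 1" "ee c \<in> gr (-1) (-1) (-1)" using c by (auto intro!: gs_gr[OF ee(1)[OF cr]])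
  obtain X where X: "X \<in> gr 1 1 1" "hproj 1 (Ad g X) = ee c"
   using cell_det_surj[OF nz(1) _ ec(1)] by auto
  define X' where "X' = Ad w X"
  have X': "X' \<in> gr 1 1 1" unfolding X'_def by (rule gr_stable_unipotent[OF _ w(1) X(1)]) simp
  have AX: "Ad g X \<in> \<g>" by (rule Ad_g[OF g gr_g[OF X(1)]])
  have hsub: "hproj k (A - C) = hproj k A - hproj k C" for k A C
   using hproj_simps(1)[of k "A - C" C] by simp
  have "hproj 1 (Ad g X - ee c) = 0" by (simp only: hsub X(2) hproj_id[OF order_refl ec(1)]) simp
  hence D1: "Ad g X - ee c \<in> gr (-1) (-1) 0"
   using hproj_eq_0[of "Ad g X - ee c" 1] mm.subspace_diff[OF csub_g AX gs_g[OF ee(1)[OF cr]]] by simp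
  have "br (Z - h') (ee c) \<in> gr (-1) (-1) 0" using br_gr[OF Z1 ec(2)] by simp
  moreover have "br Z (Ad g X - ee c) \<in> gr (-1) (-1) 0" using br_gr[OF Z0 D1] by simp
  moreover have "br Z (Ad g X) - ev c h' \<cdot> Ad g X =
    br (Z - h') (ee c) + br Z (Ad g X - ee c) - ev c h' \<cdot> (Ad g X - ee c)"
   using br_h[OF h' ee(1)[OF cr]] by (simp add: br_simps mm.scale_right_diff_distrib)
  ultimately have D2: "br Z (Ad g X) - ev c h' \<cdot> Ad g X \<in> gr (-1) (-1) 0"
   using gr_scale[OF D1] by (simp add: mm.subspace_diff mm.subspace_add csub_gr)
  define W where "W = br h0 X' - ev c h' \<cdot> X'"
  have W: "W \<in> gr 1 1 1" unfolding W_def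
   using br_gr[OF gs_gr[OF h0(1), of 0 1 1] X'] gr_scale[OF X'] gr_diff by simp
  have "Ad g' W = br Z (Ad g X) - ev c h' \<cdot> Ad g X"
   unfolding W_def Z_def by (simp add: Ad_simps Ad_br[OF Ginv[OF g'G]] X'_def g')
  moreover have "Ad g' W = Ad g (Ad (matrix_inv w) W)"
   using g'[of "Ad (matrix_inv w) W"] by (simp add: Ad_inv(2)[OF Ginv[OF wG]])
  ultimately have *: "Ad g (Ad (matrix_inv w) W) \<in> gr (-1) (-1) 0" using D2 by simp
  have "Ad (matrix_inv w) W = 0"
  proof (rule cell_det_inj[OF nz(1)])
   show "hproj 1 (Ad g (Ad (matrix_inv w) W)) = 0" using hproj_eq_0[OF gr_g[OF *], of 1] * by simp
  qed (use gr_stable_unipotent[OF _ iw W] in auto)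
  hence "W = 0" using Ad_eq_0_iff invertible_matrix_inv[OF Ginv[OF wG]] by blast
  hence ev: "br h0 X' = ev c h' \<cdot> X'" by (simp add: W_def)
  show ?thesis
  proof (rule ccontr)
   assume ne: "ev c h' ~= 1"
   have "(ev c h' - 1) \<cdot> X' \<in> gr 1 1 2"
    using br_h0_gr[of 1, OF _ X'] by (simp add: ev mm.scale_left_diff_distrib)
   hence "inverse (ev c h' - 1) \<cdot> (ev c h' - 1) \<cdot> X' \<in> gr 1 1 2" by (rule gr_scale)
   hence X2: "X' \<in> gr 1 1 2" using ne by (simp only: mm.scale_scale) simp
   have X3: "X \<in> gr 1 1 2"
    using gr_stable_unipotent[OF _ iw X2] Ad_inv(1)[OF Ginv[OF wG], of X] by (simp add: X'_def)
   have "Ad g X - ee c \<in> gr (-1) (-1) (-1)" using D1 gr_mono[of "-1" 0 "-1" "-1"] by auto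
   from gr_add[OF this ec(2)] have "hproj 2 (Ad g X) = 0" using hproj_eq_0[OF AX, of 2] by simp
   hence "X = 0" using cell_det_inj[OF nz(2) _ X3] by simp
   hence "ee c = 0" using X(2) hproj_simps(2)[of 1 0 0] by (simp add: Ad_simps)
   thus False using ee(2)[OF cr] by blast
  qed
 qed
 have "h' = h0" by (rule h0_unique[OF h']) (simp_all add: one)
 hence "Z - h0 \<in> gr (-1) (-1) 1" using Z1 by simp
 then obtain v where v: "v \<in> gen (gr (-1) (-1) 1)" "Ad v Z = h0" using conjugate_to_h0[of "-1"] by blast
 have vG: "v \<in> G" by (rule gen_gr_G[OF v(1)])
 have fx: "Ad (v ** g') h0 = h0"
  using v(2) by (simp add: Ad_mult[OF Ginv[OF vG] Ginv[OF g'G]] Z_def)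
 obtain h z where hz: "h \<in> gs (0,0)" "z \<in> Z1" "v ** g' = mexp h 1 ** z"
  using fixes_h0[OF G_group(3)[OF vG g'G] fx] by (elim bexE) auto
 have "matrix_inv v ** (v ** g') ** w = g"
  unfolding g'_def matrix_mul_assoc using matrix_inv_mult(1)[OF Ginv[OF vG]] matrix_inv_mult(1)[OF Ginv[OF wG]]
  by (simp add: matrix_mul_assoc[symmetric])
 hence "g = matrix_inv v ** (mexp h 1 ** z) ** w" unfolding hz(3) by (rule sym)
 thus ?thesis using hz(1,2) w(1) gen_inv[OF v(1)] by (intro bexI) 
qed

lemma Z1_commute_gen:
 assumes "z \<in> Z1" "g \<in> gen \<g>"
 shows "z ** g = g ** z"
 using assms(2)
proof induction
 case (step X g t)
 have z: "invertible z" using assms(1) G_group(1) by (auto simp: Z1_def)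
 have "z ** mexp X t ** matrix_inv z = mexp X t"
  using mexp_conj[OF z, of X t] assms(1) step.hyps(1) by (simp add: Z1_def)
 hence "z ** mexp X t ** matrix_inv z ** z = mexp X t ** z" by simp
 hence "z ** mexp X t = mexp X t ** z"
  by (simp add: matrix_mul_assoc[symmetric] matrix_inv_mult(1)[OF z])
 thus ?case using step.IH by (metis matrix_mul_assoc)
qed simp

lemma Z1_commute_zcl: "z \<in> Z1 ==> g \<in> zcl (gen \<g>) ==> z ** g = g ** z"
 using zcl_commute[of "{z}" "gen \<g>" z g] Z1_commute_gen zcl_superset[of "{z}"] G_group(1)
 by (auto simp: Z1_def)

end

section \<open>Density of the exponentials and of the big cell\<close>

lemma zirrD:
 "zirr S ==> f \<in> poly_fun ==> g \<in> poly_fun ==> (\<And>A. A \<in> S ==> f A * g A = 0) ==>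
  (\<forall>A\<in>S. f A = 0) \<or> (\<forall>A\<in>S. g A = 0)"
 by (auto simp: zirr_def)

lemma zirr_prod:
 assumes S: "zirr S" and I: "finite I" and f: "\<And>i. i \<in> I ==> f i \<in> poly_fun"
  and 0: "\<And>A. A \<in> S ==> (\<Prod>i\<in>I. f i A) = 0"
 shows "\<exists>i\<in>I. \<forall>A\<in>S. f i A = 0"
 using I f 0
proof (induction I)
 case empty
 thus ?case using S by (auto simp: zirr_def)
next
 case (insert i I)
 have p: "f i \<in> poly_fun" "(\<lambda>A. \<Prod>i\<in>I. f i A) \<in> poly_fun" using insert.prems(1) by (auto intro!: poly_fun_prod)
 have "f i A * (\<Prod>i\<in>I. f i A) = 0" if "A \<in> S" for A using insert.prems(2)[OF that] insert.hyps by simp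
 from zirrD[OF S p this] have "(\<forall>A\<in>S. f i A = 0) \<or> (\<forall>A\<in>S. (\<Prod>i\<in>I. f i A) = 0)" .
 thus ?case using insert.IH insert.prems(1) by auto
qed

context g2_setting
begin

text \<open>By the big cell, a neighbourhood of the identity lies in finitely many translates of the
  closed subgroup \<open>?H\<close>. Removing the other translates leaves a neighbourhood inside
  \<open>?H\<close>, which is therefore open and closed in the connected group.\<close>

lemma zcl_gen_G: "zcl (gen \<g>) = G"
proof -
 let ?H = "zcl (gen \<g>)"
 have sub: "?H \<subseteq> G"
  using zcl_mono[of "gen \<g>" G] gen_g_G G_group(5) by blast
 have H: "closed_subgroup ?H" by (rule zcl_subgroup[OF gen_subgroup])
 note Hg = closed_subgroupD[OF H]
 have genH: "gen \<g> \<subseteq> ?H" by (rule zcl_superset) (auto simp: gen_invertible)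
 define D where "D A = cell_det 1 A * cell_det 2 A" for A
 have D: "D \<in> reg_fun" unfolding D_def using reg_fun_mult[OF cell_det_reg cell_det_reg] .
 \<comment> \<open>Removed are the translates of \<open>?H\<close> by elements of \<open>Z1\<close>
   outside it, finitely many and hence closed in total, and the zero set of the cell determinants;
   the identity stays.\<close>
 define bad where "bad = (\<Union>z\<in>Z1 - ?H. (**) z ` ?H) \<union> {A. invertible A \<and> D A = 0}"
 have zinv: "z \<in> Z1 ==> invertible z" for z using G_group(1) by (auto simp: Z1_def)
 have bad: "closedin zariski bad"
  unfolding bad_def using finite_Z1 zinv
  by (intro closedin_Un closedin_Union closedin_reg_zero[OF D]) (auto intro!: closedin_translate closedin_zcl)
 have one: "mat 1 \<notin> bad"
 proof
  assume "mat 1 \<in> bad"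
  then obtain z A where z: "z \<in> Z1" "z \<notin> ?H" "A \<in> ?H" "mat 1 = z ** A"
   unfolding bad_def by (auto simp: D_def cell_det_1)
  hence "z = matrix_inv A"
   using matrix_inv_unique[of A z] Hg(1) matrix_left_right_inverse by metis
  thus False using Hg(4)[OF z(3)] z(2) by simp
 qed
 have nbhd: "A \<in> ?H" if A: "A \<in> G" "A \<notin> bad" for A
 proof -
  have "D A ~= 0" using A G_group(1) unfolding bad_def by auto
  then obtain v h z u where dec: "v \<in> gen (gr (-1) (-1) 1)" "h \<in> gs (0,0)" "z \<in> Z1" "u \<in> gen (gr 1 1 1)"
   "A = v ** (mexp h 1 ** z) ** u" using big_cell[OF A(1)] by (auto simp: D_def)
  have g: "v \<in> gen \<g>" "u \<in> gen \<g>" "mexp h 1 \<in> gen \<g>"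
   using dec(1,2,4) gen_mono[of "gr _ _ _" \<g>] gr_g gs_g gen_mexp by blast+
  define y where "y = v ** mexp h 1 ** u"
  have y: "y \<in> gen \<g>" unfolding y_def by (intro gen_mult g)
  have "A = z ** y"
   unfolding dec(5) y_def using Z1_commute_gen[OF dec(3) g(1)] Z1_commute_gen[OF dec(3) g(3)]
   by (simp add: matrix_mul_assoc) (simp add: matrix_mul_assoc[symmetric])
  thus ?thesis using A(2) dec(3) y genH Hg(3) unfolding bad_def by blast
 qed
 have "closedin (subtopology zariski G) (G - ?H)"
 proof -
  have "G - ?H = G \<inter> (\<Inter>h\<in>?H. (**) h ` bad)"
  proof (intro equalityI subsetI)
   fix A assume A: "A \<in> G - ?H"
   have "A \<in> (**) h ` bad" if h: "h \<in> ?H" for h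
   proof -
    have "matrix_inv h ** A \<in> G" using h sub A G_group by blast
    moreover have "h ** (matrix_inv h ** A) = A"
     by (simp add: matrix_mul_assoc matrix_inv_mult(2)[OF Hg(1)[OF h]])
    ultimately show ?thesis using nbhd[of "matrix_inv h ** A"] Hg(3)[OF h, of "matrix_inv h ** A"] A
     by (metis Diff_iff image_eqI)
   qed
   thus "A \<in> G \<inter> (\<Inter>h\<in>?H. (**) h ` bad)" using A by blast
  next
   fix A assume A: "A \<in> G \<inter> (\<Inter>h\<in>?H. (**) h ` bad)"
   have "A \<notin> ?H"
   proof
    assume h: "A \<in> ?H"
    then obtain x where x: "x \<in> bad" "A = A ** x" using A by blast
    have "matrix_inv A ** A = matrix_inv A ** (A ** x)" using x(2) by simp
    hence "x = mat 1" by (simp add: matrix_mul_assoc matrix_inv_mult(1)[OF Hg(1)[OF h]])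
    thus False using one x(1) by simp
   qed
   thus "A \<in> G - ?H" using A by blast
  qed
  moreover have "closedin zariski (\<Inter>h\<in>?H. (**) h ` bad)"
   using Hg(1,2) bad by (intro closedin_Inter) (auto intro!: closedin_translate)
  ultimately show ?thesis by (auto simp: closedin_subtopology)
 qed
 moreover have "closedin (subtopology zariski G) ?H"
  by (rule closedin_subset_topspace[OF closedin_zcl sub])
 moreover have ts: "topspace (subtopology zariski G) = G" using G_group(1) by auto
 moreover have "connected_space (subtopology zariski G)"
  using ss by (simp add: semisimple_group_def connected_algebraic_group_def)
 ultimately have "G - ?H = {} \<or> ?H = {}"
  unfolding connected_space_closedin by (metis Diff_disjoint Un_Diff_cancel2 Un_absorb2 sub inf_commute order_refl)
 thus ?thesis using sub Hg(2) by auto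
qed

lemma zirr_G: "zirr G"
proof -
 have "zirr (zcl (gen \<g>))" by (rule zirr_zcl[OF zirr_gen]) (auto simp: gen_invertible)
 thus ?thesis by (simp only: zcl_gen_G)
qed

text \<open>On the cell, some translate by \<open>Z1\<close> puts an element into the product
  without central factor. So a product over \<open>Z1\<close> vanishes on \<open>G\<close>, and by
  irreducibility so does one translate of \<open>f\<close>.\<close>

lemma big_cell_dense:
 assumes f: "f \<in> poly_fun"
  and 0: "\<And>v t u. v \<in> gen (gr (-1) (-1) 1) ==> t \<in> T ==> u \<in> gen (gr 1 1 1) ==> f (v ** t ** u) = 0"
  and g: "g \<in> G"
 shows "f g = 0"
proof -
 obtain p k where p: "p \<in> poly_fun" "\<And>A. invertible A ==> cell_det 1 A * cell_det 2 A = p A / det A ^ k"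
  using reg_funE[OF reg_fun_mult[OF cell_det_reg cell_det_reg]] by blast
 define q where "q z A = p A * f (matrix_inv z ** A)" for z A
 have q: "q z \<in> poly_fun" for z
  unfolding q_def using poly_fun_subst[OF f, of "matrix_inv z" "mat 1"] by (intro poly_fun.mult p) simp
 have zinv: "z \<in> Z1 ==> invertible z" for z using G_group(1) by (auto simp: Z1_def)
 have "(\<Prod>z\<in>Z1. q z A) = 0" if A: "A \<in> G" for A
 proof (cases "p A = 0")
  case True
  have "mat 1 \<in> Z1" using G_group(2) by (simp add: Z1_def Ad_simps)
  thus ?thesis using True finite_Z1 by (intro prod_zero) (auto simp: q_def)
 next
  case False
  hence "cell_det 1 A * cell_det 2 A ~= 0" using p(2) G_group(1)[OF A] by (simp add: det_nz)
  then obtain v h z u where dec: "v \<in> gen (gr (-1) (-1) 1)" "h \<in> gs (0,0)" "z \<in> Z1" "u \<in> gen (gr 1 1 1)"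
   "A = v ** (mexp h 1 ** z) ** u" using big_cell[OF A] by auto
  have gg: "v \<in> gen \<g>" "mexp h 1 \<in> gen \<g>"
   using dec(1,2) gen_mono[of "gr _ _ _" \<g>] gr_g gs_g gen_mexp by blast+
  have "A = z ** (v ** mexp h 1 ** u)"
   unfolding dec(5) using Z1_commute_gen[OF dec(3) gg(1)] Z1_commute_gen[OF dec(3) gg(2)]
   by (simp add: matrix_mul_assoc) (simp add: matrix_mul_assoc[symmetric])
  hence "matrix_inv z ** A = v ** mexp h 1 ** u"
   by (simp add: matrix_mul_assoc matrix_inv_mult(1)[OF zinv[OF dec(3)]])
  hence "q z A = 0" using 0[OF dec(1) mexp_T[OF dec(2)] dec(4)] by (simp add: q_def)
  thus ?thesis using dec(3) finite_Z1 by auto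
 qed
 then obtain z where z: "z \<in> Z1" "\<forall>A\<in>G. q z A = 0"
  using zirr_prod[OF zirr_G finite_Z1, of q] q by blast
 have "(\<lambda>A. f (matrix_inv z ** A)) \<in> poly_fun" using poly_fun_subst[OF f, of "matrix_inv z" "mat 1"] by simp
 hence "(\<forall>A\<in>G. p A = 0) \<or> (\<forall>A\<in>G. f (matrix_inv z ** A) = 0)"
  using zirrD[OF zirr_G p(1)] z(2) unfolding q_def by blast
 moreover have "p (mat 1) ~= 0" using p(2)[of "mat 1"] by (simp add: cell_det_1)
 ultimately have "f (matrix_inv z ** (z ** g)) = 0" using G_group(2,3) g z(1) by (auto simp: Z1_def)
 thus ?thesis by (simp add: matrix_mul_assoc matrix_inv_mult(1)[OF zinv[OF z(1)]])
qed

end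

section \<open>The center lies in the torus\<close>

text \<open>Unipotent triangular for the preorder given by \<open>\<rho>\<close>; on indices with
  equal values the block is the identity.\<close>

definition unitri :: "('n::finite => real) => complex^'n^'n => bool" where
 "unitri \<rho> A \<longleftrightarrow> (\<forall>i j. \<rho> j \<le> \<rho> i --> A $ i $ j = (if i = j then 1 else 0))"

lemma unitri_mult:
 assumes A: "unitri \<rho> A" and B: "unitri \<rho> B"
 shows "unitri \<rho> (A ** B)"
 unfolding unitri_def
proof (intro allI impI)
 fix i j assume ij: "\<rho> j \<le> \<rho> i"
 have "A $ i $ k * B $ k $ j = (if k = i then (if i = j then 1 else 0) else 0)" for k
 proof (cases "\<rho> k \<le> \<rho> i")
  case True
  thus ?thesis using A B ij by (auto simp: unitri_def)
 next
  case False
  hence "B $ k $ j = (if k = j then 1 else 0)" using B ij by (simp add: unitri_def)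
  thus ?thesis using False ij by auto
 qed
 thus "(A ** B) $ i $ j = (if i = j then 1 else 0)" by (simp add: matrix_matrix_mult_def)
qed

text \<open>A permutation with nonzero product can only raise \<open>\<rho>\<close>, and as the sum
  of all values is invariant, it moves no index.\<close>

lemma det_unitri:
 fixes A :: "complex^'n^'n"
 assumes A: "unitri \<rho> A"
 shows "det A = 1"
proof -
 have perm: "of_int (sign p) * (\<Prod>i\<in>UNIV. A $ i $ p i) = (if p = id then 1 else 0)" if p: "p permutes UNIV" for p
 proof (cases "p = id")
  case True
  thus ?thesis using A by (simp add: unitri_def)
 next
  case False
  have "\<exists>i. A $ i $ p i = 0"
  proof (rule ccontr)
   assume "\<not> (\<exists>i. A $ i $ p i = 0)"
   hence 1: "p i = i \<or> \<rho> i < \<rho> (p i)" for i using A unfolding unitri_def by (metis not_le)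
   have "(\<Sum>i\<in>UNIV. \<rho> (p i) - \<rho> i) = 0"
    using sum.permute[OF p, of \<rho>] by (simp add: sum_subtractf o_def)
   moreover have "0 \<le> \<rho> (p i) - \<rho> i" for i using 1[of i] by auto
   ultimately have "\<rho> (p i) - \<rho> i = 0" for i
    using sum_nonneg_eq_0_iff[of UNIV "\<lambda>i. \<rho> (p i) - \<rho> i"] by simp
   hence "p i = i" for i using 1[of i] by (metis less_irrefl right_minus_eq)
   thus False using False by (simp add: fun_eq_iff)
  qed
  thus ?thesis using False by simp
 qed
 have "det A = (\<Sum>p | p permutes (UNIV :: 'n set). if p = id then 1 else 0)"
  unfolding det_def by (rule sum.cong) (simp_all add: perm)
 also have "\<dots> = 1" using permutes_id[of "UNIV :: 'n set"] by (simp add: finite_permutations)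
 finally show ?thesis .
qed

lemma unitri_mexp:
 assumes X: "\<And>i j. \<rho> j \<le> \<rho> i ==> X $ i $ j = 0"
 shows "unitri \<rho> (mexp X t)"
 unfolding unitri_def
proof (intro allI impI)
 fix i j assume ij: "\<rho> j \<le> \<rho> i"
 have pow: "mpow X (Suc k) $ a $ b = 0" if "\<rho> b \<le> \<rho> a" for k a b
  using that
 proof (induction k arbitrary: a b)
  case (Suc k)
  have "X $ a $ c * mpow X (Suc k) $ c $ b = 0" for c
   by (cases "\<rho> c \<le> \<rho> a") (use Suc X in auto)
  hence "(\<Sum>c\<in>UNIV. X $ a $ c * mpow X (Suc k) $ c $ b) = 0" by (intro sum.neutral) blast
  thus ?case by (subst mpow.simps(2), subst matrix_matrix_mult_def) (simp only: vec_lambda_beta)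
 qed (simp add: X)
 have "mpow X k $ i $ j / fact k * t ^ k = 0" if "k \<notin> {0}" for k
  using pow[OF ij] that by (cases k) auto
 hence "mexp X t $ i $ j = (\<Sum>k\<in>{0}. mpow X k $ i $ j / fact k * t ^ k)"
  unfolding mexp_def by (simp only: vec_lambda_beta) (rule suminf_finite, auto)
 thus "mexp X t $ i $ j = (if i = j then 1 else 0)" by (simp add: mat_def)
qed

text \<open>The principal submatrix on \<open>S\<close>, filled up by the identity so that its
  determinant is the principal minor.\<close>

definition minor :: "'n set => complex^'n^'n => complex^'n^'n" where
 "minor S A = (\<chi> i j. if i \<in> S \<and> j \<in> S then A $ i $ j else if i = j then 1 else 0)"

lemma minor_mult:
 fixes V M :: "complex^'n^'n"
 shows
 "(\<And>i l. i \<in> S ==> l \<notin> S ==> V $ i $ l = 0) ==> minor S (V ** M) = minor S V ** minor S M"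
 "(\<And>l j. l \<notin> S ==> j \<in> S ==> V $ l $ j = 0) ==> minor S (M ** V) = minor S M ** minor S V"
proof -
 have *: "(minor S A ** minor S C) $ i $ j = (if i \<in> S \<and> j \<in> S then (\<Sum>l\<in>UNIV. if l \<in> S then A $ i $ l * C $ l $ j else 0)
   else if i = j then 1 else 0)" for A C :: "complex^'n^'n" and i j
 proof -
  have "(minor S A ** minor S C) $ i $ j = (\<Sum>l\<in>UNIV. if i \<in> S \<and> j \<in> S then (if l \<in> S then A $ i $ l * C $ l $ j else 0)
    else if l = i then (if i = j then 1 else 0) else 0)"
   unfolding minor_def matrix_matrix_mult_def vec_lambda_beta by (intro sum.cong) auto
  thus ?thesis by (cases "i \<in> S \<and> j \<in> S") (auto simp: sum.delta)
 qed
 have eqI: "minor S (A ** C) = minor S A ** minor S C"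
  if AC: "\<And>i j l. i \<in> S ==> j \<in> S ==> l \<notin> S ==> A $ i $ l * C $ l $ j = 0" for A C :: "complex^'n^'n"
 proof -
  have "(\<Sum>l\<in>UNIV. if l \<in> S then A $ i $ l * C $ l $ j else 0) = (A ** C) $ i $ j" if "i \<in> S" "j \<in> S" for i j
   unfolding matrix_matrix_mult_def vec_lambda_beta by (intro sum.cong) (simp_all add: AC that)
  hence "minor S (A ** C) $ i $ j = (minor S A ** minor S C) $ i $ j" for i j
   unfolding * by (simp add: minor_def)
  thus ?thesis by (simp only: vec_eq_iff) simp
 qed
 show "minor S (V ** M) = minor S V ** minor S M" if "\<And>i l. i \<in> S ==> l \<notin> S ==> V $ i $ l = 0"
  by (rule eqI) (simp add: that)
 show "minor S (M ** V) = minor S M ** minor S V" if "\<And>l j. l \<notin> S ==> j \<in> S ==> V $ l $ j = 0"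
  by (rule eqI) (simp add: that)
qed

text \<open>As \<open>S\<close> is upward closed, neither triangular factor leads out of
  \<open>S\<close> on the side where it acts; the minor is then multiplicative and both factors
  contribute 1.\<close>

lemma det_minor_cell:
 fixes V D W :: "complex^'n^'n"
 assumes V: "unitri \<rho> V" and W: "unitri (\<lambda>i. - \<rho> i) W" and D: "\<And>i j. i ~= j ==> D $ i $ j = 0"
  and S: "\<And>i j. i \<in> S ==> \<rho> i < \<rho> j ==> j \<in> S"
 shows "det (minor S (V ** D ** W)) = (\<Prod>i\<in>S. D $ i $ i)"
proof -
 have V0: "V $ i $ l = 0" if "i \<in> S" "l \<notin> S" for i l
 proof -
  have "\<not> \<rho> i < \<rho> l" using S that by blast
  thus ?thesis using V that by (auto simp: unitri_def)
 qed
 have W0: "W $ l $ i = 0" if "i \<in> S" "l \<notin> S" for i l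
 proof -
  have "\<not> \<rho> i < \<rho> l" using S that by blast
  thus ?thesis using W that by (auto simp: unitri_def)
 qed
 have "minor S (V ** D ** W) = minor S V ** minor S D ** minor S W"
  using minor_mult(2)[of S W "V ** D"] minor_mult(1)[of S V D] V0 W0 by simp
 moreover have "unitri \<rho> (minor S V)" "unitri (\<lambda>i. - \<rho> i) (minor S W)"
  using V W by (auto simp: unitri_def minor_def)
 ultimately have "det (minor S (V ** D ** W)) = det (minor S D)"
  by (simp add: det_mul det_unitri)
 also have "\<dots> = (\<Prod>i\<in>UNIV. if i \<in> S then D $ i $ i else 1)"
  by (subst det_diagonal) (auto simp: minor_def D intro!: prod.cong)
 also have "\<dots> = (\<Prod>i\<in>S. D $ i $ i)" by (simp add: prod.If_cases)
 finally show ?thesis .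
qed

text \<open>The polynomial \<open>x^m - 1\<close> has simple roots, so \<open>z\<close> acts by
  scalars on the images of its spectral idempotents, and these commute with
  \<open>S\<close>.\<close>

lemma simdiag_finite_order:
 fixes z :: "complex^'n^'n"
 assumes S: "simdiag S" and com: "\<And>A. A \<in> S ==> z ** A = A ** z" and m: "0 < m" "mpow z m = mat 1"
 shows "simdiag (S \<union> {z})"
proof -
 define p :: "complex poly" where "p = monom 1 m - 1"
 have "coeff p m = 1" using m(1) by (simp add: p_def)
 hence p: "p ~= 0" by auto
 have "pmat z p = 0"
  unfolding p_def pmat_diff using m(2) by (simp add: pmat_monom pmat_1)
 then obtain E where E: "(\<Sum>l | poly p l = 0. E l) = mat 1"
  "\<And>l. mpow (z - l \<cdot> mat 1) (Polynomial.order l p) ** E l = 0" "\<And>l. \<exists>q. E l = pmat z q"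
  using spectral_idempotents[OF p] by metis
 show ?thesis
 proof (rule simdiag_Un[OF S _ E(1)])
  show "finite {l. poly p l = 0}" by (rule poly_roots_finite[OF p])
  fix l assume l: "l \<in> {l. poly p l = 0}"
  show "E l ** A = A ** E l" if "A \<in> S" for A
   using E(3)[of l] pmat_commute[OF com[OF that]] by auto
  fix D assume "D \<in> {z}"
  have "l ^ m = 1" using l by (simp add: p_def poly_monom)
  hence "l ~= 0" using m(1) by (auto simp: power_0_left)
  hence "poly (pderiv p) l ~= 0" using m(1) by (simp add: p_def pderiv_diff pderiv_monom poly_monom)
  hence "Polynomial.order l (pderiv p) = 0" by (simp add: order_0I)
  moreover have "pderiv p ~= 0" using \<open>poly (pderiv p) l ~= 0\<close> by auto
  ultimately have "Polynomial.order l p = 1"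
   using order_pderiv[of p l] l p by (simp add: order_root)
  hence "(z - l \<cdot> mat 1) ** E l = 0" using E(2)[of l] by simp
  hence "z ** E l = l \<cdot> E l" by (simp add: matrix_ring_simps mat_scale_simps)
  thus "\<exists>c. D ** E l = c \<cdot> E l" using \<open>D \<in> {z}\<close> by blast
 qed
qed

context g2_setting
begin

lemma Z1_finite_order:
 assumes z: "z \<in> Z1"
 shows "\<exists>m>0. mpow z m = mat 1"
proof -
 note Zg = closed_subgroupD[OF Z1_closed]
 have pow: "mpow z k \<in> Z1" for k by (induction k) (simp_all add: Zg z)
 have "\<not> inj (mpow z)"
  using finite_subset[of "range (mpow z)" Z1] pow finite_Z1 range_inj_infinite[of "mpow z"] by auto
 then obtain j k where jk: "mpow z j = mpow z k" "j < k"
  unfolding inj_def by (metis linorder_neqE_nat)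
 have "mpow z j ** mpow z (k - j) = mpow z j" using jk mpow_add[of z j "k - j"] by simp
 hence "matrix_inv (mpow z j) ** (mpow z j ** mpow z (k - j)) = mat 1"
  using matrix_inv_mult(1)[OF Zg(1)[OF pow]] by simp
 thus ?thesis
  using jk(2) matrix_inv_mult(1)[OF Zg(1)[OF pow]] by (intro exI[of _ "k - j"]) (simp add: matrix_mul_assoc)
qed

text \<open>The torus component of an element of the cell is a rational function
  \<open>\<pi>\<close> of it, given by quotients of minors. For \<open>f\<close> vanishing on
  \<open>T\<close>, clearing denominators in \<open>f (\<pi> A)\<close> gives a polynomial that
  vanishes on the cell, hence on \<open>G\<close>. At \<open>z\<close> itself \<open>\<pi>\<close>
  returns \<open>z\<close>, so \<open>f\<close> vanishes there.\<close>

lemma Z1_subset_T: "Z1 \<subseteq> T"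
proof
 fix z assume z: "z \<in> Z1"
 have zG: "z \<in> G" and zi: "invertible z" using z G_group(1) by (auto simp: Z1_def)
 obtain m where m: "0 < m" "mpow z m = mat 1" using Z1_finite_order[OF z] by blast
 have com: "z ** A = A ** z" if "A \<in> T" for A
  using Z1_commute_zcl[OF z] zcl_gen_G T_subset that by blast
 have sd: "simdiag (T \<union> {z})" by (rule simdiag_finite_order[OF T_simdiag com m])
 obtain P :: "complex^'n^'n" where P0: "invertible P"
  "\<forall>A\<in>T \<union> {z}. \<forall>i j. i ~= j --> (matrix_inv P ** A ** P) $ i $ j = 0"
  using simdiag_imp_diagonalizable[OF sd] by (elim exE conjE) (rule that)
 note P = P0(1) P0(2)[rule_format]
 define cj where "cj A = matrix_inv P ** A ** P" for A
 have cj_mult: "cj (A ** C) = cj A ** cj C" for A C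
 proof -
  have "cj A ** cj C = matrix_inv P ** A ** (P ** matrix_inv P) ** C ** P" by (simp only: cj_def matrix_mul_assoc)
  thus ?thesis by (simp add: cj_def matrix_inv_mult(2)[OF P(1)] matrix_mul_assoc)
 qed
 have cj_inv: "P ** cj A ** matrix_inv P = A" for A
 proof -
  have "P ** cj A ** matrix_inv P = (P ** matrix_inv P) ** A ** (P ** matrix_inv P)" by (simp only: cj_def matrix_mul_assoc)
  thus ?thesis by (simp add: matrix_inv_mult(2)[OF P(1)])
 qed
 have cj_Ad: "cj A = Ad (matrix_inv P) A" for A by (simp add: cj_def Ad_def matrix_inv_inv[OF P(1)])
 have diag: "cj A $ i $ j = 0" if "A \<in> T \<union> {z}" "i ~= j" for A i j using P(2)[OF that] by (simp add: cj_def)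
 have h0diag: "cj h0 $ i $ j = 0" if "i ~= j" for i j
 proof -
  have "mderiv (\<lambda>t. matrix_inv P ** mexp h0 t ** P) (matrix_inv P ** (h0 ** mexp h0 0) ** P) 0"
   using mderiv_mult[OF mderiv_mult[OF mderiv_const mderiv_mexp] mderiv_const, of "matrix_inv P" h0 P 0]
   by (simp add: matrix_ring_simps)
  hence "((\<lambda>t. cj (mexp h0 t) $ i $ j) has_field_derivative cj h0 $ i $ j) (at 0)"
   by (simp add: mderiv_def cj_def)
  moreover have "(\<lambda>t. cj (mexp h0 t) $ i $ j) = (\<lambda>t. 0)"
   using diag[OF UnI1[OF mexp_T[OF h0(1)]] that] by blast
  ultimately show ?thesis using DERIV_unique[OF _ DERIV_const] by metis
 qed
 \<comment> \<open>Conjugated by \<open>P\<close>, \<open>h0\<close> is diagonal. A vector of height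
   \<open>n\<close> connects only indices whose values of \<open>\<rho>\<close> differ by
   \<open>n\<close>, which makes the unipotent factors triangular.\<close>
 define \<rho> where "\<rho> i = Re (cj h0 $ i $ i)" for i
 have tri: "cj X $ i $ j = 0" if s: "s = 1 \<or> s = - 1" and X: "X \<in> gr s s 1" and ij: "s * \<rho> i \<le> s * \<rho> j" for s :: int and X i j
 proof -
  have "X \<in> {X. cj X $ i $ j = 0}"
  proof (rule gr_induct[OF X])
   show "mm.subspace {X. cj X $ i $ j = 0}"
    by (rule mm.subspaceI) (simp_all add: cj_Ad Ad_simps)
   fix c Y assume c: "1 \<le> s * fst c + s * snd c" and Y: "Y \<in> gs c"
   have "cj (br h0 Y) = br (cj h0) (cj Y)"
    unfolding cj_Ad by (rule Ad_br[OF invertible_matrix_inv[OF P(1)]])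
   moreover have "cj (br h0 Y) = of_int (fst c + snd c) \<cdot> cj Y" unfolding br_h0[OF Y] cj_Ad Ad_simps(3) ..
   ultimately have "br (cj h0) (cj Y) = of_int (fst c + snd c) \<cdot> cj Y" by (rule trans[OF sym])
   from arg_cong[OF this, of "\<lambda>A. A $ i $ j"]
   have "br (cj h0) (cj Y) $ i $ j = of_int (fst c + snd c) * cj Y $ i $ j" by simp
   hence "(cj h0 $ i $ i - cj h0 $ j $ j) * cj Y $ i $ j = of_int (fst c + snd c) * cj Y $ i $ j"
    unfolding br_def using diag_mult[of "cj h0" "cj Y" i j] h0diag by (simp add: algebra_simps)
   hence "cj Y $ i $ j = 0 \<or> cj h0 $ i $ i - cj h0 $ j $ j = of_int (fst c + snd c)" by auto
   moreover have "cj h0 $ i $ i - cj h0 $ j $ j ~= of_int (fst c + snd c)"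
   proof
    assume "cj h0 $ i $ i - cj h0 $ j $ j = of_int (fst c + snd c)"
    from arg_cong[OF this, of Re] have "\<rho> i - \<rho> j = fst c + snd c" by (simp add: \<rho>_def)
    moreover have "of_int (fst c + snd c) \<ge> (1::real) \<or> of_int (fst c + snd c) \<le> (-1::real)"
     using c s by auto
    ultimately show False using s c ij by auto
   qed
   ultimately show "Y \<in> {X. cj X $ i $ j = 0}" by blast
  qed
  thus ?thesis by blast
 qed
 have uni: "unitri (\<lambda>i. - s * \<rho> i) (cj g)" if s: "s = 1 \<or> s = - 1" and g: "g \<in> gen (gr s s 1)" for s :: int and g
  using g
 proof induction
  case one
  have "cj (mat 1) = mat 1" by (simp add: cj_def matrix_inv_mult(1)[OF P(1)])
  thus ?case by (simp only:) (simp add: unitri_def mat_def)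
 next
  case (step X g t)
  have "cj (mexp X t) = mexp (cj X) t"
   using mexp_conj[OF invertible_matrix_inv[OF P(1)], of X t] unfolding cj_Ad
   by (simp add: matrix_inv_inv[OF P(1)] Ad_def)
  moreover have "unitri (\<lambda>i. - s * \<rho> i) (mexp (cj X) t)"
   by (rule unitri_mexp) (use tri[OF s step.hyps(1)] in simp)
  ultimately show ?case unfolding cj_mult using unitri_mult step.IH by simp
 qed
 \<comment> \<open>On the cell, the quotient of the minors of \<open>insert i (S i)\<close> and
   \<open>S i\<close> is the diagonal entry of the torus component at \<open>i\<close>. The strict
   inequality keeps \<open>i\<close> out of \<open>S i\<close>.\<close>
 define S where "S i = {j. \<rho> i < \<rho> j}" for i
 define num where "num i A = det (minor (insert i (S i)) (cj A))" for i A
 define den where "den i A = det (minor (S i) (cj A))" for i A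
 define \<delta> where "\<delta> A = (\<Prod>i\<in>UNIV. den i A)" for A
 define \<pi> where "\<pi> A = P ** (\<chi> i j. if i = j then num i A / den i A else 0) ** matrix_inv P" for A
 have minor_poly: "(\<lambda>A. det (minor R (cj A))) \<in> poly_fun" for R
 proof (rule poly_fun_det)
  fix i j
  show "(\<lambda>A. minor R (cj A) $ i $ j) \<in> poly_fun"
   using poly_fun_subst[OF poly_fun.coord[of i j], of "matrix_inv P" P]
   by (cases "i \<in> R"; cases "j \<in> R"; cases "i = j") (simp_all add: minor_def cj_def poly_fun.const)
 qed
 have cell: "num i (v ** t ** u) = cj t $ i $ i * den i (v ** t ** u)" "den i (v ** t ** u) ~= 0"
  if v: "v \<in> gen (gr (-1) (-1) 1)" and t: "t \<in> T \<union> {z}" and u: "u \<in> gen (gr 1 1 1)" for v t u i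
 proof -
  have U: "unitri \<rho> (cj v)" "unitri (\<lambda>i. - \<rho> i) (cj u)" using uni[of "-1" v] uni[of 1 u] v u by simp_all
  have den: "den i (v ** t ** u) = (\<Prod>i\<in>S i. cj t $ i $ i)"
   unfolding den_def cj_mult by (rule det_minor_cell[OF U diag[OF t]]) (auto simp: S_def)
  have "num i (v ** t ** u) = (\<Prod>i\<in>insert i (S i). cj t $ i $ i)"
   unfolding num_def cj_mult by (rule det_minor_cell[OF U diag[OF t]]) (auto simp: S_def)
  moreover have "i \<notin> S i" by (simp add: S_def)
  ultimately show "num i (v ** t ** u) = cj t $ i $ i * den i (v ** t ** u)" by (simp add: den)
  have "invertible t" using t zi T_group(1) by auto
  hence "det (cj t) ~= 0"
   unfolding cj_def using P(1) by (simp add: det_mul det_nz invertible_matrix_inv)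
  hence "cj t $ j $ j ~= 0" for j using det_diagonal[of "cj t"] diag[OF t] by auto
  thus "den i (v ** t ** u) ~= 0" by (simp add: den)
 qed
 have \<pi>: "\<pi> (v ** t ** u) = t" "\<delta> (v ** t ** u) ~= 0"
  if "v \<in> gen (gr (-1) (-1) 1)" "t \<in> T \<union> {z}" "u \<in> gen (gr 1 1 1)" for v t u
 proof -
  have "(\<chi> i j. if i = j then num i (v ** t ** u) / den i (v ** t ** u) else 0) = cj t"
   using cell[OF that] diag[OF that(2)] by (simp add: vec_eq_iff)
  thus "\<pi> (v ** t ** u) = t" unfolding \<pi>_def by (simp only: cj_inv)
  show "\<delta> (v ** t ** u) ~= 0" unfolding \<delta>_def using cell(2)[OF that] by simp
 qed
 have \<delta>_poly: "\<delta> \<in> poly_fun" unfolding \<delta>_def den_def by (intro poly_fun_prod minor_poly)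
 have \<pi>_loc: "(\<lambda>A. \<pi> A $ a $ b) \<in> loc_fun \<delta>" for a b
 proof -
  have "(\<lambda>A. num i A / den i A) \<in> loc_fun \<delta>" for i
  proof (rule loc_funI[where k = 1])
   show "(\<lambda>A. num i A * (\<Prod>j\<in>UNIV - {i}. den j A)) \<in> poly_fun"
    unfolding num_def den_def by (intro poly_fun.mult poly_fun_prod minor_poly)
   fix A assume "\<delta> A ~= 0"
   moreover have "\<delta> A = den i A * (\<Prod>j\<in>UNIV - {i}. den j A)" unfolding \<delta>_def by (simp add: prod.remove[of UNIV i])
   ultimately show "num i A / den i A = num i A * (\<Prod>j\<in>UNIV - {i}. den j A) / \<delta> A ^ 1" by simp
  qed
  hence *: "(\<lambda>A. P $ a $ i * (num i A / den i A) * matrix_inv P $ i $ b) \<in> loc_fun \<delta>" for i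
   by (intro loc_fun_mult poly_fun_imp_loc_fun[OF poly_fun.const])
  have "(\<lambda>A. \<Sum>i\<in>I. P $ a $ i * (num i A / den i A) * matrix_inv P $ i $ b) \<in> loc_fun \<delta>" if "finite I" for I
   using that
  proof induction
   case empty
   show ?case using poly_fun_imp_loc_fun[OF poly_fun.const[of 0]] by simp
  next
   case (insert i I)
   thus ?case using loc_fun_add[OF \<delta>_poly *[of i] insert.IH] by simp
  qed
  from this[of UNIV] show ?thesis
   unfolding \<pi>_def matrix_matrix_mult_def by (simp add: if_distrib[of "\<lambda>x. _ * x"] cong: if_cong)
 qed
 have "f z = 0" if f: "f \<in> poly_fun" "\<And>t. t \<in> T ==> f t = 0" for f
 proof -
  from loc_fun_compose[OF f(1) \<delta>_poly \<pi>_loc]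
  obtain q k where q: "q \<in> poly_fun" "\<And>A. \<delta> A ~= 0 ==> f (\<pi> A) = q A / \<delta> A ^ k"
   unfolding loc_fun_def by blast
  have "q z = 0"
  proof (rule big_cell_dense[OF q(1) _ zG])
   fix v t u assume vtu: "v \<in> gen (gr (-1) (-1) 1)" "t \<in> T" "u \<in> gen (gr 1 1 1)"
   hence t: "t \<in> T \<union> {z}" by blast
   show "q (v ** t ** u) = 0"
    using q(2)[OF \<pi>(2)[OF vtu(1) t vtu(3)]] \<pi>[OF vtu(1) t vtu(3)] f(2)[OF vtu(2)] by simp
  qed
  thus ?thesis using q(2)[of z] \<pi>[OF gen.one _ gen.one, of z] by simp
 qed
 hence "z \<in> zcl T" using zi by (simp add: zcl_def)
 thus "z \<in> T" using T_group(5) by simp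
qed

end

section \<open>The Borel subgroup\<close>

text \<open>\<open>Ad g\<close> is injective and \<open>V\<close> has finite dimension, so it maps
  \<open>V\<close> onto itself.\<close>

lemma Ad_inv_stable:
 fixes V :: "(complex^'n^'n) set"
 assumes V: "mm.subspace V" and g: "invertible g" and stable: "\<And>X. X \<in> V ==> Ad g X \<in> V" and X: "X \<in> V"
 shows "Ad (matrix_inv g) X \<in> V"
proof -
 have sub: "subspace V"
  using mm.subspace_0[OF V] mm.subspace_add[OF V] mm.subspace_scale[OF V]
  by (auto simp: subspace_def scaleR_eq_mat_scale)
 have lin: "linear (Ad g)"
  by (rule linearI) (simp_all add: Ad_simps scaleR_eq_mat_scale)
 have inj: "inj (Ad g)"
  by (rule injI) (metis Ad_inv(1)[OF g])
 have "Ad g ` V = V"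
 proof (rule subspace_dim_equal[OF linear_subspace_image[OF lin sub] sub])
  show "Ad g ` V \<subseteq> V" using stable by blast
  show "dim V \<le> dim (Ad g ` V)" using dim_image_eq[OF lin] inj by (metis inj_on_subset order_refl subset_UNIV)
 qed
 then obtain Y where "Y \<in> V" "X = Ad g Y" using X by blast
 thus ?thesis by (simp add: Ad_inv(1)[OF g])
qed

lemma csub_trace:
 fixes X Y :: "complex^'n^'n"
 shows "mm.subspace {X. trace (X ** Y) = 0}" "mm.subspace {Y. trace (X ** Y) = 0}"
proof -

 have 0: "trace (0 :: complex^'n^'n) = 0" by (simp add: trace_def)
 show "mm.subspace {X. trace (X ** Y) = 0}" "mm.subspace {Y. trace (X ** Y) = 0}"
  by (rule mm.subspaceI; simp add: matrix_ring_simps mat_scale_simps(1,2) trace_add 0)+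
qed

context g2_setting
begin

lemma rts_positive: "rts = G2_positive \<union> (\<lambda>(i, j). (- i, - j)) ` G2_positive"
 by (auto simp: rts_def G2_positive_def)

text \<open>Since root spaces are lines, a root of \<open>B\<close> brings the whole root space of
  \<open>G\<close> with it, and the exponentials of \<open>gs (0, 0)\<close> already lie in
  \<open>T\<close>. In the other direction, all weights of \<open>B\<close> are weights of
  \<open>G\<close>.\<close>

lemma lie_B: "lie_algebra B = gr 1 1 0"
proof
 have bg: "lie_algebra B \<subseteq> \<g>" unfolding \<g>_def by (rule lie_algebra_mono[OF B_subset])
 have csub: "mm.subspace (lie_algebra B)" by (rule csubspace_lie_algebra[OF B_closed])
 have stable: "pc c X \<in> lie_algebra B" if "X \<in> lie_algebra B" for c X
  by (rule pc_stable[OF csub _ that]) (use Ad_lie_algebra[OF B_closed] TB in blast)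
 have rootsB: "roots B T = chr ` G2_positive" and rootsG: "roots G T = chr ` rts"
  using simple unfolding G2_simple_roots_def rts_positive by simp_all
 show "lie_algebra B \<subseteq> gr 1 1 0"
 proof
  fix X assume X: "X \<in> lie_algebra B"
  have "pc c X = 0" if c: "c \<in> wts" "1 * fst c + 1 * snd c < 0" for c
  proof (rule ccontr)
   assume nz: "pc c X ~= 0"
   have "c \<in> rts" by (rule rts_wts(2)[OF c(1)]) (use c(2) in auto)
   hence "chr c \<in> roots G T" unfolding rootsG by blast
   moreover have "pc c X \<in> root_space B T (chr c)"
    using stable[OF X, of c] pc_in_gs[OF subsetD[OF bg X], of c] unfolding gs_iff root_space_def by simp
   ultimately have "chr c \<in> roots B T" using nz unfolding roots_def by blast
   hence "c \<in> G2_positive" unfolding rootsB using lin_comb_inj by blast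
   thus False using c(2) by (auto simp: G2_positive_def)
  qed
  thus "X \<in> gr 1 1 0" using X bg by (auto simp: gr_def)
 qed
 show "gr 1 1 0 \<subseteq> lie_algebra B"
 proof
  fix X assume "X \<in> gr 1 1 0"
  thus "X \<in> lie_algebra B"
  proof (rule gr_induct[OF _ csub])
   fix c Y assume c: "c \<in> wts" "0 \<le> 1 * fst c + 1 * snd c" and Y: "Y \<in> gs c"
   show "Y \<in> lie_algebra B"
   proof (cases "c = (0, 0)")
    case True
    thus ?thesis using mexp_T Y TB by (intro mexp_lie_algebraI) blast
   next
    case False
    hence cr: "c \<in> rts" by (rule rts_wts(2)[OF c(1)])
    hence "c \<in> G2_positive" unfolding rts_def using c(2) by (elim insertE) (simp_all add: G2_positive_def)
    hence "chr c \<in> roots B T" unfolding rootsB by blast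
    then obtain e where e: "e \<in> root_space B T (chr c)" "e ~= 0"
     unfolding roots_def using mm.subspace_0[OF csub] by (auto simp: root_space_def Ad_simps)
    hence "e \<in> gs c" "e \<in> lie_algebra B" using bg unfolding gs_iff root_space_def by blast+
    thus ?thesis using gs_1dim[OF cr _ e(2) Y] mm.subspace_scale[OF csub] by blast
   qed
  qed
 qed
qed

lemma gen_gr_B: "u \<in> gen (gr 1 1 1) ==> u \<in> B"
 using gen_subset[OF B_closed, of "gr 1 1 1"] mexp_in_closed_subgroup[OF B_closed] lie_B gr_mono[of 0 1 1 1] by auto

lemma Ad_T_gr: "t \<in> T ==> X \<in> gr p q k ==> Ad t X \<in> gr p q k"
proof -
 assume t: "t \<in> T" and X: "X \<in> gr p q k"
 have "X \<in> {X. Ad t X \<in> gr p q k}"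
 proof (rule gr_induct[OF X])
  show "mm.subspace {X. Ad t X \<in> gr p q k}"
   using csub_gr[of p q k] unfolding mm.subspace_def by (auto simp: Ad_simps)
  fix c Y assume "k \<le> p * fst c + q * snd c" "Y \<in> gs c"
  thus "Y \<in> {X. Ad t X \<in> gr p q k}"
   using t gr_scale[OF gs_gr] by (simp add: gs_iff)
 qed
 thus ?thesis by blast
qed

text \<open>The trace form pairs opposite weights. The orthogonality shows that an element
  normalising \<open>gr 1 1 0\<close> normalises \<open>gr 1 1 1\<close> as well.\<close>

lemma gr_1_1_perp: "gr 1 1 1 = {X \<in> \<g>. \<forall>Y\<in>gr 1 1 0. trace (X ** Y) = 0}"
proof (intro equalityI subsetI)
 fix X assume X: "X \<in> gr 1 1 1"
 have "trace (X ** Y) = 0" if Y: "Y \<in> gr 1 1 0" for Y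
 proof -
  have "X \<in> {X. trace (X ** Y) = 0}"
  proof (rule gr_induct[OF X])
   show "mm.subspace {X. trace (X ** Y) = 0}"
    by (rule csub_trace)
   fix c X assume c: "c \<in> wts" "1 \<le> 1 * fst c + 1 * snd c" and X: "X \<in> gs c"
   have "Y \<in> {Y. trace (X ** Y) = 0}"
   proof (rule gr_induct[OF Y])
    show "mm.subspace {Y. trace (X ** Y) = 0}"
     by (rule csub_trace)
    fix d Y assume "d \<in> wts" "0 \<le> 1 * fst d + 1 * snd d" "Y \<in> gs d"
    thus "Y \<in> {Y. trace (X ** Y) = 0}" using trace_gs[OF X, of Y d] c by (auto simp: prod_eq_iff)
   qed
   thus "X \<in> {X. trace (X ** Y) = 0}" by blast
  qed
  thus ?thesis by blast
 qed
 thus "X \<in> {X \<in> \<g>. \<forall>Y\<in>gr 1 1 0. trace (X ** Y) = 0}" using gr_g[OF X] by blast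
next
 fix X assume "X \<in> {X \<in> \<g>. \<forall>Y\<in>gr 1 1 0. trace (X ** Y) = 0}"
 hence X: "X \<in> \<g>" "\<And>Y. Y \<in> gr 1 1 0 ==> trace (X ** Y) = 0" by blast+
 have "pc c X = 0" if c: "c \<in> wts" "1 * fst c + 1 * snd c < 1" for c
 proof (rule ccontr)
  assume "pc c X ~= 0"
  then obtain Y where Y: "Y \<in> gs (- c)" "trace (pc c X ** Y) ~= 0"
   using nondeg_gs[OF pc_in_gs[OF X(1)]] by blast
  have "trace (X ** Y) = trace ((\<Sum>d\<in>wts. pc d X) ** Y)" by (simp add: sum_pc[OF X(1)])
  also have "\<dots> = (\<Sum>d\<in>wts. trace (pc d X ** Y))" by (simp add: matrix_sum_left trace_def sum_component) (rule sum.swap)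
  also have "\<dots> = (\<Sum>d\<in>wts. if d = c then trace (pc c X ** Y) else 0)"
  proof (rule sum.cong[OF refl])
   fix d show "trace (pc d X ** Y) = (if d = c then trace (pc c X ** Y) else 0)"
    using trace_gs[OF pc_in_gs[OF X(1), of d] Y(1)] by (cases "d = c") (simp, force simp: prod_eq_iff)
  qed
  also have "\<dots> = trace (pc c X ** Y)" using c(1) by simp
  finally show False using X(2)[of Y] Y gs_gr[OF Y(1), of 0 1 1] c(2) by simp
 qed
 thus "X \<in> gr 1 1 1" using X(1) by (auto simp: gr_def)
qed

text \<open>A normaliser preserves the heights at least 0, 1 and 2, so it sends \<open>h0\<close> to
  \<open>h0\<close> up to positive height. A unipotent correction makes it fix \<open>h0\<close>,
  and such elements lie in \<open>T\<close> now that \<open>Z1\<close> does.\<close>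

lemma borel_normaliser:
 assumes g: "g \<in> G" and stable: "\<And>X. X \<in> gr 1 1 0 ==> Ad g X \<in> gr 1 1 0"
 shows "\<exists>u\<in>gen (gr 1 1 1). \<exists>t\<in>T. g = u ** t"
proof -
 note gi = G_group(1)[OF g]
 have stable': "Ad (matrix_inv g) X \<in> gr 1 1 0" if "X \<in> gr 1 1 0" for X
  by (rule Ad_inv_stable[OF csub_gr gi stable that])
 have n: "Ad g X \<in> gr 1 1 1" if X: "X \<in> gr 1 1 1" for X
  unfolding gr_1_1_perp
 proof (intro CollectI conjI ballI)
  show "Ad g X \<in> \<g>" by (rule Ad_g[OF g gr_g[OF X]])
  fix Y assume Y: "Y \<in> gr 1 1 0"
  have "trace (Ad g X ** Y) = trace (X ** Ad (matrix_inv g) Y)"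
   using trace_Ad_Ad[OF gi, of X "Ad (matrix_inv g) Y"] by (simp add: Ad_inv(2)[OF gi])
  thus "trace (Ad g X ** Y) = 0" using X stable'[OF Y] unfolding gr_1_1_perp by simp
 qed
 have n': "Ad (matrix_inv g) X \<in> gr 1 1 1" if "X \<in> gr 1 1 1" for X
  by (rule Ad_inv_stable[OF csub_gr gi n that])
 have br_n: "br X Y \<in> gr 1 1 2" if "X \<in> gr 1 1 1" "Y \<in> gr 1 1 1" for X Y using br_gr[OF that] by simp
 have n2: "Ad g X \<in> gr 1 1 2" if X: "X \<in> gr 1 1 2" for X
 proof -
  have csub: "mm.subspace {X. Ad g X \<in> gr 1 1 2}"
   using csub_gr[of 1 1 2] unfolding mm.subspace_def by (auto simp: Ad_simps)
  have "X \<in> {X. Ad g X \<in> gr 1 1 2}"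
  proof (rule gr_induct[OF X csub])
   fix c Y assume c: "c \<in> wts" "2 \<le> 1 * fst c + 1 * snd c" and Y: "Y \<in> gs c"
   obtain a b where ab: "a \<in> rts" "b \<in> rts" "a + b = c" "1 \<le> fst a + snd a" "1 \<le> fst b + snd b" "c \<in> rts"
   proof -
    have "c \<in> {(1,1), (2,1), (3,1), (3,2)}" using c by (auto simp: wts_eq)
    thus ?thesis
     using that[of "(0,1)" "(1,0)"] that[of "(1,1)" "(1,0)"] that[of "(2,1)" "(1,0)"] that[of "(3,1)" "(0,1)"]
     by (auto simp: rts_def)
   qed
   have ne: "br (ee a) (ee b) ~= 0" by (rule root_string[OF ab(1,2) _ ee[OF ab(1)] ee[OF ab(2)]]) (use ab in simp)
   have "br (ee a) (ee b) \<in> gs c" using br_gs[OF ee(1)[OF ab(1)] ee(1)[OF ab(2)]] ab(3) by simp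
   then obtain k where k: "Y = k \<cdot> br (ee a) (ee b)" using gs_1dim[OF ab(6) _ ne Y] by blast
   have "ee a \<in> gr 1 1 1" "ee b \<in> gr 1 1 1" using ab by (auto intro!: gs_gr[OF ee(1)])
   hence "Ad g (br (ee a) (ee b)) \<in> gr 1 1 2" unfolding Ad_br[OF gi] by (intro br_n n)
   thus "Y \<in> {X. Ad g X \<in> gr 1 1 2}" unfolding k using mm.subspace_scale[OF csub] by blast
  qed
  thus ?thesis by blast
 qed
 have n2': "Ad (matrix_inv g) X \<in> gr 1 1 2" if "X \<in> gr 1 1 2" for X
  by (rule Ad_inv_stable[OF csub_gr gi n2 that])
 define Z where "Z = Ad g h0"
 have Z0: "Z \<in> gr 1 1 0" unfolding Z_def by (rule stable[OF gs_gr[OF h0(1)]]) simp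
 define h' where "h' = pc (0,0) Z"
 have h': "h' \<in> gs (0,0)" unfolding h'_def by (rule pc_in_gs[OF gr_g[OF Z0]])
 have Z1: "Z - h' \<in> gr 1 1 1" unfolding h'_def by (rule gr_minus_cartan[OF _ Z0]) simp
 \<comment> \<open>On height one modulo height two \<open>h0\<close> acts as the identity.
   Transported by \<open>g\<close>, the same must hold for the Cartan part of
   \<open>Ad g h0\<close>.\<close>
 have one: "ev c h' = 1" if c: "c \<in> {(1,0), (0,1)}" for c
 proof (rule ccontr)
  assume ne: "ev c h' ~= 1"
  have cr: "c \<in> rts" using c by (auto simp: rts_def)
  have ec: "ee c \<in> gr 1 1 1" using c by (auto intro!: gs_gr[OF ee(1)[OF cr]])
  define X where "X = Ad (matrix_inv g) (ee c)"
  have X: "X \<in> gr 1 1 1" unfolding X_def by (rule n'[OF ec])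
  have "br Z (ee c) - ev c h' \<cdot> ee c = br (Z - h') (ee c)"
   using br_h[OF h' ee(1)[OF cr]] by (simp add: br_simps)
  hence "br Z (ee c) - ev c h' \<cdot> ee c \<in> gr 1 1 2" using br_n[OF Z1 ec] by simp
  from n2'[OF this] have "br h0 X - ev c h' \<cdot> X \<in> gr 1 1 2"
   by (simp add: Ad_simps Ad_br[OF invertible_matrix_inv[OF gi]] Z_def X_def Ad_inv(1)[OF gi])
  moreover have "br h0 X - X \<in> gr 1 1 2" using br_h0_gr[of 1, OF _ X] by simp
  ultimately have "(br h0 X - X) - (br h0 X - ev c h' \<cdot> X) \<in> gr 1 1 2"
   using gr_diff by blast
  hence "(ev c h' - 1) \<cdot> X \<in> gr 1 1 2" by (simp add: mm.scale_left_diff_distrib)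
  hence "inverse (ev c h' - 1) \<cdot> (ev c h' - 1) \<cdot> X \<in> gr 1 1 2" by (rule gr_scale)
  hence "X \<in> gr 1 1 2" using ne by (simp only: mm.scale_scale) simp
  from n2[OF this] have "ee c \<in> gr 1 1 2" by (simp add: X_def Ad_inv(2)[OF gi])
  moreover have "c \<in> wts" "fst c + snd c < 2" using c cr rts_wts(1) by auto
  ultimately have "pc c (ee c) = 0" by (simp add: gr_def)
  thus False using pc_gs[OF ee(1)[OF cr], of c] ee(2)[OF cr] by simp
 qed
 have "h' = h0" by (rule h0_unique[OF h']) (simp_all add: one)
 hence "Z - h0 \<in> gr 1 1 1" using Z1 by simp
 then obtain w where w: "w \<in> gen (gr 1 1 1)" "Ad w Z = h0" using conjugate_to_h0[of 1] by blast
 have wG: "w \<in> G" by (rule gen_gr_G[OF w(1)])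
 have fx: "Ad (w ** g) h0 = h0" using w(2) by (simp add: Ad_mult[OF G_group(1)[OF wG] gi] Z_def)
 obtain h z where hz: "h \<in> gs (0,0)" "z \<in> Z1" "w ** g = mexp h 1 ** z"
  using fixes_h0[OF G_group(3)[OF wG g] fx] by (elim bexE) auto
 have "w ** g \<in> T" unfolding hz(3) using mexp_T[OF hz(1)] Z1_subset_T hz(2) T_group(3) by blast
 moreover have "g = matrix_inv w ** (w ** g)"
  by (simp add: matrix_mul_assoc matrix_inv_mult(1)[OF G_group(1)[OF wG]])
 ultimately show ?thesis using gen_inv[OF w(1)] by blast
qed

lemma B_decomp: "b \<in> B ==> \<exists>u\<in>gen (gr 1 1 1). \<exists>t\<in>T. b = u ** t"
 using borel_normaliser[of b] Ad_lie_algebra[OF B_closed, of b] B_subset unfolding lie_B by blast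

lemma in_B_if_normalises:
 "g \<in> G ==> (\<And>X. X \<in> gr 1 1 0 ==> Ad g X \<in> gr 1 1 0) ==> g \<in> B"
 using borel_normaliser[of g] gen_gr_B TB B_group(3) by blast

lemma B_stable:
 assumes pq: "0 \<le> p" "0 \<le> q" and b: "b \<in> B" and X: "X \<in> gr p q k"
 shows "Ad b X \<in> gr p q k"
proof -
 obtain u t where ut: "u \<in> gen (gr 1 1 1)" "t \<in> T" "b = u ** t" using B_decomp[OF b] by blast
 have "gr 1 1 1 \<subseteq> gr p q 0"
 proof
  fix X assume "X \<in> gr 1 1 1"
  thus "X \<in> gr p q 0"
  proof (rule gr_induct[OF _ csub_gr])
   fix c Y assume c: "c \<in> wts" "1 \<le> 1 * fst c + 1 * snd c" and Y: "Y \<in> gs c"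
   have "0 \<le> fst c" "0 \<le> snd c" using c by (auto simp: wts_eq)
   thus "Y \<in> gr p q 0" using pq by (intro gs_gr[OF Y]) auto
  qed
 qed
 hence "u \<in> gen (gr p q 0)" using gen_mono ut(1) by blast
 thus ?thesis
  using gr_stable Ad_T_gr[OF ut(2) X] Ad_mult[of u t X] gen_invertible[OF ut(1)] T_group(1)[OF ut(2)] ut(3) by simp
qed

end

section \<open>Reflections\<close>

context g2_setting
begin

lemma pc_br:
 assumes X: "X \<in> \<g>" and Y: "Y \<in> gs d"
 shows "pc (c + d) (br X Y) = br (pc c X) Y"
proof -
 have "br X Y = (\<Sum>a\<in>wts. br (pc a X) Y)" by (subst sum_pc[OF X, symmetric]) (rule br_sum_left)
 hence "pc (c + d) (br X Y) = (\<Sum>a\<in>wts. pc (c + d) (br (pc a X) Y))" by (simp add: pc_sum)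
 also have "\<dots> = (\<Sum>a\<in>wts. if a = c then br (pc c X) Y else 0)"
 proof (rule sum.cong[OF refl])
  fix a show "pc (c + d) (br (pc a X) Y) = (if a = c then br (pc c X) Y else 0)"
   using pc_gs[OF br_gs[OF pc_in_gs[OF X, of a] Y], of "c + d"] by auto
 qed
 also have "\<dots> = br (pc c X) Y"
  using gs_outside[OF _ pc_in_gs[OF X, of c]] by (cases "c \<in> wts") (auto simp: br_simps)
 finally show ?thesis .
qed

lemma br_ee_eq_0:
 assumes "c \<in> rts" "d \<in> rts" "c + d \<in> rts" "X \<in> \<g>" "pc (c + d) (br X (ee d)) = 0"
 shows "pc c X = 0"
proof -
 have "cf c X \<cdot> br (ee c) (ee d) = 0"
  using assms(5) unfolding pc_br[OF assms(4) ee(1)[OF assms(2)]] pc_cf[OF assms(1,4)] by (simp add: br_simps)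
 thus ?thesis
  using root_string[OF assms(1-3) ee[OF assms(1)] ee[OF assms(2)]] by (simp add: pc_cf[OF assms(1,4)])
qed

lemma eigen_gs:
 assumes Y: "Y \<in> \<g>" and eig: "\<And>h. h \<in> gs (0,0) ==> br h Y = ev d h \<cdot> Y"
 shows "Y \<in> gs d"
proof -
 have "pc c Y = 0" if c: "c ~= d" for c
 proof -
  \<comment> \<open>Prescribing the coordinates of \<open>c - d\<close> as values on the simple
    roots makes the difference of the two eigenvalues a sum of two squares.\<close>
  obtain h where h: "h \<in> gs (0,0)" "ev (1,0) h = of_int (fst (c - d))" "ev (0,1) h = of_int (snd (c - d))"
   using ex_cartan by blast
  have "ev c h - ev d h = of_int (fst (c - d) ^ 2 + snd (c - d) ^ 2)"
  proof -
   have e: "fst (eig h) = of_int (fst (c - d))" "snd (eig h) = of_int (snd (c - d))" using h(2,3) by (simp_all add: ev_def)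
   show ?thesis unfolding ev_def e by (simp add: algebra_simps power2_eq_square)
  qed
  moreover have "fst (c - d) ^ 2 + snd (c - d) ^ 2 ~= 0" using c by (simp add: sum_power2_eq_zero_iff prod_eq_iff)
  ultimately have ne: "ev c h - ev d h ~= 0" by (simp only: of_int_eq_0_iff) simp
  have "pc c (br h Y) = br h (pc c Y)"
   using pc_br[OF Y h(1), of c] br_anti[of h Y] br_anti[of h "pc c Y"] pc_scale[of c "-1" "br Y h"] mm.scale_minus_left[of 1]
   by (simp add: zero_prod_def[symmetric])
  hence "(ev c h - ev d h) \<cdot> pc c Y = 0"
   unfolding eig[OF h(1)] pc_scale br_h[OF h(1) pc_in_gs[OF Y]] mm.scale_left_diff_distrib by (simp only: diff_self)
  thus ?thesis using ne by simp
 qed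
 hence "(\<Sum>c\<in>wts. pc c Y) = (\<Sum>c\<in>wts. if c = d then pc d Y else 0)" by (intro sum.cong) auto
 also have "\<dots> = pc d Y" using gs_outside[OF _ pc_in_gs[OF Y, of d]] by simp
 finally show ?thesis using sum_pc[OF Y] pc_in_gs[OF Y, of d] by simp
qed

lemma Ad_mexp_step2:
 assumes "br X (br X Y) = 0"
 shows "Ad (mexp X t) Y = Y + t \<cdot> br X Y"
 using Ad_mexp_finite[of 2 X Y t] assms by (simp add: numeral_2_eq_2)

lemma Ad_mexp_step3:
 assumes "br X (br X (br X Y)) = 0"
 shows "Ad (mexp X t) Y = Y + t \<cdot> br X Y + (t ^ 2 / 2) \<cdot> br X (br X Y)"
 using Ad_mexp_finite[of 3 X Y t] assms by (simp add: numeral_3_eq_3 power2_eq_square add.assoc)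

text \<open>The usual representative of the reflection in \<open>c\<close>, as a product of three
  exponentials in an \<open>sl(2)\<close> triple.\<close>

definition nn :: "int \<times> int => complex^'n^'n" where
 "nn c = mexp (ee c) 1 ** mexp (- ff c) 1 ** mexp (ee c) 1"

lemma invertible_nn: "invertible (nn c)"
 unfolding nn_def by (intro invertible_mult invertible_mexp)

lemma Ad_nn_cartan:
 assumes c: "c \<in> rts" and h: "h \<in> gs (0,0)"
 shows "Ad (nn c) h = h - ev c h \<cdot> hh c"
proof -
 note e = ee(1)[OF c] and f = ff_gs[OF c] and H = hh(1)[OF c] and H2 = hh(2)[OF c]
 have bh: "br (ee c) h' = (- ev c h') \<cdot> ee c" "br (ff c) h' = ev c h' \<cdot> ff c" if "h' \<in> gs (0,0)" for h'
  using br_h_right[OF that e] br_h_right[OF that f] by (simp_all add: ev_minus)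
 have ef: "br (ee c) (ff c) = hh c" "br (ff c) (ee c) = - hh c" using br_ee_ff br_anti[of "ff c" "ee c"] by auto
 have e1: "Ad (mexp (ee c) 1) h' = h' - ev c h' \<cdot> ee c" if "h' \<in> gs (0,0)" for h'
  using Ad_mexp_step2[of "ee c" h' 1] bh(1)[OF that] by (simp add: br_simps)
 have ee: "Ad (mexp (ee c) 1) (ee c) = ee c" using Ad_mexp_step2[of "ee c" "ee c" 1] by (simp add: br_simps)
 have ef1: "Ad (mexp (ee c) 1) (ff c) = ff c + hh c - ee c"
  using Ad_mexp_step3[of "ee c" "ff c" 1] bh(1)[OF H] by (simp add: br_simps ef H2 mat_scale_simps(6,9,10))
 have f1: "Ad (mexp (- ff c) 1) h = h - ev c h \<cdot> ff c"
  using Ad_mexp_step2[of "- ff c" h 1] bh(2)[OF h] by (simp add: br_simps)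
 have fe: "Ad (mexp (- ff c) 1) (ee c) = ee c + hh c - ff c"
  using Ad_mexp_step3[of "- ff c" "ee c" 1] bh(2)[OF H] by (simp add: br_simps ef H2 mat_scale_simps(6,9,10))
 have "Ad (nn c) h = Ad (mexp (ee c) 1) (Ad (mexp (- ff c) 1) (Ad (mexp (ee c) 1) h))"
  unfolding nn_def by (simp add: Ad_mult invertible_mexp invertible_mult)
 also have "\<dots> = h - ev c h \<cdot> hh c"
  unfolding e1[OF h] by (simp add: Ad_simps f1 fe e1[OF h] e1[OF H] ee ef1 H2 mat_scale_simps(3,4))
   (simp add: vec_eq_iff algebra_simps)
 finally show ?thesis .
qed

lemma nn_gs:
 assumes c: "c \<in> rts" and m: "ev d (hh c) = of_int m" and X: "X \<in> gs d" and cG: "nn c \<in> G"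
 shows "Ad (nn c) X \<in> gs (d - (m * fst c, m * snd c))"
proof (rule eigen_gs)
 show "Ad (nn c) X \<in> \<g>" by (rule Ad_g[OF cG gs_g[OF X]])
 fix h assume h: "h \<in> gs (0,0)"
 define h' where "h' = h - ev c h \<cdot> hh c"
 have sH: "(- ev c h) \<cdot> hh c \<in> gs (0,0)" by (rule mm.subspace_scale[OF csub_gs hh(1)[OF c]])
 have h'_eq: "h' = h + (- ev c h) \<cdot> hh c" by (simp add: h'_def)
 have h': "h' \<in> gs (0,0)" unfolding h'_eq by (rule mm.subspace_add[OF csub_gs h sH])
 have evh': "ev a h' = ev a h - ev c h * ev a (hh c)" for a
  unfolding h'_eq ev_linear(1)[OF h sH] ev_linear(2)[OF hh(1)[OF c] hh(1)[OF c]] by simp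
 have "Ad (nn c) h' = h"
  unfolding Ad_nn_cartan[OF c h'] unfolding evh' hh(2)[OF c] unfolding h'_def
  by (simp add: mm.scale_minus_left)
 hence "br h (Ad (nn c) X) = Ad (nn c) (br h' X)" by (simp add: Ad_br[OF invertible_nn])
 also have "\<dots> = ev d h' \<cdot> Ad (nn c) X" unfolding br_h[OF h' X] Ad_simps ..
 also have "ev d h' = ev (d - (m * fst c, m * snd c)) h"
  unfolding evh' m by (simp add: ev_def algebra_simps)
 finally show "br h (Ad (nn c) X) = ev (d - (m * fst c, m * snd c)) h \<cdot> Ad (nn c) X" .
qed

lemma nn_G: "c \<in> rts ==> nn c \<in> G"
 unfolding nn_def by (intro G_group mexp_G mm.subspace_neg[OF csub_g] gs_g[OF ee(1)] gs_g[OF ff_gs])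

definition nb :: "complex^'n^'n" where "nb = nn (0,1)"
text \<open>This reflection exchanges (2,1) with (1,0) and (3,2) with (0,-1), and fixes (3,1). It
  brings a conjugate of \<open>ee (2,1)\<close> that lies along \<alpha> back to the line of
  \<open>ee (2,1)\<close>.\<close>

definition na :: "complex^'n^'n" where "na = nn (1,1)"

lemma nb_gs: "X \<in> gs (i, j) ==> Ad nb X \<in> gs (i, i - j)"
proof -
 assume X: "X \<in> gs (i, j)"
 have c: "(0,1) \<in> rts" by (simp add: rts_def)
 have "ev (i, j) (hh (0,1)) = of_int (2 * j - i)"
  using ev_hh(2) hh(2)[OF c] by (simp add: ev_def algebra_simps)
 from nn_gs[OF c this X nn_G[OF c]] show ?thesis by (simp add: nb_def)
qed

lemma ev_hh11: "ev (i, j) (hh (1,1)) = of_int (3 * j - i)"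
proof -
 have c: "(1,1) \<in> rts" and d: "(0,-1) \<in> rts" by (simp_all add: rts_def)
 let ?e = "ee (1,1)" and ?y = "ee (0,-1)"
 have 1: "br ?e ?y \<in> gs (1,0)" "br ?e ?y ~= 0"
  using br_gs[OF ee(1)[OF c] ee(1)[OF d]] root_string[OF c d _ ee[OF c] ee[OF d]] by (auto simp: rts_def)
 have 2: "br ?e (br ?e ?y) \<in> gs (2,1)" "br ?e (br ?e ?y) ~= 0"
  using br_gs[OF ee(1)[OF c] 1(1)] root_string[OF c _ _ ee[OF c] 1] by (auto simp: rts_def)
 have 3: "br ?e (br ?e (br ?e ?y)) \<in> gs (3,2)" "br ?e (br ?e (br ?e ?y)) ~= 0"
  using br_gs[OF ee(1)[OF c] 2(1)] root_string[OF c _ _ ee[OF c] 2] by (auto simp: rts_def)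
 have 4: "br ?e (br ?e (br ?e (br ?e ?y))) = 0"
  using br_gs[OF ee(1)[OF c] 3(1)] gs_outside[of "(4,3)"] by (simp add: wts_eq)
 have "ev (0,-1) (hh (1,1)) = - of_nat 3"
  by (rule ev_string[OF c d]) (use 3 4 in \<open>simp_all add: wts_eq numeral_3_eq_3\<close>)
 hence "snd (eig (hh (1,1))) = 3" by (simp add: ev_def)
 moreover from this have "fst (eig (hh (1,1))) = - 1"
  using hh(2)[OF c] by (simp add: ev_def eq_neg_iff_add_eq_0 add.commute)
 ultimately show ?thesis by (simp add: ev_def)
qed

lemma na_gs: "X \<in> gs (i, j) ==> Ad na X \<in> gs (2 * i - 3 * j, i - 2 * j)"
proof -
 assume X: "X \<in> gs (i, j)"
 have c: "(1,1) \<in> rts" by (simp add: rts_def)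
 from nn_gs[OF c ev_hh11 X nn_G[OF c]] show ?thesis by (simp add: na_def algebra_simps)
qed

lemma na_G: "na \<in> G" and nb_G: "nb \<in> G"
 unfolding na_def nb_def by (rule nn_G, simp add: rts_def)+

lemma rts_mem: "(1,0) \<in> rts" "(0,1) \<in> rts" "(1,1) \<in> rts" "(2,1) \<in> rts" "(3,1) \<in> rts" "(3,2) \<in> rts"
  "(-1,0) \<in> rts" "(0,-1) \<in> rts" "(-1,-1) \<in> rts" "(-2,-1) \<in> rts" "(-3,-1) \<in> rts" "(-3,-2) \<in> rts"
 by (simp_all add: rts_def)

lemmas Ad_nz = Ad_eq_0_iff[OF G_group(1)]

lemma gs_line: "c \<in> rts ==> X \<in> gs c ==> X = cf c X \<cdot> ee c"
 using pc_gs[of X c c] pc_cf[of c X] gs_g by auto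

end

section \<open>The fiber as a union of two orbits of cells\<close>

lemma scale_memD: "mm.subspace V ==> k ~= 0 ==> k \<cdot> X \<in> V ==> X \<in> V"
 using mm.subspace_scale[of V "k \<cdot> X" "inverse k"] by (simp only: mm.scale_scale) simp

context g2_setting
begin

text \<open>The stabiliser of the plane spanned by \<open>ee (3,1)\<close> and
  \<open>ee (3,2)\<close>, a parabolic subgroup containing \<open>B\<close> and the rank one group
  \<open>KK\<close>.\<close>

definition QQ :: "(complex^'n^'n) set" where
 "QQ = {g \<in> G. \<forall>X\<in>gr 1 0 3. Ad g X \<in> gr 1 0 3}"

definition KK :: "(complex^'n^'n) set" where
 "KK = gen {ee (0,1), ee (0,-1)}"

lemma QQ_G: "g \<in> QQ ==> g \<in> G" and QQ_gr3: "g \<in> QQ ==> X \<in> gr 1 0 3 ==> Ad g X \<in> gr 1 0 3"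
 by (auto simp: QQ_def)

lemma QQ_inv: "g \<in> QQ ==> matrix_inv g \<in> QQ"
 using Ad_inv_stable[OF csub_gr, of g 1 0 3] G_group(1,4) unfolding QQ_def by blast

lemma QQ_mult: "g \<in> QQ ==> h \<in> QQ ==> g ** h \<in> QQ"
 using G_group(1,3) by (auto simp: QQ_def Ad_mult)

lemma gr3_eq: "X \<in> gr 1 0 3 ==> X = cf (3,1) X \<cdot> ee (3,1) + cf (3,2) X \<cdot> ee (3,2)"
proof -
 assume X: "X \<in> gr 1 0 3"
 have "{c \<in> wts. 3 \<le> 1 * fst c + 0 * snd c} = {(3,1), (3,2)}" by (auto simp: wts_eq)
 thus ?thesis using gr_sum[OF X] by (simp add: pc_cf[OF _ gr_g[OF X]] rts_mem)
qed

lemma ee_gr: "c \<in> rts ==> k \<le> p * fst c + q * snd c ==> ee c \<in> gr p q k"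
 by (rule gs_gr[OF ee(1)])

lemma gr_3I:
 assumes "X \<in> \<g>" "\<And>c. c \<in> wts ==> p * fst c + q * snd c < k ==> pc c X = 0"
 shows "X \<in> gr p q k"
 using assms by (simp add: gr_def)

text \<open>The Borel subalgebra stabilises a flag, the line of \<open>ee (3,2)\<close> inside the
  plane \<open>gr 1 0 3\<close>. A component at a root of negative \<alpha>-degree would push some
  vector out of the plane, and one at -\<beta> would move the line.\<close>

lemma borel_char: "gr 1 1 0 = {X \<in> \<g>. (\<forall>Y\<in>gr 1 0 3. br X Y \<in> gr 1 0 3) \<and> (\<exists>k. br X (ee (3,2)) = k \<cdot> ee (3,2))}"
proof (intro equalityI subsetI)
 fix X assume X: "X \<in> gr 1 1 0"
 have "X \<in> gr 1 0 0"
 proof (rule gr_3I[OF gr_g[OF X]])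
  fix c assume "c \<in> wts" "1 * fst c + 0 * snd c < 0"
  hence "c \<in> wts" "1 * fst c + 1 * snd c < 0" by (auto simp: wts_eq)
  thus "pc c X = 0" using X by (simp add: gr_def)
 qed
 hence "br X Y \<in> gr 1 0 3" if "Y \<in> gr 1 0 3" for Y using br_gr[OF _ that] by fastforce
 moreover have "br X (ee (3,2)) \<in> gr 1 1 5" using br_gr[OF X ee_gr[of "(3,2)" 5 1 1]] by (simp add: rts_mem)
 moreover have "{c \<in> wts. 5 \<le> 1 * fst c + 1 * snd c} = {(3,2)}" by (auto simp: wts_eq)
 ultimately show "X \<in> {X \<in> \<g>. (\<forall>Y\<in>gr 1 0 3. br X Y \<in> gr 1 0 3) \<and> (\<exists>k. br X (ee (3,2)) = k \<cdot> ee (3,2))}"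
  using gr_g[OF X] gr_sum[of "br X (ee (3,2))" 1 1 5] pc_cf[OF rts_mem(6) gr_g, of "br X (ee (3,2))"] by auto
next
 fix X assume "X \<in> {X \<in> \<g>. (\<forall>Y\<in>gr 1 0 3. br X Y \<in> gr 1 0 3) \<and> (\<exists>k. br X (ee (3,2)) = k \<cdot> ee (3,2))}"
 then obtain k where X: "X \<in> \<g>" "\<And>Y. Y \<in> gr 1 0 3 ==> br X Y \<in> gr 1 0 3" "br X (ee (3,2)) = k \<cdot> ee (3,2)" by blast
 have low: "pc c X = 0" if "c \<in> rts" "d \<in> rts" "c + d \<in> rts" "fst d = 3" "fst c < 0" for c d
 proof (rule br_ee_eq_0[OF that(1-3) X(1)])
  show "pc (c + d) (br X (ee d)) = 0"
   using X(2)[OF ee_gr[of d]] that rts_wts(1)[OF that(3)] by (simp add: gr_def)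
 qed
 have "pc (0,-1) X = 0"
 proof (rule br_ee_eq_0[of _ "(3,2)"])
  show "pc ((0,-1) + (3,2)) (br X (ee (3,2))) = 0"
   unfolding X(3) pc_scale pc_gs[OF ee(1)[OF rts_mem(6)]] by simp
 qed (simp_all add: rts_mem X(1))
 moreover have "pc (-1,0) X = 0" "pc (-1,-1) X = 0" "pc (-2,-1) X = 0" "pc (-3,-1) X = 0" "pc (-3,-2) X = 0"
  using low[of "(-1,0)" "(3,1)"] low[of "(-1,-1)" "(3,2)"] low[of "(-2,-1)" "(3,1)"]
   low[of "(-3,-1)" "(3,2)"] low[of "(-3,-2)" "(3,1)"] by (simp_all add: rts_mem)
 ultimately show "X \<in> gr 1 1 0" by (intro gr_3I X(1)) (auto simp: wts_eq)
qed

lemma QQ_stabilizer: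
 assumes g: "g \<in> QQ" and l: "Ad g (ee (3,2)) = l \<cdot> ee (3,2)"
 shows "g \<in> B"
proof (rule in_B_if_normalises[OF QQ_G[OF g]])
 note gi = G_group(1)[OF QQ_G[OF g]]
 fix X assume X: "X \<in> gr 1 1 0"
 then obtain k where k: "br X (ee (3,2)) = k \<cdot> ee (3,2)" unfolding borel_char by blast
 have l0: "l ~= 0" using l Ad_nz[OF QQ_G[OF g], of "ee (3,2)"] ee(2)[OF rts_mem(6)] by auto
 show "Ad g X \<in> gr 1 1 0"
  unfolding borel_char
 proof (intro CollectI conjI ballI)
  show "Ad g X \<in> \<g>" by (rule Ad_g[OF QQ_G[OF g] gr_g[OF X]])
  fix Y assume Y: "Y \<in> gr 1 0 3"
  have "br X (Ad (matrix_inv g) Y) \<in> gr 1 0 3" using X QQ_gr3[OF QQ_inv[OF g] Y] unfolding borel_char by blast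
  from QQ_gr3[OF g this] show "br (Ad g X) Y \<in> gr 1 0 3" by (simp add: Ad_br[OF gi] Ad_inv(2)[OF gi])
 next
  have "l \<cdot> br (Ad g X) (ee (3,2)) = Ad g (br X (ee (3,2)))"
   unfolding Ad_br[OF gi] l by (simp add: br_simps)
  also have "\<dots> = l \<cdot> k \<cdot> ee (3,2)" unfolding k Ad_simps l by (rule mm.scale_left_commute)
  finally have "br (Ad g X) (ee (3,2)) = k \<cdot> ee (3,2)" using l0 by (simp only: mm.scale_left_imp_eq)
  thus "\<exists>k. br (Ad g X) (ee (3,2)) = k \<cdot> ee (3,2)" ..
 qed
qed

lemma KK_gr: "k \<in> KK ==> X \<in> gr p 0 l ==> Ad k X \<in> gr p 0 l"
 unfolding KK_def
 by (rule gr_stable, rule subsetD[OF gen_mono], simp_all add: ee_gr rts_mem)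

lemma KK_G: "k \<in> KK ==> k \<in> G"
 unfolding KK_def using gen_g_G gen_mono[of "{ee (0,1), ee (0,-1)}" \<g>] gs_g[OF ee(1)] rts_mem by blast

lemma KK_QQ: "k \<in> KK ==> k \<in> QQ" and B_QQ: "b \<in> B ==> b \<in> QQ"
 using KK_G KK_gr B_subset B_stable[of 1 0] by (auto simp: QQ_def)

lemma nb_KK: "nb \<in> KK"
 unfolding nb_def nn_def ff_def KK_def mexp_uminus mexp_scale by (intro gen_mult gen_mexp) auto

lemma KK_mexp: "mexp (ee (0,1)) s \<in> KK" "mexp (ee (0,-1)) s \<in> KK"
 unfolding KK_def by (auto intro: gen_mexp)

lemma br_wts: "c \<in> rts ==> d \<in> rts ==> c + d \<notin> wts ==> br (ee c) (ee d) = 0"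
 by (rule gs_outside[OF _ br_gs[OF ee(1) ee(1)]])

lemma br_cf:
 assumes "c \<in> rts" "d \<in> rts" "c + d \<in> rts"
 obtains k where "k ~= 0" "br (ee c) (ee d) = k \<cdot> ee (c + d)"
proof -
 from gs_1dim[OF assms(3) ee[OF assms(3)] br_gs[OF ee(1)[OF assms(1)] ee(1)[OF assms(2)]]]
 obtain k where "br (ee c) (ee d) = k \<cdot> ee (c + d)" ..
 moreover from this have "k ~= 0" using root_string[OF assms ee[OF assms(1)] ee[OF assms(2)]] by auto
 ultimately show ?thesis using that by blast
qed

lemma mexp_line:
 assumes c: "c \<in> rts" "d \<in> rts" "c + d \<in> rts" "c + (c + d) \<notin> wts"
 obtains k where "k ~= 0" "\<And>t. Ad (mexp (ee c) t) (ee d) = ee d + (t * k) \<cdot> ee (c + d)"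
proof -
 obtain k where k: "k ~= 0" "br (ee c) (ee d) = k \<cdot> ee (c + d)" by (rule br_cf[OF c(1-3)])
 have "br (ee c) (br (ee c) (ee d)) = 0" using br_wts[OF c(1,3,4)] by (simp add: k(2) br_simps)
 from Ad_mexp_step2[OF this] have "Ad (mexp (ee c) t) (ee d) = ee d + (t * k) \<cdot> ee (c + d)" for t by (simp add: k(2))
 with k(1) show ?thesis using that by blast
qed

text \<open>A projective line is an affine line and a point. The two admissible pairs start from
  either coordinate axis of the plane.\<close>

lemma plane_cells:
 assumes X: "X \<in> gr 1 0 3" "X ~= 0" and cd: "(c, d) = ((0,-1), (3,2)) \<or> (c, d) = ((0,1), (3,1))"
 shows "\<exists>y\<in>insert nb (range (mexp (ee c))). \<exists>m. X = m \<cdot> Ad y (ee d)"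
proof -
 have rt: "c \<in> rts" "d \<in> rts" "c + d \<in> rts" "c + (c + d) \<notin> wts" using cd by (auto simp: rts_mem wts_eq)
 have Xe: "X = cf d X \<cdot> ee d + cf (c + d) X \<cdot> ee (c + d)" using gr3_eq[OF X(1)] cd by (auto simp: add.commute)
 show ?thesis
 proof (cases "cf d X = 0")
  case True
  have "Ad nb (ee d) \<in> gs (c + d)" using nb_gs[OF ee(1)[of "(3,1)"]] nb_gs[OF ee(1)[of "(3,2)"]] cd by (auto simp: rts_mem)
  moreover have "X \<in> gs (c + d)" using True by (subst Xe) (simp add: mm.subspace_scale[OF csub_gs ee(1)[OF rt(3)]])
  ultimately show ?thesis using gs_1dim[OF rt(3)] Ad_nz[OF nb_G] ee(2)[OF rt(2)] by blast
 next
  case False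
  obtain k where k: "k ~= 0" "\<And>t. Ad (mexp (ee c) t) (ee d) = ee d + (t * k) \<cdot> ee (c + d)"
   by (rule mexp_line[of c d]) (simp_all add: rt)
  have "X = cf d X \<cdot> Ad (mexp (ee c) (cf (c + d) X / cf d X / k)) (ee d)"
   unfolding k(2) by (subst Xe) (simp add: k(1) False mm.scale_right_distrib field_simps)
  thus ?thesis by blast
 qed
qed

text \<open>Elements of \<open>QQ\<close> that send \<open>ee (3,2)\<close> to the same line differ
  by an element of \<open>B\<close>, so it suffices to decompose the lines of the plane.\<close>

lemma QQ_cells:
 assumes g: "g \<in> QQ"
 shows "\<exists>y\<in>insert nb (range (mexp (ee (0,-1)))). \<exists>b\<in>B. g = y ** b"
proof -
 note gi = G_group(1)[OF QQ_G[OF g]]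
 have "Ad g (ee (3,2)) \<in> gr 1 0 3" by (rule QQ_gr3[OF g ee_gr]) (simp_all add: rts_mem)
 moreover have "Ad g (ee (3,2)) ~= 0" using Ad_nz[OF QQ_G[OF g]] ee(2)[OF rts_mem(6)] by simp
 ultimately obtain y m where y: "y \<in> insert nb (range (mexp (ee (0,-1))))" "Ad g (ee (3,2)) = m \<cdot> Ad y (ee (3,2))"
  using plane_cells[of _ "(0,-1)" "(3,2)"] by blast
 have yK: "y \<in> KK" using y(1) nb_KK KK_mexp by auto
 note yi = G_group(1)[OF KK_G[OF yK]]
 have "Ad (matrix_inv y ** g) (ee (3,2)) = m \<cdot> ee (3,2)"
  unfolding Ad_mult[OF invertible_matrix_inv[OF yi] gi] y(2) Ad_simps Ad_inv(1)[OF yi] ..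
 from QQ_stabilizer[OF QQ_mult[OF QQ_inv[OF KK_QQ[OF yK]] g] this] have "matrix_inv y ** g \<in> B" .
 moreover have "g = y ** (matrix_inv y ** g)" by (simp add: matrix_mul_assoc matrix_inv_mult(2)[OF yi])
 ultimately show ?thesis using y(1) by blast
qed

lemma QQ_gr:
 assumes g: "g \<in> QQ" and X: "X \<in> gr 1 0 k"
 shows "Ad g X \<in> gr 1 0 k"
proof -
 obtain y b where yb: "y \<in> KK" "b \<in> B" "g = y ** b" using QQ_cells[OF g] nb_KK KK_mexp by blast
 show ?thesis
  unfolding yb(3) Ad_mult[OF G_group(1)[OF KK_G[OF yb(1)]] B_group(1)[OF yb(2)]]
  by (intro KK_gr yb B_stable X) simp_all
qed

text \<open>Three brackets with \<open>ee (2,1)\<close> lead from degree -3 onto the plane. If the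
  conjugate \<open>M\<close> has degree at least 2, three brackets with it still raise -3 to at
  least 3, so the plane is preserved.\<close>

lemma QQ_if_deg2:
 assumes g: "g \<in> G" and M: "Ad (matrix_inv g) (ee (2,1)) \<in> gr 1 0 2"
 shows "g \<in> QQ"
proof -
 note gi = G_group(1)[OF g]
 define g' where "g' = matrix_inv g"
 have g': "g' \<in> G" "invertible g'" unfolding g'_def by (intro G_group g, rule invertible_matrix_inv[OF gi])
 define M where "M = Ad g' (ee (2,1))"
 have M2: "M \<in> gr 1 0 2" using M by (simp add: M_def g'_def)
 have line: "Ad g' (ee d) \<in> gr 1 0 3" if d: "c \<in> rts" "c + (2,1) \<in> rts" "c + (2,1) + (2,1) \<in> rts" "d = c + (2,1) + (2,1) + (2,1)" "d \<in> rts" "fst c = - 3" for c d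
 proof -
  obtain k1 where k1: "k1 ~= 0" "br (ee (2,1)) (ee c) = k1 \<cdot> ee ((2,1) + c)"
   using br_cf[of "(2,1)" c] d(1,2) rts_mem(4) by (metis add.commute)
  obtain k2 where k2: "k2 ~= 0" "br (ee (2,1)) (ee ((2,1) + c)) = k2 \<cdot> ee ((2,1) + ((2,1) + c))"
   using br_cf[of "(2,1)" "(2,1) + c"] d(2,3) rts_mem(4) by (metis add.commute)
  obtain k3 where k3: "k3 ~= 0" "br (ee (2,1)) (ee ((2,1) + ((2,1) + c))) = k3 \<cdot> ee ((2,1) + ((2,1) + ((2,1) + c)))"
   using br_cf[of "(2,1)" "(2,1) + ((2,1) + c)"] d(3,4,5) rts_mem(4) by (metis add.commute)
  have "br (ee (2,1)) (br (ee (2,1)) (br (ee (2,1)) (ee c))) = (k1 * k2 * k3) \<cdot> ee d"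
   unfolding k1(2) br_simps k2(2) k3(2) mm.scale_scale d(4) by (simp add: add_ac)
  from arg_cong[OF this, of "Ad g'"] have "br M (br M (br M (Ad g' (ee c)))) = (k1 * k2 * k3) \<cdot> Ad g' (ee d)"
   by (simp add: Ad_br[OF g'(2)] Ad_simps M_def)
  moreover have "Ad g' (ee c) \<in> gr 1 0 (-3)"
   by (rule gr_3I[OF Ad_g[OF g'(1) gs_g[OF ee(1)[OF d(1)]]]]) (auto simp: wts_eq)
  hence "br M (br M (br M (Ad g' (ee c)))) \<in> gr 1 0 (2 + (2 + (2 + -3)))" by (intro br_gr M2)
  ultimately have "(k1 * k2 * k3) \<cdot> Ad g' (ee d) \<in> gr 1 0 3" by simp
  thus ?thesis by (rule scale_memD[OF csub_gr, rotated]) (use k1(1) k2(1) k3(1) in simp)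
 qed
 have "Ad g' (ee (3,1)) \<in> gr 1 0 3" "Ad g' (ee (3,2)) \<in> gr 1 0 3"
  using line[of "(-3,-2)" "(3,1)"] line[of "(-3,-1)" "(3,2)"] by (simp_all add: rts_mem)
 hence "Ad g' X \<in> gr 1 0 3" if "X \<in> gr 1 0 3" for X
  by (subst gr3_eq[OF that]) (simp add: Ad_simps gr_add gr_scale)
 hence "g' \<in> QQ" using g'(1) by (simp add: QQ_def)
 from QQ_inv[OF this] show ?thesis by (simp add: g'_def matrix_inv_inv[OF gi])
qed

end

section \<open>The two parts of the preimage of the fiber\<close>

context g2_setting
begin

definition fib :: "(complex^'n^'n) set" where
 "fib = {g \<in> G. Ad (matrix_inv g) (ee (2,1)) \<in> gr 1 0 1}"

text \<open>The preimage of the surface. The coefficient required to vanish here is nonzero on all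
  of \<open>QQ\<close>.\<close>

definition sec :: "(complex^'n^'n) set" where
 "sec = {g \<in> fib. cf (2,1) (Ad g (ee (2,1))) = 0}"

lemma pc_ee: "c \<in> rts ==> pc d (ee c) = (if d = c then ee c else 0)"
 using pc_gs[OF ee(1)] by auto

lemma ee_not_gr: "c \<in> rts ==> p * fst c + q * snd c < k ==> ee c \<notin> gr p q k"
 using pc_ee[of c c] ee(2)[of c] rts_wts(1)[of c] by (auto simp: gr_def)

lemma cf_eq_0_gr:
 "c \<in> rts ==> X \<in> gr p q k ==> p * fst c + q * snd c < k ==> cf c X = 0"
 using pc_cf[of c X] gr_g[of X p q k] rts_wts(1)[of c] ee(2)[of c] by (auto simp: gr_def)

lemma QQ_fib:
 assumes g: "g \<in> QQ"
 shows "g \<in> fib" "cf (2,1) (Ad g (ee (2,1))) ~= 0"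
proof -
 have N2: "ee (2,1) \<in> gr 1 0 2" by (simp add: ee_gr rts_mem)
 show "g \<in> fib"
  unfolding fib_def using QQ_G[OF g] QQ_gr[OF QQ_inv[OF g] N2] gr_mono[of 1 2 1 0] by auto
 show "cf (2,1) (Ad g (ee (2,1))) ~= 0"
 proof
  assume 0: "cf (2,1) (Ad g (ee (2,1))) = 0"
  have A: "Ad g (ee (2,1)) \<in> gr 1 0 2" by (rule QQ_gr[OF g N2])
  have "Ad g (ee (2,1)) \<in> gr 1 0 3"
  proof (rule gr_3I[OF gr_g[OF A]])
   fix c assume c: "c \<in> wts" "1 * fst c + 0 * snd c < 3"
   show "pc c (Ad g (ee (2,1))) = 0"
   proof (cases "c = (2,1)")
    case True
    thus ?thesis using pc_cf[OF rts_mem(4) gr_g[OF A]] 0 by simp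
   next
    case False
    hence "1 * fst c + 0 * snd c < 2" using c by (auto simp: wts_eq)
    thus ?thesis using A c(1) by (simp add: gr_def)
   qed
  qed
  from QQ_gr[OF QQ_inv[OF g] this] show False
   using ee_not_gr[of "(2,1)" 1 0 3] by (simp add: Ad_inv(1)[OF G_group(1)[OF QQ_G[OF g]]] rts_mem)
 qed
qed

lemma KK_N: "k \<in> KK ==> Ad k (ee (2,1)) = ee (2,1)"
 unfolding KK_def
proof (induction rule: gen.induct)
 case (step X g t)
 have "br X (ee (2,1)) = 0"
  using step.hyps(1) br_wts[of "(0,1)" "(2,1)"] br_wts[of "(0,-1)" "(2,1)"] by (auto simp: rts_mem wts_eq)
 hence "Ad (mexp X t) (ee (2,1)) = ee (2,1)" using Ad_mexp_step2[of X "ee (2,1)" t] by (simp add: br_simps)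
 thus ?case using step.IH Ad_mult[OF invertible_mexp gen_invertible[OF step.hyps(2)]] by simp
qed (simp add: Ad_simps)

lemma na_inv_gs:
 assumes c: "(i, j) \<in> rts" "(2 * i - 3 * j, i - 2 * j) \<in> rts" and X: "X \<in> gs (i, j)"
 shows "Ad (matrix_inv na) X \<in> gs (2 * i - 3 * j, i - 2 * j)"
proof -
 note ni = G_group(1)[OF na_G]
 let ?e = "ee (2 * i - 3 * j, i - 2 * j)"
 have "Ad na ?e \<in> gs (i, j)" using na_gs[OF ee(1)[OF c(2)]] by (simp add: algebra_simps)
 then obtain k where "X = k \<cdot> Ad na ?e"
  using gs_1dim[OF c(1) _ _ X] Ad_nz[OF na_G] ee(2)[OF c(2)] by blast
 thus ?thesis using mm.subspace_scale[OF csub_gs ee(1)[OF c(2)]] by (simp add: Ad_simps Ad_inv(1)[OF ni])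
qed

lemma cell_sec:
 assumes x: "x \<in> KK" and q: "q \<in> QQ"
 shows "x ** na ** q \<in> sec"
proof -
 note xi = G_group(1)[OF KK_G[OF x]] and ni = G_group(1)[OF na_G] and qi = G_group(1)[OF QQ_G[OF q]]
 have G: "x ** na ** q \<in> G" by (intro G_group(3) KK_G x na_G QQ_G q)
 have N2: "ee (2,1) \<in> gr 1 0 2" by (simp add: ee_gr rts_mem)
 have "Ad (matrix_inv x) (ee (2,1)) = ee (2,1)" using KK_N[OF x] Ad_inv(1)[OF xi, of "ee (2,1)"] by simp
 hence "Ad (matrix_inv (x ** na ** q)) (ee (2,1)) = Ad (matrix_inv q) (Ad (matrix_inv na) (ee (2,1)))"
  by (simp add: matrix_inv_mult_distrib xi ni qi invertible_mult Ad_mult invertible_matrix_inv)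
 moreover have "Ad (matrix_inv na) (ee (2,1)) \<in> gs (1,0)"
  using na_inv_gs[of 2 1 "ee (2,1)"] ee(1)[of "(2,1)"] by (simp add: rts_mem)
 hence "Ad (matrix_inv na) (ee (2,1)) \<in> gr 1 0 1" by (rule gs_gr) simp
 ultimately have f: "x ** na ** q \<in> fib"
  using QQ_gr[OF QQ_inv[OF q]] G by (simp add: fib_def)
 define X where "X = Ad q (ee (2,1))"
 have X2: "X \<in> gr 1 0 2" unfolding X_def by (rule QQ_gr[OF q N2])
 have "{c \<in> wts. 2 \<le> 1 * fst c + 0 * snd c} = {(2,1), (3,1), (3,2)}" by (auto simp: wts_eq)
 hence X: "X = pc (2,1) X + pc (3,1) X + pc (3,2) X" using gr_sum[OF X2] by (simp add: add.assoc)
 \<comment> \<open>The weights (2,1), (3,1), (3,2) are sent by \<open>na\<close> to the degrees 1,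
   3, 0. As \<open>KK\<close> preserves the filtration by \<alpha>-degree in both directions, no
   coefficient at degree 2 arises.\<close>
 have low: "cf (2,1) (Ad x (Ad na Y)) = 0"
  if Y: "Y \<in> gs (i, j)" and s: "2 * i - 3 * j = 3 \<or> 2 * i - 3 * j < 2" for i j Y
 proof -
  note aY = na_gs[OF Y]
  show ?thesis
  proof (cases "2 * i - 3 * j = 3")
   case True
   have "Ad na Y \<in> gr 1 0 3" by (rule gs_gr[OF aY]) (simp add: True)
   from cf_eq_0_gr[OF rts_mem(4) KK_gr[OF x this]] show ?thesis by simp
  next
   case False
   have "Ad na Y \<in> gr (-1) 0 (-1)" by (rule gs_gr[OF aY]) (use s False in auto)
   from cf_eq_0_gr[OF rts_mem(4) KK_gr[OF x this]] show ?thesis by simp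
  qed
 qed
 have pcs: "pc c X \<in> gs c" for c by (rule pc_in_gs[OF gr_g[OF X2]])
 have "cf (2,1) (Ad x (Ad na X)) = 0"
  by (subst X) (simp add: Ad_simps cf_simps low[OF pcs])
 thus ?thesis using f unfolding sec_def X_def by (simp add: Ad_mult xi ni qi invertible_mult)
qed

text \<open>Subtracting \<beta> twice from a weight gives a weight only if one starts from \<beta>
  itself.\<close>

lemma extremal:
 assumes "Z \<in> \<g>"
 shows "br (ee (0,-1)) (br (ee (0,-1)) Z) \<in> gs (0,-1)"
proof -
 note e = ee(1)[OF rts_mem(8)]
 have "Z \<in> gr 0 0 0" by (rule gr_3I[OF assms]) simp
 hence "Z \<in> {Z. br (ee (0,-1)) (br (ee (0,-1)) Z) \<in> gs (0,-1)}"
 proof (rule gr_induct)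
  show "mm.subspace {Z. br (ee (0,-1)) (br (ee (0,-1)) Z) \<in> gs (0,-1)}"
   using csub_gs[of "(0,-1)"] unfolding mm.subspace_def by (auto simp: br_simps)
  fix c Y assume c: "c \<in> wts" and Y: "Y \<in> gs c"
  have W: "br (ee (0,-1)) (br (ee (0,-1)) Y) \<in> gs ((0,-1) + ((0,-1) + c))" by (rule br_gs[OF e br_gs[OF e Y]])
  show "Y \<in> {Z. br (ee (0,-1)) (br (ee (0,-1)) Z) \<in> gs (0,-1)}"
  proof (cases "c = (0,1)")
   case True
   thus ?thesis using W by simp
  next
   case False
   hence "(0,-1) + ((0,-1) + c) \<notin> wts" using c unfolding wts_eq
    by (elim insertE) (simp_all add: zero_prod_def)
   thus ?thesis using gs_outside[OF _ W] mm.subspace_0[OF csub_gs] by simp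
  qed
 qed
 thus ?thesis by blast
qed

text \<open>An element fixing the lines of \<open>ee (2,1)\<close> and \<open>ee (3,1)\<close> maps \<open>ee (0,-1)\<close> to the common
 centralizer of these two vectors, which is spanned by them together with \<open>ee (0,-1)\<close> and
 \<open>ee (3,2)\<close>; that the image is again extremal kills two of the four coordinates.\<close>

lemma opposite_plane:
 assumes k: "k \<in> QQ" and N: "Ad k (ee (2,1)) = p \<cdot> ee (2,1)" and e31: "Ad k (ee (3,1)) = l \<cdot> ee (3,1)"
 shows "\<exists>y r. Ad k (ee (0,-1)) = y \<cdot> ee (0,-1) + r \<cdot> ee (3,1)"
proof -
 note kG = QQ_G[OF k] and ki = G_group(1)[OF QQ_G[OF k]]
 define Y where "Y = Ad k (ee (0,-1))"
 have Yg: "Y \<in> \<g>" unfolding Y_def by (rule Ad_g[OF kG gs_g[OF ee(1)[OF rts_mem(8)]]])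
 have p0: "p ~= 0" "l ~= 0"
  using N e31 Ad_nz[OF kG, of "ee (2,1)"] Ad_nz[OF kG, of "ee (3,1)"] ee(2)[of "(2,1)"] ee(2)[of "(3,1)"] by (auto simp: rts_mem)
 have "br (ee (0,-1)) (ee (2,1)) = 0" "br (ee (0,-1)) (ee (3,1)) = 0" by (auto intro!: br_wts simp: rts_mem wts_eq)
 from this[THEN arg_cong[of _ _ "Ad k"]] have Y0: "br Y (ee (2,1)) = 0" "br Y (ee (3,1)) = 0"
  using p0 by (simp_all add: Ad_br[OF ki] Ad_simps N e31 Y_def br_simps)
 have z: "pc c Y = 0" if "c \<in> rts" "d = (2,1) \<or> d = (3,1)" "c + d \<in> rts" for c d
  by (rule br_ee_eq_0[of c d]) (use that Y0 Yg in \<open>auto simp: rts_mem\<close>)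
 define h where "h = pc (0,0) Y"
 have h: "h \<in> gs (0,0)" unfolding h_def by (rule pc_in_gs[OF Yg])
 have "br h (ee d) = 0" if "br Y (ee d) = 0" "d \<in> rts" for d
  using pc_br[OF Yg ee(1)[OF that(2)], of "(0,0)"] that(1) by (simp add: h_def)
 from this[OF Y0(1)] this[OF Y0(2)] have ev0: "ev (2,1) h = 0" "ev (3,1) h = 0"
  using br_h[OF h ee(1)[of "(2,1)"]] br_h[OF h ee(1)[of "(3,1)"]] ee(2)[of "(2,1)"] ee(2)[of "(3,1)"] by (auto simp: rts_mem)
 have "ev (1,0) h = ev (3,1) h - ev (2,1) h" by (simp add: ev_def)
 hence e1: "ev (1,0) h = 0" using ev0 by simp
 hence "ev (0,1) h = 0" using ev0(1) by (simp add: ev_def)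
 with e1 have h0: "pc (0,0) Y = 0" using cartan_zero[OF h] by (simp add: h_def)
 define y m r w where defs: "y = cf (0,-1) Y" "m = cf (2,1) Y" "r = cf (3,1) Y" "w = cf (3,2) Y"
 have "Y = (\<Sum>c\<in>wts. pc c Y)" by (rule sum_pc[OF Yg, symmetric])
 also have "\<dots> = (\<Sum>c\<in>{(0,-1), (2,1), (3,1), (3,2)}. pc c Y)"
 proof (rule sum.mono_neutral_right)
  show "\<forall>c\<in>wts - {(0, - 1), (2, 1), (3, 1), (3, 2)}. pc c Y = 0"
   using h0 z[of "(1,0)" "(2,1)"] z[of "(0,1)" "(3,1)"] z[of "(1,1)" "(2,1)"] z[of "(-1,0)" "(2,1)"]
    z[of "(-1,-1)" "(2,1)"] z[of "(-2,-1)" "(3,1)"] z[of "(-3,-1)" "(2,1)"] z[of "(-3,-2)" "(2,1)"]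
   by (auto simp: wts_eq rts_mem)
 qed (auto simp: wts_eq)
 finally have Y: "Y = y \<cdot> ee (0,-1) + m \<cdot> ee (2,1) + r \<cdot> ee (3,1) + w \<cdot> ee (3,2)"
  by (simp add: pc_cf[OF _ Yg] rts_mem defs add.assoc)
 have y0: "y ~= 0"
 proof
  assume "y = 0"
  hence "Y \<in> gr 1 0 2" unfolding Y
   by (auto intro!: gr_add gr_scale ee_gr simp: rts_mem gr_0)
  from QQ_gr[OF QQ_inv[OF k] this] show False
   using ee_not_gr[of "(0,-1)" 1 0 2] by (simp add: Y_def Ad_inv(1)[OF ki] rts_mem)
 qed
 \<comment> \<open>\<open>E\<close> is a probe. By extremality the double bracket \<open>S\<close>
   of \<open>Y\<close> with it is a multiple of \<open>Y\<close>, but it has no component at (0,-1),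
   where \<open>Y\<close> has one; so \<open>S\<close> is zero. Its components at (1,0) and (2,1)
   are \<open>y * w\<close> and \<open>m * m\<close> times nonzero vectors.\<close>
 define E where "E = ee (-2,-1)"
 have Eg: "E \<in> gs (-2,-1)" unfolding E_def by (rule ee(1)[OF rts_mem(10)])
 define S where "S = br Y (br Y E)"
 have "Ad (matrix_inv k) E \<in> \<g>" by (rule Ad_g[OF G_group(4)[OF kG] gs_g[OF Eg]])
 from gs_line[OF rts_mem(8) extremal[OF this]] obtain a
  where "br (ee (0,-1)) (br (ee (0,-1)) (Ad (matrix_inv k) E)) = a \<cdot> ee (0,-1)" by blast
 from arg_cong[OF this, of "Ad k"] have SY: "S = a \<cdot> Y"
  by (simp add: Ad_br[OF ki] Ad_simps Ad_inv(2)[OF ki] S_def Y_def)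
 note gsb = ee(1)[OF rts_mem(8)] and gsN = ee(1)[OF rts_mem(4)] and gs1 = ee(1)[OF rts_mem(5)] and gs2 = ee(1)[OF rts_mem(6)]
 define H P R where HPR: "H = br (ee (2,1)) E" "P = br (ee (3,1)) E" "R = br (ee (3,2)) E"
 have HPRg: "H \<in> gs (0,0)" "P \<in> gs (1,0)" "R \<in> gs (1,1)"
  unfolding HPR using br_gs[OF gsN Eg] br_gs[OF gs1 Eg] br_gs[OF gs2 Eg] by simp_all
 have bE: "br (ee (0,-1)) E = 0" unfolding E_def by (rule br_wts) (simp_all add: rts_mem wts_eq)
 have bN: "br (ee (0,-1)) (ee (2,1)) = 0" by (rule br_wts) (simp_all add: rts_mem wts_eq)
 have bH: "br (ee (0,-1)) H = 0" unfolding HPR jacobi[of "ee (0,-1)" "ee (2,1)" E] by (simp add: bE bN br_simps)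
 have bP: "br (ee (0,-1)) P = 0" by (rule gs_outside[OF _ br_gs[OF gsb HPRg(2)]]) (simp add: wts_eq)
 have out: "br (ee (3,1)) P = 0" "br (ee (3,1)) R = 0" "br (ee (3,2)) P = 0" "br (ee (3,2)) R = 0"
  by (rule gs_outside[OF _ br_gs[OF gs1 HPRg(2)]], simp add: wts_eq)
   (rule gs_outside[OF _ br_gs[OF gs1 HPRg(3)]], simp add: wts_eq,
    rule gs_outside[OF _ br_gs[OF gs2 HPRg(2)]], simp add: wts_eq,
    rule gs_outside[OF _ br_gs[OF gs2 HPRg(3)]], simp add: wts_eq)
 have "br Y E = m \<cdot> H + r \<cdot> P + w \<cdot> R" unfolding Y by (simp add: br_simps bE HPR)
 hence S: "S = (y * w) \<cdot> br (ee (0,-1)) R + (m * m) \<cdot> br (ee (2,1)) H + (m * r) \<cdot> br (ee (2,1)) P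
   + (m * w) \<cdot> br (ee (2,1)) R + (r * m) \<cdot> br (ee (3,1)) H + (w * m) \<cdot> br (ee (3,2)) H"
  unfolding S_def by (simp only:) (simp add: Y br_simps bH bP out mm.scale_right_distrib
    mult.commute[of w y] mult.commute[of m r] mult.commute[of w m] add_ac)
 have G: "br (ee (0,-1)) R \<in> gs (1,0)" "br (ee (2,1)) H \<in> gs (2,1)" "br (ee (2,1)) P \<in> gs (3,1)"
  "br (ee (2,1)) R \<in> gs (3,2)" "br (ee (3,1)) H \<in> gs (3,1)" "br (ee (3,2)) H \<in> gs (3,2)"
  using br_gs[OF gsb HPRg(3)] br_gs[OF gsN HPRg(1)] br_gs[OF gsN HPRg(2)] br_gs[OF gsN HPRg(3)]
   br_gs[OF gs1 HPRg(1)] br_gs[OF gs2 HPRg(1)] by simp_all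
 have "pc (0,-1) S = 0" unfolding S by (simp add: pc_add pc_scale pc_gs[OF G(1)] pc_gs[OF G(2)] pc_gs[OF G(3)] pc_gs[OF G(4)] pc_gs[OF G(5)] pc_gs[OF G(6)])
 moreover have "pc (0,-1) Y = y \<cdot> ee (0,-1)" unfolding Y by (simp add: pc_add pc_scale pc_ee rts_mem)
 ultimately have "a = 0" using y0 ee(2)[OF rts_mem(8)] by (simp add: SY pc_scale)
 hence S0: "S = 0" using SY by simp
 have "pc (1,0) S = (y * w) \<cdot> br (ee (0,-1)) R" "pc (2,1) S = (m * m) \<cdot> br (ee (2,1)) H"
  unfolding S by (simp_all add: pc_add pc_scale pc_gs[OF G(1)] pc_gs[OF G(2)] pc_gs[OF G(3)] pc_gs[OF G(4)] pc_gs[OF G(5)] pc_gs[OF G(6)])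
 moreover have "R ~= 0"
  unfolding HPR E_def by (rule root_string[of "(3,2)" "(-2,-1)"]) (simp_all add: rts_mem ee)
 hence "br (ee (0,-1)) R ~= 0"
  using root_string[OF rts_mem(8,3) _ gsb ee(2)[OF rts_mem(8)] HPRg(3)] by (simp add: rts_mem)
 moreover have "br (ee (2,1)) H ~= 0"
  using br_h_right[OF HPRg(1) gsN] sl2_nonzero[OF rts_mem(4) gsN, of E] Eg trace_ee[OF rts_mem(4)] ee(2)[OF rts_mem(4)]
  by (simp add: HPR E_def)
 ultimately have "w = 0" "m = 0" using S0 y0 by simp_all
 thus ?thesis using Y unfolding Y_def by (intro exI[of _ y] exI[of _ r]) simp
qed

end

section \<open>Normal forms of conjugates and the cells of the fiber\<close>

context g2_setting
begin

lemma br_funpow_gr: "X \<in> gr p q j ==> Y \<in> gr p q k ==> (br X ^^ n) Y \<in> gr p q (k + int n * j)"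
proof (induction n)
 case (Suc n)
 from br_gr[OF Suc.prems(1) Suc.IH[OF Suc.prems]] show ?case by (simp add: algebra_simps)
qed simp

text \<open>Terms of order two and more in the exponential series raise the degree by at least twice
  that of \<open>ee c\<close>.\<close>

lemma Ad_mexp_mod:
 assumes c: "c \<in> rts" "0 \<le> fst c" and Y: "Y \<in> gr 1 0 k"
 shows "Ad (mexp (ee c) t) Y - (Y + t \<cdot> br (ee c) Y) \<in> gr 1 0 (k + 2 * fst c)"
proof -
 obtain K where K: "(br (ee c) ^^ K) Y = 0" using br_root_nilpotent[OF ee(1)[OF c(1)] c(1)] by blast
 let ?f = "\<lambda>i. (t ^ i / fact i) \<cdot> (br (ee c) ^^ i) Y"
 have "(br (ee c) ^^ Suc (Suc K)) Y = 0" by (simp add: K br_simps)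
 from Ad_mexp_finite[OF this] have "Ad (mexp (ee c) t) Y = ?f 0 + (?f (Suc 0) + (\<Sum>i<K. ?f (Suc (Suc i))))"
  unfolding sum.lessThan_Suc_shift by simp
 hence "Ad (mexp (ee c) t) Y - (Y + t \<cdot> br (ee c) Y) = (\<Sum>i<K. ?f (Suc (Suc i)))" by simp
 also have "\<dots> \<in> gr 1 0 (k + 2 * fst c)"
 proof (intro gr_sum_mem gr_scale)
  fix i
  have "(br (ee c) ^^ Suc (Suc i)) Y \<in> gr 1 0 (k + int (Suc (Suc i)) * fst c)"
   by (rule br_funpow_gr[OF ee_gr[OF c(1)] Y]) simp
  moreover have "k + 2 * fst c \<le> k + int (Suc (Suc i)) * fst c" using c(2) by (simp add: distrib_right)
  ultimately show "(br (ee c) ^^ Suc (Suc i)) Y \<in> gr 1 0 (k + 2 * fst c)" using gr_mono by blast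
 qed
 finally show ?thesis .
qed

lemma gr_top:
 assumes X: "X \<in> gr 1 0 k" and z: "\<And>c. c \<in> rts ==> fst c = k ==> cf c X = 0" and k: "0 < k"
 shows "X \<in> gr 1 0 (k + 1)"
proof (rule gr_3I[OF gr_g[OF X]])
 fix c assume c: "c \<in> wts" "1 * fst c + 0 * snd c < k + 1"
 show "pc c X = 0"
 proof (cases "fst c = k")
  case True
  hence "c \<in> rts" using rts_wts(2)[OF c(1)] k by (cases c) auto
  thus ?thesis using pc_cf[OF _ gr_g[OF X]] z True by simp
 next
  case False
  thus ?thesis using X c by (simp add: gr_def)
 qed
qed

lemma rts_deg: "c \<in> rts ==> fst c = 1 ==> c = (1,0) \<or> c = (1,1)" "c \<in> rts ==> fst c = 2 ==> c = (2,1)"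
 "c \<in> rts ==> fst c = 3 ==> c = (3,1) \<or> c = (3,2)"
 by (auto simp: rts_def)

lemma cf_ee': "c \<in> rts ==> d \<in> rts ==> cf c (ee d) = (if c = d then 1 else 0)"
 using cf_ee cf_gs[of c "ee d" d] ee(1)[of d] by auto

text \<open>Modulo degree two, \<open>M\<close> is a nonzero vector in the plane of
  \<open>ee (1,0)\<close> and \<open>ee (1,1)\<close>, on which \<open>KK\<close> acts; a root
  element or the reflection \<open>nb\<close> moves it to the first axis.\<close>

lemma reduce1:
 assumes M: "M \<in> gr 1 0 1" "M \<notin> gr 1 0 2"
 shows "\<exists>p\<in>KK. \<exists>c. c ~= 0 \<and> Ad p M - c \<cdot> ee (1,0) \<in> gr 1 0 2"
proof -
 define x y where xy: "x = cf (1,0) M" "y = cf (1,1) M"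
 define M2 where "M2 = M - (x \<cdot> ee (1,0) + y \<cdot> ee (1,1))"
 have "M2 \<in> gr 1 0 1"
  unfolding M2_def
  by (intro gr_diff gr_add gr_scale M(1) ee_gr rts_mem) simp_all
 hence M2: "M2 \<in> gr 1 0 (1 + 1)"
  by (rule gr_top) (auto dest: rts_deg(1) simp: M2_def cf_simps cf_ee' rts_mem xy)
 have Meq: "M = x \<cdot> ee (1,0) + y \<cdot> ee (1,1) + M2" by (simp add: M2_def)
 have red: ?thesis if p: "p \<in> KK" and c: "c ~= 0" "x \<cdot> Ad p (ee (1,0)) + y \<cdot> Ad p (ee (1,1)) = c \<cdot> ee (1,0)" for p c
 proof (intro bexI[OF _ p] exI[of _ c] conjI c(1))
  have "Ad p M - c \<cdot> ee (1,0) = Ad p M2" by (subst Meq) (simp add: Ad_simps c(2))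
  thus "Ad p M - c \<cdot> ee (1,0) \<in> gr 1 0 2" using KK_gr[OF p M2] by simp
 qed
 show ?thesis
 proof (cases "x = 0")
  case True
  hence "y ~= 0" using M(2) M2 Meq by auto
  have "Ad nb (ee (1,1)) \<in> gs (1,0)" using nb_gs[OF ee(1)[of "(1,1)"]] by (simp add: rts_mem)
  then obtain k where k: "Ad nb (ee (1,1)) = k \<cdot> ee (1,0)" using gs_line[OF rts_mem(1)] by blast
  moreover have "k ~= 0" using k Ad_nz[OF nb_G, of "ee (1,1)"] ee(2)[of "(1,1)"] by (auto simp: rts_mem)
  ultimately show ?thesis using red[OF nb_KK, of "y * k"] True \<open>y ~= 0\<close> by simp
 next
  case False
  obtain k where k: "k ~= 0" "\<And>t. Ad (mexp (ee (0,1)) t) (ee (1,0)) = ee (1,0) + (t * k) \<cdot> ee ((0,1) + (1,0))"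
   by (rule mexp_line[of "(0,1)" "(1,0)"]) (simp_all add: rts_mem wts_eq)
  have "br (ee (0,1)) (ee (1,1)) = 0" by (rule br_wts) (simp_all add: rts_mem wts_eq)
  hence "Ad (mexp (ee (0,1)) t) (ee (1,1)) = ee (1,1)" for t using Ad_mexp_step2[of "ee (0,1)" "ee (1,1)" t] by (simp add: br_simps)
  hence "x \<cdot> Ad (mexp (ee (0,1)) (- y / x / k)) (ee (1,0)) + y \<cdot> Ad (mexp (ee (0,1)) (- y / x / k)) (ee (1,1)) = x \<cdot> ee (1,0)"
   unfolding k(2) using k(1) False by (simp add: mm.scale_right_distrib mm.scale_right_diff_distrib mm.scale_minus_left)
  thus ?thesis using red[OF KK_mexp(1) False] by blast
 qed
qed

lemma reduce_step:
 assumes c: "c ~= 0" and M: "M - c \<cdot> ee (1,0) \<in> gr 1 0 k"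
  and d: "d \<in> rts" "0 < snd d" "fst d = k - 1" "d + (1,0) \<in> rts" and k: "2 \<le> k"
 shows "\<exists>p\<in>B. Ad p M - c \<cdot> ee (1,0) \<in> gr 1 0 k \<and> cf (d + (1,0)) (Ad p M) = 0"
proof -
 have d10: "d + (1,0) ~= (1,0)" using d(2) by auto
 obtain l where l: "l ~= 0" "br (ee d) (ee (1,0)) = l \<cdot> ee (d + (1,0))" by (rule br_cf[OF d(1) rts_mem(1) d(4)])
 define M2 where "M2 = M - c \<cdot> ee (1,0)"
 \<comment> \<open>The value cancels the coefficient at \<open>d + (1,0)\<close> to first order. All
   other corrections have degree at least \<open>2 * k - 1\<close>, which exceeds \<open>k\<close>
   because \<open>k\<close> is at least 2.\<close>
 define t where "t = - cf (d + (1,0)) M / (c * l)"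
 define R where "R = Ad (mexp (ee d) t) M - (M + t \<cdot> br (ee d) M)"
 have M1: "M = c \<cdot> ee (1,0) + M2" by (simp add: M2_def)
 have "M2 \<in> gr 1 0 1" using M gr_mono[of 1 k 1 0] k by (auto simp: M2_def)
 hence "M \<in> gr 1 0 1" unfolding M1
  by (intro gr_add gr_scale ee_gr rts_mem) simp_all
 from Ad_mexp_mod[OF d(1) _ this] have "R \<in> gr 1 0 (1 + 2 * (k - 1))" using k by (simp add: R_def d(3))
 hence R: "R \<in> gr 1 0 (k + 1)" using gr_mono[of "k + 1" "1 + 2 * (k - 1)" 1 0] k by auto
 have "br (ee d) M2 \<in> gr 1 0 ((k - 1) + k)"
  by (rule br_gr[OF ee_gr[OF d(1)]]) (use M d(3) in \<open>simp_all add: M2_def\<close>)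
 hence D: "br (ee d) M2 \<in> gr 1 0 (k + 1)" using gr_mono[of "k + 1" "(k - 1) + k" 1 0] k by auto
 have A: "Ad (mexp (ee d) t) M = M + (t * c * l) \<cdot> ee (d + (1,0)) + t \<cdot> br (ee d) M2 + R"
 proof -
  have "Ad (mexp (ee d) t) M = M + t \<cdot> br (ee d) M + R" by (simp add: R_def)
  also have "br (ee d) M = c \<cdot> l \<cdot> ee (d + (1,0)) + br (ee d) M2" unfolding M1 by (simp add: br_simps l(2))
  finally show ?thesis by (simp add: mm.scale_right_distrib mult.assoc)
 qed
 show ?thesis
 proof (intro bexI[of _ "mexp (ee d) t"] conjI)
  have "0 \<le> fst d" using d(3) k by simp
  thus "mexp (ee d) t \<in> B" using d(2) by (intro gen_gr_B gen_mexp ee_gr d(1)) simp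
  have "(t * c * l) \<cdot> ee (d + (1,0)) \<in> gr 1 0 k"
   by (intro gr_scale ee_gr d(4)) (simp add: d(3))
  moreover have "Ad (mexp (ee d) t) M - c \<cdot> ee (1,0) = M2 + (t * c * l) \<cdot> ee (d + (1,0)) + t \<cdot> br (ee d) M2 + R"
   unfolding A by (simp add: M2_def)
  moreover have "R \<in> gr 1 0 k" "br (ee d) M2 \<in> gr 1 0 k" "M2 \<in> gr 1 0 k" using R D M gr_mono[of k "k + 1" 1 0] by (auto simp: M2_def)
  ultimately show "Ad (mexp (ee d) t) M - c \<cdot> ee (1,0) \<in> gr 1 0 k"
   by (simp add: gr_add gr_scale)
  have "cf (d + (1,0)) R = 0" "cf (d + (1,0)) (br (ee d) M2) = 0"
   using cf_eq_0_gr[OF d(4) R] cf_eq_0_gr[OF d(4) D] d(3) by simp_all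
  thus "cf (d + (1,0)) (Ad (mexp (ee d) t) M) = 0"
   unfolding A by (simp add: cf_simps cf_ee[OF d(4)] t_def c l(1))
 qed
qed

text \<open>The root groups of (1,1) and (2,1) remove the coefficients at (2,1) and (3,1). The one
  at (3,2) resists this method, as (2,2) is not a root, and is left to
  \<open>kill_highest\<close>.\<close>

lemma reduce2:
 assumes c: "c ~= 0" and M: "M - c \<cdot> ee (1,0) \<in> gr 1 0 2"
 shows "\<exists>p\<in>B. \<exists>z. Ad p M = c \<cdot> ee (1,0) + z \<cdot> ee (3,2)"
proof -
 obtain p where p: "p \<in> B" "Ad p M - c \<cdot> ee (1,0) \<in> gr 1 0 2" "cf (2,1) (Ad p M) = 0"
  using reduce_step[OF c M, of "(1,1)"] by (auto simp: rts_mem)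
 have "Ad p M - c \<cdot> ee (1,0) \<in> gr 1 0 (2 + 1)"
  using p(2) by (rule gr_top) (auto dest!: rts_deg(2) simp: cf_simps cf_ee' rts_mem p(3))
 then obtain q where q: "q \<in> B" "Ad q (Ad p M) - c \<cdot> ee (1,0) \<in> gr 1 0 3" "cf (3,1) (Ad q (Ad p M)) = 0"
  using reduce_step[OF c, of "Ad p M" 3 "(2,1)"] by (auto simp: rts_mem)
 have "Ad q (Ad p M) - c \<cdot> ee (1,0) = cf (3,2) (Ad q (Ad p M)) \<cdot> ee (3,2)"
  using gr3_eq[OF q(2)] by (simp add: cf_simps cf_ee' rts_mem q(3))
 hence "Ad (q ** p) M = c \<cdot> ee (1,0) + cf (3,2) (Ad q (Ad p M)) \<cdot> ee (3,2)"
  using Ad_mult[OF B_group(1)[OF q(1)] B_group(1)[OF p(1)]] by (simp add: diff_eq_eq add.commute)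
 thus ?thesis using B_group(3)[OF q(1) p(1)] by blast
qed

text \<open>The brackets with \<open>?A\<close> and \<open>?T\<close> commute, \<open>?T\<close>
  kills \<open>?E\<close> in two steps and \<open>?A\<close> in four. Of the binomial expansion of
  the fourth power only the term with coefficient \<open>4 * c ^ 3 * z\<close> remains, and its
  vector is nonzero.\<close>

lemma kill_highest:
 assumes c: "c ~= 0" and M: "M = c \<cdot> ee (1,0) + z \<cdot> ee (3,2)" and 0: "(br M ^^ 4) (ee (-3,-1)) = 0"
 shows "z = 0"
proof -
 let ?A = "ee (1,0)" and ?T = "ee (3,2)" and ?E = "ee (-3,-1)"
 note A = ee[OF rts_mem(1)] and T = ee[OF rts_mem(6)] and E = ee[OF rts_mem(11)]
 define F where "F = br ?T ?E"
 have F: "F \<in> gs (0,1)" "F ~= 0"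
  unfolding F_def using br_gs[OF T(1) E(1)] root_string[OF rts_mem(6,11) _ T E] by (simp_all add: rts_mem)
 have F1: "br ?A F \<in> gs (1,1)" "br ?A F ~= 0"
  using br_gs[OF A(1) F(1)] root_string[OF rts_mem(1,2) _ A F] by (simp_all add: rts_mem)
 have F2: "br ?A (br ?A F) \<in> gs (2,1)" "br ?A (br ?A F) ~= 0"
  using br_gs[OF A(1) F1(1)] root_string[OF rts_mem(1,3) _ A F1] by (simp_all add: rts_mem)
 have F3: "br ?A (br ?A (br ?A F)) ~= 0"
  using root_string[OF rts_mem(1,4) _ A F2] by (simp_all add: rts_mem)
 have AT: "br ?T ?A = 0" by (rule br_wts) (simp_all add: rts_mem wts_eq)
 have com: "br ?T (br ?A X) = br ?A (br ?T X)" for X unfolding jacobi[of ?T ?A X] by (simp add: AT br_simps)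
 have A4: "br ?A (br ?A (br ?A (br ?A ?E))) = 0"
  by (rule gs_outside[OF _ br_gs[OF A(1) br_gs[OF A(1) br_gs[OF A(1) br_gs[OF A(1) E(1)]]]]]) (simp add: wts_eq)
 have TF: "br ?T F = 0" by (rule gs_outside[OF _ br_gs[OF T(1) F(1)]]) (simp add: wts_eq)
 have "(br M ^^ 4) ?E = (4 * c ^ 3 * z) \<cdot> br ?A (br ?A (br ?A F))"
 proof -
  have 1: "br M ?E = c \<cdot> br ?A ?E + z \<cdot> F" by (simp add: M br_simps F_def)
  have 2: "br M (br M ?E) = (c * c) \<cdot> br ?A (br ?A ?E) + (2 * c * z) \<cdot> br ?A F"
   unfolding 1 by (simp add: M br_simps com F_def[symmetric] TF mm.scale_right_distrib) (simp add: vec_eq_iff algebra_simps)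
  have 3: "br M (br M (br M ?E)) = (c * c * c) \<cdot> br ?A (br ?A (br ?A ?E)) + (3 * c * c * z) \<cdot> br ?A (br ?A F)"
   unfolding 2 by (simp add: M br_simps com F_def[symmetric] TF mm.scale_right_distrib) (simp add: vec_eq_iff algebra_simps)
  have "br M (br M (br M (br M ?E))) = (4 * c ^ 3 * z) \<cdot> br ?A (br ?A (br ?A F))"
   unfolding 3 by (simp add: M br_simps com F_def[symmetric] TF A4 mm.scale_right_distrib)
    (simp add: vec_eq_iff algebra_simps power3_eq_cube)
  thus ?thesis by (simp add: numeral_eq_Suc)
 qed
 thus ?thesis using 0 F3 c by simp
qed

lemma ad_fourth: "X \<in> \<g> ==> (br (ee (2,1)) ^^ 4) X = 0"
proof -
 assume X: "X \<in> \<g>"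
 have "X \<in> gr 1 0 (-3)" by (rule gr_3I[OF X]) (auto simp: wts_eq)
 from br_funpow_gr[OF ee_gr[of "(2,1)" 2] this, of 4] have "(br (ee (2,1)) ^^ 4) X \<in> gr 1 0 5" by (simp add: rts_mem)
 from gr_sum[OF this] show ?thesis
 proof (rule trans)
  have e: "{c \<in> wts. 5 \<le> 1 * fst c + 0 * snd c} = {}" by (auto simp: wts_eq)
  show "(\<Sum>c\<in>{c \<in> wts. 5 \<le> 1 * fst c + 0 * snd c}. pc c ((br (ee (2,1)) ^^ 4) X)) = 0" unfolding e by simp
 qed
qed

lemma Ad_funpow_br: "invertible g ==> Ad g ((br X ^^ n) Y) = (br (Ad g X) ^^ n) (Ad g Y)"
 by (induction n) (simp_all add: Ad_br)

text \<open>The normal form gives \<open>w\<close> taking \<open>ee (2,1)\<close> to a multiple of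
  \<open>ee (1,0)\<close>. Then \<open>na ** w\<close> preserves the line of
  \<open>ee (2,1)\<close>, so \<open>g\<close> is \<open>c0 ** na ** p\<close> with
  \<open>c0\<close> and \<open>p\<close> in \<open>QQ\<close>. Once \<open>x\<close> is split off
  from \<open>c0\<close>, the rest \<open>k\<close> fixes the line of \<open>ee (3,1)\<close>, and
  by \<open>opposite_plane\<close> it can be pulled through \<open>na\<close> into
  \<open>QQ\<close>.\<close>

lemma fib_cells:
 assumes g: "g \<in> fib" "g \<notin> QQ"
 shows "\<exists>x\<in>insert nb (range (mexp (ee (0,1)))). \<exists>y\<in>insert nb (range (mexp (ee (0,-1)))). \<exists>b\<in>B.
  g = x ** na ** y ** b"
proof -
 have gG: "g \<in> G" and M1: "Ad (matrix_inv g) (ee (2,1)) \<in> gr 1 0 1" using g(1) by (auto simp: fib_def)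
 note gi = G_group(1)[OF gG] and ni = G_group(1)[OF na_G]
 have M2: "Ad (matrix_inv g) (ee (2,1)) \<notin> gr 1 0 2" using QQ_if_deg2[OF gG] g(2) by blast
 obtain p1 c where p1: "p1 \<in> KK" "c ~= 0" "Ad p1 (Ad (matrix_inv g) (ee (2,1))) - c \<cdot> ee (1,0) \<in> gr 1 0 2"
  using reduce1[OF M1 M2] by blast
 obtain p2 z where p2: "p2 \<in> B" "Ad p2 (Ad p1 (Ad (matrix_inv g) (ee (2,1)))) = c \<cdot> ee (1,0) + z \<cdot> ee (3,2)"
  using reduce2[OF p1(2,3)] by blast
 define p where "p = p2 ** p1"
 have p: "p \<in> QQ" unfolding p_def by (intro QQ_mult B_QQ KK_QQ p1 p2)
 note pi = G_group(1)[OF QQ_G[OF p]]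
 define w where "w = p ** matrix_inv g"
 have wG: "w \<in> G" unfolding w_def by (intro G_group QQ_G p gG)
 note wi = G_group(1)[OF wG]
 have w: "Ad w (ee (2,1)) = c \<cdot> ee (1,0) + z \<cdot> ee (3,2)"
  unfolding w_def p_def p2(2)[symmetric]
  using Ad_mult invertible_mult invertible_matrix_inv[OF gi] G_group(1)[OF KK_G[OF p1(1)]] B_group(1)[OF p2(1)] by metis
 have "(br (Ad w (ee (2,1))) ^^ 4) (ee (-3,-1)) = Ad w ((br (ee (2,1)) ^^ 4) (Ad (matrix_inv w) (ee (-3,-1))))"
  by (simp add: Ad_funpow_br[OF wi] Ad_inv(2)[OF wi])
 also have "\<dots> = 0"
  using ad_fourth[OF Ad_g[OF G_group(4)[OF wG] gs_g[OF ee(1)[OF rts_mem(11)]]]] by (simp add: Ad_simps)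
 finally have "z = 0" by (rule kill_highest[OF p1(2) w])
 hence w: "Ad w (ee (2,1)) = c \<cdot> ee (1,0)" using w by simp
 define c0 where "c0 = matrix_inv (na ** w)"
 have c0G: "c0 \<in> G" unfolding c0_def by (intro G_group na_G wG)
 have ic0: "matrix_inv c0 = na ** w" unfolding c0_def by (rule matrix_inv_inv) (simp add: invertible_mult ni wi)
 have nw: "Ad (na ** w) (ee (2,1)) \<in> gs (2,1)"
  unfolding Ad_mult[OF ni wi] w using na_gs[OF mm.subspace_scale[OF csub_gs ee(1)[OF rts_mem(1)]]] by simp
 have c0: "c0 \<in> QQ" by (rule QQ_if_deg2[OF c0G]) (unfold ic0, rule gs_gr[OF nw], simp)
 obtain l where l: "Ad (na ** w) (ee (2,1)) = l \<cdot> ee (2,1)" using gs_line[OF rts_mem(4) nw] by blast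
 have l0: "l ~= 0" using l Ad_nz[OF G_group(3)[OF na_G wG], of "ee (2,1)"] ee(2)[OF rts_mem(4)] by auto
 note c0i = G_group(1)[OF c0G]
 have "l \<cdot> Ad c0 (ee (2,1)) = ee (2,1)"
  using Ad_inv(2)[OF c0i, of "ee (2,1)"] l by (simp add: ic0 Ad_simps)
 hence "inverse l \<cdot> l \<cdot> Ad c0 (ee (2,1)) = inverse l \<cdot> ee (2,1)" by simp
 hence c0N: "Ad c0 (ee (2,1)) = inverse l \<cdot> ee (2,1)" using l0 by (simp only: mm.scale_scale) simp
 have g_eq: "g = c0 ** na ** p"
 proof -
  have "c0 ** (na ** w) = mat 1" using matrix_inv_mult(2)[OF c0i] by (simp add: ic0)
  hence "c0 ** na ** p ** matrix_inv g = mat 1" by (simp add: w_def matrix_mul_assoc)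
  hence "c0 ** na ** p ** matrix_inv g ** g = g" by simp
  thus ?thesis by (simp add: matrix_mul_assoc[symmetric] matrix_inv_mult(1)[OF gi])
 qed
 define X where "X = Ad c0 (ee (3,1))"
 have X3: "X \<in> gr 1 0 3" unfolding X_def by (rule QQ_gr3[OF c0 ee_gr]) (simp_all add: rts_mem)
 have Xnz: "X ~= 0" unfolding X_def using Ad_nz[OF c0G] ee(2)[of "(3,1)"] by (simp add: rts_mem)
 obtain x m where x: "x \<in> insert nb (range (mexp (ee (0,1))))" "X = m \<cdot> Ad x (ee (3,1))"
  using plane_cells[OF X3 Xnz, of "(0,1)" "(3,1)"] by blast
 have xK: "x \<in> KK" using x(1) nb_KK KK_mexp by auto
 note xi = G_group(1)[OF KK_G[OF xK]]
 define k where "k = matrix_inv x ** c0"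
 have k: "k \<in> QQ" unfolding k_def by (intro QQ_mult QQ_inv KK_QQ xK c0)
 note ki = G_group(1)[OF QQ_G[OF k]]
 have kA: "Ad k Y = Ad (matrix_inv x) (Ad c0 Y)" for Y
  unfolding k_def by (rule Ad_mult[OF invertible_matrix_inv[OF xi] c0i])
 have k31: "Ad k (ee (3,1)) = m \<cdot> ee (3,1)"
  unfolding kA X_def[symmetric] x(2) by (simp add: Ad_simps Ad_inv(1)[OF xi])
 have kN: "Ad k (ee (2,1)) = inverse l \<cdot> ee (2,1)"
  unfolding kA c0N Ad_simps using KK_N[OF xK] Ad_inv(1)[OF xi, of "ee (2,1)"] by simp
 obtain y r where Y: "Ad k (ee (0,-1)) = y \<cdot> ee (0,-1) + r \<cdot> ee (3,1)" using opposite_plane[OF k kN k31] by blast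
 define q where "q = matrix_inv na ** k ** na"
 have qG: "q \<in> G" unfolding q_def by (intro G_group na_G QQ_G k)
 have "q \<in> QQ"
 proof -
  have qA: "Ad q Z = Ad (matrix_inv na) (Ad k (Ad na Z))" for Z
   unfolding q_def by (simp add: Ad_mult invertible_mult invertible_matrix_inv ni ki)
  have i31: "Ad (matrix_inv na) (ee (3,1)) \<in> gr 1 0 3" and i01: "Ad (matrix_inv na) (ee (0,-1)) \<in> gr 1 0 3"
   using na_inv_gs[of 3 1 "ee (3,1)"] na_inv_gs[of 0 "-1" "ee (0,-1)"] ee(1)
   by (auto intro!: gs_gr[of _ "(3,_)"] simp: rts_mem)
  have "Ad na (ee (3,1)) \<in> gs (3,1)" "Ad na (ee (3,2)) \<in> gs (0,-1)"
   using na_gs[OF ee(1)[of "(3,1)"]] na_gs[OF ee(1)[of "(3,2)"]] by (simp_all add: rts_mem)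
  then obtain u v where uv: "Ad na (ee (3,1)) = u \<cdot> ee (3,1)" "Ad na (ee (3,2)) = v \<cdot> ee (0,-1)"
   using gs_line[of "(3,1)"] gs_line[of "(0,-1)"] rts_mem by blast
  have "Ad q (ee (3,1)) \<in> gr 1 0 3" "Ad q (ee (3,2)) \<in> gr 1 0 3"
   unfolding qA uv by (auto simp: Ad_simps k31 Y intro!: gr_add gr_scale i31 i01)
  hence "Ad q Z \<in> gr 1 0 3" if "Z \<in> gr 1 0 3" for Z
   by (subst gr3_eq[OF that]) (simp add: Ad_simps gr_add gr_scale)
  thus ?thesis using qG by (simp add: QQ_def)
 qed
 then obtain y' b where yb: "y' \<in> insert nb (range (mexp (ee (0,-1))))" "b \<in> B" "q ** p = y' ** b"
  using QQ_cells[OF QQ_mult[OF _ p]] by blast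
 have "x ** k = c0" unfolding k_def by (simp add: matrix_mul_assoc matrix_inv_mult(2)[OF xi])
 moreover have "na ** q = k ** na" unfolding q_def by (simp add: matrix_mul_assoc matrix_inv_mult(2)[OF ni])
 ultimately have "g = x ** na ** (q ** p)" unfolding g_eq by (metis matrix_mul_assoc)
 hence "g = x ** na ** y' ** b" by (simp add: yb(3) matrix_mul_assoc)
 thus ?thesis using x(1) yb(1,2) by blast
qed

end

section \<open>Polynomial charts and dimension\<close>

inductive_set poly2 :: "(complex \<times> complex => complex) set" where
 const: "(\<lambda>z. c) \<in> poly2"
| fst: "fst \<in> poly2"
| snd: "snd \<in> poly2"
| add: "f \<in> poly2 ==> g \<in> poly2 ==> (\<lambda>z. f z + g z) \<in> poly2"
| mult: "f \<in> poly2 ==> g \<in> poly2 ==> (\<lambda>z. f z * g z) \<in> poly2"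

text \<open>The coefficients of the outer polynomial are polynomials in the first coordinate; the
  outer variable, whose degree is counted, is the second coordinate.\<close>

definition eval2 :: "complex poly poly => complex \<times> complex => complex" where
 "eval2 p z = poly (poly p [:snd z:]) (fst z)"

lemma eval2_simps: "eval2 (p + q) z = eval2 p z + eval2 q z" "eval2 (p * q) z = eval2 p z * eval2 q z"
  "eval2 (smult u p) z = poly u (fst z) * eval2 p z" "eval2 0 z = 0" "eval2 [:u:] z = poly u (fst z)"
  "eval2 (pCons u p) z = poly u (fst z) + snd z * eval2 p z"
 by (simp_all add: eval2_def)

lemma poly2_eval2: "f \<in> poly2 ==> \<exists>p. f = eval2 p"
proof (induction rule: poly2.induct)
 case (const c)
 show ?case by (rule exI[of _ "[:[:c:]:]"]) (simp add: fun_eq_iff eval2_def)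
next
 case fst
 show ?case by (rule exI[of _ "[:[:0, 1:]:]"]) (simp add: fun_eq_iff eval2_def)
next
 case snd
 show ?case by (rule exI[of _ "[:0, 1:]"]) (simp add: fun_eq_iff eval2_def)
next
 case (add f g)
 then obtain p q where "f = eval2 p" "g = eval2 q" by blast
 thus ?case by (intro exI[of _ "p + q"]) (simp add: eval2_simps fun_eq_iff)
next
 case (mult f g)
 then obtain p q where "f = eval2 p" "g = eval2 q" by blast
 thus ?case by (intro exI[of _ "p * q"]) (simp add: eval2_simps fun_eq_iff)
qed

lemma eval2_poly2: "eval2 p \<in> poly2"
proof (induction p)
 case 0
 show ?case using poly2.const[of 0] by (simp add: eval2_simps[abs_def])
next
 case (pCons u p)
 have "(\<lambda>z. poly u (fst z)) \<in> poly2"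
 proof (induction u)
  case (pCons a u)
  thus ?case by (simp add: poly2.intros)
 qed (simp add: poly2.const)
 hence "(\<lambda>z. poly u (fst z) + snd z * eval2 p z) \<in> poly2" using pCons.IH by (intro poly2.add poly2.mult poly2.snd)
 thus ?case by (simp add: eval2_simps[abs_def])
qed

lemma poly2_swap: "f \<in> poly2 ==> (\<lambda>z. f (prod.swap z)) \<in> poly2"
 by (induction rule: poly2.induct) (simp_all add: poly2.intros)

lemma poly2_sum: "(\<And>i. i \<in> I ==> f i \<in> poly2) ==> (\<lambda>z. \<Sum>i\<in>I. f i z) \<in> poly2"
 by (induction I rule: infinite_finite_induct) (simp_all add: poly2.intros)

lemma poly2_power: "f \<in> poly2 ==> (\<lambda>z. f z ^ k) \<in> poly2"
 by (induction k) (simp_all add: poly2.intros)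

text \<open>The polynomials vanishing on irreducible sets \<open>A1 \<subset> A2\<close> form primes \<open>p1 \<supset> p2 ~= 0\<close>. Comparing elements
 of least degree in \<open>t\<close> of \<open>p2 - {0}\<close> and of \<open>p1 - p2\<close> by pseudo-division shows that \<open>p1\<close> contains
 a nonzero polynomial in \<open>s\<close> alone.\<close>

lemma fst_constant_if_two_relations:
 assumes prime1: "\<And>f g. f \<in> poly2 ==> g \<in> poly2 ==> (\<forall>z\<in>A1. f z * g z = 0) ==> (\<forall>z\<in>A1. f z = 0) \<or> (\<forall>z\<in>A1. g z = 0)"
  and prime2: "\<And>f g. f \<in> poly2 ==> g \<in> poly2 ==> (\<forall>z\<in>A2. f z * g z = 0) ==> (\<forall>z\<in>A2. f z = 0) \<or> (\<forall>z\<in>A2. g z = 0)"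
  and A: "A1 \<subseteq> A2"
  and f: "f \<in> poly2" "f a ~= 0" "\<And>z. z \<in> A2 ==> f z = 0"
  and g: "g \<in> poly2" "b \<in> A2" "g b ~= 0" "\<And>z. z \<in> A1 ==> g z = 0"
 shows "\<exists>c. \<forall>z\<in>A1. fst z = c"
proof -
 define I1 I2 where "I1 p \<longleftrightarrow> (\<forall>z\<in>A1. eval2 p z = 0)" and "I2 p \<longleftrightarrow> (\<forall>z\<in>A2. eval2 p z = 0)" for p
 have I21: "I2 p ==> I1 p" for p using A by (auto simp: I1_def I2_def)
 have pr2: "I2 (p * q) ==> I2 p \<or> I2 q" for p q
  unfolding I2_def eval2_simps by (rule prime2[OF eval2_poly2 eval2_poly2])
 have I0: "I2 0" by (simp add: I2_def eval2_simps)
 obtain pf where pf: "f = eval2 pf" using poly2_eval2[OF f(1)] by blast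
 have "pf ~= 0 \<and> I2 pf" using f(2,3) by (auto simp: I2_def eval2_simps pf)
 from ex_has_least_nat[of "\<lambda>p. p ~= 0 \<and> I2 p", OF this, of degree]
 obtain p where p: "p ~= 0" "I2 p" and p_min: "\<And>q. q ~= 0 ==> I2 q ==> degree p \<le> degree q" by blast
 obtain pg where pg: "g = eval2 pg" using poly2_eval2[OF g(1)] by blast
 have "I1 pg \<and> \<not> I2 pg" using g(2-4) by (auto simp: I1_def I2_def pg)
 from ex_has_least_nat[of "\<lambda>h. I1 h \<and> \<not> I2 h", OF this, of degree]
 obtain h where h: "I1 h" "\<not> I2 h" and h_min: "\<And>q. I1 q ==> \<not> I2 q ==> degree h \<le> degree q" by blast
 have h0: "h ~= 0" using h(2) I0 by auto
 have lead: "\<not> I2 [:u:]" if "u ~= 0" "0 < degree p" for u using p_min[of "[:u:]"] that by auto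
 have sm: "smult u q = [:u:] * q" for u and q :: "complex poly poly" by simp
 have "\<exists>u. u ~= 0 \<and> I1 [:u:]"
 proof (cases "degree p = 0")
  case True
  then obtain u where "p = [:u:]" by (rule degree_eq_zeroE)
  thus ?thesis using p I21 by auto
 next
  case False
  obtain q r where qr: "pseudo_divmod h p = (q, r)" by (cases "pseudo_divmod h p")
  define u where "u = lead_coeff p ^ (Suc (degree h) - degree p)"
  have u: "u ~= 0" "smult u h = p * q + r" "r = 0 \<or> degree r < degree p"
   using pseudo_divmod[OF p(1) qr] p(1) by (simp_all add: u_def)
  \<comment> \<open>The remainder lies in the larger prime but not in the smaller one, so the
    minimality of \<open>h\<close> gives \<open>degree h < degree p\<close>.\<close>
  have "\<not> I2 r"
  proof
   assume "I2 r"
   hence "r = 0" using p_min u(3) by (metis not_le)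
   hence "I2 ([:u:] * h)" using u(2) p(2) unfolding sm by (simp add: I2_def eval2_simps)
   thus False using pr2 h(2) lead u(1) False by blast
  qed
  moreover have "I1 r"
  proof -
   have "eval2 r z = poly u (fst z) * eval2 h z - eval2 p z * eval2 q z" for z
    using arg_cong[OF u(2), of "\<lambda>p. eval2 p z"] by (simp add: eval2_simps)
   thus ?thesis using h(1) I21[OF p(2)] by (simp add: I1_def)
  qed
  ultimately have hp: "degree h < degree p" using h_min u(3) I0 by (metis le_less_trans)
  have "degree h = 0"
  proof (rule ccontr)
   assume dh: "degree h ~= 0"
   obtain q r where qr: "pseudo_divmod p h = (q, r)" by (cases "pseudo_divmod p h")
   define u where "u = lead_coeff h ^ (Suc (degree p) - degree h)"
   have u: "u ~= 0" "smult u p = h * q + r" "r = 0 \<or> degree r < degree h"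
    using pseudo_divmod[OF h0 qr] h0 by (simp_all add: u_def)
   \<comment> \<open>By both minimality conditions this remainder is zero. The cofactor
     \<open>q\<close> then lies in the smaller prime and has degree at least that of
     \<open>p\<close>, which leaves degree 0 for \<open>h\<close>.\<close>
   have "I1 r"
   proof -
    have "eval2 r z = poly u (fst z) * eval2 p z - eval2 h z * eval2 q z" for z
     using arg_cong[OF u(2), of "\<lambda>p. eval2 p z"] by (simp add: eval2_simps)
    thus ?thesis using h(1) I21[OF p(2)] by (simp add: I1_def)
   qed
   hence r: "r = 0" using h_min[of r] p_min[of r] u(3) hp by fastforce
   hence hq: "smult u p = h * q" using u(2) by simp
   hence q0: "q ~= 0" using u(1) p(1) by auto
   have "I2 (h * q)" using p(2) unfolding hq[symmetric] by (simp add: I2_def eval2_simps)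
   hence "I2 q" using pr2 h(2) by blast
   hence "degree p \<le> degree q" using p_min q0 by blast
   moreover have "degree p = degree h + degree q"
    using arg_cong[OF hq, of degree] u(1) h0 q0 by (simp add: degree_mult_eq)
   ultimately show False using dh by simp
  qed
  then obtain u where "h = [:u:]" by (rule degree_eq_zeroE)
  thus ?thesis using h h0 by auto
 qed
 then obtain u' where "u' ~= 0 \<and> I1 [:u':]" ..
 \<comment> \<open>Minimal degree and primeness force this polynomial to be linear up to a scalar: a
   root of it can be split off, and the cofactor no longer vanishes on \<open>A1\<close>.\<close>
 from ex_has_least_nat[of "\<lambda>u. u ~= 0 \<and> I1 [:u:]", OF this, of degree]
 obtain u where u: "u ~= 0" "I1 [:u:]" and u_min: "\<And>v. v ~= 0 ==> I1 [:v:] ==> degree u \<le> degree v" by blast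
 show ?thesis
 proof (cases "A1 = {}")
  case False
  then obtain z0 where z0: "z0 \<in> A1" by blast
  hence "poly u (fst z0) = 0" using u(2) by (simp add: I1_def eval2_simps)
  then obtain v where v: "u = [:- fst z0, 1:] * v" unfolding poly_eq_0_iff_dvd dvd_def by blast
  have "\<forall>z\<in>A1. eval2 [:[:- fst z0, 1:]:] z * eval2 [:v:] z = 0"
   using u(2) unfolding I1_def eval2_simps v by auto
  hence "(\<forall>z\<in>A1. eval2 [:[:- fst z0, 1:]:] z = 0) \<or> I1 [:v:]"
   unfolding I1_def by (rule prime1[OF eval2_poly2 eval2_poly2])
  hence "(\<forall>z\<in>A1. fst z = fst z0) \<or> I1 [:v:]" by (auto simp: eval2_simps)
  moreover have "\<not> I1 [:v:]"
  proof
   assume "I1 [:v:]"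
   moreover have "v ~= 0" using u(1) v by auto
   ultimately have "degree u \<le> degree v" by (rule u_min[rotated])
   thus False using \<open>v ~= 0\<close> unfolding v by (subst (asm) degree_mult_eq) auto
  qed
  ultimately show ?thesis by blast
 qed blast
qed

section \<open>Chains of irreducible closed sets and charts\<close>

lemma irreducible_spaceD:
 assumes "irreducible_space (subtopology X Z)" "closedin X Z" "closedin X C" "closedin X D" "Z \<subseteq> C \<union> D"
 shows "Z \<subseteq> C \<or> Z \<subseteq> D"
proof -
 have ts: "topspace (subtopology X Z) = Z" using closedin_subset[OF assms(2)] by auto
 have "closedin (subtopology X Z) (Z \<inter> C)" "closedin (subtopology X Z) (Z \<inter> D)"
  using assms(2-4) by (simp_all add: closedin_closed_subtopology closedin_Int)
 moreover have "Z = (Z \<inter> C) \<union> (Z \<inter> D)" using assms(5) by blast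
 ultimately have "Z \<inter> C = Z \<or> Z \<inter> D = Z" using assms(1) unfolding irreducible_space_def ts by metis
 thus ?thesis by blast
qed

lemma irreducible_space_nonempty:
 assumes "irreducible_space (subtopology X Z)"
 shows "Z ~= {}"
 using conjunct1[OF assms[unfolded irreducible_space_def]] by auto

lemma irreducible_spaceI:
 assumes Z: "closedin X Z" "Z ~= {}"
  and cover: "\<And>C D. closedin X C ==> closedin X D ==> Z \<subseteq> C \<union> D ==> Z \<subseteq> C \<or> Z \<subseteq> D"
 shows "irreducible_space (subtopology X Z)"
 unfolding irreducible_space_def
proof (intro conjI allI impI)
 have ts: "topspace (subtopology X Z) = Z" using closedin_subset[OF Z(1)] by auto
 thus "topspace (subtopology X Z) ~= {}" using Z(2) by simp
 fix C D assume CD: "closedin (subtopology X Z) C \<and> closedin (subtopology X Z) D \<and> topspace (subtopology X Z) = C \<union> D"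
 hence "closedin X C" "closedin X D" "Z = C \<union> D" unfolding ts by (simp_all add: closedin_closed_subtopology[OF Z(1)])
 thus "C = topspace (subtopology X Z) \<or> D = topspace (subtopology X Z)" using cover[of C D] unfolding ts by auto
qed

definition chain :: "'a topology => nat => (nat => 'a set) => bool" where
 "chain X n Z \<longleftrightarrow> (\<forall>i\<le>n. closedin X (Z i) \<and> irreducible_space (subtopology X (Z i))) \<and> (\<forall>i<n. Z i \<subset> Z (Suc i))"

lemma chain_subtopology:
 assumes C: "closedin X C"
 shows "chain (subtopology X C) m W \<longleftrightarrow> chain X m W \<and> W m \<subseteq> C"
proof -
 have sub: "subtopology (subtopology X C) A = subtopology X A" if "A \<subseteq> C" for A
  using that by (simp add: subtopology_subtopology inf.absorb2)
 have "W i \<subseteq> W m" if "i \<le> m" "\<forall>i<m. W i \<subset> W (Suc i)" for i m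
  using that
 proof (induction m)
  case (Suc m)
  thus ?case by (cases "i = Suc m") (simp_all, blast)
 qed simp
 thus ?thesis
  unfolding chain_def closedin_closed_subtopology[OF C] using sub by (metis dual_order.trans order_refl)
qed

lemma krull_dim_closed:
 assumes C: "closedin X C" and ex: "chain X n Z" "Z n \<subseteq> C" and no: "\<And>W. chain X (Suc n) W ==> W (Suc n) \<subseteq> C ==> False"
 shows "krull_dim (subtopology X C) = enat n"
proof -
 have iff: "(\<exists>W. chain (subtopology X C) m W) \<longleftrightarrow> (\<exists>W. chain X m W \<and> W m \<subseteq> C)" for m
  by (simp add: chain_subtopology[OF C])
 show ?thesis
  unfolding krull_dim_def chain_def[symmetric] iff
 proof (rule Sup_eqI)
  fix y assume "y \<in> {enat m |m. \<exists>W. chain X m W \<and> W m \<subseteq> C}"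
  then obtain m W where m: "y = enat m" "chain X m W" "W m \<subseteq> C" by blast
  have "\<not> Suc n \<le> m"
  proof
   assume le: "Suc n \<le> m"
   \<comment> \<open>Dropping the lowest members of a longer chain keeps its top member inside
     \<open>C\<close>.\<close>
   hence "chain X (Suc n) (\<lambda>i. W (i + (m - Suc n)))" using m(2) unfolding chain_def by auto
   thus False by (rule no) (use le m(3) in simp)
  qed
  thus "y \<le> enat n" using m(1) by simp
 next
  fix y assume "\<And>x. x \<in> {enat m |m. \<exists>W. chain X m W \<and> W m \<subseteq> C} ==> x \<le> y"
  thus "enat n \<le> y" using ex by blast
 qed
qed

text \<open>A closed set is cut out in the chart by polynomials, and the zero set of a polynomial
  becomes closed once the complement of the chart is added. For the constant 1 the latter says that
  the image of the chart is open.\<close>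

definition chart :: "'a topology => (complex \<times> complex => 'a) => bool" where
 "chart X \<phi> \<longleftrightarrow> inj \<phi> \<and>
   (\<forall>C p. closedin X C --> \<phi> p \<notin> C --> (\<exists>f\<in>poly2. f p ~= 0 \<and> (\<forall>q. \<phi> q \<in> C --> f q = 0))) \<and>
   (\<forall>f\<in>poly2. closedin X {x \<in> topspace X. \<forall>p. x = \<phi> p --> f p = 0})"

text \<open>A chart around a point of \<open>Z 0\<close> meets every member of the chain, and the
  traces stay irreducible and distinct. Two relations make the first coordinate constant on
  \<open>A 1\<close>, and after exchanging the coordinates also the second, so there is no room for
  \<open>A 0\<close> below.\<close>

lemma no_chain_if_charts:
 assumes charts: "\<And>z. z \<in> topspace X ==> \<exists>\<phi>. chart X \<phi> \<and> z \<in> range \<phi>"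
  and ch3: "chain X 3 Z"
 shows False
proof -
 have Z: "closedin X (Z i)" "irreducible_space (subtopology X (Z i))" if "i \<le> 3" for i
  using ch3 that by (simp_all add: chain_def)
 have chain: "Z i \<subset> Z (Suc i)" if "i < 3" for i using ch3 that by (simp add: chain_def)
 have "Z 0 ~= {}" using irreducible_space_nonempty[OF Z(2)[of 0]] by simp
 then obtain z where z: "z \<in> Z 0" by blast
 hence "z \<in> topspace X" using closedin_subset[OF Z(1)[of 0]] by auto
 from charts[OF this] obtain \<phi> where ch: "chart X \<phi>" and z\<phi>: "z \<in> range \<phi>" by blast
 note \<phi> = conjunct1[OF ch[unfolded chart_def]] z\<phi>
  and pull = conjunct1[OF conjunct2[OF ch[unfolded chart_def]], rule_format]
  and push = conjunct2[OF conjunct2[OF ch[unfolded chart_def]], rule_format]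
 define A where "A i = {p. \<phi> p \<in> Z i}" for i
 have zZ: "z \<in> Z i" if "i \<le> 3" for i
  using that
 proof (induction i)
  case (Suc i)
  thus ?case using chain[of i] by auto
 qed (rule z)
 have prime: "(\<forall>z\<in>A i. f z = 0) \<or> (\<forall>z\<in>A i. g z = 0)"
  if i: "i \<le> 3" and fg: "f \<in> poly2" "g \<in> poly2" "\<forall>z\<in>A i. f z * g z = 0" for i f g
 proof -
  have "Z i \<subseteq> {x \<in> topspace X. \<forall>p. x = \<phi> p --> f p = 0} \<union> {x \<in> topspace X. \<forall>p. x = \<phi> p --> g p = 0}"
  proof
   fix x assume x: "x \<in> Z i"
   hence xX: "x \<in> topspace X" using closedin_subset[OF Z(1)[OF i]] by blast
   show "x \<in> {x \<in> topspace X. \<forall>p. x = \<phi> p --> f p = 0} \<union> {x \<in> topspace X. \<forall>p. x = \<phi> p --> g p = 0}"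
   proof (cases "x \<in> range \<phi>")
    case True
    then obtain p where p: "x = \<phi> p" by blast
    have "p \<in> A i" using x p by (simp add: A_def)
    hence "f p * g p = 0" using fg(3) by blast
    hence "f p = 0 \<or> g p = 0" by simp
    thus ?thesis using p xX inj_eq[OF \<phi>(1)] by auto
   qed (use xX in auto)
  qed
  from irreducible_spaceD[OF Z(2)[OF i] Z(1)[OF i] push[OF fg(1)] push[OF fg(2)] this]
  show ?thesis by (auto simp: A_def)
 qed
 \<comment> \<open>If two traces agreed, the larger set would be covered by the smaller one and the
   complement of the chart; irreducibility excludes this, as the larger set meets the chart.\<close>
 have strict: "\<exists>p. p \<in> A (Suc i) \<and> p \<notin> A i" if i: "i < 3" for i
 proof (rule ccontr)
  assume no: "\<not> (\<exists>p. p \<in> A (Suc i) \<and> p \<notin> A i)"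
  have "Z (Suc i) \<subseteq> {x \<in> topspace X. \<forall>p. x = \<phi> p --> (1 :: complex) = 0} \<union> Z i"
   using no closedin_subset[OF Z(1)[of "Suc i"]] i by (auto simp: A_def)
  from irreducible_spaceD[OF Z(2) Z(1) push[OF poly2.const] Z(1) this] i
  have "Z (Suc i) \<subseteq> {x \<in> topspace X. \<forall>p. x = \<phi> p --> (1 :: complex) = 0} \<or> Z (Suc i) \<subseteq> Z i" by auto
  moreover have "z \<in> Z (Suc i)" using zZ[of "Suc i"] i by simp
  ultimately show False using \<phi>(2) chain[OF i] by auto
 qed
 have sub: "A i \<subseteq> A (Suc i)" if "i < 3" for i using chain[OF that] by (auto simp: A_def)
 obtain a where a: "a \<in> A (Suc 2)" "a \<notin> A 2" using strict[of 2] by auto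
 obtain f where f: "f \<in> poly2" "f a ~= 0" "\<And>q. q \<in> A 2 ==> f q = 0"
  using pull[OF Z(1)[of 2], of a] a(2) by (auto simp: A_def)
 obtain b where b: "b \<in> A 2" "b \<notin> A 1" using strict[of 1] by (auto simp: numeral_2_eq_2)
 obtain g where g: "g \<in> poly2" "g b ~= 0" "\<And>q. q \<in> A 1 ==> g q = 0"
  using pull[OF Z(1)[of 1], of b] b(2) by (auto simp: A_def)
 have s12: "A 1 \<subseteq> A 2" using sub[of 1] by (simp add: numeral_2_eq_2)
 have c1: "\<exists>c. \<forall>z\<in>A 1. fst z = c"
  by (rule fst_constant_if_two_relations[of "A 1" "A 2" f a g b]) (use prime[of 1] prime[of 2] s12 f g b(1) in simp_all)
 have c2: "\<exists>c. \<forall>z\<in>prod.swap ` A 1. fst z = c"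
 proof (rule fst_constant_if_two_relations[of _ "prod.swap ` A 2" "\<lambda>z. f (prod.swap z)" "prod.swap a" "\<lambda>z. g (prod.swap z)" "prod.swap b"])
  fix f' g' assume fg: "f' \<in> poly2" "g' \<in> poly2"
  show "(\<forall>z\<in>prod.swap ` A 1. f' z = 0) \<or> (\<forall>z\<in>prod.swap ` A 1. g' z = 0)" if "\<forall>z\<in>prod.swap ` A 1. f' z * g' z = 0"
   using prime[OF _ poly2_swap[OF fg(1)] poly2_swap[OF fg(2)], of 1] that by simp
  show "(\<forall>z\<in>prod.swap ` A 2. f' z = 0) \<or> (\<forall>z\<in>prod.swap ` A 2. g' z = 0)" if "\<forall>z\<in>prod.swap ` A 2. f' z * g' z = 0"
   using prime[OF _ poly2_swap[OF fg(1)] poly2_swap[OF fg(2)], of 2] that by simp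
 qed (use s12 poly2_swap f g b(1) in auto)
 obtain p where p: "p \<in> A (Suc 0)" "p \<notin> A 0" using strict[of 0] by auto
 obtain p0 where p0: "p0 \<in> A 0" using z \<phi>(2) by (auto simp: A_def)
 hence "p0 \<in> A 1" using sub[of 0] by auto
 hence "fst p = fst p0" "snd p = snd p0" using c1 c2 p(1) by force+
 hence "p = p0" by (rule prod_eqI)
 thus False using p(2) p0 by simp
qed

lemma connected_components_of_two:
 assumes ts: "topspace X = C1 \<union> C2" and cl: "closedin X C1" "closedin X C2" and dis: "C1 \<inter> C2 = {}"
  and con: "connectedin X C1" "connectedin X C2" and ne: "C1 ~= {}" "C2 ~= {}"
 shows "connected_components_of X = {C1, C2}"
proof -
 have comp: "connected_component_of_set X x = C" if C: "C = C1 \<and> D = C2 \<or> C = C2 \<and> D = C1" and x: "x \<in> C" for x C D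
 proof (rule antisym)
  show "C \<subseteq> connected_component_of_set X x"
   by (rule connected_component_of_maximal[OF _ x]) (use C con in auto)
  have "connectedin X (connected_component_of_set X x)" by (rule connectedin_connected_component_of)
  hence "\<not> (\<exists>E1 E2. closedin X E1 \<and> closedin X E2 \<and> connected_component_of_set X x \<subseteq> E1 \<union> E2 \<and>
    E1 \<inter> E2 \<inter> connected_component_of_set X x = {} \<and> E1 \<inter> connected_component_of_set X x ~= {} \<and>
    E2 \<inter> connected_component_of_set X x ~= {})" unfolding connectedin_closedin by blast
  moreover have "connected_component_of_set X x \<subseteq> C \<union> D"
   using connected_component_of_subset_topspace[of X x] ts C by blast
  moreover have "x \<in> connected_component_of_set X x" using x C ts by (auto simp: connected_component_of_refl)
  ultimately have "D \<inter> connected_component_of_set X x = {}" using C cl dis x by blast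
  thus "connected_component_of_set X x \<subseteq> C" using \<open>connected_component_of_set X x \<subseteq> C \<union> D\<close> by blast
 qed
 have "connected_components_of X = connected_component_of_set X ` (C1 \<union> C2)"
  unfolding connected_components_of_def ts ..
 also have "\<dots> = {C1, C2}"
  unfolding image_Un using comp[of C1 C2] comp[of C2 C1] ne by auto
 finally show ?thesis .
qed

section \<open>The topology of the fiber\<close>

lemma closedin_zariski_separate:
 assumes C: "closedin zariski C" and a: "invertible a" "a \<notin> C"
 shows "\<exists>f\<in>poly_fun. f a ~= 0 \<and> (\<forall>A\<in>C. f A = 0)"
proof -
 obtain R where R: "R \<subseteq> poly_fun" "C = {A \<in> carrier GL. \<forall>f\<in>R. f A = 0}"
  using C unfolding closedin_zariski by (elim exE conjE)
 from a obtain f where "f \<in> R" "f a ~= 0" unfolding R(2) by auto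
 thus ?thesis using R(1) unfolding R(2) by auto
qed

lemma zirr_closed_cover:
 assumes S: "zirr S" "S \<subseteq> carrier GL" and CD: "closedin zariski C" "closedin zariski D" "S \<subseteq> C \<union> D"
 shows "S \<subseteq> C \<or> S \<subseteq> D"
proof (rule ccontr)
 assume no: "\<not> (S \<subseteq> C \<or> S \<subseteq> D)"
 have sep: "\<exists>f\<in>poly_fun. f a ~= 0 \<and> (\<forall>A\<in>C. f A = 0)" if C: "closedin zariski C" "a \<in> S" "a \<notin> C" for a C
  using closedin_zariski_separate[OF C(1) _ C(3)] S(2) C(2) by auto
 obtain a b where ab: "a \<in> S" "a \<notin> C" "b \<in> S" "b \<notin> D" using no by blast
 obtain f where f: "f \<in> poly_fun" "f a ~= 0" "\<And>A. A \<in> C ==> f A = 0" using sep[OF CD(1) ab(1,2)] by blast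
 obtain g where g: "g \<in> poly_fun" "g b ~= 0" "\<And>A. A \<in> D ==> g A = 0" using sep[OF CD(2) ab(3,4)] by blast
 have "f A * g A = 0" if "A \<in> S" for A using CD(3) f(3) g(3) that by auto
 from zirrD[OF S(1) f(1) g(1) this] show False using f(2) g(2) ab by blast
qed

text \<open>A subspace is the common kernel of trace functionals. Invariance of the trace moves
  \<open>matrix_inv A\<close> from one factor to the other as \<open>A\<close>.\<close>

lemma closedin_Ad_subspace:
 fixes V :: "(complex^'n^'n) set"
 assumes V: "mm.subspace V"
 shows "closedin zariski {A. invertible A \<and> Ad A X \<in> V}" "closedin zariski {A. invertible A \<and> Ad (matrix_inv A) X \<in> V}"
proof -
 define F where "F = {F :: complex^'n^'n. \<forall>A\<in>V. trace (A ** F) = 0}"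
 have V_iff: "Y \<in> V \<longleftrightarrow> (\<forall>Z\<in>F. trace (Y ** Z) = 0)" for Y
 proof
  assume *: "\<forall>Z\<in>F. trace (Y ** Z) = 0"
  show "Y \<in> V"
  proof (rule ccontr)
   assume "Y \<notin> V"
   then obtain Z where "\<And>A. A \<in> V ==> trace (A ** Z) = 0" "trace (Y ** Z) ~= 0"
    using csubspace_separation[OF V] by auto
   thus False using * by (simp add: F_def)
  qed
 qed (simp add: F_def)
 have 0: "0 \<in> F" by (simp add: F_def matrix_ring_simps)
 have "trace (Ad (matrix_inv A) X ** Z) = trace (Ad A Z ** X)" if A: "invertible A" for A Z
  using trace_Ad_Ad[OF A, of "Ad (matrix_inv A) X" Z] by (simp add: Ad_inv(2)[OF A] trace_mul_sym[of X])
 hence eq: "{A. invertible A \<and> Ad (matrix_inv A) X \<in> V} = (\<Inter>Z\<in>F. {A. invertible A \<and> trace (Ad A Z ** X) = 0})"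
  "{A. invertible A \<and> Ad A X \<in> V} = (\<Inter>Z\<in>F. {A. invertible A \<and> trace (Ad A X ** Z) = 0})"
  unfolding V_iff using 0 by auto
 show "closedin zariski {A. invertible A \<and> Ad A X \<in> V}" "closedin zariski {A. invertible A \<and> Ad (matrix_inv A) X \<in> V}"
  unfolding eq using 0 by (auto intro!: closedin_Inter closedin_reg_zero reg_fun_trace_Ad)
qed

lemma zirr_double: "zirr {k ** n ** l | k l. k \<in> gen S \<and> l \<in> gen S'}"
proof (rule zirr_curves)
 show "{k ** n ** l | k l. k \<in> gen S \<and> l \<in> gen S'} ~= {}" using gen.one by blast
 fix p q assume "p \<in> {k ** n ** l | k l. k \<in> gen S \<and> l \<in> gen S'}" "q \<in> {k ** n ** l | k l. k \<in> gen S \<and> l \<in> gen S'}"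
 then obtain k l k' l' where kl: "k \<in> gen S" "l \<in> gen S'" "k' \<in> gen S" "l' \<in> gen S'" "p = k ** n ** l" "q = k' ** n ** l'" by blast
 obtain c where c: "entire_curve c" "\<And>t. c t \<in> gen S" "c 0 = mat 1" "c 1 = matrix_inv k ** k'"
  using gen_curve[OF gen_mult[OF gen_inv[OF kl(1)] kl(3)]] by blast
 obtain d where d: "entire_curve d" "\<And>t. d t \<in> gen S'" "d 0 = mat 1" "d 1 = matrix_inv l ** l'"
  using gen_curve[OF gen_mult[OF gen_inv[OF kl(2)] kl(4)]] by blast
 show "\<exists>c. entire_curve c \<and> (\<forall>t. c t \<in> {k ** n ** l | k l. k \<in> gen S \<and> l \<in> gen S'}) \<and> c 0 = p \<and> c 1 = q"
 proof (intro exI[of _ "\<lambda>t. (k ** c t) ** n ** (l ** d t)"] conjI allI)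
  show "entire_curve (\<lambda>t. (k ** c t) ** n ** (l ** d t))"
   by (intro entire_curve_mult entire_curve_const c(1) d(1))
  show "(k ** c t) ** n ** (l ** d t) \<in> {k ** n ** l | k l. k \<in> gen S \<and> l \<in> gen S'}" for t
   using gen_mult[OF kl(1) c(2)] gen_mult[OF kl(2) d(2)] by blast
  have "k ** (matrix_inv k ** k') = k'" "l ** (matrix_inv l ** l') = l'"
   using matrix_inv_mult(2) gen_invertible kl(1,2) by (metis matrix_mul_assoc matrix_mul_lid)+
  thus "(k ** c 0) ** n ** (l ** d 0) = p" "(k ** c 1) ** n ** (l ** d 1) = q" by (simp_all add: c d kl)
 qed
qed

lemma poly2_matrix_mult:
 assumes "\<And>i j. (\<lambda>p. M p $ i $ j) \<in> poly2" "\<And>i j. (\<lambda>p. M' p $ i $ j) \<in> poly2"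
 shows "(\<lambda>p. (M p ** M' p) $ i $ j) \<in> poly2"
 by (simp add: matrix_matrix_mult_def) (intro poly2_sum poly2.mult assms)

lemma poly2_mexp: "nilpotent X ==> f \<in> poly2 ==> (\<lambda>p. mexp X (f p) $ i $ j) \<in> poly2"
proof -
 assume "nilpotent X" and f: "f \<in> poly2"
 then obtain K where "mpow X K = 0" unfolding nilpotent_def by blast
 from mexp_nilpotent[OF this] have "(\<lambda>p. mexp X (f p) $ i $ j) = (\<lambda>p. \<Sum>k<K. f p ^ k * (inverse (fact k) * mpow X k $ i $ j))"
  by (simp add: fun_eq_iff sum_component divide_inverse mult.assoc)
 moreover have "(\<lambda>p. \<Sum>k<K. f p ^ k * (inverse (fact k) * mpow X k $ i $ j)) \<in> poly2"
  by (intro poly2_sum poly2.mult poly2_power f poly2.const)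
 ultimately show ?thesis by simp
qed

lemma poly2_poly_fun: "f \<in> poly_fun ==> (\<And>i j. (\<lambda>p. M p $ i $ j) \<in> poly2) ==> (\<lambda>p. f (M p)) \<in> poly2"
 by (induction rule: poly_fun.induct) (simp_all add: poly2.intros)

text \<open>This clears the denominators in \<open>f\<close> evaluated at the quotients of
  \<open>n1\<close> and \<open>n2\<close> by \<open>den\<close>. The implications express the
  quotients without division.\<close>

lemma homogenize:
 assumes "f \<in> poly2" and reg: "den \<in> reg_fun" "n1 \<in> reg_fun" "n2 \<in> reg_fun"
 shows "\<exists>F\<in>reg_fun. \<exists>k. \<forall>g p. n1 g = den g * fst p --> n2 g = den g * snd p --> F g = den g ^ k * f p"
 using assms(1)
proof (induction rule: poly2.induct)
 case (const c)
 show ?case by (intro bexI[of _ "\<lambda>g. c"] exI[of _ 0] reg_fun_const) simp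
next
 case fst
 show ?case by (intro bexI[OF _ reg(2)] exI[of _ 1]) simp
next
 case snd
 show ?case by (intro bexI[OF _ reg(3)] exI[of _ 1]) simp
next
 case (add f f')
 then obtain F k F' k' where F: "F \<in> reg_fun" "\<forall>g p. n1 g = den g * fst p --> n2 g = den g * snd p --> F g = den g ^ k * f p"
  and F': "F' \<in> reg_fun" "\<forall>g p. n1 g = den g * fst p --> n2 g = den g * snd p --> F' g = den g ^ k' * f' p" by blast
 have pw: "(\<lambda>g. den g ^ k) \<in> reg_fun" for k
  using reg_fun_prod[of "{..<k}" "\<lambda>i. den"] reg(1) by simp
 show ?case
 proof (intro bexI[of _ "\<lambda>g. den g ^ k' * F g + den g ^ k * F' g"] exI[of _ "k + k'"] allI impI)
  fix g p assume "n1 g = den g * fst p" "n2 g = den g * snd p"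
  thus "den g ^ k' * F g + den g ^ k * F' g = den g ^ (k + k') * (f p + f' p)"
   using F(2)[rule_format, of g p] F'(2)[rule_format, of g p] by (simp add: power_add algebra_simps)
 qed (intro reg_fun_add reg_fun_mult pw F F')
next
 case (mult f f')
 then obtain F k F' k' where F: "F \<in> reg_fun" "\<forall>g p. n1 g = den g * fst p --> n2 g = den g * snd p --> F g = den g ^ k * f p"
  and F': "F' \<in> reg_fun" "\<forall>g p. n1 g = den g * fst p --> n2 g = den g * snd p --> F' g = den g ^ k' * f' p" by blast
 show ?case
 proof (intro bexI[of _ "\<lambda>g. F g * F' g"] exI[of _ "k + k'"] allI impI)
  fix g p assume "n1 g = den g * fst p" "n2 g = den g * snd p"
  thus "F g * F' g = den g ^ (k + k') * (f p * f' p)"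
   using F(2)[rule_format, of g p] F'(2)[rule_format, of g p] by (simp add: power_add algebra_simps)
 qed (intro reg_fun_mult F F')
qed

section \<open>The flag variety\<close>

context g2_setting
begin

text \<open>The left coset of \<open>g\<close>, not the cosine.\<close>

definition cos :: "complex^'n^'n => (complex^'n^'n) set" where
 "cos g = (**) g ` B"

abbreviation flag :: "(complex^'n^'n) set topology" where
 "flag \<equiv> flag_variety G B"

lemma cos_l_coset: "g <#\<^bsub>as_group G\<^esub> B = cos g"
 by (auto simp: l_coset_def cos_def)

lemma cos_mult_B: "g \<in> G ==> b \<in> B ==> cos (g ** b) = cos g"
proof -
 assume g: "g \<in> G" and b: "b \<in> B"
 have "g ** b ** c \<in> cos g" if "c \<in> B" for c
  using B_group(3)[OF b that] by (auto simp: cos_def matrix_mul_assoc[symmetric])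
 moreover have "g ** c \<in> cos (g ** b)" if c: "c \<in> B" for c
 proof -
  have "g ** b ** (matrix_inv b ** c) = g ** (b ** matrix_inv b) ** c" by (simp only: matrix_mul_assoc)
  hence "g ** c = g ** b ** (matrix_inv b ** c)" by (simp add: matrix_inv_mult(2)[OF B_group(1)[OF b]])
  thus ?thesis using B_group(3)[OF B_group(4)[OF b] c] by (auto simp: cos_def)
 qed
 ultimately show ?thesis by (auto simp: cos_def)
qed

lemma cos_eq_imp:
 assumes "g \<in> G" "h \<in> G" "cos g = cos h"
 shows "\<exists>b\<in>B. h = g ** b"
proof -
 have "h \<in> cos h" using B_group(2) by (auto simp: cos_def intro: image_eqI[of _ _ "mat 1"])
 thus ?thesis using assms(3) by (auto simp: cos_def)
qed

lemma lcosets_cos: "lcosets\<^bsub>as_group G\<^esub> B = cos ` G"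
 unfolding LCOSETS_def cos_l_coset by auto

lemma openin_flag: "openin flag U \<longleftrightarrow> U \<subseteq> cos ` G \<and> openin (subtopology zariski G) {g \<in> G. cos g \<in> U}"
 unfolding openin_flag_variety lcosets_cos cos_l_coset ..

lemma topspace_G: "topspace (subtopology zariski G) = G"
 using G_group(1) by auto

lemma topspace_flag: "topspace flag = cos ` G"
proof -
 have "{g \<in> G. cos g \<in> cos ` G} = topspace (subtopology zariski G)" using topspace_G by auto
 hence "openin flag (cos ` G)" unfolding openin_flag by (simp only: openin_topspace) simp
 thus ?thesis using openin_flag openin_subset by blast
qed

lemma closedin_flag: "closedin flag C \<longleftrightarrow> C \<subseteq> cos ` G \<and> closedin zariski {g \<in> G. cos g \<in> C}"
proof -
 have "{g \<in> G. cos g \<in> cos ` G - C} = G - {g \<in> G. cos g \<in> C}" by auto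
 hence "openin (subtopology zariski G) {g \<in> G. cos g \<in> cos ` G - C} \<longleftrightarrow> closedin (subtopology zariski G) {g \<in> G. cos g \<in> C}"
  unfolding closedin_def topspace_G by auto
 also have "\<dots> \<longleftrightarrow> closedin zariski {g \<in> G. cos g \<in> C}"
  using G_closed closedin_closed_subtopology[of zariski G] by (auto simp: closed_subgroup_def)
 finally show ?thesis unfolding closedin_def topspace_flag openin_flag by auto
qed

lemma closedin_flag_cos:
 assumes S: "S \<subseteq> G" "\<And>g b. g \<in> S ==> b \<in> B ==> g ** b \<in> S" "closedin zariski S"
 shows "closedin flag (cos ` S)" "{g \<in> G. cos g \<in> cos ` S} = S"
proof -
 show *: "{g \<in> G. cos g \<in> cos ` S} = S"
 proof (intro equalityI subsetI)
  fix g assume "g \<in> {g \<in> G. cos g \<in> cos ` S}"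
  then obtain h where "g \<in> G" "h \<in> S" "cos g = cos h" by blast
  thus "g \<in> S" using cos_eq_imp[of h g] S by blast
 qed (use S(1) in auto)
 show "closedin flag (cos ` S)" unfolding closedin_flag * using S(1,3) by blast
qed

lemma irreducible_cos:
 assumes S: "S \<subseteq> G" "zirr S" and cl: "closedin flag (cos ` S)"
 shows "irreducible_space (subtopology flag (cos ` S))"
proof (rule irreducible_spaceI[OF cl])
 show "cos ` S ~= {}" using S(2) by (auto simp: zirr_def)
 fix C D assume CD: "closedin flag C" "closedin flag D" "cos ` S \<subseteq> C \<union> D"
 hence "S \<subseteq> {g \<in> G. cos g \<in> C} \<union> {g \<in> G. cos g \<in> D}" using S(1) by blast
 moreover have "S \<subseteq> carrier GL" using S(1) G_group(1) by auto
 ultimately have "S \<subseteq> {g \<in> G. cos g \<in> C} \<or> S \<subseteq> {g \<in> G. cos g \<in> D}"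
  using zirr_closed_cover[OF S(2)] CD(1,2) by (simp add: closedin_flag)
 thus "cos ` S \<subseteq> C \<or> cos ` S \<subseteq> D" by blast
qed

definition tr :: "complex^'n^'n => (complex^'n^'n) set set => (complex^'n^'n) set set" where
 "tr x D = (\<lambda>S. (**) x ` S) ` D"

lemma tr_cos: "tr x (cos ` S) = cos ` (**) x ` S"
 by (simp add: tr_def cos_def image_image matrix_mul_assoc)

lemma tr_inv: "invertible x ==> tr (matrix_inv x) (tr x D) = D" "invertible x ==> tr x (tr (matrix_inv x) D) = D"
 by (simp_all add: tr_def image_image matrix_mul_assoc matrix_inv_mult)

lemma tr_mono: "invertible x ==> tr x C \<subseteq> tr x D \<longleftrightarrow> C \<subseteq> D"
 using tr_inv(1)[of x] by (metis image_mono tr_def)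

lemma closedin_tr:
 assumes x: "x \<in> G" and D: "closedin flag D"
 shows "closedin flag (tr x D)"
proof -
 let ?S = "{g \<in> G. cos g \<in> D}"
 have D_eq: "D = cos ` ?S" using D unfolding closedin_flag by auto
 have "closedin flag (cos ` (**) x ` ?S)"
 proof (rule closedin_flag_cos(1))
  show "(**) x ` ?S \<subseteq> G" using G_group(3)[OF x] by blast
  show "g ** b \<in> (**) x ` ?S" if g: "g \<in> (**) x ` ?S" and b: "b \<in> B" for g b
  proof -
   obtain h where h: "h \<in> ?S" "g = x ** h" using g by blast
   hence "h ** b \<in> ?S" using b B_subset G_group(3) cos_mult_B by auto
   thus ?thesis using h(2) by (auto simp: matrix_mul_assoc[symmetric])
  qed
  show "closedin zariski ((**) x ` ?S)" using closedin_translate[OF G_group(1)[OF x]] D by (simp add: closedin_flag)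
 qed
 thus ?thesis unfolding tr_cos[symmetric] D_eq[symmetric] .
qed

lemma irreducible_tr:
 assumes x: "x \<in> G" and Z: "closedin flag Z" "irreducible_space (subtopology flag Z)"
 shows "irreducible_space (subtopology flag (tr x Z))"
proof (rule irreducible_spaceI[OF closedin_tr[OF x Z(1)]])
 note xi = G_group(1)[OF x] and ix = G_group(4)[OF x]
 show "tr x Z ~= {}" using irreducible_space_nonempty[OF Z(2)] by (simp add: tr_def)
 fix C D assume CD: "closedin flag C" "closedin flag D" "tr x Z \<subseteq> C \<union> D"
 have "tr (matrix_inv x) (C \<union> D) = tr (matrix_inv x) C \<union> tr (matrix_inv x) D" by (simp add: tr_def image_Un)
 hence "Z \<subseteq> tr (matrix_inv x) C \<union> tr (matrix_inv x) D"
  using CD(3) tr_mono[OF invertible_matrix_inv[OF xi], of "tr x Z" "C \<union> D"] by (simp add: tr_inv(1)[OF xi])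
 from irreducible_spaceD[OF Z(2,1) closedin_tr[OF ix CD(1)] closedin_tr[OF ix CD(2)] this]
 show "tr x Z \<subseteq> C \<or> tr x Z \<subseteq> D"
  using tr_mono[OF xi, of Z "tr (matrix_inv x) C"] tr_mono[OF xi, of Z "tr (matrix_inv x) D"] by (simp add: tr_inv(2)[OF xi])
qed

lemma closedin_point: "closedin flag {cos (mat 1)}"
proof -
 have "closedin flag (cos ` B)"
  by (rule closedin_flag_cos(1)[OF B_subset]) (use B_closed B_group(3) in \<open>simp_all add: closed_subgroup_def\<close>)
 moreover have "cos ` B = (\<lambda>b. cos (mat 1)) ` B"
  by (rule image_cong) (use cos_mult_B[OF G_group(2)] in simp_all)
 ultimately show ?thesis by (simp only: image_constant[OF B_group(2)])
qed

lemma closedin_QQ: "closedin zariski QQ"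
proof -
 have "QQ = G \<inter> ({A. invertible A \<and> Ad A (ee (3,1)) \<in> gr 1 0 3} \<inter> {A. invertible A \<and> Ad A (ee (3,2)) \<in> gr 1 0 3})"
 proof (intro equalityI subsetI)
  fix g assume g: "g \<in> G \<inter> ({A. invertible A \<and> Ad A (ee (3,1)) \<in> gr 1 0 3} \<inter> {A. invertible A \<and> Ad A (ee (3,2)) \<in> gr 1 0 3})"
  have "Ad g X \<in> gr 1 0 3" if "X \<in> gr 1 0 3" for X
   by (subst gr3_eq[OF that]) (use g in \<open>simp add: Ad_simps gr_add gr_scale\<close>)
  thus "g \<in> QQ" using g by (simp add: QQ_def)
 qed (use G_group(1) ee_gr[OF rts_mem(5), of 3 1 0] ee_gr[OF rts_mem(6), of 3 1 0] in \<open>auto simp: QQ_def\<close>)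
 thus ?thesis using G_closed closedin_Ad_subspace(1)[OF csub_gr] by (auto simp: closed_subgroup_def intro!: closedin_Int)
qed

lemma closedin_fib: "closedin zariski fib"
proof -
 have "fib = G \<inter> {A. invertible A \<and> Ad (matrix_inv A) (ee (2,1)) \<in> gr 1 0 1}" using G_group(1) by (auto simp: fib_def)
 thus ?thesis using G_closed closedin_Ad_subspace(2)[OF csub_gr] by (auto simp: closed_subgroup_def intro!: closedin_Int)
qed

lemma reg_fun_cf: "(\<lambda>g. cf c (Ad g X)) \<in> reg_fun"
 unfolding cf_def divide_inverse by (intro reg_fun_mult reg_fun_trace_Ad reg_fun_const)

lemma closedin_sec: "closedin zariski sec"
proof -
 have "sec = fib \<inter> {A. invertible A \<and> cf (2,1) (Ad A (ee (2,1))) = 0}" using G_group(1) by (auto simp: sec_def fib_def)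
 thus ?thesis using closedin_Int[OF closedin_fib closedin_reg_zero[OF reg_fun_cf]] by (simp only:)
qed

lemma sec_G: "g \<in> sec ==> g \<in> G"
 by (simp add: sec_def fib_def)

lemma sec_cells:
 assumes g: "g \<in> sec"
 shows "\<exists>x\<in>insert nb (range (mexp (ee (0,1)))). \<exists>y\<in>insert nb (range (mexp (ee (0,-1)))). \<exists>b\<in>B. g = x ** na ** y ** b"
 using fib_cells[of g] QQ_fib(2)[of g] g by (auto simp: sec_def)

lemma cell_KK: "x \<in> insert nb (range (mexp (ee (0,1)))) ==> x \<in> KK" "y \<in> insert nb (range (mexp (ee (0,-1)))) ==> y \<in> KK"
 using nb_KK KK_mexp by auto

lemma sec_cells_KK: "g \<in> sec ==> \<exists>x\<in>KK. \<exists>y\<in>KK. \<exists>b\<in>B. g = x ** na ** y ** b"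
 by (drule sec_cells, elim bexE, intro bexI, assumption) (assumption | erule cell_KK)+

lemma sec_mult:
 assumes "g \<in> sec" "b \<in> B" "k \<in> KK"
 shows "k ** g ** b \<in> sec"
proof -
 obtain x y c where xyc: "x \<in> KK" "y \<in> KK" "c \<in> B" "g = x ** na ** y ** c" using sec_cells_KK[OF assms(1)] by (elim bexE)
 have "k ** x \<in> KK" using gen_mult assms(3) xyc(1) unfolding KK_def by blast
 moreover have "y ** (c ** b) \<in> QQ" using xyc assms by (intro QQ_mult KK_QQ B_QQ)
 ultimately have "(k ** x) ** na ** (y ** (c ** b)) \<in> sec" by (rule cell_sec)
 thus ?thesis by (simp add: xyc(4) matrix_mul_assoc)
qed

lemma mat_1_KK: "mat 1 \<in> KK" unfolding KK_def by (rule gen.one)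

lemma sec_saturated: "g \<in> sec ==> b \<in> B ==> g ** b \<in> sec"
 using sec_mult[OF _ _ mat_1_KK] by simp

lemma cos_QQ: "cos ` QQ = cos ` KK"
proof -
 have "cos g \<in> cos ` KK" if "g \<in> QQ" for g
  using QQ_cells[OF that] cell_KK(2) cos_mult_B KK_G by (metis image_eqI)
 thus ?thesis using KK_QQ by blast
qed

lemma cos_sec: "cos ` sec = cos ` {k ** na ** l | k l. k \<in> KK \<and> l \<in> KK}"
proof -
 have "cos g \<in> cos ` {k ** na ** l | k l. k \<in> KK \<and> l \<in> KK}" if g: "g \<in> sec" for g
 proof -
  obtain x y b where xyb: "x \<in> KK" "y \<in> KK" "b \<in> B" "g = x ** na ** y ** b" using sec_cells_KK[OF g] by (elim bexE)
  have "x ** na ** y \<in> G" using xyb KK_G na_G G_group(3) by blast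
  hence "cos g = cos (x ** na ** y)" unfolding xyb(4) by (rule cos_mult_B[OF _ xyb(3)])
  thus ?thesis by (rule image_eqI) (use xyb(1,2) in auto)
 qed
 moreover have "k ** na ** l \<in> sec" if "k \<in> KK" "l \<in> KK" for k l using cell_sec[OF that(1) KK_QQ[OF that(2)]] .
 ultimately show ?thesis by auto
qed

end

context g2_setting
begin

text \<open>\<open>\<psi>\<close> is a polynomial slice and the quotients of \<open>n1\<close> and
  \<open>n2\<close> by \<open>den\<close> recover its parameters, independently of the
  representative modulo \<open>B\<close>. Where \<open>den\<close> is nonzero the slice meets the
  coset.\<close>

lemma chart_sec:
 assumes \<psi>: "\<And>p. \<psi> p \<in> sec" "\<And>i j. (\<lambda>p. \<psi> p $ i $ j) \<in> poly2"
  and reg: "den \<in> reg_fun" "n1 \<in> reg_fun" "n2 \<in> reg_fun"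
  and on: "\<And>p b. b \<in> B ==> den (\<psi> p ** b) ~= 0"
   "\<And>p b. b \<in> B ==> n1 (\<psi> p ** b) = den (\<psi> p ** b) * fst p"
   "\<And>p b. b \<in> B ==> n2 (\<psi> p ** b) = den (\<psi> p ** b) * snd p"
  and off: "\<And>g. g \<in> sec ==> den g ~= 0 ==> \<exists>p. \<exists>b\<in>B. g = \<psi> p ** b"
 shows "chart (subtopology flag (cos ` sec)) (\<lambda>p. cos (\<psi> p))"
proof -
 have \<psi>G: "\<psi> p \<in> G" for p by (rule sec_G[OF \<psi>(1)])
 have sec_closed: "closedin flag (cos ` sec)" "{g \<in> G. cos g \<in> cos ` sec} = sec"
  using closedin_flag_cos[OF _ sec_saturated closedin_sec] sec_G by blast+
 show ?thesis unfolding chart_def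
proof (intro conjI allI ballI impI)
 have cos_inj: "p = q" if eq: "cos (\<psi> p) = cos (\<psi> q)" for p q
 proof -
  obtain b where b: "b \<in> B" "\<psi> q = \<psi> p ** b" using cos_eq_imp[OF \<psi>G \<psi>G eq] by (elim bexE)
  have q1: "\<psi> q ** mat 1 = \<psi> p ** b" using b(2) by simp
  note 1 = on(1)[OF b(1), of p] and f = on(2,3)[OF b(1), of p] and f' = on(2,3)[OF B_group(2), of q, unfolded q1]
  have "fst p = fst q" "snd p = snd q" using f f' 1 by auto
  thus ?thesis by (rule prod_eqI)
 qed
 thus "inj (\<lambda>p. cos (\<psi> p))" by (rule injI)
 fix C p assume C: "closedin (subtopology flag (cos ` sec)) C" "cos (\<psi> p) \<notin> C"
 hence cl: "closedin zariski {g \<in> G. cos g \<in> C}" and np: "\<psi> p \<notin> {g \<in> G. cos g \<in> C}"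
  unfolding closedin_closed_subtopology[OF sec_closed(1)] closedin_flag by simp_all
 obtain f where f: "f \<in> poly_fun" "f (\<psi> p) ~= 0" "\<forall>A\<in>{g \<in> G. cos g \<in> C}. f A = 0"
  using closedin_zariski_separate[OF cl G_group(1)[OF \<psi>G] np] by (elim bexE conjE)
 show "\<exists>f\<in>poly2. f p ~= 0 \<and> (\<forall>q. cos (\<psi> q) \<in> C --> f q = 0)"
  by (rule bexI[OF _ poly2_poly_fun[OF f(1) \<psi>(2)]]) (use f(2,3) \<psi>G in simp)
next
 fix f assume "f \<in> poly2"
 then obtain F k where F: "F \<in> reg_fun" "\<forall>g p. n1 g = den g * fst p --> n2 g = den g * snd p --> F g = den g ^ k * f p"
  using homogenize[OF _ reg] by blast
 \<comment> \<open>The factor \<open>den\<close> adds everything outside the chart, so that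
   \<open>S\<close> is closed and stable under \<open>B\<close> and its image is the set required by
   \<open>chart\<close>.\<close>
 define S where "S = sec \<inter> {A. invertible A \<and> den A * F A = 0}"
 have S_iff: "den (\<psi> p ** b) * F (\<psi> p ** b) = 0 \<longleftrightarrow> f p = 0" if "b \<in> B" for p b
  using F(2)[rule_format, OF on(2,3)[OF that]] on(1)[OF that, of p] by simp
 have sat: "g ** b \<in> S" if g: "g \<in> S" and b: "b \<in> B" for g b
 proof -
  have gb: "g ** b \<in> sec" using g sec_saturated[OF _ b] by (simp add: S_def)
  have "den (g ** b) * F (g ** b) = 0"
  proof (cases "den (g ** b) = 0")
   case False
   then obtain p c where pc: "c \<in> B" "g ** b = \<psi> p ** c" using off[OF gb] by blast
   have ib: "matrix_inv b \<in> B" "invertible b" using b B_group by auto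
   have "g = (g ** b) ** matrix_inv b" by (simp add: matrix_mul_assoc[symmetric] matrix_inv_mult(2)[OF ib(2)])
   also have "\<dots> = \<psi> p ** (c ** matrix_inv b)" unfolding pc(2) by (simp add: matrix_mul_assoc)
   finally have "f p = 0" using g S_iff[OF B_group(3)[OF pc(1) ib(1)], of p] by (simp add: S_def)
   thus ?thesis unfolding pc(2) S_iff[OF pc(1)] .
  qed simp
  thus ?thesis using gb G_group(1)[OF sec_G[OF gb]] by (simp add: S_def)
 qed
 have SG: "S \<subseteq> G" using sec_G by (auto simp: S_def)
 have "closedin zariski S" unfolding S_def by (intro closedin_Int closedin_sec closedin_reg_zero reg_fun_mult reg F)
 hence cl: "closedin flag (cos ` S)" by (rule closedin_flag_cos(1)[OF SG sat, rotated 2])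
 have "{x \<in> topspace (subtopology flag (cos ` sec)). \<forall>p. x = cos (\<psi> p) --> f p = 0} = cos ` S"
 proof (intro equalityI subsetI)
  fix x assume x: "x \<in> {x \<in> topspace (subtopology flag (cos ` sec)). \<forall>p. x = cos (\<psi> p) --> f p = 0}"
  then obtain g where g: "g \<in> sec" "x = cos g" by auto
  have "den g * F g = 0"
  proof (cases "den g = 0")
   case False
   then obtain p b where pb: "b \<in> B" "g = \<psi> p ** b" using off[OF g(1)] by blast
   hence "x = cos (\<psi> p)" unfolding g(2) pb(2) by (intro cos_mult_B[OF \<psi>G])
   thus ?thesis using x unfolding pb(2) S_iff[OF pb(1)] by blast
  qed simp
  thus "x \<in> cos ` S" using g G_group(1)[OF sec_G[OF g(1)]] by (simp add: S_def)
 next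
  fix x assume "x \<in> cos ` S"
  then obtain g where g: "g \<in> S" "x = cos g" by blast
  hence gs: "g \<in> sec" "den g * F g = 0" by (simp_all add: S_def)
  have "f p = 0" if xp: "x = cos (\<psi> p)" for p
  proof -
   have "cos (\<psi> p) = cos g" using xp g(2) by simp
   then obtain b where b: "b \<in> B" "g = \<psi> p ** b" using cos_eq_imp[OF \<psi>G sec_G[OF gs(1)]] by blast
   show ?thesis using gs(2) unfolding b(2) S_iff[OF b(1)] .
  qed
  thus "x \<in> {x \<in> topspace (subtopology flag (cos ` sec)). \<forall>p. x = cos (\<psi> p) --> f p = 0}"
   using g gs(1) sec_G by (auto simp: topspace_flag)
 qed
 thus "closedin (subtopology flag (cos ` sec)) {x \<in> topspace (subtopology flag (cos ` sec)). \<forall>p. x = cos (\<psi> p) --> f p = 0}"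
  using cl unfolding closedin_closed_subtopology[OF sec_closed(1)] by (auto simp: S_def)
qed
qed

lemma B_highest: "b \<in> B ==> \<exists>m. m ~= 0 \<and> Ad b (ee (3,2)) = m \<cdot> ee (3,2)"
proof -
 assume b: "b \<in> B"
 have W: "Ad b (ee (3,2)) \<in> gr 1 1 5" by (rule B_stable[OF _ _ b ee_gr]) (simp_all add: rts_mem)
 have "{c \<in> wts. 5 \<le> 1 * fst c + 1 * snd c} = {(3,2)}" by (auto simp: wts_eq)
 hence "Ad b (ee (3,2)) = cf (3,2) (Ad b (ee (3,2))) \<cdot> ee (3,2)"
  using gr_sum[OF W] pc_cf[OF rts_mem(6) gr_g[OF W]] by simp
 moreover from this have "cf (3,2) (Ad b (ee (3,2))) ~= 0"
  using Ad_nz[of b "ee (3,2)"] b B_subset ee(2)[of "(3,2)"] by (metis mm.scale_zero_left rts_mem(6) subsetD)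
 ultimately show ?thesis by blast
qed

lemma reg_fun_shift: "invertible x ==> (\<lambda>g. trace (Ad (matrix_inv x) (Ad g X) ** Z)) \<in> reg_fun"
proof -
 assume x: "invertible x"
 have "trace (Ad (matrix_inv x) (Ad g X) ** Z) = trace (Ad g X ** Ad x Z)" for g
  using trace_Ad_Ad[OF x, of "Ad (matrix_inv x) (Ad g X)" Z] by (simp add: Ad_inv(2)[OF x])
 thus ?thesis using reg_fun_trace_Ad by simp
qed

lemma nn_line: "c \<in> rts ==> d \<in> rts ==> Ad n (ee c) \<in> gs d ==> n \<in> G ==> \<exists>k. k ~= 0 \<and> Ad n (ee c) = k \<cdot> ee d"
 using gs_line[of d "Ad n (ee c)"] Ad_nz[of n "ee c"] ee(2)[of c] by (metis mm.scale_zero_left)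

text \<open>Around the point \<open>x na y B\<close> the second component is parametrised by moving \<open>x\<close> and \<open>y\<close> along
 root subgroups. The coordinates are ratios of coefficients of \<open>v g\<close>, the highest root
 vector moved by \<open>g\<close> and translated back by \<open>x\<close>.\<close>

lemma ex_chart:
 assumes z: "z \<in> cos ` sec"
 shows "\<exists>\<phi>. chart (subtopology flag (cos ` sec)) \<phi> \<and> z \<in> range \<phi>"
proof -
 let ?e = "mexp (ee (0,-1))" and ?E = "mexp (ee (0,1))"
 obtain c1 where c1: "c1 ~= 0" "Ad na (ee (3,2)) = c1 \<cdot> ee (0,-1)"
  using nn_line[of "(3,2)" "(0,-1)" na] na_gs[OF ee(1)[of "(3,2)"]] na_G by (auto simp: rts_mem)
 obtain c2 where c2: "c2 ~= 0" "Ad na (ee (3,1)) = c2 \<cdot> ee (3,1)"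
  using nn_line[of "(3,1)" "(3,1)" na] na_gs[OF ee(1)[of "(3,1)"]] na_G by (auto simp: rts_mem)
 obtain k where k: "k ~= 0" "\<And>t. Ad (?e t) (ee (3,2)) = ee (3,2) + (t * k) \<cdot> ee (3,1)"
  using mexp_line[of "(0,-1)" "(3,2)"] by (auto simp: rts_mem wts_eq)
 obtain k' where k': "k' ~= 0" "\<And>t. Ad (?E t) (ee (3,1)) = ee (3,1) + (t * k') \<cdot> ee (3,2)"
  using mexp_line[of "(0,1)" "(3,1)"] by (auto simp: rts_mem wts_eq)
 define h where "h = br (ee (0,1)) (ee (0,-1))"
 have h: "h \<in> gs (0,0)" unfolding h_def using br_gs[OF ee(1)[OF rts_mem(2)] ee(1)[OF rts_mem(8)]] by simp
 define r where "r = br (ee (0,1)) h"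
 have r: "r \<in> gs (0,1)" unfolding r_def using br_gs[OF ee(1)[OF rts_mem(2)] h] by simp
 have Eb: "Ad (?E s) (ee (0,-1)) = ee (0,-1) + s \<cdot> h + (s ^ 2 / 2) \<cdot> r" for s
 proof -
  have "br (ee (0,1)) r = 0" by (rule gs_outside[OF _ br_gs[OF ee(1)[OF rts_mem(2)] r]]) (simp add: wts_eq)
  thus ?thesis using Ad_mexp_step3[of "ee (0,1)" "ee (0,-1)" s] by (simp add: h_def r_def)
 qed
 have hh: "trace (h ** h) ~= 0"
  using trace_h_br[OF ee(1)[OF rts_mem(2)] _ h, of "ee (0,-1)"] sl2_nonzero[OF rts_mem(2) ee(1)[OF rts_mem(2)], of "ee (0,-1)"]
   ee(1)[OF rts_mem(8)] trace_ee[OF rts_mem(2)] by (simp add: h_def)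
 have tr: "trace (ee c ** h) = 0" if "c \<in> rts" for c
  using trace_gs[OF ee(1)[OF that] h] rts_wts(3)[OF that] by (simp add: zero_prod_def[symmetric])
 have trr: "trace (r ** h) = 0" by (rule trace_gs[OF r h]) simp
 have cfr: "cf (0,-1) r = 0" "cf (3,1) r = 0" "cf (3,2) r = 0" "cf (0,-1) h = 0" "cf (3,1) h = 0" "cf (3,2) h = 0"
  using cf_gs[OF _ r] cf_gs[OF _ h] by (simp_all add: rts_mem)
 \<comment> \<open>For \<open>v\<close> of the form \<open>Ad (?E s) (Ad na w)\<close> these
   functionals return the two coefficients of \<open>w\<close> and their multiples by
   \<open>s\<close>; the Cartan vector \<open>h\<close> detects the term linear in \<open>s\<close>
   along -\<beta>.\<close>
 define A1 A2 A3 A4 where "A1 v = cf (0,-1) v * inverse c1" and "A2 v = cf (3,1) v * inverse c2"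
  and "A3 v = trace (v ** h) * inverse (c1 * trace (h ** h))" and "A4 v = cf (3,2) v * inverse (c2 * k')" for v
 note A = A1_def A2_def A3_def A4_def
 have na: "Ad na w = (cf (3,1) w * c2) \<cdot> ee (3,1) + (cf (3,2) w * c1) \<cdot> ee (0,-1)" if "w \<in> gr 1 0 3" for w
  by (subst gr3_eq[OF that]) (simp add: Ad_simps c1(2) c2(2))
 have A_E: "A1 (Ad (?E s) (Ad na w)) = cf (3,2) w" "A2 (Ad (?E s) (Ad na w)) = cf (3,1) w"
  "A3 (Ad (?E s) (Ad na w)) = s * cf (3,2) w" "A4 (Ad (?E s) (Ad na w)) = s * cf (3,1) w" if "w \<in> gr 1 0 3" for s w
  unfolding na[OF that] A using c1(1) c2(1) k'(1) hh
  by (simp_all add: Ad_simps Eb k'(2) cf_simps cf_ee' rts_mem cfr matrix_ring_simps mat_scale_simps(1,2) trace_add tr trr)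
   (simp_all add: field_simps)
 have A_nb: "A1 (Ad nb (Ad na w)) = 0" "A2 (Ad nb (Ad na w)) = 0" if "w \<in> gr 1 0 3" for w
  using cf_gs[OF rts_mem(8) nb_gs[OF ee(1)[OF rts_mem(8)]]] cf_gs[OF rts_mem(5) nb_gs[OF ee(1)[OF rts_mem(8)]]]
   cf_gs[OF rts_mem(8) nb_gs[OF ee(1)[OF rts_mem(5)]]] cf_gs[OF rts_mem(5) nb_gs[OF ee(1)[OF rts_mem(5)]]]
  unfolding na[OF that] A by (simp_all add: Ad_simps cf_simps)
 obtain g0 where g0: "g0 \<in> sec" "z = cos g0" using z by blast
 obtain x y b0 where x: "x \<in> KK" and y: "y \<in> KK" and b0: "b0 \<in> B" "g0 = x ** na ** y ** b0"
  using sec_cells_KK[OF g0(1)] by (elim bexE)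
 have zeq: "z = cos (x ** na ** y)"
  unfolding g0(2) b0(2) by (rule cos_mult_B[OF _ b0(1)]) (intro G_group(3) KK_G x na_G y)
 note xi = G_group(1)[OF KK_G[OF x]] and yi = G_group(1)[OF KK_G[OF y]] and ni = G_group(1)[OF na_G]
 define v where "v g = Ad (matrix_inv x) (Ad g (ee (3,2)))" for g
 define l where "l c d = cf c (Ad (matrix_inv y) (ee d))" for c d
 \<comment> \<open>Coefficients of \<open>w\<close> translated back by \<open>y\<close> are linear
   in those of \<open>w\<close>. So \<open>den\<close> is the highest coefficient of the translate,
   \<open>n1\<close> is \<open>s\<close> times it, and \<open>n2\<close> is the coefficient at (3,1)
   divided by \<open>k\<close>.\<close>
 have l: "cf c (Ad (matrix_inv y) w) = cf (3,2) w * l c (3,2) + cf (3,1) w * l c (3,1)" if "w \<in> gr 1 0 3" for c w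
  by (subst gr3_eq[OF that]) (simp add: Ad_simps cf_simps l_def)
 define den where "den g = A1 (v g) * l (3,2) (3,2) + A2 (v g) * l (3,2) (3,1)" for g
 define n1 where "n1 g = A3 (v g) * l (3,2) (3,2) + A4 (v g) * l (3,2) (3,1)" for g
 define n2 where "n2 g = (A1 (v g) * l (3,1) (3,2) + A2 (v g) * l (3,1) (3,1)) * inverse k" for g
 have "(\<lambda>g. trace (v g ** Z)) \<in> reg_fun" for Z unfolding v_def by (rule reg_fun_shift[OF xi])
 hence reg: "den \<in> reg_fun" "n1 \<in> reg_fun" "n2 \<in> reg_fun"
  unfolding den_def n1_def n2_def A cf_def divide_inverse by (intro reg_fun_add reg_fun_mult reg_fun_const; assumption)+
 have v_eq: "v (x ** X ** na ** y' ** b) = Ad X (Ad na (Ad y' (Ad b (ee (3,2)))))"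
  if "X \<in> KK" "y' \<in> QQ" "b \<in> B" for X y' b
  unfolding v_def using that ni xi G_group(1)[OF KK_G] G_group(1)[OF QQ_G] B_group(1)
  by (simp add: Ad_mult invertible_mult Ad_inv(1))
 have w3: "Ad y' (Ad b (ee (3,2))) \<in> gr 1 0 3" if "y' \<in> QQ" "b \<in> B" for y' b
  by (intro QQ_gr3 that B_QQ ee_gr) (simp_all add: rts_mem)
 have yQ: "y ** ?e t \<in> QQ" for t by (intro QQ_mult KK_QQ y KK_mexp)
 define \<psi> where "\<psi> p = x ** ?E (fst p) ** na ** (y ** ?e (snd p))" for p
 have "chart (subtopology flag (cos ` sec)) (\<lambda>p. cos (\<psi> p))"
 proof (rule chart_sec[OF _ _ reg])
  have "x ** ?E s \<in> KK" for s using x KK_mexp(1) gen_mult unfolding KK_def by blast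
  thus "\<psi> p \<in> sec" for p unfolding \<psi>_def by (rule cell_sec[OF _ yQ])
  have "nilpotent (ee (0,1))" "nilpotent (ee (0,-1))"
   by (rule root_nilpotent[OF ee(1)], simp_all add: rts_mem)+
  thus "(\<lambda>p. \<psi> p $ i $ j) \<in> poly2" for i j
   unfolding \<psi>_def by (intro poly2_matrix_mult poly2_mexp poly2.intros)
  fix p :: "complex \<times> complex" and b assume b: "b \<in> B"
  obtain m where m: "m ~= 0" "Ad b (ee (3,2)) = m \<cdot> ee (3,2)" using B_highest[OF b] by blast
  define w where "w = Ad (y ** ?e (snd p)) (Ad b (ee (3,2)))"
  have w: "w \<in> gr 1 0 3" unfolding w_def by (rule w3[OF yQ b])
  have v: "v (\<psi> p ** b) = Ad (?E (fst p)) (Ad na w)"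
   unfolding \<psi>_def w_def by (rule v_eq[OF KK_mexp(1) yQ b])
  have "Ad (matrix_inv y) w = m \<cdot> (ee (3,2) + (snd p * k) \<cdot> ee (3,1))"
   unfolding w_def Ad_mult[OF yi invertible_mexp] Ad_inv(1)[OF yi] m(2) Ad_simps k(2) ..
  hence "cf (3,2) (Ad (matrix_inv y) w) = m" "cf (3,1) (Ad (matrix_inv y) w) = m * (snd p * k)"
   by (simp_all add: cf_simps cf_ee' rts_mem)
  hence lm: "cf (3,2) w * l (3,2) (3,2) + cf (3,1) w * l (3,2) (3,1) = m"
   "cf (3,2) w * l (3,1) (3,2) + cf (3,1) w * l (3,1) (3,1) = m * (snd p * k)" unfolding l[OF w] .
  have d: "den (\<psi> p ** b) = m" unfolding den_def v A_E[OF w] by (rule lm(1))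
  show "den (\<psi> p ** b) ~= 0" unfolding d by (rule m(1))
  show "n1 (\<psi> p ** b) = den (\<psi> p ** b) * fst p"
   unfolding d n1_def v A_E[OF w] lm(1)[symmetric] by (simp add: algebra_simps)
  show "n2 (\<psi> p ** b) = den (\<psi> p ** b) * snd p"
   unfolding d n2_def v A_E[OF w] lm(2) using k(1) by simp
 next
  fix g assume g: "g \<in> sec" "den g ~= 0"
  have "matrix_inv x \<in> KK" using x gen_inv unfolding KK_def by blast
  hence "matrix_inv x ** g \<in> sec" using sec_mult[OF g(1) B_group(2)] by simp
  from sec_cells[OF this] obtain x' y' b where c: "x' \<in> insert nb (range ?E)" "y' \<in> insert nb (range ?e)" "b \<in> B"
   "matrix_inv x ** g = x' ** na ** y' ** b" by (elim bexE)
  have "g = x ** (matrix_inv x ** g)" by (simp add: matrix_mul_assoc matrix_inv_mult(2)[OF xi])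
  hence g_eq: "g = x ** x' ** na ** y' ** b" unfolding c(4) by (simp add: matrix_mul_assoc)
  have y': "y' \<in> QQ" by (rule KK_QQ[OF cell_KK(2)[OF c(2)]])
  define w where "w = Ad y' (Ad b (ee (3,2)))"
  have w: "w \<in> gr 1 0 3" unfolding w_def by (rule w3[OF y' c(3)])
  have v: "v g = Ad x' (Ad na w)" unfolding g_eq w_def by (rule v_eq[OF cell_KK(1)[OF c(1)] y' c(3)])
  \<comment> \<open>A nonzero \<open>den\<close> excludes the closed cells for both factors, here
    because \<open>A1\<close> and \<open>A2\<close> vanish after \<open>nb\<close>, below because
    \<open>nb\<close> leaves no coefficient at (3,2).\<close>
  have "x' ~= nb" using g(2) A_nb[OF w] unfolding den_def v by auto
  then obtain s where s: "x' = ?E s" using c(1) by blast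
  have nz: "cf (3,2) (Ad (matrix_inv y) w) ~= 0" using g(2) unfolding den_def v s A_E[OF w] l[OF w] .
  define q where "q = matrix_inv y ** y'"
  have q: "q \<in> QQ" unfolding q_def by (intro QQ_mult QQ_inv KK_QQ y y')
  obtain m where m: "Ad b (ee (3,2)) = m \<cdot> ee (3,2)" using B_highest[OF c(3)] by blast
  have wq: "Ad (matrix_inv y) w = m \<cdot> Ad q (ee (3,2))"
   unfolding w_def q_def m Ad_mult[OF invertible_matrix_inv[OF yi] G_group(1)[OF QQ_G[OF y']]] Ad_simps ..
  obtain y'' b'' where yb: "y'' \<in> insert nb (range ?e)" "b'' \<in> B" "q = y'' ** b''" using QQ_cells[OF q] by (elim bexE)
  have "y'' ~= nb"
  proof
   assume nb: "y'' = nb"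
   obtain m'' where m'': "Ad b'' (ee (3,2)) = m'' \<cdot> ee (3,2)" using B_highest[OF yb(2)] by blast
   have "Ad q (ee (3,2)) = m'' \<cdot> Ad nb (ee (3,2))"
    unfolding yb(3) nb Ad_mult[OF G_group(1)[OF nb_G] B_group(1)[OF yb(2)]] m'' Ad_simps ..
   thus False
    using nz cf_gs[OF rts_mem(6) nb_gs[OF ee(1)[OF rts_mem(6)]]] unfolding wq by (simp add: cf_simps)
  qed
  then obtain t where t: "y'' = ?e t" using yb(1) by blast
  have "y' = y ** q" unfolding q_def by (simp add: matrix_mul_assoc matrix_inv_mult(2)[OF yi])
  hence "g = \<psi> (s, t) ** (b'' ** b)" unfolding g_eq s yb(3) t \<psi>_def by (simp add: matrix_mul_assoc)
  thus "\<exists>p. \<exists>b\<in>B. g = \<psi> p ** b" using B_group(3)[OF yb(2) c(3)] by blast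
 qed
 moreover have "z = cos (\<psi> (0, 0))" by (simp add: zeq \<psi>_def)
 ultimately show ?thesis by blast
qed

end

section \<open>Components of the fiber and their dimensions\<close>

context g2_setting
begin

lemma I_alpha_gr: "I_alpha G T \<alpha> \<beta> = gr 1 0 1"
proof (intro equalityI subsetI)
 fix X assume "X \<in> I_alpha G T \<alpha> \<beta>"
 thus "X \<in> gr 1 0 1"
  unfolding I_alpha_def gs_def[symmetric]
  by (elim CollectE exE conjE) (simp add: gr_add gs_gr)
next
 fix X assume X: "X \<in> gr 1 0 1"
 have "{c \<in> wts. 1 \<le> 1 * fst c + 0 * snd c} = {(1,0), (1,1), (2,1), (3,1), (3,2)}" by (auto simp: wts_eq)
 hence "X = pc (1,0) X + pc (1,1) X + pc (2,1) X + pc (3,1) X + pc (3,2) X" using gr_sum[OF X] by (simp add: add.assoc)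
 thus "X \<in> I_alpha G T \<alpha> \<beta>"
  unfolding I_alpha_def gs_def[symmetric] using pc_in_gs[OF gr_g[OF X]]
  by (intro CollectI exI[of _ "pc _ X"] conjI)
qed

lemma fib_Un: "fib = QQ \<union> sec"
proof -
 have "g \<in> QQ \<union> sec" if g: "g \<in> fib" for g
 proof (cases "g \<in> QQ")
  case False
  from fib_cells[OF g this] obtain x y b where xyb: "x \<in> insert nb (range (mexp (ee (0,1))))"
   "y \<in> insert nb (range (mexp (ee (0,-1))))" "b \<in> B" "g = x ** na ** y ** b" by (elim bexE)
  have "x ** na ** (y ** b) \<in> sec" by (intro cell_sec cell_KK(1)[OF xyb(1)] QQ_mult KK_QQ cell_KK(2)[OF xyb(2)] B_QQ xyb(3))
  thus ?thesis by (simp add: xyb(4) matrix_mul_assoc)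
 qed simp
 thus ?thesis using QQ_fib(1) by (auto simp: sec_def)
qed

lemma QQ_sec: "QQ \<inter> sec = {}"
 using QQ_fib(2) by (auto simp: sec_def)

lemma fiber_eq:
 assumes N: "N \<in> root_space G T (chr (2, 1))" "N ~= 0"
 shows "hessenberg_fiber G B (I_alpha G T \<alpha> \<beta>) N = cos ` QQ \<union> cos ` sec"
proof -
 obtain k where NN: "N = k \<cdot> ee (2,1)" using gs_line[OF rts_mem(4), of N] N(1) unfolding gs_def by blast
 hence k: "k ~= 0" using N(2) by auto
 have iff: "Ad (matrix_inv g) N \<in> gr 1 0 1 \<longleftrightarrow> Ad (matrix_inv g) (ee (2,1)) \<in> gr 1 0 1" for g
  unfolding NN Ad_simps using scale_memD[OF csub_gr k] gr_scale by blast
 have "hessenberg_fiber G B (I_alpha G T \<alpha> \<beta>) N = cos ` fib"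
  unfolding hessenberg_fiber_def I_alpha_gr cos_l_coset fib_def iff by blast
 thus ?thesis by (simp add: fib_Un image_Un)
qed

lemma QQ_sat: "g \<in> QQ ==> b \<in> B ==> g ** b \<in> QQ"
 by (rule QQ_mult[OF _ B_QQ])

lemma closedin_cos: "closedin flag (cos ` QQ)" "closedin flag (cos ` sec)" "cos ` QQ \<inter> cos ` sec = {}"
proof -
 have QG: "QQ \<subseteq> G" and sG: "sec \<subseteq> G" using QQ_G sec_G by blast+
 have Q: "closedin flag (cos ` QQ)" "{g \<in> G. cos g \<in> cos ` QQ} = QQ" and s: "closedin flag (cos ` sec)"
  by (rule closedin_flag_cos[OF QG _ closedin_QQ], erule (1) QQ_sat)+
   (rule closedin_flag_cos(1)[OF sG _ closedin_sec], erule (1) sec_saturated)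
 show "closedin flag (cos ` QQ)" "closedin flag (cos ` sec)" by (rule Q(1), rule s)
 show "cos ` QQ \<inter> cos ` sec = {}"
 proof (rule ccontr)
  assume "cos ` QQ \<inter> cos ` sec ~= {}"
  then obtain g h where "g \<in> QQ" "h \<in> sec" "cos g = cos h" by auto
  hence "h \<in> {g \<in> G. cos g \<in> cos ` QQ}" using sG by (auto intro: image_eqI[of _ _ g])
  hence "h \<in> QQ" unfolding Q(2) .
  thus False using \<open>h \<in> sec\<close> QQ_sec by blast
 qed
qed

lemma irreducible_QQ: "irreducible_space (subtopology flag (cos ` QQ))"
 using closedin_cos(1) unfolding cos_QQ by (intro irreducible_cos) (use KK_G zirr_gen in \<open>auto simp: KK_def\<close>)

lemma irreducible_sec: "irreducible_space (subtopology flag (cos ` sec))"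
proof -
 have "{k ** na ** l | k l. k \<in> KK \<and> l \<in> KK} \<subseteq> G" using KK_G na_G G_group(3) by auto
 moreover have "zirr {k ** na ** l | k l. k \<in> KK \<and> l \<in> KK}" unfolding KK_def by (rule zirr_double)
 ultimately show ?thesis using closedin_cos(2) unfolding cos_sec by (rule irreducible_cos)
qed

lemma irreducible_point: "irreducible_space (subtopology flag {cos (mat 1)})"
 using irreducible_cos[of "{mat 1}"] closedin_point G_group(2) by (simp add: zirr_def)

text \<open>The coset of \<open>nb\<close> is a second point: \<open>nb\<close> sends
  \<open>ee (3,2)\<close> to weight (3,1), while \<open>B\<close> preserves its line.\<close>

lemma point_QQ: "{cos (mat 1)} \<subset> cos ` QQ"
proof -
 have "cos nb ~= cos (mat 1)"
 proof
  assume "cos nb = cos (mat 1)"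
  then obtain b where "b \<in> B" "nb = mat 1 ** b" using cos_eq_imp[OF G_group(2) nb_G] by auto
  hence "nb \<in> B" by simp
  then obtain m where m: "m ~= 0" "Ad nb (ee (3,2)) = m \<cdot> ee (3,2)" using B_highest by blast
  have "Ad nb (ee (3,2)) \<in> gs (3,1)" using nb_gs[OF ee(1)[of "(3,2)"]] by (simp add: rts_mem)
  hence "cf (3,2) (Ad nb (ee (3,2))) = 0" by (rule cf_gs[OF rts_mem(6)]) auto
  thus False using m by (simp add: cf_simps cf_ee rts_mem)
 qed
 thus ?thesis using KK_QQ[OF mat_1_KK] KK_QQ[OF nb_KK] by auto
qed

text \<open>The coset of \<open>nb ** na\<close> lies outside the translate, for otherwise an
  element of \<open>QQ\<close> would send \<open>ee (3,1)\<close> to a multiple of the vector that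
  \<open>na\<close> maps to \<open>ee (3,2)\<close>. That vector has weight (0,-1) and lies outside
  the plane.\<close>

lemma tr_QQ: "tr na (cos ` QQ) \<subset> cos ` sec"
proof -
 note ni = G_group(1)[OF na_G] and bi = G_group(1)[OF nb_G]
 have "tr na (cos ` QQ) \<subseteq> cos ` sec" unfolding tr_cos using cell_sec[OF mat_1_KK] by auto
 moreover have "cos (nb ** na) \<in> cos ` sec" using cell_sec[OF nb_KK KK_QQ[OF mat_1_KK]] by auto
 moreover have "cos (nb ** na) \<notin> tr na (cos ` QQ)"
 proof
  assume "cos (nb ** na) \<in> tr na (cos ` QQ)"
  then obtain q where q: "q \<in> QQ" "cos (na ** q) = cos (nb ** na)" unfolding tr_cos by auto
  then obtain b where b: "b \<in> B" "nb ** na = na ** q ** b"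
   using cos_eq_imp[of "na ** q" "nb ** na"] G_group(3) na_G nb_G QQ_G by blast
  have qb: "q ** b \<in> QQ" by (rule QQ_sat[OF q(1) b(1)])
  note qi = G_group(1)[OF QQ_G[OF qb]]
  obtain k where k: "Ad na (ee (3,1)) = k \<cdot> ee (3,1)" "k ~= 0"
   using nn_line[of "(3,1)" "(3,1)" na] na_gs[OF ee(1)[of "(3,1)"]] na_G by (auto simp: rts_mem)
  obtain d where d: "Ad nb (ee (3,1)) = d \<cdot> ee (3,2)" "d ~= 0"
   using nn_line[of "(3,1)" "(3,2)" nb] nb_gs[OF ee(1)[of "(3,1)"]] nb_G by (auto simp: rts_mem)
  have "Ad na (Ad (q ** b) (ee (3,1))) = (k * d) \<cdot> ee (3,2)"
   using Ad_mult[OF bi ni, of "ee (3,1)"] Ad_mult[OF ni qi, of "ee (3,1)"] by (simp add: b(2) k(1) d(1) Ad_simps matrix_mul_assoc)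
  hence "Ad (q ** b) (ee (3,1)) = (k * d) \<cdot> Ad (matrix_inv na) (ee (3,2))"
   using Ad_inv(1)[OF ni, of "Ad (q ** b) (ee (3,1))"] by (simp add: Ad_simps)
  hence "(k * d) \<cdot> Ad (matrix_inv na) (ee (3,2)) \<in> gr 1 0 3"
   using QQ_gr3[OF qb ee_gr[of "(3,1)" 3 1 0]] by (simp add: rts_mem)
  hence A: "Ad (matrix_inv na) (ee (3,2)) \<in> gr 1 0 3" by (rule scale_memD[OF csub_gr, rotated]) (simp add: k d)
  have X: "Ad (matrix_inv na) (ee (3,2)) \<in> gs (0,-1)"
   using na_inv_gs[of 3 2 "ee (3,2)"] ee(1)[of "(3,2)"] by (simp add: rts_mem)
  hence "Ad (matrix_inv na) (ee (3,2)) = 0"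
   using pc_gs[OF X, of "(0,-1)"] A rts_wts(1)[OF rts_mem(8)] by (simp add: gr_def)
  thus False using Ad_nz[OF G_group(4)[OF na_G]] ee(2)[OF rts_mem(6)] by simp
 qed
 ultimately show ?thesis by blast
qed

lemma no_chain_sec:
 assumes "chain flag 3 W" "W 3 \<subseteq> cos ` sec"
 shows False
proof (rule no_chain_if_charts)
 show "chain (subtopology flag (cos ` sec)) 3 W" using assms by (simp add: chain_subtopology[OF closedin_cos(2)])
 show "\<exists>\<phi>. chart (subtopology flag (cos ` sec)) \<phi> \<and> z \<in> range \<phi>" if "z \<in> topspace (subtopology flag (cos ` sec))" for z
  using ex_chart that by auto
qed

lemma chain_tr: "x \<in> G ==> chain flag n Z ==> chain flag n (\<lambda>i. tr x (Z i))"
 unfolding chain_def using closedin_tr irreducible_tr tr_mono[OF G_group(1)] by (simp add: psubset_eq) (metis order_refl antisym)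

lemma chain_extend:
 "chain X n Z ==> Z n \<subset> C ==> closedin X C ==> irreducible_space (subtopology X C) ==>
  chain X (Suc n) (Z(Suc n := C))"
 by (auto simp: chain_def le_Suc_eq less_Suc_eq)

lemma chain_QQ: "chain flag 1 ((\<lambda>i. {cos (mat 1)})(Suc 0 := cos ` QQ))"
 unfolding One_nat_def
 by (rule chain_extend[OF _ point_QQ closedin_cos(1) irreducible_QQ]) (simp add: chain_def closedin_point irreducible_point)

text \<open>A chain of length two in the line, translated by \<open>na\<close> and topped by the
  surface, would be a chain of length three in the surface.\<close>

lemma krull_dim_QQ: "krull_dim (subtopology flag (cos ` QQ)) = enat 1"
proof (rule krull_dim_closed[OF closedin_cos(1) chain_QQ])
 fix W assume W: "chain flag (Suc 1) W" "W (Suc 1) \<subseteq> cos ` QQ"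
 have "tr na (W (Suc 1)) \<subset> cos ` sec"
  by (rule order.strict_trans1[OF iffD2[OF tr_mono[OF G_group(1)[OF na_G]] W(2)] tr_QQ])
 from chain_extend[OF chain_tr[OF na_G W(1)] this closedin_cos(2) irreducible_sec]
 show False unfolding One_nat_def by - (erule no_chain_sec[unfolded numeral_3_eq_3], simp)
qed simp

text \<open>The lower bound comes from a translated point inside the translated line inside the
  surface.\<close>

lemma krull_dim_sec: "krull_dim (subtopology flag (cos ` sec)) = enat 2"
proof (rule krull_dim_closed[OF closedin_cos(2)])
 have "tr na (((\<lambda>i. {cos (mat 1)})(Suc 0 := cos ` QQ)) 1) \<subset> cos ` sec" using tr_QQ by simp
 from chain_extend[OF chain_tr[OF na_G chain_QQ] this closedin_cos(2) irreducible_sec]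
 show "chain flag 2 ((\<lambda>i. tr na (((\<lambda>i. {cos (mat 1)})(Suc 0 := cos ` QQ)) i))(Suc 1 := cos ` sec))"
  by (simp add: numeral_2_eq_2)
qed (use no_chain_sec in \<open>simp_all add: numeral_3_eq_3 numeral_2_eq_2\<close>)

end

theorem theorem4p8:
  fixes G B T :: "(complex^'n^'n) set" and \<alpha> \<beta> :: "complex^'n^'n \<Rightarrow> complex"
    and N :: "complex^'n^'n" and F :: "(complex^'n^'n) set topology"
  assumes "semisimple_group G"
    and "borel_subgroup B G"
    and "maximal_torus T G" and "T \<subseteq> B"
    and "G2_simple_roots G B T \<alpha> \<beta>"
    and "N \<in> root_space G T (lin_comb T \<alpha> \<beta> (2, 1))" and "N \<noteq> 0"
  defines "F \<equiv> subtopology (flag_variety G B) (hessenberg_fiber G B (I_alpha G T \<alpha> \<beta>) N)"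
  shows "\<exists>C1 C2. C1 \<noteq> C2 \<and> connected_components_of F = {C1, C2} \<and>
           irreducible_space (subtopology F C1) \<and> irreducible_space (subtopology F C2) \<and>
           krull_dim (subtopology F C1) = 1 \<and> krull_dim (subtopology F C2) = 2"
proof -
  interpret g2_setting G B T \<alpha> \<beta>
    using assms(1-5) by unfold_locales
  let ?C1 = "cos ` QQ" and ?C2 = "cos ` sec"
  have F: "F = subtopology flag (?C1 \<union> ?C2)" unfolding F_def fiber_eq[OF assms(6,7)] ..
  have sub: "subtopology F ?C1 = subtopology flag ?C1" "subtopology F ?C2 = subtopology flag ?C2"
    unfolding F by (simp_all add: subtopology_subtopology inf.absorb2)
  have ts: "topspace F = ?C1 \<union> ?C2" unfolding F using QQ_G sec_G by (auto simp: topspace_flag)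
  have cl: "closedin F ?C1" "closedin F ?C2"
    unfolding F using closedin_closed_subtopology[OF closedin_Un[OF closedin_cos(1,2)]] closedin_cos(1,2) by auto
  have irr: "irreducible_space (subtopology F ?C1)" "irreducible_space (subtopology F ?C2)"
    unfolding sub by (fact irreducible_QQ, fact irreducible_sec)
  have ne: "?C1 \<noteq> {}" "?C2 \<noteq> {}"
    using irreducible_space_nonempty[OF irr(1)] irreducible_space_nonempty[OF irr(2)] by blast+
  have con: "connectedin F ?C1" "connectedin F ?C2"
    unfolding connectedin_def ts using irr[THEN irreducible_imp_connected] by auto
  have comp: "connected_components_of F = {?C1, ?C2}"
    by (rule connected_components_of_two[OF ts cl closedin_cos(3) con ne])
  have neq: "?C1 \<noteq> ?C2" using closedin_cos(3) ne by auto
  have "krull_dim (subtopology F ?C1) = 1" "krull_dim (subtopology F ?C2) = 2"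
    unfolding sub krull_dim_QQ krull_dim_sec by (simp_all add: one_enat_def numeral_eq_enat)
  with neq comp irr have "?C1 \<noteq> ?C2 \<and> connected_components_of F = {?C1, ?C2} \<and>
      irreducible_space (subtopology F ?C1) \<and> irreducible_space (subtopology F ?C2) \<and>
      krull_dim (subtopology F ?C1) = 1 \<and> krull_dim (subtopology F ?C2) = 2" by (intro conjI)
  then show ?thesis by (intro exI)
qed

end
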